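(* The generalized Heisenberg groups and the non-symmetric Damek-Ricci spaces have non-polar isotropy actions.
   Context: Generalized Heisenberg groups: let $\mathfrak n=\mathfrak v\oplus\mathfrak z$ be a Lie algebra with $\mathfrak v,\mathfrak z\neq0$, equipped with an inner product $\langle\cdot,\cdot\rangle$ with $\langle\mathfrak v,\mathfrak z\rangle=0$, and such that $[\mathfrak v,\mathfrak v]\subseteq\mathfrak z$, $[\mathfrak v,\mathfrak z]=[\mathfrak z,\mathfrak z]=0$. Define the linear map $J\colon\mathfrak z\to\mathrm{End}(\mathfrak v)$ by $\langle J_ZU,V\rangle=\langle[U,V],Z\rangle$ for $U,V\in\mathfrak v$, $Z\in\mathfrak z$. $\mathfrak n$ is a generalized Heisenberg algebra if $J_Z^2=-\langle Z,Z\rangle\,\mathrm{id}_{\mathfrak v}$ for all $Z\in\mathfrak z$. The simply connected Lie group with Lie algebra $\mathfrak n$, with the left-invariant metric induced by $\langle\cdot,\cdot\rangle$, is a generalized Heisenberg group. Damek-Ricci spaces: let $\mathfrak a$ be a one-dimensional real vector space with an inner product, $B\in\mathfrak a$ a unit vector, and $\mathfrak n=\mathfrak v\oplus\mathfrak z$ a generalized Heisenberg algebra. On the orthogonal direct sum $\mathfrak s=\mathfrak a\oplus\mathfrak n$ extend the bracket of $\mathfrak n$ by $[B,U]=\frac12U$, $[B,Z]=Z$ for $U\in\mathfrak v$, $Z\in\mathfrak z$. The simply connected Lie group with Lie algebra $\mathfrak s$ and the left-invariant Riemannian metric given by the inner product on $\mathfrak s$ is a Damek-Ricci space. "Non-symmetric"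 means not a Riemannian symmetric space. Isotropy action of a homogeneous Riemannian manifold $M$: let $G$ be the identity component of the isometry group of $M$ and $H=G_p$ the isotropy subgroup at a point $p$; the isotropy action is the action of $H$ on $M$. An isometric Lie group action on a Riemannian manifold is polar if there exists an embedded closed submanifold $\Sigma$ (a section) which intersects all orbits and which, at each of its points $x$, meets the orbit through $x$ orthogonally (the tangent space of the orbit at $x$ is orthogonal to $T_x\Sigma$); otherwise it is non-polar. *)

theory Defs
  imports "HOL-Analysis.Analysis"
begin

section \<open>Smooth manifolds\<close>

text \<open>\<open>Ck_on k f S\<close>: \<open>f\<close> is \<open>k\<close> times continuously differentiable on the open set \<open>S\<close>.\<close>

primrec Ck_on :: "nat \<Rightarrow> ('a::euclidean_space \<Rightarrow> 'b::euclidean_space) \<Rightarrow> 'a set \<Rightarrow> bool" where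
  "Ck_on 0 f S \<longleftrightarrow> continuous_on S f"
| "Ck_on (Suc k) f S \<longleftrightarrow>
     (\<forall>x\<in>S. f differentiable (at x)) \<and> (\<forall>v. Ck_on k (\<lambda>x. frechet_derivative f (at x) v) S)"

definition Cinf_on :: "('a::euclidean_space \<Rightarrow> 'b::euclidean_space) \<Rightarrow> 'a set \<Rightarrow> bool" where
  "Cinf_on f S \<longleftrightarrow> (\<forall>k. Ck_on k f S)"

text \<open>A manifold is a whole (Hausdorff, second countable) type together with an atlas. A chart is
  a pair of its domain and the coordinate map; values outside the domain are irrelevant.\<close>

type_synonym ('m, 'e) chart = "'m set \<times> ('m \<Rightarrow> 'e)"

definition smooth_atlas ::
  "('m::{t2_space,second_countable_topology}, 'e::euclidean_space) chart set \<Rightarrow> bool" where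
  "smooth_atlas A \<longleftrightarrow>
     (\<Union>(U,\<phi>)\<in>A. U) = UNIV \<and>
     (\<forall>(U,\<phi>)\<in>A. open U \<and> open (\<phi> ` U) \<and> homeomorphism U (\<phi> ` U) \<phi> (inv_into U \<phi>)) \<and>
     (\<forall>(U,\<phi>)\<in>A. \<forall>(V,\<psi>)\<in>A. Cinf_on (\<lambda>x. \<psi> (inv_into U \<phi> x)) (\<phi> ` (U \<inter> V)))"

definition euclidean_atlas :: "('e::euclidean_space, 'e) chart set" where
  "euclidean_atlas = {(UNIV, id)}"

definition prod_atlas ::
  "('m, 'e) chart set \<Rightarrow> ('n, 'f) chart set \<Rightarrow> ('m \<times> 'n, 'e \<times> 'f) chart set" where
  "prod_atlas A B = {(U \<times> V, map_prod \<phi> \<psi>) | U \<phi> V \<psi>. (U, \<phi>) \<in> A \<and> (V, \<psi>) \<in> B}"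

definition smooth_map ::
  "('m::topological_space, 'e::euclidean_space) chart set \<Rightarrow>
   ('n::topological_space, 'f::euclidean_space) chart set \<Rightarrow> ('m \<Rightarrow> 'n) \<Rightarrow> bool" where
  "smooth_map A B F \<longleftrightarrow> continuous_on UNIV F \<and>
     (\<forall>(U,\<phi>)\<in>A. \<forall>(V,\<psi>)\<in>B. Cinf_on (\<lambda>x. \<psi> (F (inv_into U \<phi> x))) (\<phi> ` (U \<inter> F -` V)))"

abbreviation smooth_fun ::
  "('m::topological_space, 'e::euclidean_space) chart set \<Rightarrow> ('m \<Rightarrow> real) \<Rightarrow> bool" where
  "smooth_fun A f \<equiv> smooth_map A euclidean_atlas f"

text \<open>Tangent vectors are derivations of the algebra of smooth functions. They are
  represented by functionals on all functions, normalized to be 0 on non-smooth ones.\<close>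

type_synonym 'm tangent = "('m \<Rightarrow> real) \<Rightarrow> real"

definition tangent_space ::
  "('m::topological_space, 'e::euclidean_space) chart set \<Rightarrow> 'm \<Rightarrow> 'm tangent set" where
  "tangent_space A p = {X.
     (\<forall>f. \<not> smooth_fun A f \<longrightarrow> X f = 0) \<and>
     (\<forall>f h. smooth_fun A f \<longrightarrow> smooth_fun A h \<longrightarrow>
        X (\<lambda>x. f x + h x) = X f + X h \<and>
        X (\<lambda>x. f x * h x) = f p * X h + h p * X f) \<and>
     (\<forall>f c. smooth_fun A f \<longrightarrow> X (\<lambda>x. c * f x) = c * X f)}"

definition differential ::
  "('m::topological_space, 'e::euclidean_space) chart set \<Rightarrow> ('m \<Rightarrow> 'm) \<Rightarrow> 'm tangent \<Rightarrow> 'm tangent" where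
  "differential A F X = (\<lambda>f. if smooth_fun A f then X (f \<circ> F) else 0)"

definition velocity ::
  "('m::topological_space, 'e::euclidean_space) chart set \<Rightarrow> (real \<Rightarrow> 'm) \<Rightarrow> 'm tangent" where
  "velocity A c = (\<lambda>f. if smooth_fun A f then deriv (f \<circ> c) 0 else 0)"

text \<open>The velocities at \<open>x\<close> of smooth curves inside \<open>S\<close>. For embedded submanifolds, and for orbits
  of Lie group actions, this is the image of the tangent space of \<open>S\<close> at \<open>x\<close>.\<close>

definition tangent_of_subset ::
  "('m::topological_space, 'e::euclidean_space) chart set \<Rightarrow> 'm set \<Rightarrow> 'm \<Rightarrow> 'm tangent set" where
  "tangent_of_subset A S x =
     {velocity A c | c. smooth_map euclidean_atlas A c \<and> c 0 = x \<and> range c \<subseteq> S}"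

text \<open>Slice charts are taken from the maximal atlas, i.e. they are the charts that can be added
  to \<open>A\<close>.\<close>

definition embedded_submanifold ::
  "('m::{t2_space,second_countable_topology}, 'e::euclidean_space) chart set \<Rightarrow> 'm set \<Rightarrow> bool" where
  "embedded_submanifold A S \<longleftrightarrow>
     (\<exists>k. \<forall>x\<in>S. \<exists>U \<phi> L. smooth_atlas (insert (U, \<phi>) A) \<and> x \<in> U \<and>
        subspace L \<and> dim L = k \<and> \<phi> ` (U \<inter> S) = \<phi> ` U \<inter> L)"


section \<open>Isometries, isotropy actions and polarity\<close>

text \<open>Throughout, \<open>g p X Y\<close> is the inner product of the tangent vectors \<open>X\<close> and \<open>Y\<close> at \<open>p\<close>.\<close>

type_synonym 'm metric_tensor = "'m \<Rightarrow> 'm tangent \<Rightarrow> 'm tangent \<Rightarrow> real"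

definition isometry_group ::
  "('m::topological_space, 'e::euclidean_space) chart set \<Rightarrow> 'm metric_tensor \<Rightarrow> ('m \<Rightarrow> 'm) set" where
  "isometry_group A g = {F. bij F \<and> smooth_map A A F \<and> smooth_map A A (inv F) \<and>
     (\<forall>p. \<forall>X\<in>tangent_space A p. \<forall>Y\<in>tangent_space A p.
        g (F p) (differential A F X) (differential A F Y) = g p X Y)}"

definition compact_open_topology :: "('m::topological_space \<Rightarrow> 'm) topology" where
  "compact_open_topology = topology_generated_by {{f. f ` K \<subseteq> U} | K U. compact K \<and> open U}"

definition isometry_identity_component ::
  "('m::topological_space, 'e::euclidean_space) chart set \<Rightarrow> 'm metric_tensor \<Rightarrow> ('m \<Rightarrow> 'm) set" where
  "isometry_identity_component A g =
     connected_component_of_set (subtopology compact_open_topology (isometry_group A g)) id"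

definition isotropy_group ::
  "('m::topological_space, 'e::euclidean_space) chart set \<Rightarrow> 'm metric_tensor \<Rightarrow> 'm \<Rightarrow> ('m \<Rightarrow> 'm) set" where
  "isotropy_group A g p = {h \<in> isometry_identity_component A g. h p = p}"

definition orbit_of :: "('m \<Rightarrow> 'm) set \<Rightarrow> 'm \<Rightarrow> 'm set" where
  "orbit_of H x = {h x | h. h \<in> H}"

definition polar_action ::
  "('m::{t2_space,second_countable_topology}, 'e::euclidean_space) chart set \<Rightarrow> 'm metric_tensor \<Rightarrow>
   ('m \<Rightarrow> 'm) set \<Rightarrow> bool" where
  "polar_action A g H \<longleftrightarrow> (\<exists>\<Sigma>. embedded_submanifold A \<Sigma> \<and> closed \<Sigma> \<and>
     (\<forall>x. orbit_of H x \<inter> \<Sigma> \<noteq> {}) \<and>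
     (\<forall>x\<in>\<Sigma>. \<forall>X\<in>tangent_of_subset A (orbit_of H x) x. \<forall>Y\<in>tangent_of_subset A \<Sigma> x. g x X Y = 0))"

text \<open>A geodesic symmetry of a connected manifold is the isometry fixing \<open>p\<close> with differential
  \<open>-id\<close> there.\<close>

definition riemannian_symmetric ::
  "('m::topological_space, 'e::euclidean_space) chart set \<Rightarrow> 'm metric_tensor \<Rightarrow> bool" where
  "riemannian_symmetric A g \<longleftrightarrow> (\<forall>p. \<exists>s\<in>isometry_group A g. s p = p \<and>
     (\<forall>X\<in>tangent_space A p. differential A s X = (\<lambda>f. - X f)))"


section \<open>Lie groups with left-invariant metrics\<close>

definition lie_group ::
  "('m::{t2_space,second_countable_topology}, 'e::euclidean_space) chart set \<Rightarrow>
   ('m \<Rightarrow> 'm \<Rightarrow> 'm) \<Rightarrow> 'm \<Rightarrow> ('m \<Rightarrow> 'm) \<Rightarrow> bool" where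
  "lie_group A mul e iv \<longleftrightarrow> smooth_atlas A \<and> group mul e iv \<and>
     smooth_map (prod_atlas A A) A (\<lambda>(x, y). mul x y) \<and> smooth_map A A iv"

text \<open>The left-invariant vector field extending \<open>X\<close> maps \<open>f\<close> to \<open>\<lambda>a. X (f \<circ> mul a)\<close>; this is the
  commutator of two such fields, evaluated at the identity.\<close>

definition left_invariant_bracket ::
  "('m::topological_space, 'e::euclidean_space) chart set \<Rightarrow> ('m \<Rightarrow> 'm \<Rightarrow> 'm) \<Rightarrow>
   'm tangent \<Rightarrow> 'm tangent \<Rightarrow> 'm tangent" where
  "left_invariant_bracket A mul X Y = (\<lambda>f. if smooth_fun A f
     then X (\<lambda>a. Y (f \<circ> mul a)) - Y (\<lambda>a. X (f \<circ> mul a)) else 0)"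

definition lie_algebra :: "('n::real_vector \<Rightarrow> 'n \<Rightarrow> 'n) \<Rightarrow> bool" where
  "lie_algebra br \<longleftrightarrow> (\<forall>x. linear (br x)) \<and> (\<forall>y. linear (\<lambda>x. br x y)) \<and> (\<forall>x. br x x = 0) \<and>
     (\<forall>x y w. br x (br y w) + br y (br w x) + br w (br x y) = 0)"

text \<open>\<open>\<phi>\<close> identifies the Lie algebra \<open>('n, br)\<close> with the Lie algebra of the group, i.e. with the
  tangent space at the identity.\<close>

definition is_lie_algebra_of ::
  "('m::topological_space, 'e::euclidean_space) chart set \<Rightarrow> ('m \<Rightarrow> 'm \<Rightarrow> 'm) \<Rightarrow> 'm \<Rightarrow>
   ('n::real_vector \<Rightarrow> 'n \<Rightarrow> 'n) \<Rightarrow> ('n \<Rightarrow> 'm tangent) \<Rightarrow> bool" where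
  "is_lie_algebra_of A mul e br \<phi> \<longleftrightarrow>
     bij_betw \<phi> UNIV (tangent_space A e) \<and>
     (\<forall>x y. \<phi> (x + y) = (\<lambda>f. \<phi> x f + \<phi> y f)) \<and>
     (\<forall>c x. \<phi> (c *\<^sub>R x) = (\<lambda>f. c * \<phi> x f)) \<and>
     (\<forall>x y. \<phi> (br x y) = left_invariant_bracket A mul (\<phi> x) (\<phi> y))"

definition left_invariant_metric ::
  "('m::topological_space, 'e::euclidean_space) chart set \<Rightarrow> ('m \<Rightarrow> 'm \<Rightarrow> 'm) \<Rightarrow> ('m \<Rightarrow> 'm) \<Rightarrow>
   ('n::real_inner \<Rightarrow> 'm tangent) \<Rightarrow> 'm metric_tensor" where
  "left_invariant_metric A mul iv \<phi> = (\<lambda>p X Y.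
     inv \<phi> (differential A (mul (iv p)) X) \<bullet> inv \<phi> (differential A (mul (iv p)) Y))"

text \<open>\<open>(A, mul, e, iv)\<close> is a simply connected Lie group with Lie algebra \<open>('n, br)\<close>.\<close>

definition simply_connected_lie_group_of ::
  "('m::{t2_space,second_countable_topology}, 'e::euclidean_space) chart set \<Rightarrow>
   ('m \<Rightarrow> 'm \<Rightarrow> 'm) \<Rightarrow> 'm \<Rightarrow> ('m \<Rightarrow> 'm) \<Rightarrow>
   ('n::real_vector \<Rightarrow> 'n \<Rightarrow> 'n) \<Rightarrow> ('n \<Rightarrow> 'm tangent) \<Rightarrow> bool" where
  "simply_connected_lie_group_of A mul e iv br \<phi> \<longleftrightarrow>
     lie_group A mul e iv \<and> simply_connected (UNIV :: 'm set) \<and> is_lie_algebra_of A mul e br \<phi>"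


section \<open>Generalized Heisenberg algebras and Damek-Ricci algebras\<close>

definition J_map :: "('n::euclidean_space \<Rightarrow> 'n \<Rightarrow> 'n) \<Rightarrow> 'n set \<Rightarrow> 'n \<Rightarrow> 'n \<Rightarrow> 'n" where
  "J_map br v Z U = (THE W. W \<in> v \<and> (\<forall>V\<in>v. W \<bullet> V = br U V \<bullet> Z))"

text \<open>The subspace \<open>v \<oplus> z\<close> of the ambient Lie algebra \<open>('n, br)\<close> is a generalized Heisenberg
  algebra. It need not be the whole space, since it is a proper ideal of a Damek-Ricci algebra.\<close>

definition generalized_heisenberg_on ::
  "('n::euclidean_space \<Rightarrow> 'n \<Rightarrow> 'n) \<Rightarrow> 'n set \<Rightarrow> 'n set \<Rightarrow> bool" where
  "generalized_heisenberg_on br v z \<longleftrightarrow>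
     subspace v \<and> subspace z \<and> v \<noteq> {0} \<and> z \<noteq> {0} \<and> (\<forall>U\<in>v. \<forall>Z\<in>z. U \<bullet> Z = 0) \<and>
     (\<forall>U\<in>v. \<forall>V\<in>v. br U V \<in> z) \<and> (\<forall>U\<in>v. \<forall>Z\<in>z. br U Z = 0) \<and> (\<forall>Z\<in>z. \<forall>W\<in>z. br Z W = 0) \<and>
     (\<forall>Z\<in>z. \<forall>U\<in>v. J_map br v Z (J_map br v Z U) = - (Z \<bullet> Z) *\<^sub>R U)"

definition generalized_heisenberg_algebra ::
  "('n::euclidean_space \<Rightarrow> 'n \<Rightarrow> 'n) \<Rightarrow> bool" where
  "generalized_heisenberg_algebra br \<longleftrightarrow> lie_algebra br \<and>
     (\<exists>v z. generalized_heisenberg_on br v z \<and> (\<forall>x. \<exists>U\<in>v. \<exists>Z\<in>z. x = U + Z))"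

text \<open>Here \<open>span {B}\<close> is the one-dimensional space called \<open>a\<close> in \<open>s = a \<oplus> v \<oplus> z\<close>.\<close>

definition damek_ricci_algebra ::
  "('s::euclidean_space \<Rightarrow> 's \<Rightarrow> 's) \<Rightarrow> bool" where
  "damek_ricci_algebra br \<longleftrightarrow> lie_algebra br \<and>
     (\<exists>B v z. generalized_heisenberg_on br v z \<and> norm B = 1 \<and>
        (\<forall>U\<in>v. B \<bullet> U = 0) \<and> (\<forall>Z\<in>z. B \<bullet> Z = 0) \<and>
        (\<forall>x. \<exists>c. \<exists>U\<in>v. \<exists>Z\<in>z. x = c *\<^sub>R B + U + Z) \<and>
        (\<forall>U\<in>v. br B U = (1/2) *\<^sub>R U) \<and> (\<forall>Z\<in>z. br B Z = Z))"

end

(* In suitable global coordinates the group is R B + v + z with an explicit left-invariant coframe th.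
   Written in left-invariant frames, an isometry fixing the identity is a field Q of orthogonal maps with
   dQ = Q Gm - Gm Q, where Gm is the Levi-Civita connection; hence Q preserves the curvature and its covariant
   derivative. In the Heisenberg case the Ricci curvature separates v from z; in the Damek-Ricci case the
   multiples of B are the only directions in which the curvature is parallel, unless the J2-condition holds,
   and then the geodesic inversion is an isometry and the space is symmetric. So Q consists of automorphisms,
   dQ = 0, and the isotropy group acts by orthogonal automorphisms, containing the flows of skew derivations.
   A section meets every orbit, so for uncountably many r it passes, after an automorphism, through r V; a
   limiting argument makes V and Z + D V tangent to it there, with Z in z arbitrary and D a skew derivation. The
   one-forms dual to the orbit directions vanish on the section, and so do their exterior derivatives. This forces
   J Z V to be orthogonal to all D V, which fails for the derivations built from products of the operators J. *)
theory Submission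
  imports Defs
begin

section \<open>Smooth functions on Euclidean spaces\<close>

text \<open>A section is known only through its incidence with orbits: nothing says how the
  automorphism carrying \<open>r *\<^sub>R u\<close> into it depends on \<open>r\<close>.
  Uncountability replaces regularity: any bounded choice on \<open>{1..2}\<close> has a parameter at
  which it is continuous along some sequence, and difference quotients there give tangent vectors up
  to an orbit direction \<open>D x\<close>. For \<open>V\<close> this ambiguity is removed by
  orthogonality alone. For \<open>Z\<close> two scalar identities for the same \<open>D\<close> are
  compared, in which one term has the coefficient \<open>r\<^sup>2 / 2\<close> and
  \<open>r\<^sup>2\<close> respectively. Orthogonality at a single point would not suffice; the
  exterior derivative brings in the bracket and yields \<open>N V (E V) \<bullet> Z = 0\<close>.
  Non-symmetry of the space enters through the failure of \<open>J2\<close>, and to exploit it an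
  explicit geodesic inversion, hence explicit coordinates, must exist. As the group is given
  abstractly by an atlas and by derivations, they are constructed by integrating its Maurer-Cartan
  form, continuing the local isomorphism along rays, and lifting a homotopy of loops to exclude a
  kernel.\<close>

abbreviation fderiv :: "('a::real_normed_vector => 'b::real_normed_vector) => 'a => 'a => 'b" where
  "fderiv f x \<equiv> frechet_derivative f (at x)"

text \<open>\<open>Ck_on\<close> refers to the chosen \<open>frechet_derivative\<close>; this rule
  admits any explicit derivative instead. Functions that agree on an open set have the same
  derivatives there, so the exchange is harmless at every order.\<close>

lemma Ck_onI:
  assumes "open S" "\<And>x. x \<in> S ==> (f has_derivative f' x) (at x)" "\<And>v. Ck_on k (\<lambda>x. f' x v) S"
  shows "Ck_on (Suc k) f S"
  using assms
proof -
  have *: "fderiv f x = f' x" if "x \<in> S" for x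
    using assms(2)[OF that] frechet_derivative_at by metis
  have cong: "Ck_on k g S \<longleftrightarrow> Ck_on k h S" if "\<And>x. x \<in> S ==> g x = h x" for g h :: "'a => 'b" and k
    using that
  proof (induction k arbitrary: g h)
    case 0 then show ?case by (auto cong: continuous_on_cong)
  next
    case (Suc k)
    have d: "(g has_derivative d) (at x) \<longleftrightarrow> (h has_derivative d) (at x)" if "x \<in> S" for x d
      using has_derivative_transform_within_open[OF _ assms(1) that] Suc.prems by metis
    have f: "fderiv g x = fderiv h x" if "x \<in> S" for x
      unfolding frechet_derivative_def using d[OF that] by simp
    have "Ck_on k (\<lambda>x. fderiv g x v) S \<longleftrightarrow> Ck_on k (\<lambda>x. fderiv h x v) S" for v
      by (rule Suc.IH) (simp add: f)
    then show ?case using d by (auto simp: differentiable_def)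
  qed
  have "Ck_on k (\<lambda>x. fderiv f x v) S" for v
    using assms(3)[of v] cong[of "\<lambda>x. f' x v" "\<lambda>x. fderiv f x v"] by (simp add: *)
  then show ?thesis using assms(2) by (auto simp: differentiable_def)
qed

lemma has_derivative_frechet:
  "f differentiable (at x) ==> (f has_derivative fderiv f x) (at x)"
  by (simp add: frechet_derivative_works)

lemma Ck_on_SucD:
  assumes "Ck_on (Suc k) f S"
  shows "x \<in> S ==> (f has_derivative fderiv f x) (at x)"
    "Ck_on k (\<lambda>x. fderiv f x v) S"
  using assms by (auto intro: has_derivative_frechet)

lemma Ck_on_cong:
  assumes "open S" "\<And>x. x \<in> S ==> f x = g x" "Ck_on k f S"
  shows "Ck_on k g S"
proof (cases k)
  case 0 then show ?thesis using assms by (auto cong: continuous_on_cong)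
next
  case (Suc k')
  show ?thesis unfolding Suc
  proof (rule Ck_onI[OF assms(1), of _ "\<lambda>x. fderiv f x"])
    show "(g has_derivative fderiv f x) (at x)" if "x \<in> S" for x
      using has_derivative_transform_within_open[OF Ck_on_SucD(1)[OF assms(3)[unfolded Suc]] assms(1)]
        that assms(2) by metis
  qed (use assms(3) Suc in auto)
qed

lemma Ck_on_subset: "Ck_on k f S ==> T \<subseteq> S ==> Ck_on k f T"
  by (induction k arbitrary: f) (auto intro: continuous_on_subset)

lemma Ck_on_continuous: "Ck_on k f S ==> continuous_on S f"
  by (cases k) (simp, metis Ck_on.simps(2) continuous_at_imp_continuous_on differentiable_imp_continuous_within)

lemma Ck_on_pred: "Ck_on (Suc k) f S ==> Ck_on k f S"
proof (induction k arbitrary: f)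
  case 0 then show ?case using Ck_on_continuous by (metis Ck_on.simps(1))
next
  case (Suc k) then show ?case by (metis Ck_on.simps(2))
qed

lemma Ck_on_const: "open S ==> Ck_on k (\<lambda>x. c) S"
proof (induction k arbitrary: c)
  case (Suc k) show ?case
    by (rule Ck_onI[OF Suc.prems, of _ "\<lambda>x v. 0"]) (use Suc in auto)
qed auto

lemma Ck_on_bounded_linear:
  assumes "bounded_linear L" "open S"
  shows "Ck_on k f S ==> Ck_on k (\<lambda>x. L (f x)) S"
proof (induction k arbitrary: f)
  case 0 then show ?case using assms by (auto intro: bounded_linear.continuous_on)
next
  case (Suc k) show ?case
    by (rule Ck_onI[OF assms(2), of _ "\<lambda>x v. L (fderiv f x v)"])
      (rule bounded_linear.has_derivative[OF assms(1) Ck_on_SucD(1)[OF Suc.prems]] Suc.IH Ck_on_SucD(2)[OF Suc.prems]; assumption?)+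
qed

lemma Ck_on_add:
  assumes "open S"
  shows "Ck_on k f S ==> Ck_on k g S ==> Ck_on k (\<lambda>x. f x + g x) S"
proof (induction k arbitrary: f g)
  case 0 then show ?case by (auto intro: continuous_intros)
next
  case (Suc k) show ?case
    by (rule Ck_onI[OF assms, of _ "\<lambda>x v. fderiv f x v + fderiv g x v"])
      (use Suc Ck_on_SucD[OF Suc.prems(1)] Ck_on_SucD[OF Suc.prems(2)] in \<open>auto intro: has_derivative_add\<close>)
qed

lemma Ck_on_sum:
  assumes "open S" "\<And>i. i \<in> I ==> Ck_on k (f i) S"
  shows "Ck_on k (\<lambda>x. \<Sum>i\<in>I. f i x) S"
  using assms(2) by (induction I rule: infinite_finite_induct) (auto intro!: Ck_on_const Ck_on_add assms(1))

lemma Ck_on_bilinear: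
  assumes p: "bounded_bilinear p" and S: "open S"
  shows "Ck_on k f S ==> Ck_on k g S ==> Ck_on k (\<lambda>x. p (f x) (g x)) S"
proof (induction k arbitrary: f g)
  case 0 then show ?case using p by (auto intro: bounded_bilinear.continuous_on)
next
  case (Suc k)
  note pr = Suc.prems[THEN Ck_on_pred]
  show ?case
    by (rule Ck_onI[OF S, of _ "\<lambda>x v. p (f x) (fderiv g x v) + p (fderiv f x v) (g x)"])
      (rule bounded_bilinear.FDERIV[OF p] Ck_on_add S Suc.IH Ck_on_SucD[OF Suc.prems(1)]
        Ck_on_SucD[OF Suc.prems(2)] pr; assumption?)+
qed

lemma linear_apply_basis:
  fixes L :: "'a::euclidean_space => 'b::real_vector"
  assumes "linear L"
  shows "L v = (\<Sum>b\<in>Basis. (v \<bullet> b) *\<^sub>R L b)"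
  by (subst euclidean_representation[of v, symmetric])
    (simp only: linear_sum[OF assms] linear_scale[OF assms])

text \<open>In the chain rule the direction \<open>fderiv g x v\<close> varies with
  \<open>x\<close>, while \<open>Ck_on\<close> differentiates in fixed directions. Expanding it in
  \<open>Basis\<close> leaves a sum of products, and the induction hypothesis applies to each
  partial derivative of \<open>f\<close>.\<close>

lemma Ck_on_compose:
  assumes "open S" "open T" "g ` S \<subseteq> T"
  shows "Ck_on k f T ==> Ck_on k g S ==> Ck_on k (\<lambda>x. f (g x)) S"
proof (induction k arbitrary: f)
  case 0 then show ?case using assms by (auto intro: continuous_on_compose2)
next
  case (Suc k)
  let ?F = "\<lambda>x v. \<Sum>b\<in>Basis. (fderiv g x v \<bullet> b) *\<^sub>R fderiv f ((g x)) b"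
  show ?case
  proof (rule Ck_onI[OF assms(1), of _ ?F])
    show "((\<lambda>x. f (g x)) has_derivative ?F x) (at x)" if "x \<in> S" for x
    proof -
      have df: "(f has_derivative fderiv f ((g x))) (at (g x))"
        using Ck_on_SucD(1)[OF Suc.prems(1)] that assms by auto
      have "?F x = (\<lambda>v. fderiv f ((g x)) (fderiv g x v))"
        by (rule ext) (rule linear_apply_basis[OF has_derivative_linear[OF df], symmetric])
      then show ?thesis using has_derivative_compose[OF Ck_on_SucD(1)[OF Suc.prems(2) that] df] by simp
    qed
    show "Ck_on k (\<lambda>x. ?F x v) S" for v
    proof (rule Ck_on_sum[OF assms(1)], rule Ck_on_bilinear[OF bounded_bilinear_scaleR assms(1)])
      fix b :: 'b
      show "Ck_on k (\<lambda>x. fderiv g x v \<bullet> b) S"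
        by (rule Ck_on_bounded_linear[OF bounded_linear_inner_left assms(1) Ck_on_SucD(2)[OF Suc.prems(2)]])
      show "Ck_on k (\<lambda>x. fderiv f ((g x)) b) S"
        by (rule Suc.IH[OF Ck_on_SucD(2)[OF Suc.prems(1)] Ck_on_pred[OF Suc.prems(2)]])
    qed
  qed
qed

lemma Cinf_onD: "Cinf_on f S ==> Ck_on k f S"
  by (simp add: Cinf_on_def)

lemma Cinf_on_has_derivative:
  "Cinf_on f S ==> x \<in> S ==> (f has_derivative fderiv f x) (at x)"
  using Ck_on_SucD(1) Cinf_onD by blast

lemma Cinf_on_frechet: "Cinf_on f S ==> Cinf_on (\<lambda>x. fderiv f x v) S"
  unfolding Cinf_on_def by (metis Ck_on.simps(2))

lemma Cinf_on_continuous: "Cinf_on f S ==> continuous_on S f"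
  by (simp add: Cinf_on_def) (metis Ck_on.simps(1))

lemma Cinf_onI:
  assumes "open S" "\<And>x. x \<in> S ==> (f has_derivative f' x) (at x)" "\<And>v. Cinf_on (\<lambda>x. f' x v) S"
  shows "Cinf_on f S"
  unfolding Cinf_on_def
proof
  fix k show "Ck_on k f S"
    by (rule Ck_on_pred, rule Ck_onI[OF assms(1,2)]) (use assms(3) Cinf_onD in auto)
qed

lemma Cinf_on_cong: "open S ==> (\<And>x. x \<in> S ==> f x = g x) ==> Cinf_on f S ==> Cinf_on g S"
  unfolding Cinf_on_def using Ck_on_cong by blast

lemma Cinf_on_subset: "Cinf_on f S ==> T \<subseteq> S ==> Cinf_on f T"
  unfolding Cinf_on_def using Ck_on_subset by blast

lemma Cinf_on_const: "open S ==> Cinf_on (\<lambda>x. c) S"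
  unfolding Cinf_on_def using Ck_on_const by blast

lemma Cinf_on_bounded_linear: "bounded_linear L ==> open S ==> Cinf_on f S ==> Cinf_on (\<lambda>x. L (f x)) S"
  unfolding Cinf_on_def using Ck_on_bounded_linear by blast

lemma Cinf_on_add: "open S ==> Cinf_on f S ==> Cinf_on g S ==> Cinf_on (\<lambda>x. f x + g x) S"
  unfolding Cinf_on_def using Ck_on_add by blast

lemma Cinf_on_sum: "open S ==> (\<And>i. i \<in> I ==> Cinf_on (f i) S) ==> Cinf_on (\<lambda>x. \<Sum>i\<in>I. f i x) S"
  unfolding Cinf_on_def by (blast intro: Ck_on_sum)

lemma Cinf_on_bilinear:
  "bounded_bilinear p ==> open S ==> Cinf_on f S ==> Cinf_on g S ==> Cinf_on (\<lambda>x. p (f x) (g x)) S"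
  unfolding Cinf_on_def using Ck_on_bilinear by blast

lemma Cinf_on_compose:
  "open S ==> open T ==> g ` S \<subseteq> T ==> Cinf_on f T ==> Cinf_on g S ==> Cinf_on (\<lambda>x. f (g x)) S"
  unfolding Cinf_on_def using Ck_on_compose by blast

lemma Cinf_on_id: "open S ==> Cinf_on (\<lambda>x. x) S"
  by (rule Cinf_onI[of _ _ "\<lambda>x v. v"]) (auto intro: Cinf_on_const)

lemma Cinf_on_linear: "linear L ==> open S ==> Cinf_on L S"
  for L :: "'a::euclidean_space => 'b::euclidean_space"
  by (rule Cinf_on_bounded_linear[OF _ _ Cinf_on_id]) (auto simp: linear_conv_bounded_linear)

lemma Cinf_on_Pair:
  assumes "open S" "Cinf_on f S" "Cinf_on g S"
  shows "Cinf_on (\<lambda>x. (f x, g x)) S"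
proof -
  have "Cinf_on (\<lambda>x. (f x, 0) + (0, g x)) S"
    using assms
    by (intro Cinf_on_add Cinf_on_bounded_linear[of "\<lambda>a. (a, 0)"] Cinf_on_bounded_linear[of "\<lambda>a. (0, a)"])
      (auto intro: bounded_linear_Pair bounded_linear_zero bounded_linear_ident)
  then show ?thesis by simp
qed

lemma Cinf_on_fst: "open S ==> Cinf_on f S ==> Cinf_on (\<lambda>x. fst (f x)) S"
  by (rule Cinf_on_bounded_linear[OF bounded_linear_fst])

lemma Cinf_on_snd: "open S ==> Cinf_on f S ==> Cinf_on (\<lambda>x. snd (f x)) S"
  by (rule Cinf_on_bounded_linear[OF bounded_linear_snd])

lemmas Cinf_on_scaleR = Cinf_on_bilinear[OF bounded_bilinear_scaleR]
lemmas Cinf_on_mult = Cinf_on_bilinear[OF bounded_bilinear_mult[where 'a=real]]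
lemmas Cinf_on_inner = Cinf_on_bilinear[OF bounded_bilinear_inner]

lemma Cinf_on_minus: "open S ==> Cinf_on f S ==> Cinf_on (\<lambda>x. - f x) S"
  by (rule Cinf_on_bounded_linear[OF bounded_linear_minus[OF bounded_linear_ident]])

lemma Cinf_on_diff: "open S ==> Cinf_on f S ==> Cinf_on g S ==> Cinf_on (\<lambda>x. f x - g x) S"
  using Cinf_on_add[OF _ _ Cinf_on_minus, of S f g] by simp

lemma Cinf_on_exp_real: "Cinf_on (exp :: real => real) UNIV"
  unfolding Cinf_on_def
proof
  fix k show "Ck_on k (exp :: real => real) UNIV"
  proof (induction k)
    case (Suc k) show ?case
      by (rule Ck_onI[of _ _ "\<lambda>x v. exp x * v"])
       (auto intro!: derivative_eq_intros Ck_on_bilinear[OF bounded_bilinear_mult] Suc Ck_on_const)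
  qed (auto intro: continuous_intros)
qed

lemma Cinf_on_inverse_real: "Cinf_on (inverse :: real => real) (-{0})"
  unfolding Cinf_on_def
proof
  fix k show "Ck_on k (inverse :: real => real) (-{0})"
  proof (induction k)
    case (Suc k)
    have "Ck_on k (\<lambda>x. - (inverse x * v * inverse x)) (-{0::real})" for v :: real
      by (intro Ck_on_bounded_linear[OF bounded_linear_minus[OF bounded_linear_ident]]
          Ck_on_bilinear[OF bounded_bilinear_mult] Suc Ck_on_const) auto
    then show ?case
      by (intro Ck_onI[of _ _ "\<lambda>x v. - (inverse x * v * inverse x)"]) (auto intro!: has_derivative_inverse')
  qed (auto intro!: continuous_intros)
qed

lemma Cinf_on_exp: "open S ==> Cinf_on f S ==> Cinf_on (\<lambda>x. exp (f x :: real)) S"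
  by (rule Cinf_on_compose[OF _ _ _ Cinf_on_exp_real]) auto

lemma Cinf_on_inverse:
  "open S ==> Cinf_on f S ==> (\<And>x. x \<in> S ==> f x \<noteq> 0) ==> Cinf_on (\<lambda>x. inverse (f x :: real)) S"
  by (rule Cinf_on_compose[OF _ _ _ Cinf_on_inverse_real]) auto

lemma Cinf_on_ln:
  assumes "open S" "Cinf_on f S" "\<And>x. x \<in> S ==> f x > 0"
  shows "Cinf_on (\<lambda>x. ln (f x :: real)) S"
proof -
  have "Cinf_on (ln :: real => real) {0<..}"
    by (rule Cinf_onI[of _ _ "\<lambda>x v. v * inverse x"])
      (auto intro!: derivative_eq_intros Cinf_on_mult Cinf_on_const Cinf_on_inverse Cinf_on_id simp: divide_inverse)
  then show ?thesis using Cinf_on_compose[OF assms(1) _ _ _ assms(2), of "{0<..}" ln] assms(3) by auto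
qed

text \<open>\<open>sin\<close> and \<open>cos\<close> differentiate into one another up to sign,
  hence the joint induction. The sine later serves as a bounded smooth reparametrization with
  derivative 1 at 0.\<close>

lemma Cinf_on_sin: "Cinf_on (sin :: real => real) UNIV"
proof -
  have "Ck_on k (sin :: real => real) UNIV \<and> Ck_on k (cos :: real => real) UNIV" for k
  proof (induction k)
    case (Suc k)
    have "Ck_on (Suc k) (sin :: real => real) UNIV"
      by (rule Ck_onI[of _ _ "\<lambda>x v. cos x * v"])
       (auto intro!: derivative_eq_intros Ck_on_bilinear[OF bounded_bilinear_mult] conjunct2[OF Suc] Ck_on_const)
    moreover have "Ck_on k (\<lambda>x. - sin x * v) UNIV" for v :: real
      by (intro Ck_on_bounded_linear[OF bounded_linear_minus[OF bounded_linear_ident]]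
          Ck_on_bilinear[OF bounded_bilinear_mult] Suc Ck_on_const conjunct1[OF Suc]) auto
    then have "Ck_on (Suc k) (cos :: real => real) UNIV"
      by (intro Ck_onI[of _ _ "\<lambda>x v. - sin x * v"]) (auto intro!: derivative_eq_intros)
    ultimately show ?case by blast
  qed (auto intro: continuous_intros)
  then show ?thesis by (simp add: Cinf_on_def)
qed

lemma Cinf_on_open_cover:
  assumes "\<And>x. x \<in> S ==> \<exists>T. open T \<and> x \<in> T \<and> Cinf_on f T"
  shows "Cinf_on f S"
proof -
  have "Ck_on k f S" if "\<And>x. x \<in> S ==> \<exists>T. open T \<and> x \<in> T \<and> Ck_on k f T" for k and f :: "'a => 'b"
    using that
  proof (induction k arbitrary: f)
    case 0 show ?case
      using 0 by (auto intro!: continuous_at_imp_continuous_on) (meson continuous_on_eq_continuous_at)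
  next
    case (Suc k) show ?case using Suc.prems Suc.IH by (simp; meson)
  qed
  then show ?thesis using assms unfolding Cinf_on_def by meson
qed

section \<open>Differentiation under the integral sign and symmetry of second derivatives\<close>

lemma integral_unit_cong:
  assumes "\<And>t. t \<in> {0..1} ==> f t = g t"
  shows "integral {0..1::real} f = integral {0..1} g"
  using assms by (rule integral_cong)

text \<open>The Leibniz rule asks for a jointly continuous derivative with values in bounded linear
  maps; its matrix entries are the smooth functions \<open>fderiv f s (j, 0) \<bullet> i\<close>.
  The open set \<open>O'\<close> is a separate parameter since \<open>S \<times> {0..1}\<close> is
  not open.\<close>

lemma has_derivative_integral_unit:
  fixes f :: "'a::euclidean_space \<times> real => 'b::euclidean_space"
  assumes "Cinf_on f O'" "S \<times> {0..1} \<subseteq> O'" "open S" "x \<in> S"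
  shows "((\<lambda>x. integral {0..1} (\<lambda>t. f (x, t))) has_derivative
    (\<lambda>v. integral {0..1} (\<lambda>t. fderiv f ((x, t)) (v, 0)))) (at x)"
proof -
  obtain r where r: "r > 0" "ball x r \<subseteq> S" using assms(3,4) openE by blast
  let ?U = "ball x r"
  define D where "D y t = Blinfun (\<lambda>v. fderiv f ((y, t)) (v, 0))" for y t
  have sub: "?U \<times> {0..1} \<subseteq> O'" using r assms(2) by auto
  have der: "(f has_derivative fderiv f ((y, t))) (at (y, t))" if "y \<in> ?U" "t \<in> {0..1}" for y t
    using Cinf_on_has_derivative[OF assms(1)] that sub by blast
  have der2: "((\<lambda>y. f (y, t)) has_derivative (\<lambda>v. fderiv f ((y, t)) (v, 0))) (at y)"
    if "y \<in> ?U" "t \<in> {0..1}" for y t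
  proof -
    have "((\<lambda>y. (y, t)) has_derivative (\<lambda>v. (v, 0))) (at y)" by (auto intro!: derivative_eq_intros)
    from has_derivative_compose[OF this, of f] der[OF that] show ?thesis by simp
  qed
  have bl: "bounded_linear (\<lambda>v. fderiv f ((y, t)) (v, 0))" if "y \<in> ?U" "t \<in> {0..1}" for y t
    using der2[OF that] by (rule has_derivative_bounded_linear)
  have D: "blinfun_apply (D y t) = (\<lambda>v. fderiv f ((y, t)) (v, 0))" if "y \<in> ?U" "t \<in> {0..1}" for y t
    unfolding D_def by (rule bounded_linear_Blinfun_apply[OF bl[OF that]])
  have cD: "continuous_on (?U \<times> {0..1}) (\<lambda>(y, t). D y t)"
  proof -
    have "continuous_on (?U \<times> {0..1}) (\<lambda>s. blinfun_of_matrix (\<lambda>i j. fderiv f s (j, 0) \<bullet> i))"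
      by (intro continuous_on_blinfun_of_matrix continuous_intros
          continuous_on_subset[OF Cinf_on_continuous[OF Cinf_on_frechet[OF assms(1)]] sub])
    moreover have "(\<lambda>(y, t). D y t) s = blinfun_of_matrix (\<lambda>i j. fderiv f s (j, 0) \<bullet> i)"
      if "s \<in> ?U \<times> {0..1}" for s
      using that unfolding D_def by (auto simp: Blinfun_eq_matrix[OF bl])
    ultimately show ?thesis by (metis (no_types, lifting) continuous_on_cong)
  qed
  have cont: "continuous_on {0..1} (\<lambda>t. f (y, t))" if "y \<in> ?U" for y
    using that sub by (auto intro!: continuous_on_compose2[OF Cinf_on_continuous[OF assms(1)]] continuous_intros)
  have "((\<lambda>y. integral (cbox 0 1) (\<lambda>t. f (y, t))) has_derivative integral (cbox 0 1) (D x)) (at x within ?U)"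
  proof (rule leibniz_rule)
    show "((\<lambda>y. f (y, t)) has_derivative blinfun_apply (D y t)) (at y within ?U)" if "y \<in> ?U" "t \<in> cbox 0 1" for y t
      using der2[of y t] D[of y t] that by (simp add: has_derivative_at_withinI)
    show "(\<lambda>t. f (y, t)) integrable_on cbox 0 1" if "y \<in> ?U" for y
      using cont[OF that] integrable_continuous_interval by simp
    show "continuous_on (?U \<times> cbox 0 1) (\<lambda>(x, t). D x t)" using cD by simp
  qed (use r in auto)
  moreover have "at x within ?U = at x" by (rule at_within_open) (use r in auto)
  moreover have "D x integrable_on {0..1}"
    using continuous_on_compose2[OF cD, of "{0..1}" "\<lambda>t. (x, t)"] r
    by (intro integrable_continuous_interval) (auto simp: continuous_on_Pair continuous_on_const continuous_on_id image_subset_iff)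
  then have "blinfun_apply (integral {0..1} (D x)) v = integral {0..1} (\<lambda>t. fderiv f ((x, t)) (v, 0))" for v
    using r D[of x] by (subst blinfun_apply_integral) (auto intro!: integral_cong)
  then have "blinfun_apply (integral {0..1} (D x)) = (\<lambda>v. integral {0..1} (\<lambda>t. fderiv f ((x, t)) (v, 0)))"
    by (rule ext)
  ultimately show ?thesis by simp
qed

text \<open>Differentiation reproduces an integral of the same shape, with \<open>f\<close> replaced
  by a directional derivative, so the order of smoothness rises by induction.\<close>

lemma Cinf_on_integral_unit:
  fixes f :: "'a::euclidean_space \<times> real => 'b::euclidean_space"
  assumes "S \<times> {0..1} \<subseteq> O'" "open S" "Cinf_on f O'"
  shows "Cinf_on (\<lambda>x. integral {0..1} (\<lambda>t. f (x, t))) S"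
proof -
  have "Ck_on k (\<lambda>x. integral {0..1} (\<lambda>t. f (x, t))) S" if "Cinf_on f O'" for k and f :: "'a \<times> real => 'b"
    using that
  proof (induction k arbitrary: f)
    case 0
    have "(\<lambda>x. integral {0..1} (\<lambda>t. f (x, t))) differentiable (at x)" if "x \<in> S" for x
      using has_derivative_integral_unit[OF 0 assms(1,2) that] differentiable_def by blast
    then show ?case by (simp add: continuous_at_imp_continuous_on differentiable_imp_continuous_within)
  next
    case (Suc k) show ?case
      by (rule Ck_onI[OF assms(2) has_derivative_integral_unit[OF Suc.prems assms(1,2)] Suc.IH[OF Cinf_on_frechet[OF Suc.prems]]])
  qed
  then show ?thesis using assms(3) by (simp add: Cinf_on_def)
qed

lemma integral_along_segment:
  fixes f :: "'a::euclidean_space => 'b::euclidean_space"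
  assumes "Cinf_on f S" "\<And>t. t \<in> {0..1} ==> x + t *\<^sub>R v \<in> S"
  shows "integral {0..1} (\<lambda>t. fderiv f ((x + t *\<^sub>R v)) v) = f (x + v) - f x"
proof -
  have "((\<lambda>t. f (x + t *\<^sub>R v)) has_vector_derivative fderiv f ((x + t *\<^sub>R v)) v) (at t within {0..1})"
    if "t \<in> {0..1}" for t
  proof -
    note d = Cinf_on_has_derivative[OF assms(1) assms(2)[OF that]]
    have "((\<lambda>t. x + t *\<^sub>R v) has_derivative (\<lambda>s. s *\<^sub>R v)) (at t)" by (auto intro!: derivative_eq_intros)
    from has_derivative_compose[OF this d] show ?thesis
      by (simp add: has_vector_derivative_def has_derivative_at_withinI linear_cmul[OF has_derivative_linear[OF d]])
  qed
  from fundamental_theorem_of_calculus[OF _ this] show ?thesis by (simp add: integral_unique)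
qed

lemma Cinf_on_compose_UNIV:
  assumes "open S" "Cinf_on f S" "Cinf_on g UNIV"
  shows "Cinf_on (\<lambda>x. f (g x)) (g -` S)"
  by (rule Cinf_on_compose[OF open_vimage[OF assms(1) Cinf_on_continuous[OF assms(3)]] assms(1) _ assms(2)
    Cinf_on_subset[OF assms(3) subset_UNIV]]) auto

text \<open>\<open>f (y + t *\<^sub>R v) - f y\<close> is \<open>t\<close> times the average of the
  \<open>v\<close>-derivative over a segment. Its derivative in direction \<open>u\<close> can be
  taken under the integral or directly, so the average of the antisymmetric part \<open>D\<close>
  over every short segment in direction \<open>v\<close> from \<open>x\<close> vanishes; letting
  \<open>t\<close> tend to 0 gives \<open>D x = 0\<close>.\<close>

lemma Cinf_on_frechet_sym:
  fixes f :: "'a::euclidean_space => 'b::euclidean_space"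
  assumes f: "Cinf_on f S" and S: "open S" and x: "x \<in> S"
  shows "fderiv (\<lambda>y. fderiv f y u) x v =
    fderiv (\<lambda>y. fderiv f y v) x u"
proof -
  obtain r where r: "r > 0" "ball x r \<subseteq> S" using S x openE by blast
  \<comment> \<open>A displacement below \<open>d\<close> followed by one of length at most
    \<open>d * norm v\<close> stays within \<open>d * (norm v + 1) = r\<close>.\<close>
  define d where "d = r / (norm v + 1)"
  have nv: "norm v + 1 > 0" by (simp add: add_nonneg_pos)
  have d: "d > 0" using r nv by (simp add: d_def)
  have seg: "y + (t * s) *\<^sub>R v \<in> S" if "y \<in> ball x d" "\<bar>t\<bar> < d" "s \<in> {0..1}" for y t s
  proof -
    have "\<bar>t * s\<bar> \<le> d * 1" unfolding abs_mult by (rule mult_mono) (use that d in auto)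
    then have "norm ((t * s) *\<^sub>R v) \<le> d * norm v" by (simp add: mult_right_mono)
    moreover have "d * (norm v + 1) = r" using nv by (simp add: d_def)
    ultimately have "dist x (y + (t * s) *\<^sub>R v) < r"
      using that(1) norm_triangle_ineq4[of "x - y" "(t * s) *\<^sub>R v"]
      by (auto simp: dist_norm algebra_simps)
    then show ?thesis using r by auto
  qed
  define fv where "fv y = fderiv f y v" for y
  define fu where "fu y = fderiv f y u" for y
  define D where "D y = fderiv fu y v - fderiv fv y u" for y
  have fuv: "Cinf_on fv S" "Cinf_on fu S" unfolding fv_def fu_def by (rule Cinf_on_frechet[OF f])+
  have D: "Cinf_on D S" unfolding D_def by (intro Cinf_on_diff Cinf_on_frechet S fuv)
  have zero: "integral {0..1} (\<lambda>s. D (x + (t * s) *\<^sub>R v)) = 0" if t: "\<bar>t\<bar> < d" "t \<noteq> 0" for t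
  proof -
    have line: "integral {0..1} (\<lambda>s. fderiv h ((y + (t * s) *\<^sub>R v)) (t *\<^sub>R v)) = h (y + t *\<^sub>R v) - h y"
      if "Cinf_on h S" "y \<in> ball x d" for h :: "'a => 'b" and y
      using integral_along_segment[OF that(1), of y "t *\<^sub>R v"] seg[OF that(2) t(1)] by (auto simp: mult.commute)
    have sc: "fderiv h ((y + (t * s) *\<^sub>R v)) (t *\<^sub>R v) = t *\<^sub>R fderiv h ((y + (t * s) *\<^sub>R v)) v"
      if "Cinf_on h S" "y \<in> ball x d" "s \<in> {0..1}" for h :: "'a => 'b" and y s
      using Cinf_on_has_derivative[OF that(1) seg[OF that(2) t(1) that(3)]]
      by (simp add: has_derivative_linear linear_cmul)
    let ?O = "(\<lambda>p :: 'a \<times> real. fst p + (t * snd p) *\<^sub>R v) -` S"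
    let ?g = "\<lambda>p. fv (fst p + (t * snd p) *\<^sub>R v)"
    have lin: "Cinf_on (\<lambda>p :: 'a \<times> real. fst p + (t * snd p) *\<^sub>R v) UNIV"
      by (intro Cinf_on_linear) (auto simp: linear_iff algebra_simps)
    have g: "Cinf_on ?g ?O" by (rule Cinf_on_compose_UNIV[OF S fuv(1) lin])
    have sub: "ball x d \<times> {0..1} \<subseteq> ?O" using seg[OF _ t(1)] by auto
    have xd: "x \<in> ball x d" using d by simp
    have dg: "fderiv ?g ((x, s)) (u, 0) = fderiv fv ((x + (t * s) *\<^sub>R v)) u"
      if "s \<in> {0..1}" for s
    proof -
      have "((\<lambda>p :: 'a \<times> real. fst p + (t * snd p) *\<^sub>R v) has_derivative (\<lambda>p. fst p + (t * snd p) *\<^sub>R v)) (at (x, s))"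
        by (auto intro!: derivative_eq_intros)
      from has_derivative_compose[OF this, of fv] Cinf_on_has_derivative[OF fuv(1) seg[OF xd t(1) that]]
      have "(?g has_derivative (\<lambda>p. fderiv fv ((x + (t * s) *\<^sub>R v)) (fst p + (t * snd p) *\<^sub>R v))) (at (x, s))"
        by simp
      from frechet_derivative_at[OF this, symmetric] show ?thesis by simp
    qed
    have "((\<lambda>y. t *\<^sub>R integral {0..1} (\<lambda>s. ?g (y, s))) has_derivative
        (\<lambda>w. t *\<^sub>R integral {0..1} (\<lambda>s. fderiv ?g ((x, s)) (w, 0)))) (at x)"
      by (rule has_derivative_scaleR_right[OF has_derivative_integral_unit[OF g sub open_ball xd]])
    moreover have "t *\<^sub>R integral {0..1} (\<lambda>s. ?g (y, s)) = f (y + t *\<^sub>R v) - f y" if "y \<in> ball x d" for y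
    proof -
      have "integral {0..1} (\<lambda>s. fderiv f ((y + (t * s) *\<^sub>R v)) (t *\<^sub>R v)) = integral {0..1} (\<lambda>s. t *\<^sub>R ?g (y, s))"
        by (intro integral_cong) (use sc[OF f that] in \<open>auto simp: fv_def\<close>)
      then show ?thesis using line[OF f that] by simp
    qed
    ultimately have d1: "((\<lambda>y. f (y + t *\<^sub>R v) - f y) has_derivative
        (\<lambda>w. t *\<^sub>R integral {0..1} (\<lambda>s. fderiv ?g ((x, s)) (w, 0)))) (at x)"
      using has_derivative_transform_within_open[OF _ open_ball xd] by (metis (no_types, lifting))
    have xt: "x + t *\<^sub>R v \<in> S" using seg[OF xd t(1), of 1] by simp
    have "((\<lambda>y. y + t *\<^sub>R v) has_derivative (\<lambda>w. w)) (at x)" by (auto intro!: derivative_eq_intros)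
    from has_derivative_diff[OF has_derivative_compose[OF this Cinf_on_has_derivative[OF f xt]] Cinf_on_has_derivative[OF f x]]
    have "t *\<^sub>R integral {0..1} (\<lambda>s. fderiv ?g ((x, s)) (u, 0)) = fu (x + t *\<^sub>R v) - fu x"
      using has_derivative_unique[OF d1] unfolding fu_def by (metis (no_types, lifting))
    also have "\<dots> = t *\<^sub>R integral {0..1} (\<lambda>s. fderiv fu ((x + (t * s) *\<^sub>R v)) v)"
      unfolding line[OF fuv(2) xd, symmetric] integral_cmul[symmetric]
      by (intro integral_cong) (use sc[OF fuv(2) xd] in auto)
    finally have eq: "integral {0..1} (\<lambda>s. fderiv fv ((x + (t * s) *\<^sub>R v)) u) =
        integral {0..1} (\<lambda>s. fderiv fu ((x + (t * s) *\<^sub>R v)) v)"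
      using t integral_unit_cong[OF dg] by simp
    have cont: "continuous_on {0..1} (\<lambda>s. fderiv h ((x + (t * s) *\<^sub>R v)) w)" if "Cinf_on h S" for h :: "'a => 'b" and w
      using seg[OF xd t(1)] by (intro continuous_on_compose2[OF Cinf_on_continuous[OF Cinf_on_frechet[OF that]]] continuous_intros) auto
    show ?thesis unfolding D_def
      by (subst integral_diff) (auto intro!: integrable_continuous_interval cont fuv simp: eq)
  qed
  \<comment> \<open>The average is a smooth function of \<open>t\<close> also at
    \<open>t = 0\<close>, where its value is \<open>D x\<close>; away from 0 it is known to
    vanish.\<close>
  let ?O = "(\<lambda>p :: real \<times> real. x + (fst p * snd p) *\<^sub>R v) -` S"
  have "Cinf_on (\<lambda>p :: real \<times> real. x + (fst p * snd p) *\<^sub>R v) UNIV"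
    by (intro Cinf_on_add Cinf_on_const Cinf_on_scaleR Cinf_on_mult Cinf_on_fst Cinf_on_snd Cinf_on_id open_UNIV)
  from Cinf_on_compose_UNIV[OF S D this]
  have "Cinf_on (\<lambda>t. integral {0..1} (\<lambda>s. D (x + (fst (t, s) * snd (t, s)) *\<^sub>R v))) {-d<..<d}"
    using seg[of x] d by (intro Cinf_on_integral_unit[of _ ?O]) auto
  then have "isCont (\<lambda>t. integral {0..1} (\<lambda>s. D (x + (t * s) *\<^sub>R v))) 0"
    using d Cinf_on_continuous by (force simp: continuous_on_eq_continuous_at)
  then have "((\<lambda>t. integral {0..1} (\<lambda>s. D (x + (t * s) *\<^sub>R v))) \<longlongrightarrow> D x) (at 0)"
    by (simp add: isCont_def)
  moreover have "\<forall>\<^sub>F t in at 0. integral {0..1} (\<lambda>s. D (x + (t * s) *\<^sub>R v)) = 0"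
    unfolding eventually_at using d zero by (auto intro!: exI[of _ d])
  ultimately have "D x = 0"
    using tendsto_unique[OF at_neq_bot _ tendsto_eventually] by blast
  then show ?thesis by (simp add: D_def fu_def[abs_def] fv_def[abs_def])
qed

section \<open>Primitives of closed one-forms and the Hadamard expansion\<close>

text \<open>The primitive is the integral of \<open>\<omega>\<close> along the segment from
  \<open>x0\<close>. By closedness the derivative of the integrand in direction \<open>v\<close> is
  the total \<open>t\<close>-derivative of \<open>t *\<^sub>R \<omega> (?c (x, t)) v\<close>, which
  integrates to \<open>\<omega> x v\<close>.\<close>

lemma poincare_lemma:
  fixes \<omega> :: "'a::euclidean_space => 'a => 'b::euclidean_space"
  assumes smooth: "\<And>u. Cinf_on (\<lambda>x. \<omega> x u) (ball x0 r)" and lin: "\<And>x. x \<in> ball x0 r ==> linear (\<omega> x)"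
    and closed: "\<And>x u w. x \<in> ball x0 r ==> fderiv (\<lambda>y. \<omega> y u) x w = fderiv (\<lambda>y. \<omega> y w) x u"
  obtains f where "f x0 = 0" "\<And>x. x \<in> ball x0 r ==> (f has_derivative \<omega> x) (at x)" "Cinf_on f (ball x0 r)"
proof -
  let ?c = "\<lambda>p :: 'a \<times> real. x0 + snd p *\<^sub>R (fst p - x0)"
  let ?O = "?c -` ball x0 r"
  define g where "g p = (\<Sum>b\<in>Basis. ((fst p - x0) \<bullet> b) *\<^sub>R \<omega> (?c p) b)" for p
  define f where "f x = integral {0..1} (\<lambda>t. g (x, t))" for x
  have oO: "open ?O" by (intro open_vimage continuous_intros) auto
  have c: "Cinf_on ?c UNIV"
    by (intro Cinf_on_add Cinf_on_const Cinf_on_scaleR Cinf_on_diff Cinf_on_fst Cinf_on_snd Cinf_on_id open_UNIV)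
  have g: "Cinf_on g ?O" unfolding g_def
    by (intro Cinf_on_sum Cinf_on_scaleR Cinf_on_inner Cinf_on_diff Cinf_on_fst Cinf_on_id Cinf_on_const oO
        Cinf_on_compose_UNIV[OF open_ball smooth c])
  have sub: "ball x0 r \<times> {0..1} \<subseteq> ?O"
  proof
    fix q assume "q \<in> ball x0 r \<times> {0..1::real}"
    then obtain x t where q: "q = (x, t)" and "x \<in> ball x0 r" "t \<in> {0..1}" by blast
    then have "t * norm (x - x0) \<le> 1 * norm (x - x0)" "norm (x - x0) < r"
      by (auto intro!: mult_right_mono mult_left_le_one_le simp: dist_norm norm_minus_commute)
    then show "q \<in> ?O" unfolding q using \<open>t \<in> {0..1}\<close> by (auto simp: dist_norm norm_minus_commute)
  qed
  have der: "(f has_derivative \<omega> x) (at x)" if x: "x \<in> ball x0 r" for x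
  proof -
    have "integral {0..1} (\<lambda>t. fderiv g ((x, t)) (v, 0)) = \<omega> x v" for v
    proof -
      let ?D = "\<lambda>b t w. fderiv (\<lambda>y. \<omega> y b) ((?c (x, t))) w"
      have d\<omega>: "((\<lambda>y. \<omega> y b) has_derivative ?D b t) (at (?c (x, t)))" if "t \<in> {0..1}" for b t
        using Cinf_on_has_derivative[OF smooth] x that sub by blast
      have lD: "linear (?D b t)" if "t \<in> {0..1}" for b t
        using d\<omega>[OF that] by (rule has_derivative_linear)
      have eq: "fderiv g ((x, t)) (v, 0) = \<omega> (?c (x, t)) v + t *\<^sub>R ?D v t (x - x0)" if t: "t \<in> {0..1}" for t
      proof -
        have xt: "(x, t) \<in> ?O" using sub x t by blast
        have "((\<lambda>y. g (y, t)) has_derivative (\<lambda>v. fderiv g ((x, t)) (v, 0))) (at x)"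
        proof -
          have "((\<lambda>y. (y, t)) has_derivative (\<lambda>v. (v, 0))) (at x)" by (auto intro!: derivative_eq_intros)
          from has_derivative_compose[OF this, of g] Cinf_on_has_derivative[OF g xt] show ?thesis by simp
        qed
        moreover have "((\<lambda>y. g (y, t)) has_derivative (\<lambda>v. \<Sum>b\<in>Basis. ((x - x0) \<bullet> b) *\<^sub>R ?D b t (t *\<^sub>R v) + (v \<bullet> b) *\<^sub>R \<omega> (?c (x, t)) b)) (at x)"
          unfolding g_def fst_conv snd_conv
        proof (rule has_derivative_sum, rule has_derivative_scaleR)
          fix b :: 'a
          show "((\<lambda>y. (y - x0) \<bullet> b) has_derivative (\<lambda>v. v \<bullet> b)) (at x)" by (auto intro!: derivative_eq_intros)
          have "((\<lambda>y. x0 + t *\<^sub>R (y - x0)) has_derivative (\<lambda>v. t *\<^sub>R v)) (at x)" by (auto intro!: derivative_eq_intros)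
          from has_derivative_compose[OF this, of "\<lambda>y. \<omega> y b"] d\<omega>[OF t, of b]
          show "((\<lambda>y. \<omega> (x0 + t *\<^sub>R (y - x0)) b) has_derivative (\<lambda>v. fderiv (\<lambda>y. \<omega> y b) ((x0 + t *\<^sub>R (x - x0))) (t *\<^sub>R v))) (at x)"
            by simp
        qed
        ultimately have "fderiv g ((x, t)) (v, 0) =
            (\<Sum>b\<in>Basis. ((x - x0) \<bullet> b) *\<^sub>R ?D b t (t *\<^sub>R v) + (v \<bullet> b) *\<^sub>R \<omega> (?c (x, t)) b)"
          using has_derivative_unique by (metis (no_types, lifting))
        also have "\<dots> = t *\<^sub>R (\<Sum>b\<in>Basis. ((x - x0) \<bullet> b) *\<^sub>R ?D v t b) + (\<Sum>b\<in>Basis. (v \<bullet> b) *\<^sub>R \<omega> (?c (x, t)) b)"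
          using closed[of "?c (x, t)" _ v] xt linear_cmul[OF lD[OF t]]
          by (simp add: sum.distrib scaleR_sum_right mult.commute)
        also have "\<dots> = t *\<^sub>R ?D v t (x - x0) + \<omega> (?c (x, t)) v"
          using linear_apply_basis[OF lD[OF t, of v], of "x - x0"] linear_apply_basis[OF lin, of "?c (x, t)" v] xt by auto
        finally show ?thesis by simp
      qed
      have "((\<lambda>t. t *\<^sub>R \<omega> (?c (x, t)) v) has_vector_derivative (\<omega> (?c (x, t)) v + t *\<^sub>R ?D v t (x - x0))) (at t within {0..1})"
        if t: "t \<in> {0..1}" for t
      proof -
        have "((\<lambda>t. ?c (x, t)) has_derivative (\<lambda>s. s *\<^sub>R (x - x0))) (at t)" by (auto intro!: derivative_eq_intros)
        from has_derivative_compose[OF this d\<omega>[OF t, of v]] linear_cmul[OF lD[OF t, of v]]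
        have "((\<lambda>t. \<omega> (?c (x, t)) v) has_derivative (\<lambda>s. s *\<^sub>R ?D v t (x - x0))) (at t)"
          by simp
        from has_derivative_scaleR[OF has_derivative_ident this]
        show ?thesis unfolding has_vector_derivative_def
          by (rule has_derivative_at_withinI[THEN has_derivative_eq_rhs]) (auto simp: algebra_simps)
      qed
      from fundamental_theorem_of_calculus[OF _ this] have "integral {0..1} (\<lambda>t. \<omega> (?c (x, t)) v + t *\<^sub>R ?D v t (x - x0)) = \<omega> x v"
        by (simp add: integral_unique)
      then show ?thesis using integral_unit_cong[OF eq] by simp
    qed
    then show ?thesis using has_derivative_integral_unit[OF g sub open_ball x] unfolding f_def[abs_def] by simp
  qed
  show ?thesis
  proof (rule that)
    show "f x0 = 0" by (simp add: f_def g_def)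
    show "Cinf_on f (ball x0 r)" by (rule Cinf_onI[OF open_ball der smooth])
  qed (rule der)
qed

text \<open>Integrate the derivative along the segment from \<open>p\<close> and split the direction
  \<open>x - p\<close> in \<open>Basis\<close>. The expansion is what turns derivations into
  directional derivatives.\<close>

lemma hadamard_lemma:
  fixes f :: "'a::euclidean_space => real"
  assumes f: "Cinf_on f (ball p r)"
  obtains g where "\<And>b. Cinf_on (g b) (ball p r)" "\<And>x. x \<in> ball p r ==> f x = f p + (\<Sum>b\<in>Basis. ((x - p) \<bullet> b) * g b x)"
    "\<And>b. b \<in> Basis ==> g b p = fderiv f p b"
proof -
  let ?c = "\<lambda>p' :: 'a \<times> real. p + snd p' *\<^sub>R (fst p' - p)"
  let ?O = "?c -` ball p r"
  define g where "g b x = integral {0..1} (\<lambda>t. fderiv f ((?c (x, t))) b)" for b x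
  have c: "Cinf_on ?c UNIV"
    by (intro Cinf_on_add Cinf_on_const Cinf_on_scaleR Cinf_on_diff Cinf_on_fst Cinf_on_snd Cinf_on_id open_UNIV)
  have sub: "ball p r \<times> {0..1} \<subseteq> ?O"
  proof
    fix q assume "q \<in> ball p r \<times> {0..1::real}"
    then obtain x t where q: "q = (x, t)" and "x \<in> ball p r" "t \<in> {0..1}" by blast
    then have "t * norm (x - p) \<le> 1 * norm (x - p)" "norm (x - p) < r"
      by (auto intro!: mult_right_mono mult_left_le_one_le simp: dist_norm norm_minus_commute)
    then show "q \<in> ?O" unfolding q using \<open>t \<in> {0..1}\<close> by (auto simp: dist_norm norm_minus_commute)
  qed
  have 1: "Cinf_on (g b) (ball p r)" for b unfolding g_def
    by (rule Cinf_on_integral_unit[OF sub open_ball]) (rule Cinf_on_compose_UNIV[OF open_ball Cinf_on_frechet[OF f] c])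
  have 2: "g b p = fderiv f p b" for b by (simp add: g_def)
  have 3: "f x = f p + (\<Sum>b\<in>Basis. ((x - p) \<bullet> b) * g b x)" if x: "x \<in> ball p r" for x
  proof -
    have in': "p + t *\<^sub>R (x - p) \<in> ball p r" if "t \<in> {0..1}" for t using subsetD[OF sub, of "(x, t)"] x that by simp
    have "f x - f p = integral {0..1} (\<lambda>t. fderiv f ((p + t *\<^sub>R (x - p))) (x - p))"
      using integral_along_segment[OF f in'] by simp
    also have "\<dots> = integral {0..1} (\<lambda>t. \<Sum>b\<in>Basis. ((x - p) \<bullet> b) * fderiv f ((p + t *\<^sub>R (x - p))) b)"
      using linear_apply_basis[OF has_derivative_linear[OF Cinf_on_has_derivative[OF f in']], of _ "x - p"]
      by (intro integral_cong) (auto simp: inner_commute)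
    also have "\<dots> = (\<Sum>b\<in>Basis. ((x - p) \<bullet> b) * g b x)"
      unfolding g_def using in'
      by (subst integral_sum) (auto intro!: integrable_continuous_interval continuous_intros
          continuous_on_compose2[OF Cinf_on_continuous[OF Cinf_on_frechet[OF f]]])
    finally show ?thesis by simp
  qed
  show ?thesis by (rule that[OF 1 3 2])
qed

section \<open>Smooth cutoff functions\<close>

text \<open>The whole family is introduced because the derivative of a member is a combination of
  the members \<open>n + 1\<close> and \<open>n + 2\<close>, so smoothness follows by one induction
  over all \<open>n\<close>.\<close>

definition flat_exp :: "nat => real => real" where
  "flat_exp n t = (if t > 0 then inverse t ^ n * exp (- inverse t) else 0)"

lemma isCont_flat_exp_0: "isCont (flat_exp n) 0"
proof -
  have "((\<lambda>t. inverse t ^ n / exp (inverse t)) \<longlongrightarrow> 0) (at_right (0::real))"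
    by (rule filterlim_compose[OF tendsto_power_div_exp_0 filterlim_inverse_at_top_right])
  then have "(flat_exp n \<longlongrightarrow> 0) (at_right 0)"
    by (rule Lim_transform_eventually)
      (auto simp: eventually_at_right_field flat_exp_def exp_minus divide_inverse intro: exI[of _ 1])
  moreover have "(flat_exp n \<longlongrightarrow> 0) (at_left 0)"
    by (rule tendsto_eventually) (auto simp: eventually_at_left_field flat_exp_def intro: exI[of _ "-1"])
  ultimately show ?thesis
    using filterlim_split_at by (auto simp: isCont_def flat_exp_def[of n 0])
qed

lemma flat_exp_has_derivative:
  "(flat_exp n has_real_derivative (flat_exp (n + 2) t - n * flat_exp (n + 1) t)) (at t)"
proof -
  consider "t > 0" | "t < 0" | "t = 0" by linarith
  then show ?thesis
  proof cases
    case 1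
    have pw: "real n * (inverse t * (inverse t * inverse t ^ (n - Suc 0))) = real n * (inverse t * inverse t ^ n)"
      by (cases n) auto
    have "((\<lambda>t. inverse t ^ n * exp (- inverse t)) has_real_derivative (flat_exp (n + 2) t - n * flat_exp (n + 1) t)) (at t)"
      using 1 pw by (auto intro!: derivative_eq_intros simp: flat_exp_def algebra_simps power2_eq_square)
    then show ?thesis
      by (rule has_field_derivative_transform_within_open[where S = "{0<..}"]) (use 1 in \<open>auto simp: flat_exp_def\<close>)
  next
    case 2
    have "((\<lambda>t. 0) has_real_derivative (flat_exp (n + 2) t - n * flat_exp (n + 1) t)) (at t)"
      using 2 by (auto simp: flat_exp_def)
    then show ?thesis
      by (rule has_field_derivative_transform_within_open[where S = "{..<0}"]) (use 2 in \<open>auto simp: flat_exp_def\<close>)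
  next
    case 3
    have "(flat_exp n (0 + h) - flat_exp n 0) / h = flat_exp (n + 1) h" if "h \<noteq> 0" for h
      by (auto simp: flat_exp_def divide_inverse)
    then have "\<forall>\<^sub>F h in at 0. flat_exp (n + 1) h = (flat_exp n (0 + h) - flat_exp n 0) / h"
      unfolding eventually_at by (intro exI[of _ 1]) (simp del: add_0)
    then have "((\<lambda>h. (flat_exp n (0 + h) - flat_exp n 0) / h) \<longlongrightarrow> flat_exp (n + 1) 0) (at 0)"
      by (rule Lim_transform_eventually[OF isCont_flat_exp_0[of "n + 1", unfolded isCont_def]])
    then show ?thesis using 3 by (simp add: DERIV_def flat_exp_def)
  qed
qed

lemma Cinf_on_flat_exp: "Cinf_on (flat_exp n) UNIV"
proof -
  have "Ck_on k (flat_exp n) UNIV" for k n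
  proof (induction k arbitrary: n)
    case 0 show ?case
      using flat_exp_has_derivative DERIV_isCont continuous_at_imp_continuous_on by (metis Ck_on.simps(1))
  next
    case (Suc k)
    have "Ck_on k (\<lambda>t. (flat_exp (n + 2) t + (- real n) * flat_exp (n + 1) t) * v) UNIV" for v
      by (intro Ck_on_bilinear[OF bounded_bilinear_mult] Ck_on_add Ck_on_const Suc open_UNIV)
    then show ?case
      by (intro Ck_onI[of _ _ "\<lambda>t v. (flat_exp (n + 2) t + (- real n) * flat_exp (n + 1) t) * v"])
        (use flat_exp_has_derivative[unfolded has_field_derivative_def] in auto)
  qed
  then show ?thesis by (simp add: Cinf_on_def)
qed

lemma bump_function:
  fixes p :: "'a::euclidean_space"
  assumes "r > 0"
  obtains \<rho> :: "'a => real" and r' where "Cinf_on \<rho> UNIV" "0 < r'" "r' < r" "\<And>x. x \<in> ball p r' ==> \<rho> x = 1"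
    "\<And>x. x \<notin> ball p r ==> \<rho> x = 0"
proof -
  \<comment> \<open>\<open>q\<close> measures the squared distance in units of \<open>c\<close>: the
    quotient \<open>\<rho>\<close> is 1 for \<open>q \<le> 1\<close> and 0 for
    \<open>q \<ge> 2\<close>, and its denominator never vanishes because \<open>2 - q\<close> or
    \<open>q - 1\<close> is positive.\<close>
  define c where "c = (r / 2)\<^sup>2"
  define h where "h t = flat_exp 0 t" for t
  define q where "q x = (x - p) \<bullet> (x - p) / c" for x :: 'a
  define \<rho> where "\<rho> x = h (2 - q x) * inverse (h (2 - q x) + h (q x - 1))" for x
  have c: "c > 0" using assms by (simp add: c_def)
  have h: "h t = 0 \<longleftrightarrow> t \<le> 0" "h t \<ge> 0" for t by (auto simp: h_def flat_exp_def)
  have pos: "h (2 - q x) + h (q x - 1) > 0" for x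
    using h(1)[of "2 - q x"] h(1)[of "q x - 1"] h(2)[of "2 - q x"] h(2)[of "q x - 1"] by linarith
  have q: "Cinf_on q UNIV" unfolding q_def divide_inverse
    by (intro Cinf_on_mult Cinf_on_inner Cinf_on_diff Cinf_on_id Cinf_on_const open_UNIV)
  have hc: "Cinf_on (\<lambda>x. h (g x)) UNIV" if "Cinf_on g UNIV" for g :: "'a => real"
    unfolding h_def by (rule Cinf_on_compose[OF _ _ _ Cinf_on_flat_exp that]) auto
  have "Cinf_on \<rho> UNIV" unfolding \<rho>_def
    using pos by (intro Cinf_on_mult Cinf_on_inverse Cinf_on_add hc Cinf_on_diff Cinf_on_const q open_UNIV) (simp add: less_imp_neq[symmetric])
  moreover have "\<rho> x = 1" if "x \<in> ball p (r/2)" for x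
  proof -
    have "(norm (x - p))\<^sup>2 < (r/2)\<^sup>2" using that by (intro power_strict_mono) (auto simp: dist_norm norm_minus_commute)
    then have "q x < 1" using c by (simp add: q_def c_def power2_norm_eq_inner)
    then have "h (q x - 1) = 0" "h (2 - q x) \<noteq> 0" using h(1) by auto
    then show ?thesis by (simp add: \<rho>_def)
  qed
  moreover have "\<rho> x = 0" if "x \<notin> ball p r" for x
  proof -
    have "r\<^sup>2 \<le> (norm (x - p))\<^sup>2" using that assms by (intro power_mono) (auto simp: dist_norm norm_minus_commute)
    moreover have "r\<^sup>2 = 4 * c" by (simp add: c_def power_divide)
    ultimately have "2 * c \<le> (x - p) \<bullet> (x - p)" using c by (simp add: power2_norm_eq_inner)
    then have "q x \<ge> 2" using c by (simp add: q_def field_simps)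
    then show ?thesis using h(1) by (simp add: \<rho>_def)
  qed
  ultimately show ?thesis using that[of \<rho> "r/2"] assms by auto
qed

section \<open>Smooth parametrizations and tangent vectors\<close>

text \<open>The part of \<open>smooth_atlas\<close> that does not mention transition maps, so that
  \<open>prod_atlas\<close> and \<open>euclidean_atlas\<close> can be handled by the same
  lemmas.\<close>

definition charts :: "('m::topological_space, 'e::euclidean_space) chart set => bool" where
  "charts A \<longleftrightarrow> (\<Union>(U,\<phi>)\<in>A. U) = UNIV \<and>
    (\<forall>(U,\<phi>)\<in>A. open U \<and> open (\<phi> ` U) \<and> homeomorphism U (\<phi> ` U) \<phi> (inv_into U \<phi>))"

lemma chartsD:
  assumes "charts A" "(U, \<phi>) \<in> A"
  shows "open U" "open (\<phi> ` U)" "homeomorphism U (\<phi> ` U) \<phi> (inv_into U \<phi>)"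
    "continuous_on U \<phi>" "continuous_on (\<phi> ` U) (inv_into U \<phi>)"
    "q \<in> U ==> inv_into U \<phi> (\<phi> q) = q" "x \<in> \<phi> ` U ==> \<phi> (inv_into U \<phi> x) = x" "x \<in> \<phi> ` U ==> inv_into U \<phi> x \<in> U"
proof -
  show *: "open U" "open (\<phi> ` U)" "homeomorphism U (\<phi> ` U) \<phi> (inv_into U \<phi>)"
    using assms unfolding charts_def by auto
  show "continuous_on U \<phi>" "continuous_on (\<phi> ` U) (inv_into U \<phi>)"
    "q \<in> U ==> inv_into U \<phi> (\<phi> q) = q" "x \<in> \<phi> ` U ==> \<phi> (inv_into U \<phi> x) = x" "x \<in> \<phi> ` U ==> inv_into U \<phi> x \<in> U"
    using *(3) by (auto simp: homeomorphism_def)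
qed

lemma chart_at:
  assumes "charts A"
  obtains U \<phi> where "(U, \<phi>) \<in> A" "p \<in> U"
proof -
  have "p \<in> (\<Union>(U,\<phi>)\<in>A. U)" using assms by (simp add: charts_def)
  then show ?thesis using that by auto
qed

lemma open_chart_image:
  assumes "charts A" "(U, \<phi>) \<in> A" "open W"
  shows "open (\<phi> ` (U \<inter> W))"
proof -
  have "\<phi> ` (U \<inter> W) = inv_into U \<phi> -` W \<inter> \<phi> ` U"
    using chartsD(6,7,8)[OF assms(1,2)] by (auto simp: image_iff)
  then show ?thesis
    using continuous_on_open_vimage[OF chartsD(2)[OF assms(1,2)], THEN iffD1, OF chartsD(5)[OF assms(1,2)]] assms(3)
    by simp
qed

lemma charts_euclidean_atlas: "charts euclidean_atlas"
  by (auto simp: charts_def euclidean_atlas_def homeomorphism_def inv_id)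

lemma charts_smooth_atlas: "smooth_atlas A ==> charts A"
  by (auto simp: charts_def smooth_atlas_def)

lemma inv_into_map_prod:
  assumes "inj_on \<phi> U" "inj_on \<psi> V" "x \<in> \<phi> ` U \<times> \<psi> ` V"
  shows "inv_into (U \<times> V) (map_prod \<phi> \<psi>) x = map_prod (inv_into U \<phi>) (inv_into V \<psi>) x"
proof -
  obtain a b where "a \<in> U" "b \<in> V" "x = (\<phi> a, \<psi> b)" using assms(3) by auto
  then show ?thesis
    using assms by (auto intro!: inv_into_f_eq simp: map_prod_inj_on)
qed

lemma charts_prod_atlas:
  assumes A: "charts A" and B: "charts B"
  shows "charts (prod_atlas A B)"
  unfolding charts_def
proof safe
  fix p :: "'a \<times> 'c"
  obtain U \<phi> V \<psi> where "(U, \<phi>) \<in> A" "fst p \<in> U" "(V, \<psi>) \<in> B" "snd p \<in> V" using chart_at A B by metis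
  then have "(U \<times> V, map_prod \<phi> \<psi>) \<in> prod_atlas A B" "p \<in> U \<times> V" by (auto simp: prod_atlas_def mem_Times_iff)
  then show "p \<in> (\<Union>(U,\<phi>)\<in>prod_atlas A B. U)" by blast
next
  fix W \<xi> assume "(W, \<xi>) \<in> prod_atlas A B"
  then obtain U \<phi> V \<psi> where U: "(U, \<phi>) \<in> A" and V: "(V, \<psi>) \<in> B" and W: "W = U \<times> V" "\<xi> = map_prod \<phi> \<psi>"
    by (auto simp: prod_atlas_def)
  note u = chartsD[OF A U] and v = chartsD[OF B V]
  have im: "\<xi> ` W = \<phi> ` U \<times> \<psi> ` V" by (auto simp: W)
  have inj: "inj_on \<phi> U" "inj_on \<psi> V" using u(6) v(6) by (metis inj_on_inverseI)+
  show "open W" "open (\<xi> ` W)" unfolding im by (simp_all add: W(1) open_Times u v)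
  have "continuous_on (\<xi> ` W) (\<lambda>x. (inv_into U \<phi> (fst x), inv_into V \<psi> (snd x)))"
    unfolding im by (intro continuous_on_Pair continuous_on_compose2[OF u(5)] continuous_on_compose2[OF v(5)]
        continuous_intros) auto
  then have "continuous_on (\<xi> ` W) (inv_into W \<xi>)"
    by (rule continuous_on_eq) (auto simp: im W inv_into_map_prod[OF inj])
  moreover have "continuous_on W (\<lambda>x. (\<phi> (fst x), \<psi> (snd x)))"
    unfolding W by (intro continuous_on_Pair continuous_on_compose2[OF u(4)] continuous_on_compose2[OF v(4)]
        continuous_intros) auto
  then have "continuous_on W \<xi>" by (simp add: W map_prod_def split_beta)
  moreover have "inj_on \<xi> W" unfolding W by (rule map_prod_inj_on[OF inj])
  ultimately show "homeomorphism W (\<xi> ` W) \<xi> (inv_into W \<xi>)"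
    by (auto simp: homeomorphism_def f_inv_into_f inv_into_into)
qed (rule UNIV_I)

text \<open>A smooth map from an open subset of a Euclidean space into the manifold, stated with
  charts on the target side only. Curves, inverse charts and their compositions with smooth maps all
  have this form.\<close>

definition plot :: "('m::topological_space, 'e::euclidean_space) chart set => 'a::euclidean_space set => ('a => 'm) => bool" where
  "plot A S c \<longleftrightarrow> open S \<and> continuous_on S c \<and> (\<forall>(U,\<phi>)\<in>A. Cinf_on (\<lambda>x. \<phi> (c x)) (S \<inter> c -` U))"

lemma plot_open: "plot A S c ==> open S"
  by (simp add: plot_def)

lemma plot_continuous: "plot A S c ==> continuous_on S c"
  by (simp add: plot_def)

lemma plot_Cinf_on: "plot A S c ==> (U, \<phi>) \<in> A ==> T \<subseteq> S ==> c ` T \<subseteq> U ==> Cinf_on (\<lambda>x. \<phi> (c x)) T"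
  unfolding plot_def by (auto elim!: Cinf_on_subset dest!: bspec)

lemma open_preimage_Int: "open S ==> continuous_on S c ==> open U ==> open (S \<inter> c -` U)"
  using continuous_on_open_vimage by (metis Int_commute)

lemma plot_smooth_map:
  assumes A: "charts A" and B: "charts B" and F: "smooth_map A B F" and c: "plot A S c"
  shows "plot B S (\<lambda>x. F (c x))"
proof -
  have cF: "continuous_on UNIV F" using F by (simp add: smooth_map_def)
  have cont: "continuous_on S (\<lambda>x. F (c x))"
    by (rule continuous_on_compose2[OF cF plot_continuous[OF c]]) auto
  have "Cinf_on (\<lambda>x. \<psi> (F (c x))) (S \<inter> (\<lambda>x. F (c x)) -` V)" if V: "(V, \<psi>) \<in> B" for V \<psi>
  proof (rule Cinf_on_open_cover)
    fix x assume x: "x \<in> S \<inter> (\<lambda>x. F (c x)) -` V"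
    obtain U \<phi> where U: "(U, \<phi>) \<in> A" "c x \<in> U" using chart_at[OF A] .
    note u = chartsD[OF A U(1)]
    define T where "T = S \<inter> c -` U \<inter> (S \<inter> (\<lambda>x. F (c x)) -` V)"
    have T: "open T"
      unfolding T_def using u(1) chartsD(1)[OF B V] plot_open[OF c] plot_continuous[OF c] cont
      by (intro open_Int open_preimage_Int) auto
    have oV: "open (\<phi> ` (U \<inter> F -` V))"
      by (rule open_chart_image[OF A U(1) open_vimage[OF chartsD(1)[OF B V] cF]])
    have 1: "Cinf_on (\<lambda>y. \<psi> (F (inv_into U \<phi> y))) (\<phi> ` (U \<inter> F -` V))"
      using F U V unfolding smooth_map_def by blast
    have 2: "Cinf_on (\<lambda>x. \<phi> (c x)) T" by (rule plot_Cinf_on[OF c U(1)]) (auto simp: T_def)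
    have "Cinf_on (\<lambda>x. \<psi> (F (inv_into U \<phi> (\<phi> (c x))))) T"
      by (rule Cinf_on_compose[OF T oV _ 1 2]) (auto simp: T_def)
    then have "Cinf_on (\<lambda>x. \<psi> (F (c x))) T"
      by (rule Cinf_on_cong[OF T, rotated]) (auto simp: T_def u(6))
    then show "\<exists>T. open T \<and> x \<in> T \<and> Cinf_on (\<lambda>x. \<psi> (F (c x))) T"
      using T x U by (auto simp: T_def)
  qed
  then show ?thesis unfolding plot_def using plot_open[OF c] cont by auto
qed

lemma plot_euclidean_iff: "plot euclidean_atlas S f \<longleftrightarrow> open S \<and> Cinf_on f S"
  by (auto simp: plot_def euclidean_atlas_def intro: Cinf_on_continuous)

lemma plot_compose:
  assumes "plot A S c" "open T" "Cinf_on h T" "h ` T \<subseteq> S" "charts A"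
  shows "plot A T (\<lambda>x. c (h x))"
proof -
  have ch: "continuous_on T (\<lambda>x. c (h x))"
    by (rule continuous_on_compose2[OF plot_continuous[OF assms(1)] Cinf_on_continuous[OF assms(3)] assms(4)])
  have "Cinf_on (\<lambda>x. \<phi> (c (h x))) (T \<inter> (\<lambda>x. c (h x)) -` U)" if "(U, \<phi>) \<in> A" for U \<phi>
  proof (rule Cinf_on_compose[of _ "S \<inter> c -` U"])
    show "Cinf_on (\<lambda>x. \<phi> (c x)) (S \<inter> c -` U)" by (rule plot_Cinf_on[OF assms(1) that]) auto
  qed (use assms that chartsD(1) plot_open plot_continuous ch in \<open>auto intro!: open_preimage_Int intro: Cinf_on_subset\<close>)
  then show ?thesis using ch assms(2) by (auto simp: plot_def)
qed

lemma plot_subset: "plot A S c ==> charts A ==> open T ==> T \<subseteq> S ==> plot A T c"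
  using plot_compose[of A S c T "\<lambda>x. x"] by (auto intro: Cinf_on_id)

lemma plot_Pair:
  assumes c: "plot A S c" and d: "plot B S d" and A: "charts A" and B: "charts B"
  shows "plot (prod_atlas A B) S (\<lambda>x. (c x, d x))"
proof -
  have "Cinf_on (\<lambda>x. \<xi> (c x, d x)) (S \<inter> (\<lambda>x. (c x, d x)) -` W)" if "(W, \<xi>) \<in> prod_atlas A B" for W \<xi>
  proof -
    obtain U \<phi> V \<psi> where U: "(U, \<phi>) \<in> A" and V: "(V, \<psi>) \<in> B" and W: "W = U \<times> V" "\<xi> = map_prod \<phi> \<psi>"
      using \<open>(W, \<xi>) \<in> prod_atlas A B\<close> by (auto simp: prod_atlas_def)
    have oT: "open (S \<inter> (\<lambda>x. (c x, d x)) -` W)"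
      using chartsD(1)[OF A U] chartsD(1)[OF B V] c d
      by (intro open_preimage_Int) (auto simp: W plot_def intro!: open_Times continuous_on_Pair)
    show ?thesis unfolding W(2) map_prod_simp
      by (intro Cinf_on_Pair oT plot_Cinf_on[OF c U] plot_Cinf_on[OF d V]) (auto simp: W)
  qed
  then show ?thesis using c d by (auto simp: plot_def intro!: continuous_on_Pair)
qed

lemma plot_inv_chart:
  assumes "smooth_atlas A" "(U, \<phi>) \<in> A"
  shows "plot A (\<phi> ` U) (inv_into U \<phi>)"
proof -
  note u = chartsD[OF charts_smooth_atlas[OF assms(1)] assms(2)]
  have "Cinf_on (\<lambda>x. \<psi> (inv_into U \<phi> x)) (\<phi> ` U \<inter> inv_into U \<phi> -` V)" if V: "(V, \<psi>) \<in> A" for V \<psi>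
  proof -
    have "\<phi> ` U \<inter> inv_into U \<phi> -` V = \<phi> ` (U \<inter> V)" using u(6) by auto
    then show ?thesis using assms V unfolding smooth_atlas_def by fastforce
  qed
  then show ?thesis using u by (auto simp: plot_def)
qed

text \<open>\<open>H\<close> plays the role of a coordinate map on the open set \<open>W\<close>.
  Since its smoothness is expressed in charts, the composition is examined near each point through a
  chart around the image point.\<close>

lemma plot_local_inverse:
  assumes A: "charts A" and W: "open W"
    and H: "\<And>U \<phi>. (U, \<phi>) \<in> A ==> Cinf_on (\<lambda>x. H (inv_into U \<phi> x)) (\<phi> ` (U \<inter> W))"
    and c: "plot A T c" "c ` T \<subseteq> W"
  shows "Cinf_on (\<lambda>x. H (c x)) T"
proof (rule Cinf_on_open_cover)
  fix x assume x: "x \<in> T"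
  obtain U \<phi> where U: "(U, \<phi>) \<in> A" "c x \<in> U" using chart_at[OF A] .
  note u = chartsD[OF A U(1)]
  let ?T = "T \<inter> c -` U"
  have T: "open ?T" by (rule open_preimage_Int[OF plot_open[OF c(1)] plot_continuous[OF c(1)] u(1)])
  have "Cinf_on (\<lambda>x. H (inv_into U \<phi> (\<phi> (c x)))) ?T"
    by (rule Cinf_on_compose[OF T open_chart_image[OF A U(1) W] _ H[OF U(1)] plot_Cinf_on[OF c(1) U(1)]]) (use c(2) in auto)
  then have "Cinf_on (\<lambda>x. H (c x)) ?T"
    by (rule Cinf_on_cong[OF T, rotated]) (simp add: u(6))
  then show "\<exists>T. open T \<and> x \<in> T \<and> Cinf_on (\<lambda>x. H (c x)) T" using T x U(2) by blast
qed

lemma smooth_map_plotI: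
  assumes A: "charts A" and "continuous_on UNIV F" and F: "\<And>U \<phi>. (U, \<phi>) \<in> A ==> plot B (\<phi> ` U) (\<lambda>x. F (inv_into U \<phi> x))"
  shows "smooth_map A B F"
proof -
  have "Cinf_on (\<lambda>x. \<psi> (F (inv_into U \<phi> x))) (\<phi> ` (U \<inter> F -` V))" if U: "(U, \<phi>) \<in> A" and V: "(V, \<psi>) \<in> B" for U \<phi> V \<psi>
    by (rule plot_Cinf_on[OF F[OF U] V]) (auto simp: chartsD(6)[OF A U])
  then show ?thesis using assms(2) by (auto simp: smooth_map_def)
qed

lemma smooth_map_compose:
  assumes "smooth_atlas A" "charts B" "charts C" "smooth_map A B F" "smooth_map B C G"
  shows "smooth_map A C (\<lambda>x. G (F x))"
proof (rule smooth_map_plotI)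
  show "continuous_on UNIV (\<lambda>x. G (F x))"
    using assms(4,5) unfolding smooth_map_def by (metis continuous_on_compose2 subset_UNIV)
  show "plot C (\<phi> ` U) (\<lambda>x. G (F (inv_into U \<phi> x)))" if "(U, \<phi>) \<in> A" for U \<phi>
    using assms by (intro plot_smooth_map[OF _ _ assms(5)] plot_smooth_map[OF _ _ assms(4)] plot_inv_chart that charts_smooth_atlas)
qed (use assms charts_smooth_atlas in auto)

lemma smooth_fun_plot:
  assumes "charts A" "smooth_fun A f" "plot A S c"
  shows "Cinf_on (\<lambda>x. f (c x)) S"
  using plot_smooth_map[OF assms(1) charts_euclidean_atlas assms(2,3)] by (simp add: plot_euclidean_iff)

lemma smooth_funI:
  fixes A :: "('m::t2_space, 'e::euclidean_space) chart set"
  assumes "charts A" "\<And>U \<phi>. (U, \<phi>) \<in> A ==> Cinf_on (\<lambda>x. f (inv_into U \<phi> x)) (\<phi> ` U)"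
  shows "smooth_fun A f"
proof (rule smooth_map_plotI[OF assms(1)])
  show "plot euclidean_atlas (\<phi> ` U) (\<lambda>x. f (inv_into U \<phi> x))" if "(U, \<phi>) \<in> A" for U \<phi>
    using assms(2)[OF that] chartsD[OF assms(1) that] by (auto simp: plot_euclidean_iff)
  have "isCont f p" for p
  proof -
    obtain U \<phi> where U: "(U, \<phi>) \<in> A" "p \<in> U" using chart_at[OF assms(1)] .
    note u = chartsD[OF assms(1) U(1)]
    have "continuous_on U (\<lambda>q. f (inv_into U \<phi> (\<phi> q)))"
      by (rule continuous_on_compose2[OF Cinf_on_continuous[OF assms(2)[OF U(1)]] u(4)]) auto
    then have "continuous_on U f" by (rule continuous_on_eq) (simp add: u(6))
    then show ?thesis using u(1) U(2) by (simp add: continuous_on_eq_continuous_at)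
  qed
  then show "continuous_on UNIV f" by (simp add: continuous_at_imp_continuous_on)
qed

lemma smooth_fun_chart:
  assumes "smooth_atlas A" "smooth_fun A f" "(U, \<phi>) \<in> A"
  shows "Cinf_on (\<lambda>x. f (inv_into U \<phi> x)) (\<phi> ` U)"
  by (rule smooth_fun_plot[OF charts_smooth_atlas[OF assms(1)] assms(2) plot_inv_chart[OF assms(1,3)]])

lemma smooth_fun_const: "smooth_atlas A ==> smooth_fun A (\<lambda>x. c)"
  by (intro smooth_funI Cinf_on_const) (auto dest: charts_smooth_atlas intro: chartsD)

lemma smooth_fun_algebra:
  assumes A: "smooth_atlas A" and f: "smooth_fun A f" and h: "smooth_fun A h"
  shows "smooth_fun A (\<lambda>x. f x + h x)" "smooth_fun A (\<lambda>x. f x * h x)" "smooth_fun A (\<lambda>x. c * f x)"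
proof -
  note ch = charts_smooth_atlas[OF A]
  note s = smooth_fun_chart[OF A f] smooth_fun_chart[OF A h]
  show "smooth_fun A (\<lambda>x. f x + h x)"
    by (rule smooth_funI[OF ch]) (intro Cinf_on_add s chartsD(2)[OF ch])
  show "smooth_fun A (\<lambda>x. f x * h x)"
    by (rule smooth_funI[OF ch]) (intro Cinf_on_mult s chartsD(2)[OF ch])
  show "smooth_fun A (\<lambda>x. c * f x)"
    by (rule smooth_funI[OF ch]) (intro Cinf_on_mult Cinf_on_const s chartsD(2)[OF ch])
qed

lemma smooth_fun_sum:
  assumes A: "smooth_atlas A" and "\<And>b. b \<in> I ==> smooth_fun A (f b)"
  shows "smooth_fun A (\<lambda>x. \<Sum>b\<in>I. f b x)"
  using assms(2)
proof (induction I rule: infinite_finite_induct)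
  case (insert b I)
  then show ?case using smooth_fun_algebra(1)[OF A, of "f b" "\<lambda>x. \<Sum>b\<in>I. f b x"] by simp
qed (use smooth_fun_const[OF A] in auto)

text \<open>One cutoff serves all functions: \<open>ext\<close> and the radius \<open>r'\<close> are
  chosen before \<open>f\<close>. Thus coordinates and all Hadamard coefficients extend with
  agreement on the same ball.\<close>

lemma smooth_extension:
  assumes A: "smooth_atlas A" and U: "(U, \<phi>) \<in> A" and R: "R > 0" "ball (\<phi> p) R \<subseteq> \<phi> ` U"
  obtains ext r' where "0 < r'" "r' < R"
    "\<And>f. Cinf_on f (ball (\<phi> p) R) ==> smooth_fun A (ext f)"
    "\<And>f q. q \<in> U ==> \<phi> q \<in> ball (\<phi> p) r' ==> ext f q = f (\<phi> q)"
    "\<And>f q. \<not> (q \<in> U \<and> \<phi> q \<in> ball (\<phi> p) R) ==> ext f q = 0"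
proof -
  note ch = charts_smooth_atlas[OF A]
  note u = chartsD[OF ch U]
  obtain \<rho> :: "'b => real" and r' where \<rho>: "Cinf_on \<rho> UNIV" "0 < r'" "r' < R/2" "\<And>x. x \<in> ball (\<phi> p) r' ==> \<rho> x = 1"
    "\<And>x. x \<notin> ball (\<phi> p) (R/2) ==> \<rho> x = 0"
    using bump_function[of "R/2" "\<phi> p"] R by auto
  define ext where "ext f q = (if q \<in> U then \<rho> (\<phi> q) * f (\<phi> q) else 0)" for f q
  \<comment> \<open>The extension vanishes off \<open>K\<close>, which is compact and hence closed
    in the Hausdorff manifold; so near a point outside \<open>K\<close> it is identically 0.\<close>
  define K where "K = inv_into U \<phi> ` cball (\<phi> p) (R/2)"
  have cb: "cball (\<phi> p) (R/2) \<subseteq> ball (\<phi> p) R" using R by auto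
  have "compact K" unfolding K_def
    by (intro compact_continuous_image continuous_on_subset[OF u(5)]) (use R cb in auto)
  then have cK: "closed K" by (rule compact_imp_closed)
  have notK: "ext f q = 0" if "q \<notin> K" for f q
  proof (cases "q \<in> U")
    case True
    then have "\<phi> q \<notin> cball (\<phi> p) (R/2)" using that u(6) unfolding K_def by (metis image_eqI)
    then have "\<rho> (\<phi> q) = 0" using \<rho>(5) by auto
    then show ?thesis by (simp add: ext_def)
  qed (simp add: ext_def)
  have "smooth_fun A (ext f)" if f: "Cinf_on f (ball (\<phi> p) R)" for f
  proof (rule smooth_funI[OF ch])
    fix V \<psi> assume V: "(V, \<psi>) \<in> A"
    note v = chartsD[OF ch V]
    show "Cinf_on (\<lambda>x. ext f (inv_into V \<psi> x)) (\<psi> ` V)"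
    proof (rule Cinf_on_open_cover)
      fix x assume x: "x \<in> \<psi> ` V"
      show "\<exists>T. open T \<and> x \<in> T \<and> Cinf_on (\<lambda>x. ext f (inv_into V \<psi> x)) T"
      proof (cases "inv_into V \<psi> x \<in> K")
        case False
        let ?T = "\<psi> ` V \<inter> inv_into V \<psi> -` (- K)"
        have T: "open ?T" by (rule open_preimage_Int[OF v(2,5)]) (use cK in auto)
        have "Cinf_on (\<lambda>x. ext f (inv_into V \<psi> x)) ?T"
          by (rule Cinf_on_cong[OF T _ Cinf_on_const[OF T, of 0]]) (simp add: notK)
        then show ?thesis using T x False by auto
      next
        case True
        define W where "W = U \<inter> \<phi> -` ball (\<phi> p) R"
        have oW: "open W" unfolding W_def by (rule open_preimage_Int[OF u(1,4)]) auto
        have KW: "K \<subseteq> W"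
        proof
          fix q assume "q \<in> K"
          then obtain y where y: "y \<in> ball (\<phi> p) R" "q = inv_into U \<phi> y" using cb unfolding K_def by auto
          then have "y \<in> \<phi> ` U" using R(2) by blast
          then show "q \<in> W" using y u(7,8)[of y] by (simp add: W_def)
        qed
        let ?T = "\<psi> ` V \<inter> inv_into V \<psi> -` W"
        have T: "open ?T" by (rule open_preimage_Int[OF v(2,5) oW])
        have 1: "Cinf_on (\<lambda>x. \<phi> (inv_into V \<psi> x)) ?T"
          by (rule plot_Cinf_on[OF plot_inv_chart[OF A V] U]) (auto simp: W_def)
        have 2: "Cinf_on (\<lambda>y. \<rho> y * f y) (ball (\<phi> p) R)"
          by (intro Cinf_on_mult f open_ball Cinf_on_subset[OF \<rho>(1)]) auto
        have "Cinf_on (\<lambda>x. \<rho> (\<phi> (inv_into V \<psi> x)) * f (\<phi> (inv_into V \<psi> x))) ?T"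
          by (rule Cinf_on_compose[OF T open_ball _ 2 1]) (auto simp: W_def)
        then have "Cinf_on (\<lambda>x. ext f (inv_into V \<psi> x)) ?T"
          by (rule Cinf_on_cong[OF T, rotated]) (auto simp: ext_def W_def)
        then show ?thesis using T x True KW by auto
      qed
    qed
  qed
  moreover have "ext f q = f (\<phi> q)" if "q \<in> U" "\<phi> q \<in> ball (\<phi> p) r'" for f q
    using that \<rho>(4) by (simp add: ext_def)
  moreover have "ext f q = 0" if "\<not> (q \<in> U \<and> \<phi> q \<in> ball (\<phi> p) R)" for f q
    using that \<rho>(5)[of "\<phi> q"] R(1) by (auto simp: ext_def)
  ultimately show ?thesis using that[of r' ext] \<rho>(2,3) R by auto
qed

section \<open>Tangent vectors as derivatives along plots\<close>

text \<open>The image of \<open>u\<close> under the differential of \<open>c\<close> at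
  \<open>x\<close>, as a derivation; the value 0 on non-smooth functions matches the normalization
  in \<open>tangent_space\<close>.\<close>

definition pd :: "('m::topological_space, 'e::euclidean_space) chart set => ('a::euclidean_space => 'm) => 'a => 'a => 'm tangent" where
  "pd A c x u = (\<lambda>f. if smooth_fun A f then fderiv (\<lambda>y. f (c y)) x u else 0)"

context
  fixes A :: "('m::{t2_space,second_countable_topology}, 'e::euclidean_space) chart set"
  assumes A: "smooth_atlas A"
begin

lemma smooth_fun_plot_has_derivative:
  assumes "smooth_fun A f" "plot A S c" "x \<in> S"
  shows "((\<lambda>y. f (c y)) has_derivative (\<lambda>u. pd A c x u f)) (at x)"
  using Cinf_on_has_derivative[OF smooth_fun_plot[OF charts_smooth_atlas[OF A] assms(1,2)] assms(3)] assms(1)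
  by (simp add: pd_def)

lemma pd_eqI: "smooth_fun A f ==> ((\<lambda>y. f (c y)) has_derivative D) (at x) ==> pd A c x u f = D u"
  unfolding pd_def using frechet_derivative_at by metis

lemma pd_tangent:
  assumes c: "plot A S c" "x \<in> S"
  shows "pd A c x u \<in> tangent_space A (c x)"
proof -
  note d = smooth_fun_plot_has_derivative[OF _ c]
  have "pd A c x u (\<lambda>x. f x + h x) = pd A c x u f + pd A c x u h"
    "pd A c x u (\<lambda>x. f x * h x) = f (c x) * pd A c x u h + h (c x) * pd A c x u f"
    if "smooth_fun A f" "smooth_fun A h" for f h
  proof -
    show "pd A c x u (\<lambda>x. f x + h x) = pd A c x u f + pd A c x u h"
      by (rule pd_eqI[OF smooth_fun_algebra(1)[OF A that] has_derivative_add[OF d[OF that(1)] d[OF that(2)]]])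
    show "pd A c x u (\<lambda>x. f x * h x) = f (c x) * pd A c x u h + h (c x) * pd A c x u f"
      using pd_eqI[OF smooth_fun_algebra(2)[OF A that] has_derivative_mult[OF d[OF that(1)] d[OF that(2)]]]
      by (simp add: mult.commute)
  qed
  moreover have "pd A c x u (\<lambda>x. k * f x) = k * pd A c x u f" if "smooth_fun A f" for f k
    using pd_eqI[OF smooth_fun_algebra(3)[OF A that that] has_derivative_mult_right[OF d[OF that]]] .
  ultimately show ?thesis by (auto simp: tangent_space_def pd_def)
qed

lemma pd_linear:
  assumes c: "plot A S c" "x \<in> S"
  shows "pd A c x (u + v) = (\<lambda>f. pd A c x u f + pd A c x v f)" "pd A c x (k *\<^sub>R u) = (\<lambda>f. k * pd A c x u f)"
proof -
  have l: "linear (\<lambda>u. pd A c x u f)" for f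
  proof (cases "smooth_fun A f")
    case True from smooth_fun_plot_has_derivative[OF True c] show ?thesis by (rule has_derivative_linear)
  next
    case False then show ?thesis by (auto simp: pd_def linear_iff)
  qed
  show "pd A c x (u + v) = (\<lambda>f. pd A c x u f + pd A c x v f)" "pd A c x (k *\<^sub>R u) = (\<lambda>f. k * pd A c x u f)"
    using linear_add[OF l] linear_cmul[OF l] by auto
qed

lemma pd_compose:
  assumes c: "plot A S c" "h x \<in> S" and h: "(h has_derivative h') (at x)"
  shows "pd A (\<lambda>y. c (h y)) x u = pd A c (h x) (h' u)"
proof
  fix f
  show "pd A (\<lambda>y. c (h y)) x u f = pd A c (h x) (h' u) f"
  proof (cases "smooth_fun A f")
    case True
    from pd_eqI[OF True has_derivative_compose[OF h smooth_fun_plot_has_derivative[OF True c]]] show ?thesis .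
  qed (simp add: pd_def)
qed

lemma pd_cong:
  assumes "open T" "x \<in> T" "\<And>y. y \<in> T ==> c y = d y" "plot A S c" "x \<in> S"
  shows "pd A c x u = pd A d x u"
proof
  fix f
  show "pd A c x u f = pd A d x u f"
  proof (cases "smooth_fun A f")
    case True
    have "((\<lambda>y. f (d y)) has_derivative (\<lambda>u. pd A c x u f)) (at x)"
      by (rule has_derivative_transform_within_open[OF smooth_fun_plot_has_derivative[OF True assms(4,5)] assms(1,2)])
        (simp add: assms(3))
    from pd_eqI[OF True this] show ?thesis ..
  qed (simp add: pd_def)
qed

lemma differential_pd:
  assumes F: "smooth_map A A F"
  shows "differential A F (pd A c x u) = pd A (\<lambda>y. F (c y)) x u"
proof
  fix f
  show "differential A F (pd A c x u) f = pd A (\<lambda>y. F (c y)) x u f"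
  proof (cases "smooth_fun A f")
    case True
    then have "smooth_fun A (\<lambda>x. f (F x))"
      using smooth_map_compose[OF A charts_smooth_atlas[OF A] charts_euclidean_atlas F] by blast
    then show ?thesis by (simp add: differential_def pd_def o_def)
  qed (simp add: differential_def pd_def)
qed

lemma smooth_curve_plot:
  assumes "smooth_map (euclidean_atlas :: ('a::euclidean_space, 'a) chart set) A c"
  shows "plot A UNIV c"
  using plot_smooth_map[OF charts_euclidean_atlas charts_smooth_atlas[OF A] assms, of UNIV "\<lambda>x. x"]
  by (simp add: plot_euclidean_iff Cinf_on_id)

lemma velocity_eq_pd:
  assumes "smooth_map euclidean_atlas A c"
  shows "velocity A c = pd A c 0 1"
proof
  fix f
  show "velocity A c f = pd A c 0 1 f"
  proof (cases "smooth_fun A f")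
    case True
    note d = smooth_fun_plot_has_derivative[OF True smooth_curve_plot[OF assms] UNIV_I, of 0]
    have "pd A c 0 u f = pd A c 0 1 f * u" for u
      using linear_cmul[OF has_derivative_linear[OF d], of u 1] by simp
    then have "(\<lambda>u. pd A c 0 u f) = (*) (pd A c 0 1 f)" by (rule ext)
    then have "((\<lambda>t. f (c t)) has_real_derivative pd A c 0 1 f) (at 0)"
      using d by (simp add: has_field_derivative_def)
    then show ?thesis using True by (simp add: velocity_def o_def DERIV_imp_deriv)
  qed (simp add: velocity_def pd_def)
qed

lemma tangent_sum:
  assumes X: "X \<in> tangent_space A p" and "finite I" "\<And>b. b \<in> I ==> smooth_fun A (f b)"
  shows "X (\<lambda>q. \<Sum>b\<in>I. f b q) = (\<Sum>b\<in>I. X (f b))"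
  using assms(2,3)
proof (induction I rule: finite_induct)
  case empty
  have "X (\<lambda>q. 0 * 1) = 0 * X (\<lambda>q. 1)"
    using X smooth_fun_const[OF A] unfolding tangent_space_def by blast
  then show ?case by simp
next
  case (insert b I)
  have "X (\<lambda>q. f b q + (\<Sum>b\<in>I. f b q)) = X (f b) + X (\<lambda>q. \<Sum>b\<in>I. f b q)"
    using X insert smooth_fun_sum[OF A, of I f] unfolding tangent_space_def by blast
  then show ?case using insert by simp
qed

text \<open>Multiplication by a cutoff with \<open>\<rho> p = 1\<close> makes the two functions
  equal everywhere, and since \<open>f p = h p\<close> the terms with \<open>X \<rho>\<close> in the
  product rule agree.\<close>

lemma tangent_local:
  assumes X: "X \<in> tangent_space A p" and U: "(U, \<phi>) \<in> A" "p \<in> U" and R: "R > 0"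
    and f: "smooth_fun A f" and h: "smooth_fun A h"
    and eq: "\<And>q. q \<in> U ==> \<phi> q \<in> ball (\<phi> p) R ==> f q = h q"
  shows "X f = X h"
proof -
  note ch = charts_smooth_atlas[OF A]
  obtain R1 where R1: "R1 > 0" "ball (\<phi> p) R1 \<subseteq> \<phi> ` U"
    using chartsD(2)[OF ch U(1)] U(2) by (meson image_eqI openE)
  define R2 where "R2 = min R R1"
  have R2: "R2 > 0" "ball (\<phi> p) R2 \<subseteq> \<phi> ` U" using R R1 by (auto simp: R2_def)
  obtain ext r' where ext: "0 < r'" "\<And>f. Cinf_on f (ball (\<phi> p) R2) ==> smooth_fun A (ext f)"
    "\<And>f q. q \<in> U ==> \<phi> q \<in> ball (\<phi> p) r' ==> ext f q = f (\<phi> q)"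
    "\<And>f q. \<not> (q \<in> U \<and> \<phi> q \<in> ball (\<phi> p) R2) ==> ext f q = 0"
    by (rule smooth_extension[OF A U(1) R2]) blast
  define \<rho> where "\<rho> = ext (\<lambda>_. 1)"
  have \<rho>: "smooth_fun A \<rho>" "\<rho> p = 1" unfolding \<rho>_def
    using ext(1) U(2) by (auto intro!: ext(2) Cinf_on_const simp: ext(3))
  have "\<rho> q = 0 \<or> f q = h q" for q using ext(4)[of q] eq[of q] by (auto simp: \<rho>_def R2_def)
  then have eq: "(\<lambda>q. \<rho> q * f q) = (\<lambda>q. \<rho> q * h q)" by auto
  have "X (\<lambda>q. \<rho> q * f q) = \<rho> p * X f + f p * X \<rho>" "X (\<lambda>q. \<rho> q * h q) = \<rho> p * X h + h p * X \<rho>"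
    using X \<rho>(1) f h unfolding tangent_space_def by blast+
  moreover have "f p = h p" using assms(7)[OF U(2)] R by simp
  ultimately show ?thesis using eq \<rho>(2) by simp
qed

lemma chart_coordinates:
  assumes U: "(U, \<phi>) \<in> A" "p \<in> U"
  obtains r co where "r > 0" "\<And>b. smooth_fun A (co b)" "\<And>b q. q \<in> U ==> \<phi> q \<in> ball (\<phi> p) r ==> co b q = \<phi> q \<bullet> b"
proof -
  obtain R where R: "R > 0" "ball (\<phi> p) R \<subseteq> \<phi> ` U"
    using chartsD(2)[OF charts_smooth_atlas[OF A] U(1)] U(2) by (meson image_eqI openE)
  obtain ext r' where ext: "0 < r'" "\<And>f. Cinf_on f (ball (\<phi> p) R) ==> smooth_fun A (ext f)"
    "\<And>f q. q \<in> U ==> \<phi> q \<in> ball (\<phi> p) r' ==> ext f q = f (\<phi> q)"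
    by (rule smooth_extension[OF A U(1) R]) blast
  show ?thesis
    by (rule that[of r' "\<lambda>b. ext (\<lambda>x. x \<bullet> b)"])
      (use ext in \<open>auto intro!: ext(2) Cinf_on_inner Cinf_on_id Cinf_on_const\<close>)
qed

text \<open>By the Hadamard expansion \<open>f\<close> is, near \<open>p\<close>, a constant plus a
  sum of centred coordinates times smooth coefficients. The product rule leaves the values of
  \<open>X\<close> on the coordinates, which are the components of \<open>w\<close>.\<close>

lemma tangent_vector_chart:
  assumes X: "X \<in> tangent_space A p" and U: "(U, \<phi>) \<in> A" "p \<in> U"
  obtains w where "X = pd A (inv_into U \<phi>) (\<phi> p) w"
proof -
  note ch = charts_smooth_atlas[OF A]
  note u = chartsD[OF ch U(1)]
  obtain R where R: "R > 0" "ball (\<phi> p) R \<subseteq> \<phi> ` U"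
    using u(2) U(2) by (meson image_eqI openE)
  obtain ext r' where ext: "0 < r'" "r' < R" "\<And>f. Cinf_on f (ball (\<phi> p) R) ==> smooth_fun A (ext f)"
    "\<And>f q. q \<in> U ==> \<phi> q \<in> ball (\<phi> p) r' ==> ext f q = f (\<phi> q)"
    by (rule smooth_extension[OF A U(1) R]) blast
  define co where "co b = ext (\<lambda>x. (x - \<phi> p) \<bullet> b)" for b
  have co: "smooth_fun A (co b)" for b unfolding co_def
    by (intro ext(3) Cinf_on_inner Cinf_on_diff Cinf_on_id Cinf_on_const open_ball)
  define w where "w = (\<Sum>b\<in>Basis. X (co b) *\<^sub>R b)"
  have pp: "\<phi> p \<in> ball (\<phi> p) r'" "\<phi> p \<in> \<phi> ` U" using ext(1) U(2) by auto
  have X1: "X (\<lambda>_. c) = 0" for c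
  proof -
    have "X (\<lambda>q. 1 * 1) = 1 * X (\<lambda>_. 1) + 1 * X (\<lambda>_. 1)"
      using X smooth_fun_const[OF A] unfolding tangent_space_def by blast
    moreover have "X (\<lambda>q. c * 1) = c * X (\<lambda>_. 1)"
      using X smooth_fun_const[OF A] unfolding tangent_space_def by blast
    ultimately show ?thesis by simp
  qed
  have "X f = pd A (inv_into U \<phi>) (\<phi> p) w f" for f
  proof (cases "smooth_fun A f")
    case False then show ?thesis using X by (simp add: tangent_space_def pd_def)
  next
    case True
    let ?F = "\<lambda>x. f (inv_into U \<phi> x)"
    have F: "Cinf_on ?F (\<phi> ` U)" by (rule smooth_fun_chart[OF A True U(1)])
    obtain g where g: "\<And>b. Cinf_on (g b) (ball (\<phi> p) R)"
      "\<And>x. x \<in> ball (\<phi> p) R ==> ?F x = ?F (\<phi> p) + (\<Sum>b\<in>Basis. ((x - \<phi> p) \<bullet> b) * g b x)"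
      "\<And>b. b \<in> Basis ==> g b (\<phi> p) = fderiv ?F ((\<phi> p)) b"
      by (rule hadamard_lemma[OF Cinf_on_subset[OF F R(2)]]) blast
    define h where "h q = f p + (\<Sum>b\<in>Basis. co b q * ext (g b) q)" for q
    have s: "smooth_fun A (\<lambda>q. co b q * ext (g b) q)" for b
      by (intro smooth_fun_algebra[OF A] co ext(3) g(1))
    have ss: "smooth_fun A (\<lambda>q. \<Sum>b\<in>Basis. co b q * ext (g b) q)"
      by (rule smooth_fun_sum[OF A]) (rule s)
    have sh: "smooth_fun A h" unfolding h_def by (rule smooth_fun_algebra(1)[OF A smooth_fun_const[OF A] ss])
    have "f q = h q" if "q \<in> U" "\<phi> q \<in> ball (\<phi> p) r'" for q
      using g(2)[of "\<phi> q"] that ext(2) u(6)[OF that(1)] u(6)[OF U(2)] ext(4)[OF that] by (simp add: h_def co_def)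
    then have "X f = X h" by (rule tangent_local[OF X U ext(1) True sh])
    also have "\<dots> = X (\<lambda>_. f p) + X (\<lambda>q. \<Sum>b\<in>Basis. co b q * ext (g b) q)"
      using X smooth_fun_const[OF A] ss unfolding tangent_space_def h_def by blast
    also have "\<dots> = (\<Sum>b\<in>Basis. X (\<lambda>q. co b q * ext (g b) q))"
      using tangent_sum[OF X finite_Basis s] X1 by simp
    also have "\<dots> = (\<Sum>b\<in>Basis. X (co b) * fderiv ?F ((\<phi> p)) b)"
    proof (rule sum.cong[OF refl])
      fix b :: 'e assume b: "b \<in> Basis"
      have "X (\<lambda>q. co b q * ext (g b) q) = co b p * X (ext (g b)) + ext (g b) p * X (co b)"
        using X co ext(3)[OF g(1)] unfolding tangent_space_def by blast
      then show "X (\<lambda>q. co b q * ext (g b) q) = X (co b) * fderiv ?F ((\<phi> p)) b"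
        using ext(4)[OF U(2) pp(1)] g(3)[OF b] by (simp add: co_def)
    qed
    also have "\<dots> = fderiv ?F ((\<phi> p)) w"
      using has_derivative_linear[OF Cinf_on_has_derivative[OF F pp(2)]]
      unfolding w_def by (simp add: linear_sum linear_cmul)
    finally show ?thesis using True by (simp add: pd_def)
  qed
  then show ?thesis using that by blast
qed

lemma pd_coordinates:
  assumes U: "(U, \<phi>) \<in> A" "p \<in> U" and r: "r > 0" and co: "\<And>b. smooth_fun A (co b)"
    "\<And>b q. q \<in> U ==> \<phi> q \<in> ball (\<phi> p) r ==> co b q = \<phi> q \<bullet> b"
    and c: "plot A S c" "x \<in> S" "c x = p"
  shows "pd A c x w (co b) = fderiv (\<lambda>y. \<phi> (c y)) x w \<bullet> b"
proof (rule pd_eqI[OF co(1)])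
  note ch = charts_smooth_atlas[OF A]
  note u = chartsD[OF ch U(1)]
  let ?W = "U \<inter> \<phi> -` ball (\<phi> p) r"
  have "open ?W" by (rule open_preimage_Int[OF u(1,4)]) auto
  then have T: "open (S \<inter> c -` ?W)" by (rule open_preimage_Int[OF plot_open[OF c(1)] plot_continuous[OF c(1)]])
  have xT: "x \<in> S \<inter> c -` ?W" using c U r by auto
  have "Cinf_on (\<lambda>y. \<phi> (c y)) (S \<inter> c -` ?W)"
    by (rule plot_Cinf_on[OF c(1) U(1)]) auto
  from has_derivative_inner_left[OF Cinf_on_has_derivative[OF this xT], of b]
  have "((\<lambda>y. \<phi> (c y) \<bullet> b) has_derivative (\<lambda>w. fderiv (\<lambda>y. \<phi> (c y)) x w \<bullet> b)) (at x)" .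
  then show "((\<lambda>y. co b (c y)) has_derivative (\<lambda>w. fderiv (\<lambda>y. \<phi> (c y)) x w \<bullet> b)) (at x)"
    by (rule has_derivative_transform_within_open[OF _ T xT]) (auto simp: co)
qed

text \<open>Derivations act on global functions only; the cutoff extensions of the coordinates are
  smooth and recover the components.\<close>

lemma pd_eq_imp_chart_derivative_eq:
  assumes U: "(U, \<phi>) \<in> A" and c: "plot A S c" "x \<in> S" "c x \<in> U" and d: "plot A T d" "y \<in> T" "d y = c x"
    and eq: "pd A c x w = pd A d y v"
  shows "fderiv (\<lambda>z. \<phi> (c z)) x w = fderiv (\<lambda>z. \<phi> (d z)) y v"
proof -
  obtain r co where co: "r > 0" "\<And>b. smooth_fun A (co b)" "\<And>b q. q \<in> U ==> \<phi> q \<in> ball (\<phi> (c x)) r ==> co b q = \<phi> q \<bullet> b"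
    by (rule chart_coordinates[OF U c(3)]) blast
  have "fderiv (\<lambda>z. \<phi> (c z)) x w \<bullet> b = fderiv (\<lambda>z. \<phi> (d z)) y v \<bullet> b" for b
    using pd_coordinates[OF U c(3) co(1-3) c(1,2) refl, of w b] pd_coordinates[OF U c(3) co(1-3) d(1,2,3), of v b] eq
    by simp
  then show ?thesis by (metis euclidean_eqI)
qed

lemma frechet_chart_inv_chart:
  assumes U: "(U, \<phi>) \<in> A" and x: "x \<in> \<phi> ` U"
  shows "fderiv (\<lambda>z. \<phi> (inv_into U \<phi> z)) x w = w"
proof -
  note u = chartsD[OF charts_smooth_atlas[OF A] U]
  have "((\<lambda>z. \<phi> (inv_into U \<phi> z)) has_derivative (\<lambda>w. w)) (at x)"
    by (rule has_derivative_transform_within_open[OF has_derivative_ident u(2) x]) (simp add: u(7))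
  from frechet_derivative_at[OF this] show ?thesis by metis
qed

lemma pd_chart_inj:
  assumes U: "(U, \<phi>) \<in> A" and x: "x \<in> \<phi> ` U"
    and eq: "pd A (inv_into U \<phi>) x w = pd A (inv_into U \<phi>) x v"
  shows "w = v"
proof -
  note u = chartsD[OF charts_smooth_atlas[OF A] U]
  show ?thesis
    using pd_eq_imp_chart_derivative_eq[OF U plot_inv_chart[OF A U] x u(8)[OF x] plot_inv_chart[OF A U] x refl eq]
    by (simp add: frechet_chart_inv_chart[OF U x])
qed

end

section \<open>The algebra and the model group\<close>

text \<open>Both families of algebras are treated at once: \<open>B = 0\<close> is the generalized Heisenberg case
  and \<open>norm B = 1\<close> the Damek-Ricci case. \<open>pv\<close> and \<open>pz\<close> are the orthogonal projections to the
  subspaces called \<open>v\<close> and \<open>z\<close>, and \<open>N\<close> is the bracket of the \<open>v\<close>-components.\<close>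

locale heisenberg_model =
  fixes B :: "'n::euclidean_space" and pv pz :: "'n => 'n" and N :: "'n => 'n => 'n"
  assumes B: "B = 0 \<or> B \<bullet> B = 1"
    and decomp: "(x \<bullet> B) *\<^sub>R B + pv x + pz x = x"
    and lin_pv: "linear pv" and lin_pz: "linear pz"
    and pv_pv [simp]: "pv (pv x) = pv x" and pz_pz [simp]: "pz (pz x) = pz x"
    and pv_pz [simp]: "pv (pz x) = 0" and pz_pv [simp]: "pz (pv x) = 0"
    and pv_B [simp]: "pv B = 0" and pz_B [simp]: "pz B = 0"
    and pv_sym: "pv x \<bullet> y = x \<bullet> pv y" and pz_sym: "pz x \<bullet> y = x \<bullet> pz y"
    and lin_N: "linear (N x)" and N_self [simp]: "N x x = 0"
    and pz_N [simp]: "pz (N x y) = N x y" and N_pv [simp]: "N (pv x) y = N x y"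
    and nontrivial: "\<exists>x. pv x \<noteq> 0" "\<exists>x. pz x \<noteq> 0"
    and lin_N_left: "linear (\<lambda>x. N x y)"
    \<comment> \<open>This is \<open>J a (J a u) = - (pz a \<bullet> pz a) *\<^sub>R pv u\<close>
      written out, as \<open>J\<close> is defined only inside the locale.\<close>
    and clifford: "(\<Sum>b\<in>Basis. (N (\<Sum>c\<in>Basis. (N u c \<bullet> a) *\<^sub>R c) b \<bullet> a) *\<^sub>R b) = - (pz a \<bullet> pz a) *\<^sub>R pv u"
begin

definition lam :: "'n => real" where "lam x = x \<bullet> B"

text \<open>The adjoint of the bracket, given by its components. It depends only on
  \<open>pz a\<close> and \<open>pv u\<close>, so it extends the map \<open>J_Z\<close> by 0 to the
  whole space.\<close>

definition J :: "'n => 'n => 'n" where "J a u = (\<Sum>b\<in>Basis. (N u b \<bullet> a) *\<^sub>R b)"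

lemma lin_lam: "linear lam"
  by (auto simp: linear_iff lam_def inner_add_left)

lemmas lin_simps [simp] =
  linear_add[OF lin_lam] linear_add[OF lin_pv] linear_add[OF lin_pz] linear_add[OF lin_N] linear_add[OF lin_N_left]
  linear_cmul[OF lin_lam] linear_cmul[OF lin_pv] linear_cmul[OF lin_pz] linear_cmul[OF lin_N] linear_cmul[OF lin_N_left]
  linear_diff[OF lin_lam] linear_diff[OF lin_pv] linear_diff[OF lin_pz] linear_diff[OF lin_N] linear_diff[OF lin_N_left]
  linear_neg[OF lin_lam] linear_neg[OF lin_pv] linear_neg[OF lin_pz] linear_neg[OF lin_N] linear_neg[OF lin_N_left]
  linear_0[OF lin_lam] linear_0[OF lin_pv] linear_0[OF lin_pz] linear_0[OF lin_N] linear_0[OF lin_N_left]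

lemma lam_pv [simp]: "lam (pv x) = 0" and lam_pz [simp]: "lam (pz x) = 0"
  by (simp_all add: lam_def pv_sym pz_sym)

lemma lam_B_B [simp]: "lam B *\<^sub>R B = B"
  using B by (auto simp: lam_def)

lemma N_skew: "N x y = - N y x"
proof -
  have "N (x + y) (x + y) = N x y + N y x" by (simp del: N_self) simp
  then show ?thesis by (simp add: eq_neg_iff_add_eq_0)
qed

lemma N_pv_right [simp]: "N x (pv y) = N x y"
  using N_skew N_pv by metis

lemma lam_N [simp]: "lam (N x y) = 0" and pv_N [simp]: "pv (N x y) = 0"
  using lam_pz[of "N x y"] pv_pz[of "N x y"] by simp_all

lemma N_pz [simp]: "N (pz x) y = 0" "N x (pz y) = 0" and N_B [simp]: "N B y = 0" "N x B = 0"
  using N_pv[of "pz x" y] N_pv_right[of x "pz y"] N_pv[of B y] N_pv_right[of x B] by (simp_all del: N_pv N_pv_right)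

lemma N_N [simp]: "N (N x y) w = 0" "N w (N x y) = 0"
  using N_pz(1)[of "N x y" w] N_pz(2)[of w "N x y"] by simp_all

lemma pv_orth_pz [simp]: "pv x \<bullet> pz y = 0" "pz x \<bullet> pv y = 0" "pv x \<bullet> N y w = 0" "N y w \<bullet> pv x = 0"
  "pv x \<bullet> B = 0" "B \<bullet> pv x = 0" "pz x \<bullet> B = 0" "B \<bullet> pz x = 0" "N x y \<bullet> B = 0" "B \<bullet> N x y = 0"
  by (simp_all add: pv_sym pz_sym inner_commute[of "N y w"] inner_commute[of B] lam_N[unfolded lam_def])

lemma inner_decomp: "x \<bullet> y = lam x * lam y + pv x \<bullet> pv y + pz x \<bullet> pz y"
proof -
  have "x \<bullet> y = (lam x *\<^sub>R B + pv x + pz x) \<bullet> y" using decomp[of x] by (simp add: lam_def)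
  also have "\<dots> = lam x * (B \<bullet> y) + pv x \<bullet> y + pz x \<bullet> y" by (simp only: inner_add_left inner_scaleR_left)
  also have "B \<bullet> y = lam y" by (simp add: lam_def inner_commute)
  also have "pv x \<bullet> y = pv x \<bullet> pv y" using pv_sym[of "pv x" y] by simp
  also have "pz x \<bullet> y = pz x \<bullet> pz y" using pz_sym[of "pz x" y] by simp
  finally show ?thesis .
qed

lemma decomp_eqI: "lam x = lam y ==> pv x = pv y ==> pz x = pz y ==> x = y"
  using decomp[of x] decomp[of y] unfolding lam_def by metis

lemma J_inner: "J a u \<bullet> w = N u w \<bullet> a"
proof -
  have "J a u \<bullet> w = (\<Sum>b\<in>Basis. (w \<bullet> b) *\<^sub>R (N u b \<bullet> a))"
    unfolding J_def inner_sum_left by (rule sum.cong) (simp_all add: inner_commute)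
  also have "\<dots> = N u w \<bullet> a"
    using linear_apply_basis[of "\<lambda>w. N u w \<bullet> a" w] by (simp add: linear_iff inner_add_left)
  finally show ?thesis .
qed

lemma lin_J: "linear (J a)" and lin_J_left: "linear (\<lambda>a. J a u)"
  by (auto simp: linear_iff J_def inner_add_left inner_add_right scaleR_add_left sum.distrib scaleR_sum_right)

lemmas J_simps [simp] = linear_add[OF lin_J] linear_add[OF lin_J_left] linear_cmul[OF lin_J] linear_cmul[OF lin_J_left]
  linear_diff[OF lin_J] linear_diff[OF lin_J_left] linear_neg[OF lin_J] linear_neg[OF lin_J_left]
  linear_0[OF lin_J] linear_0[OF lin_J_left]

lemma J_J: "J a (J a u) = - (pz a \<bullet> pz a) *\<^sub>R pv u"
  using clifford[of u a] by (simp add: J_def)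

lemma J_pv [simp]: "J a (pv u) = J a u" and J_pz [simp]: "J (pz a) u = J a u" and pv_J [simp]: "pv (J a u) = J a u"
proof -
  show "J a (pv u) = J a u" by (simp add: J_def)
  have "N u w \<bullet> pz a = N u w \<bullet> a" for w using pz_sym[of "N u w" a] by simp
  then show "J (pz a) u = J a u" by (simp add: J_def)
  have "pv (J a u) \<bullet> w = J a u \<bullet> w" for w by (simp add: pv_sym J_inner)
  then show "pv (J a u) = J a u" using vector_eq_rdot by blast
qed

lemma pz_J [simp]: "pz (J a u) = 0" and lam_J [simp]: "lam (J a u) = 0"
  using pz_pv[of "J a u"] lam_pv[of "J a u"] by simp_all

lemma J_B [simp]: "J B u = 0" "J a B = 0" and J_of_pv [simp]: "J (pv a) u = 0" and J_of_pz [simp]: "J a (pz u) = 0"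
  and J_of_N [simp]: "J a (N u w) = 0" and J_of_J [simp]: "J (J a u) w = 0"
  using J_pz[of B u] J_pv[of a B] J_pz[of "pv a" u] J_pv[of a "pz u"] J_pv[of a "N u w"] J_pz[of "J a u" w]
  by (simp_all del: J_pv J_pz)

lemma J_skew: "J a u \<bullet> w = - (u \<bullet> J a w)"
  using J_inner[of a u w] J_inner[of a w u] N_skew[of u w] by (simp add: inner_commute)

lemma J_anticommute: "J a (J b u) + J b (J a u) = - (2 * (pz a \<bullet> pz b)) *\<^sub>R pv u"
proof -
  have "J (a + b) (J (a + b) u) = - (pz a \<bullet> pz a + 2 * (pz a \<bullet> pz b) + pz b \<bullet> pz b) *\<^sub>R pv u"
    by (simp only: J_J) (simp add: inner_add_left inner_add_right inner_commute)
  then show ?thesis by (simp add: J_J algebra_simps eq_neg_iff_add_eq_0)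
qed

lemma J_inner_J: "J a u \<bullet> J b u = (pz a \<bullet> pz b) * (pv u \<bullet> pv u)"
proof -
  have "J a u \<bullet> J b u = - (u \<bullet> J a (J b u))" "J a u \<bullet> J b u = - (u \<bullet> J b (J a u))"
    using J_skew[of a u "J b u"] J_skew[of b u "J a u"] by (simp_all add: inner_commute)
  then have "2 * (J a u \<bullet> J b u) = - (u \<bullet> (J a (J b u) + J b (J a u)))" by (simp add: inner_add_right)
  also have "\<dots> = 2 * (pz a \<bullet> pz b) * (pv u \<bullet> pv u)"
    by (simp only: J_anticommute) (simp add: pv_sym)
  finally show ?thesis by simp
qed

lemma J_inner_J': "J a u \<bullet> J a w = (pz a \<bullet> pz a) * (pv u \<bullet> pv w)"
  using J_skew[of a u "J a w"] by (simp add: J_J pv_sym inner_commute)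

text \<open>Pairing with \<open>w\<close> gives \<open>J w u \<bullet> J a u\<close>. For a unit
  vector \<open>u\<close> of \<open>v\<close> and \<open>c\<close> in \<open>z\<close> this recovers
  \<open>c\<close> from \<open>J c u\<close> as \<open>N u (J c u)\<close>, a device used repeatedly
  below.\<close>

lemma N_J: "N u (J a u) = (pv u \<bullet> pv u) *\<^sub>R pz a"
proof -
  have "N u (J a u) \<bullet> w = ((pv u \<bullet> pv u) *\<^sub>R pz a) \<bullet> w" for w
    using J_inner[of w u "J a u"] J_inner_J[of w u a] pz_sym[of a "pz w"] pz_sym[of a w] by (simp add: inner_commute)
  then show ?thesis using vector_eq_rdot by blast
qed

definition br :: "'n => 'n => 'n" where
  "br x y = N x y + lam x *\<^sub>R ((1/2) *\<^sub>R pv y + pz y) - lam y *\<^sub>R ((1/2) *\<^sub>R pv x + pz x)"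

text \<open>\<open>gm\<close> and \<open>gi\<close> are product and inverse of the simply connected group on the vector space itself; \<open>Xm\<close> is its
  left-invariant frame and \<open>th\<close> the dual coframe.\<close>

definition Xm :: "'n => 'n => 'n" where
  "Xm x u = lam u *\<^sub>R B + exp (lam x / 2) *\<^sub>R pv u + exp (lam x) *\<^sub>R pz u + (exp (lam x / 2) / 2) *\<^sub>R N x u"

definition th :: "'n => 'n => 'n" where
  "th x u = lam u *\<^sub>R B + exp (- lam x / 2) *\<^sub>R pv u + exp (- lam x) *\<^sub>R (pz u - (1/2) *\<^sub>R N x u)"

definition gm :: "'n => 'n => 'n" where "gm x y = x + Xm x y"

definition gi :: "'n => 'n" where "gi x = - th x x"

lemma lam_mult_lam_B [simp]: "lam x * lam B = lam x"
  using B by (auto simp: lam_def)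

lemma Xm_components [simp]: "lam (Xm x u) = lam u" "pv (Xm x u) = exp (lam x / 2) *\<^sub>R pv u"
  "pz (Xm x u) = exp (lam x) *\<^sub>R pz u + (exp (lam x / 2) / 2) *\<^sub>R N x u" "N w (Xm x u) = exp (lam x / 2) *\<^sub>R N w u"
  "N (Xm x u) w = exp (lam x / 2) *\<^sub>R N u w"
  by (simp_all add: Xm_def)

lemma th_components [simp]: "lam (th x u) = lam u" "pv (th x u) = exp (- lam x / 2) *\<^sub>R pv u"
  "pz (th x u) = exp (- lam x) *\<^sub>R (pz u - (1/2) *\<^sub>R N x u)" "N w (th x u) = exp (- lam x / 2) *\<^sub>R N w u"
  "N (th x u) w = exp (- lam x / 2) *\<^sub>R N u w"
  by (simp_all add: th_def)

lemma gm_components [simp]: "lam (gm x y) = lam x + lam y" "pv (gm x y) = pv x + exp (lam x / 2) *\<^sub>R pv y"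
  "pz (gm x y) = pz x + exp (lam x) *\<^sub>R pz y + (exp (lam x / 2) / 2) *\<^sub>R N x y"
  "N (gm x y) w = N x w + exp (lam x / 2) *\<^sub>R N y w" "N w (gm x y) = N w x + exp (lam x / 2) *\<^sub>R N w y"
  by (simp_all add: gm_def)

lemma exp_half: "exp (t / 2) * exp (t / 2) = exp (t::real)" "exp (- t / 2) * exp (- t / 2) = exp (- t)"
  "exp (- t) * exp (t / 2) = exp (- t / 2)" "exp t * exp (- t / 2) = exp (t / 2)"
  "exp (t / 2) * exp (- t / 2) = 1" "exp (- t / 2) * exp (t / 2) = 1"
  "exp (t / 2) * exp (- t) = exp (- t / 2)" "exp (- t / 2) * exp t = exp (t / 2)" "exp t * exp (- t) = 1" "exp (- t) * exp t = 1"
  by (simp_all flip: exp_add)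

lemma th_Xm [simp]: "th x (Xm x u) = u" and Xm_th [simp]: "Xm x (th x u) = u"
  by (rule decomp_eqI; simp add: exp_half algebra_simps)+

lemma lin_th: "linear (th x)" and lin_Xm: "linear (Xm x)"
  by (auto simp: linear_iff th_def Xm_def algebra_simps)

lemma gm_assoc: "gm (gm x y) w = gm x (gm y w)"
  by (rule decomp_eqI; simp add: add_divide_distrib exp_add exp_half algebra_simps)

lemma gm_0 [simp]: "gm 0 x = x" "gm x 0 = x"
  by (rule decomp_eqI; simp)+

lemma gm_gi [simp]: "gm x (gi x) = 0" "gm (gi x) x = 0"
proof -
  \<comment> \<open>\<open>gm x\<close> is affine in its second argument, so the right inverse
    solves a linear equation; the left inverse property then follows from associativity.\<close>
  show 1: "gm x (gi x) = 0" for x unfolding gm_def gi_def using linear_neg[OF lin_Xm, of x "th x x"] by simp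
  have "gm (gi x) x = gm (gm (gi x) x) (gm (gi x) (gi (gi x)))" by (simp only: 1 gm_0)
  also have "\<dots> = gm (gi x) (gm (gm x (gi x)) (gi (gi x)))" by (simp only: gm_assoc)
  also have "\<dots> = 0" by (simp only: 1 gm_0)
  finally show "gm (gi x) x = 0" .
qed

lemma gm_cancel: "gm (gi x) (gm x y) = y" "gm x (gm (gi x) y) = y"
  by (simp_all flip: gm_assoc)

lemma gi_gm: "gi (gm x y) = gm (gi y) (gi x)"
  by (metis gm_assoc gm_0(2) gm_cancel(1) gm_gi(1))

lemma gi_gi [simp]: "gi (gi x) = x" and gi_0 [simp]: "gi 0 = 0"
  by (metis gm_0(2) gm_cancel(1) gm_gi(2), metis gm_0(1) gm_gi(1))

text \<open>\<open>Xm x\<close> is the differential of the affine map \<open>gm x\<close> at every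
  point, so left translations preserve the coframe.\<close>

lemma th_left_invariant: "th (gm x y) (Xm x u) = th y u"
proof (rule decomp_eqI)
  have e: "exp (- (lam x + lam y) / 2) * exp (lam x / 2) = exp (- lam y / 2)"
    "exp (- (lam x + lam y)) * exp (lam x) = exp (- lam y)"
    by (simp_all add: field_simps flip: exp_add)
  show "lam (th (gm x y) (Xm x u)) = lam (th y u)" by simp
  show "pv (th (gm x y) (Xm x u)) = pv (th y u)"
    by (simp only: th_components Xm_components gm_components scaleR_scaleR e)
  have "pz (th (gm x y) (Xm x u)) = exp (- (lam x + lam y)) *\<^sub>R (exp (lam x) *\<^sub>R (pz u - (1/2) *\<^sub>R N y u))"
    by (simp only: th_components Xm_components gm_components) (simp add: exp_half algebra_simps)
  then show "pz (th (gm x y) (Xm x u)) = pz (th y u)"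
    by (simp only: th_components scaleR_scaleR e)
qed

end

section \<open>Maps into the model determined by their Maurer-Cartan forms\<close>

lemma has_derivative_eq_on_connected:
  fixes f g :: "'a::euclidean_space => 'b::euclidean_space"
  assumes "open S" "connected S" "x0 \<in> S" "f x0 = g x0" "x \<in> S"
    and "\<And>x. x \<in> S ==> (f has_derivative D x) (at x)" "\<And>x. x \<in> S ==> (g has_derivative D x) (at x)"
  shows "f x = g x"
proof -
  have "((\<lambda>x. f x - g x) has_derivative (\<lambda>h. 0)) (at x)" if "x \<in> S" for x
    using has_derivative_diff[OF assms(6)[OF that] assms(7)[OF that]] by simp
  from has_derivative_zero_unique_connected[OF assms(1,2) this assms(3,5)] assms(4) show ?thesis by simp
qed

context heisenberg_model
begin

lemma bounded_bilinear_N: "bounded_bilinear N"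
  by (auto simp: bilinear_conv_bounded_bilinear[symmetric] bilinear_def lin_N lin_N_left)

lemmas bounded_linears = lin_lam[unfolded linear_conv_bounded_linear] lin_pv[unfolded linear_conv_bounded_linear]
  lin_pz[unfolded linear_conv_bounded_linear]

lemmas N_has_derivative = bounded_bilinear.FDERIV[OF bounded_bilinear_N]
lemmas lam_has_derivative = bounded_linear.has_derivative[OF bounded_linears(1)]
lemmas pv_has_derivative = bounded_linear.has_derivative[OF bounded_linears(2)]
lemmas pz_has_derivative = bounded_linear.has_derivative[OF bounded_linears(3)]

lemmas Cinf_on_N = Cinf_on_bilinear[OF bounded_bilinear_N]
lemmas Cinf_on_lam = Cinf_on_bounded_linear[OF bounded_linears(1)]
lemmas Cinf_on_pv = Cinf_on_bounded_linear[OF bounded_linears(2)]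
lemmas Cinf_on_pz = Cinf_on_bounded_linear[OF bounded_linears(3)]

lemma Cinf_on_Xm:
  assumes S: "open S" and f: "Cinf_on f S" and g: "Cinf_on g S"
  shows "Cinf_on (\<lambda>x. Xm (f x) (g x)) S"
proof -
  have "Cinf_on (\<lambda>x. lam (f x) * (1/2)) S" by (intro Cinf_on_mult Cinf_on_lam S f Cinf_on_const)
  then have e: "Cinf_on (\<lambda>x. exp (lam (f x) / 2)) S" using Cinf_on_exp[OF S] by simp
  have "Cinf_on (\<lambda>x. exp (lam (f x) / 2) * (1/2)) S" by (intro Cinf_on_mult e S Cinf_on_const)
  then have e': "Cinf_on (\<lambda>x. exp (lam (f x) / 2) / 2) S" by simp
  show ?thesis unfolding Xm_def
    by (intro Cinf_on_add Cinf_on_scaleR Cinf_on_lam Cinf_on_pv Cinf_on_pz Cinf_on_N Cinf_on_exp Cinf_on_const S f g e e')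
qed

lemma Cinf_on_th:
  assumes S: "open S" and f: "Cinf_on f S" and g: "Cinf_on g S"
  shows "Cinf_on (\<lambda>x. th (f x) (g x)) S"
proof -
  have "Cinf_on (\<lambda>x. - lam (f x) * (1/2)) S" by (intro Cinf_on_mult Cinf_on_minus Cinf_on_lam S f Cinf_on_const)
  then have e: "Cinf_on (\<lambda>x. exp (- lam (f x) / 2)) S" using Cinf_on_exp[OF S] by simp
  show ?thesis unfolding th_def
    by (intro Cinf_on_add Cinf_on_diff Cinf_on_minus Cinf_on_scaleR Cinf_on_lam Cinf_on_pv Cinf_on_pz Cinf_on_N Cinf_on_exp Cinf_on_const S f g e)
qed

lemma Cinf_on_gm: "open S ==> Cinf_on f S ==> Cinf_on g S ==> Cinf_on (\<lambda>x. gm (f x) (g x)) S"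
  unfolding gm_def by (intro Cinf_on_add Cinf_on_Xm)

lemma Cinf_on_gi: "open S ==> Cinf_on f S ==> Cinf_on (\<lambda>x. gi (f x)) S"
  unfolding gi_def by (intro Cinf_on_minus Cinf_on_th)

lemma continuous_on_gm: "continuous_on S f ==> continuous_on S g ==> continuous_on S (\<lambda>x. gm (f x) (g x))"
  and continuous_on_gi: "continuous_on S f ==> continuous_on S (\<lambda>x. gi (f x))"
proof -
  have "continuous_on UNIV (\<lambda>p. gm (fst p) (snd p))"
    by (intro Cinf_on_continuous Cinf_on_gm Cinf_on_fst Cinf_on_snd Cinf_on_id open_UNIV)
  from continuous_on_compose2[OF this, of S "\<lambda>x. (f x, g x)"]
  show "continuous_on S f ==> continuous_on S g ==> continuous_on S (\<lambda>x. gm (f x) (g x))"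
    by (auto intro!: continuous_on_Pair)
  have "continuous_on UNIV gi" by (intro Cinf_on_continuous Cinf_on_gi Cinf_on_id open_UNIV)
  from continuous_on_compose2[OF this, of S f] show "continuous_on S f ==> continuous_on S (\<lambda>x. gi (f x))" by auto
qed

lemma gm_has_derivative: "(gm a has_derivative Xm a) (at y)"
proof -
  have "((\<lambda>y. a + Xm a y) has_derivative Xm a) (at y)"
    using bounded_linear_imp_has_derivative[OF lin_Xm[unfolded linear_conv_bounded_linear]]
    by (auto intro!: derivative_eq_intros)
  then show ?thesis by (simp add: gm_def[abs_def])
qed

definition dth :: "'n => 'n => 'n => 'n" where
  "dth x u w = - (lam u / 2 * exp (- lam x / 2)) *\<^sub>R pv w - (lam u * exp (- lam x)) *\<^sub>R (pz w - (1/2) *\<^sub>R N x w)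
     - (exp (- lam x) / 2) *\<^sub>R N u w"

lemma th_has_derivative: "((\<lambda>x. th x w) has_derivative (\<lambda>u. dth x u w)) (at x)"
  unfolding th_def dth_def
  by (rule has_derivative_eq_rhs, (rule derivative_intros lam_has_derivative N_has_derivative | simp)+)
    (auto simp: fun_eq_iff algebra_simps)

text \<open>The Maurer-Cartan equation: the left side is the exterior derivative of the coframe on
  \<open>u\<close>, \<open>w\<close>.\<close>

lemma th_maurer_cartan: "dth x u w - dth x w u = - br (th x u) (th x w)"
proof (rule decomp_eqI)
  have e: "exp (- (lam x / 2)) * exp (- (lam x / 2)) = exp (- lam x)" using exp_half(2)[of "lam x"] by simp
  have N: "a *\<^sub>R c = (a / 2) *\<^sub>R c + (a / 2) *\<^sub>R c" for a and c :: 'n by (simp flip: scaleR_left_distrib)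
  show "lam (dth x u w - dth x w u) = lam (- br (th x u) (th x w))" by (simp add: dth_def br_def)
  show "pv (dth x u w - dth x w u) = pv (- br (th x u) (th x w))" by (simp add: dth_def br_def algebra_simps)
  show "pz (dth x u w - dth x w u) = pz (- br (th x u) (th x w))"
    by (simp add: dth_def br_def e N_skew[of w u] algebra_simps flip: N)
qed

text \<open>The coframe is triangular: its \<open>lam\<close>-part determines the derivative of
  \<open>lam\<close>, then its \<open>pv\<close>-part that of \<open>pv\<close>, and with both its
  \<open>pz\<close>-part that of \<open>pz\<close>. The components are compared on the connected set
  in this order.\<close>

lemma th_unique:
  fixes F1 F2 :: "'a::euclidean_space => 'n"
  assumes S: "open S" "connected S" "x0 \<in> S" "F1 x0 = F2 x0"
    and 1: "\<And>x. x \<in> S ==> (F1 has_derivative D1 x) (at x)"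
    and 2: "\<And>x. x \<in> S ==> (F2 has_derivative D2 x) (at x)"
    and eq: "\<And>x u. x \<in> S ==> th (F1 x) (D1 x u) = th (F2 x) (D2 x u)"
    and x: "x \<in> S"
  shows "F1 x = F2 x"
proof -
  have "lam (D1 x u) = lam (D2 x u)" if "x \<in> S" for x u
    using arg_cong[OF eq[OF that, of u], of lam] by simp
  then have dl: "((\<lambda>x. lam (F2 x)) has_derivative (\<lambda>u. lam (D1 x u))) (at x)" if "x \<in> S" for x
    using lam_has_derivative[OF 2[OF that]] that by simp
  have l: "lam (F1 x) = lam (F2 x)" if "x \<in> S" for x
    by (rule has_derivative_eq_on_connected[OF S(1-3) _ that lam_has_derivative[OF 1] dl]) (auto simp: S(4))
  have dv': "pv (D1 x u) = pv (D2 x u)" if "x \<in> S" for x u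
    using arg_cong[OF eq[OF that, of u], of pv] l[OF that] by simp
  then have dv: "((\<lambda>x. pv (F2 x)) has_derivative (\<lambda>u. pv (D1 x u))) (at x)" if "x \<in> S" for x
    using pv_has_derivative[OF 2[OF that]] that by simp
  have v: "pv (F1 x) = pv (F2 x)" if "x \<in> S" for x
    by (rule has_derivative_eq_on_connected[OF S(1-3) _ that pv_has_derivative[OF 1] dv]) (auto simp: S(4))
  have "pz (D1 x u) = pz (D2 x u)" if "x \<in> S" for x u
  proof -
    have "N (pv (F1 x)) (pv (D1 x u)) = N (pv (F2 x)) (pv (D2 x u))" by (simp only: dv'[OF that] v[OF that])
    then show ?thesis using arg_cong[OF eq[OF that, of u], of pz] l[OF that] by simp
  qed
  then have dz: "((\<lambda>x. pz (F2 x)) has_derivative (\<lambda>u. pz (D1 x u))) (at x)" if "x \<in> S" for x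
    using pz_has_derivative[OF 2[OF that]] that by simp
  have "pz (F1 x) = pz (F2 x)" if "x \<in> S" for x
    by (rule has_derivative_eq_on_connected[OF S(1-3) _ that pz_has_derivative[OF 1] dz]) (auto simp: S(4))
  with l[OF x] v[OF x] x show ?thesis by (metis decomp_eqI)
qed

text \<open>The triangular structure solves the equation by three applications of the Poincare
  lemma. Closedness of each form comes from the matching component of the Maurer-Cartan equation and
  the primitives already found.\<close>

lemma maurer_cartan_integral:
  fixes \<theta> :: "'a::euclidean_space => 'a => 'n"
  assumes smooth: "\<And>u. Cinf_on (\<lambda>x. \<theta> x u) (ball x0 r)" and lin: "\<And>x. x \<in> ball x0 r ==> linear (\<theta> x)"
    and mc: "\<And>x u w. x \<in> ball x0 r ==>
      fderiv (\<lambda>y. \<theta> y w) x u - fderiv (\<lambda>y. \<theta> y u) x w = - br (\<theta> x u) (\<theta> x w)"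
  obtains F where "F x0 = 0" "Cinf_on F (ball x0 r)"
    "\<And>x u. x \<in> ball x0 r ==> th (F x) (fderiv F x u) = \<theta> x u"
proof -
  let ?S = "ball x0 r"
  define D where "D x u w = fderiv (\<lambda>y. \<theta> y u) x w" for x u w
  have d: "((\<lambda>y. \<theta> y u) has_derivative D x u) (at x)" if "x \<in> ?S" for x u
    using Cinf_on_has_derivative[OF smooth that] unfolding D_def by (simp add: fun_eq_iff[symmetric])
  have mc': "D x w u = D x u w - br (\<theta> x u) (\<theta> x w)" if "x \<in> ?S" for x u w
    using mc[OF that, of w u] by (simp add: D_def algebra_simps)
  note S = open_ball[of x0 r]
  note fd = frechet_derivative_at[symmetric]
  obtain l where l: "l x0 = 0" "\<And>x. x \<in> ?S ==> (l has_derivative (\<lambda>u. lam (\<theta> x u))) (at x)" "Cinf_on l ?S"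
  proof (rule poincare_lemma[where \<omega> = "\<lambda>x u. lam (\<theta> x u)"])
    show "Cinf_on (\<lambda>x. lam (\<theta> x u)) ?S" for u by (rule Cinf_on_lam[OF S smooth])
    show "linear (\<lambda>u. lam (\<theta> x u))" if "x \<in> ?S" for x
      using linear_compose[OF lin[OF that] lin_lam] by (simp add: o_def)
    show "fderiv (\<lambda>y. lam (\<theta> y u)) x w = fderiv (\<lambda>y. lam (\<theta> y w)) x u" if "x \<in> ?S" for x u w
      unfolding fd[OF lam_has_derivative[OF d[OF that]]] by (subst mc'[OF that]) (simp add: br_def)
  qed (rule that; assumption)
  \<comment> \<open>For a unit \<open>B\<close> this is \<open>l x\<close> itself, for
    \<open>B = 0\<close> it is 0; so the same exponentials cover both kinds of algebra.\<close>
  define L where "L x = lam (l x *\<^sub>R B)" for x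
  have L: "L x0 = 0" "(L has_derivative (\<lambda>u. lam (\<theta> x u))) (at x)" if "x \<in> ?S" for x
    using l(1) lam_has_derivative[OF has_derivative_scaleR_left[OF l(2)[OF that]], of B] by (simp_all add: L_def[abs_def])
  have cL: "Cinf_on L ?S" unfolding L_def by (intro Cinf_on_lam Cinf_on_scaleR Cinf_on_const S l(3))
  have de: "((\<lambda>x. exp (L x / 2)) has_derivative (\<lambda>u. exp (L x / 2) * (lam (\<theta> x u) / 2))) (at x)"
    "((\<lambda>x. exp (L x)) has_derivative (\<lambda>u. exp (L x) * lam (\<theta> x u))) (at x)" if "x \<in> ?S" for x
    using has_derivative_exp[OF has_derivative_divide'[OF L(2)[OF that] has_derivative_const[of 2]]]
      has_derivative_exp[OF L(2)[OF that]]
    by (simp_all add: mult.commute)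
  have "Cinf_on (\<lambda>x. L x * (1/2)) ?S" by (intro Cinf_on_mult cL Cinf_on_const S)
  then have ce: "Cinf_on (\<lambda>x. exp (L x / 2)) ?S" using Cinf_on_exp[OF S] by simp
  define \<omega> where "\<omega> x u = exp (L x / 2) *\<^sub>R pv (\<theta> x u)" for x u
  have d\<omega>: "((\<lambda>y. \<omega> y u) has_derivative (\<lambda>w. exp (L x / 2) *\<^sub>R (pv (D x u w) + (lam (\<theta> x w) / 2) *\<^sub>R pv (\<theta> x u)))) (at x)"
    if "x \<in> ?S" for x u
    unfolding \<omega>_def
    by (rule has_derivative_eq_rhs[OF has_derivative_scaleR[OF de(1)[OF that] pv_has_derivative[OF d[OF that]]]])
      (simp add: algebra_simps)
  have c\<omega>: "Cinf_on (\<lambda>x. \<omega> x u) ?S" for u unfolding \<omega>_def by (intro Cinf_on_scaleR ce Cinf_on_pv smooth S)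
  have l\<omega>: "linear (\<omega> x)" if "x \<in> ?S" for x
    using linear_add[OF lin[OF that]] linear_cmul[OF lin[OF that]] by (auto simp: linear_iff \<omega>_def algebra_simps)
  have s\<omega>: "pv (D x u w) + (lam (\<theta> x w) / 2) *\<^sub>R pv (\<theta> x u) = pv (D x w u) + (lam (\<theta> x u) / 2) *\<^sub>R pv (\<theta> x w)"
    if "x \<in> ?S" for x u w
    by (subst mc'[OF that, of u w]) (simp add: br_def)
  obtain v where v: "v x0 = 0" "\<And>x. x \<in> ?S ==> (v has_derivative \<omega> x) (at x)" "Cinf_on v ?S"
  proof (rule poincare_lemma[where \<omega> = \<omega>])
    show "fderiv (\<lambda>y. \<omega> y u) x w = fderiv (\<lambda>y. \<omega> y w) x u" if "x \<in> ?S" for x u w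
      unfolding fd[OF d\<omega>[OF that]] by (simp add: s\<omega>[OF that, of u w])
  qed (rule c\<omega> l\<omega> that; assumption)+
  define V where "V x = pv (v x)" for x
  have V: "V x0 = 0" "(V has_derivative \<omega> x) (at x)" if "x \<in> ?S" for x
    using v(1) pv_has_derivative[OF v(2)[OF that]] by (simp_all add: V_def[abs_def] \<omega>_def[abs_def])
  have cV: "Cinf_on V ?S" unfolding V_def by (intro Cinf_on_pv S v(3))
  \<comment> \<open>The result of solving the \<open>pz\<close>-part of
    \<open>th (F x) (fderiv F x u) = \<theta> x u\<close> for the derivative of the last
    component.\<close>
  define \<zeta> where "\<zeta> x u = exp (L x) *\<^sub>R pz (\<theta> x u) + (1/2) *\<^sub>R N (V x) (\<omega> x u)" for x u
  have d\<zeta>: "((\<lambda>y. \<zeta> y u) has_derivative (\<lambda>w. exp (L x) *\<^sub>R (pz (D x u w) + lam (\<theta> x w) *\<^sub>R pz (\<theta> x u)) +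
      (1/2) *\<^sub>R (exp (L x / 2) *\<^sub>R N (V x) (pv (D x u w) + (lam (\<theta> x w) / 2) *\<^sub>R pv (\<theta> x u)) + N (\<omega> x w) (\<omega> x u)))) (at x)"
    if "x \<in> ?S" for x u
    unfolding \<zeta>_def
    by (rule has_derivative_eq_rhs[OF has_derivative_add[OF has_derivative_scaleR[OF de(2)[OF that] pz_has_derivative[OF d[OF that]]]
          has_derivative_scaleR_right[OF N_has_derivative[OF V(2)[OF that] d\<omega>[OF that]]]]])
      (simp add: algebra_simps)
  obtain z where z: "z x0 = 0" "\<And>x. x \<in> ?S ==> (z has_derivative \<zeta> x) (at x)" "Cinf_on z ?S"
  proof (rule poincare_lemma[where \<omega> = \<zeta>])
    show "Cinf_on (\<lambda>x. \<zeta> x u) ?S" for u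
      unfolding \<zeta>_def by (intro Cinf_on_add Cinf_on_scaleR Cinf_on_exp cL Cinf_on_pz smooth S Cinf_on_N Cinf_on_const cV c\<omega>)
    show "linear (\<zeta> x)" if "x \<in> ?S" for x
      using linear_add[OF lin[OF that]] linear_cmul[OF lin[OF that]] linear_add[OF l\<omega>[OF that]] linear_cmul[OF l\<omega>[OF that]]
      by (auto simp: linear_iff \<zeta>_def algebra_simps)
    show "fderiv (\<lambda>y. \<zeta> y u) x w = fderiv (\<lambda>y. \<zeta> y w) x u" if "x \<in> ?S" for x u w
    proof -
      have "exp (L x) *\<^sub>R (pz (D x u w) + lam (\<theta> x w) *\<^sub>R pz (\<theta> x u)) + (1/2) *\<^sub>R N (\<omega> x w) (\<omega> x u) =
          exp (L x) *\<^sub>R (pz (D x w u) + lam (\<theta> x u) *\<^sub>R pz (\<theta> x w)) + (1/2) *\<^sub>R N (\<omega> x u) (\<omega> x w)"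
        by (subst mc'[OF that, of u w])
          (simp add: br_def \<omega>_def exp_half N_skew[of "\<theta> x w" "\<theta> x u"] algebra_simps, simp flip: scaleR_left_distrib)
      then show ?thesis unfolding fd[OF d\<zeta>[OF that]] by (simp only: s\<omega>[OF that, of u w]) (simp add: algebra_simps)
    qed
  qed (rule that; assumption)
  define F where "F x = l x *\<^sub>R B + V x + pz (z x)" for x
  have dF: "(F has_derivative (\<lambda>u. lam (\<theta> x u) *\<^sub>R B + \<omega> x u + pz (\<zeta> x u))) (at x)" if "x \<in> ?S" for x
    unfolding F_def
    by (intro has_derivative_add has_derivative_scaleR_left l(2) V(2) pz_has_derivative z(2) that)
  show ?thesis
  proof (rule that)
    show "F x0 = 0" by (simp add: F_def V_def l(1) v(1) z(1))
    show "Cinf_on F ?S" unfolding F_def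
      by (intro Cinf_on_add Cinf_on_scaleR Cinf_on_const cV Cinf_on_pz z(3) l(3) S)
    show "th (F x) (fderiv F x u) = \<theta> x u" if "x \<in> ?S" for x u
    proof -
      have [simp]: "lam (F x) = L x" "N (F x) w = N (V x) w" for w
        by (simp_all add: F_def L_def V_def)
      have [simp]: "lam (\<theta> x u) = 0 \<or> lam B = 1" by (metis lam_mult_lam_B mult_cancel_left2)
      have [simp]: "pv (\<omega> x u) = \<omega> x u" "lam (\<omega> x u) = 0" "pz (\<omega> x u) = 0" by (simp_all add: \<omega>_def)
      show ?thesis unfolding fd[OF dF[OF that]]
        by (rule decomp_eqI) (simp_all add: \<omega>_def \<zeta>_def exp_half algebra_simps)
    qed
  qed
qed

end

section \<open>Local coordinates of a Lie group with the given algebra\<close>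

locale lie_model = heisenberg_model B pv pz N
  for B :: "'n::euclidean_space" and pv pz N +
  fixes A :: "('m::{t2_space,second_countable_topology}, 'e::euclidean_space) chart set"
    and mul :: "'m => 'm => 'm" and e :: 'm and iv :: "'m => 'm" and \<phi> :: "'n => 'm tangent"
  assumes lie_group: "lie_group A mul e iv" and algebra: "is_lie_algebra_of A mul e br \<phi>"
begin

lemma atlas: "smooth_atlas A"
  and group: "group mul e iv"
  and smooth_mul: "smooth_map (prod_atlas A A) A (\<lambda>(x, y). mul x y)" and smooth_iv: "smooth_map A A iv"
  using lie_group by (auto simp: lie_group_def)

lemmas charts = charts_smooth_atlas[OF atlas]

lemma mul_assoc: "mul (mul a b) c = mul a (mul b c)" and mul_e [simp]: "mul e a = a" "mul a e = a"
  and mul_iv [simp]: "mul (iv a) a = e" "mul a (iv a) = e"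
proof -
  interpret G: group mul e iv by (rule group)
  show "mul (mul a b) c = mul a (mul b c)" "mul e a = a" "mul a e = a" "mul (iv a) a = e" "mul a (iv a) = e"
    by (simp_all add: G.assoc)
qed

lemma mul_cancel [simp]: "mul (iv a) (mul a b) = b" "mul a (mul (iv a) b) = b"
  by (simp_all flip: mul_assoc)

lemma iv_unique: "mul a b = e ==> iv a = b"
  by (metis mul_cancel(1) mul_e(2))

lemma iv_iv [simp]: "iv (iv a) = a" and iv_e [simp]: "iv e = e" and iv_mul: "iv (mul a b) = mul (iv b) (iv a)"
  by (auto intro!: iv_unique simp: mul_assoc)

lemma plot_mul: "plot A S c ==> plot A S d ==> plot A S (\<lambda>x. mul (c x) (d x))"
  using plot_smooth_map[OF charts_prod_atlas[OF charts charts] charts smooth_mul plot_Pair[OF _ _ charts charts]] by simp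

lemma plot_iv: "plot A S c ==> plot A S (\<lambda>x. iv (c x))"
  by (rule plot_smooth_map[OF charts charts smooth_iv])

lemma plot_const: "open S ==> plot A S (\<lambda>x. a)"
  by (auto simp: plot_def intro!: Cinf_on_const)

lemma smooth_map_plot: "smooth_map A A F ==> plot A S c ==> plot A S (\<lambda>x. F (c x))"
  by (rule plot_smooth_map[OF charts charts])

lemma smooth_mul_left: "smooth_map A A (mul a)"
proof (rule smooth_map_plotI[OF charts])
  have c: "continuous_on UNIV (\<lambda>(x, y). mul x y)"
    using smooth_mul by (simp add: smooth_map_def)
  have "continuous_on UNIV (\<lambda>b. (a, b))" by (intro continuous_intros)
  from continuous_on_compose2[OF c this] show "continuous_on UNIV (mul a)" by simp
  show "plot A (\<phi> ` U) (\<lambda>x. mul a (inv_into U \<phi> x))" if "(U, \<phi>) \<in> A" for U \<phi>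
    by (intro plot_mul plot_const plot_inv_chart[OF atlas that] chartsD(2)[OF charts that])
qed

lemma continuous_mul: "continuous_on S c ==> continuous_on S d ==> continuous_on S (\<lambda>x. mul (c x) (d x))"
  for c d :: "'x::topological_space => 'm"
proof -
  assume cd: "continuous_on S c" "continuous_on S d"
  have c: "continuous_on UNIV (\<lambda>(x, y). mul x y)" using smooth_mul by (simp add: smooth_map_def)
  from continuous_on_compose2[OF c continuous_on_Pair[OF cd]] show ?thesis by simp
qed

lemma continuous_iv: "continuous_on S c ==> continuous_on S (\<lambda>x. iv (c x))"
  for c :: "'x::topological_space => 'm"
  using continuous_on_compose2[of UNIV iv S c] smooth_iv by (simp add: smooth_map_def)

lemma bij_\<phi>: "bij_betw \<phi> UNIV (tangent_space A e)"
  and \<phi>_add: "\<phi> (x + y) = (\<lambda>f. \<phi> x f + \<phi> y f)" and \<phi>_scale: "\<phi> (k *\<^sub>R x) = (\<lambda>f. k * \<phi> x f)"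
  and \<phi>_br: "\<phi> (br x y) = left_invariant_bracket A mul (\<phi> x) (\<phi> y)"
  using algebra by (auto simp: is_lie_algebra_of_def)

lemma inv_\<phi>_\<phi> [simp]: "inv \<phi> (\<phi> x) = x"
  using bij_\<phi> by (simp add: bij_betw_def)

lemma \<phi>_inv_\<phi>: "X \<in> tangent_space A e ==> \<phi> (inv \<phi> X) = X"
  using bij_\<phi> by (metis bij_betw_def f_inv_into_f)

lemma \<phi>_tangent: "\<phi> x \<in> tangent_space A e"
  using bij_\<phi> by (auto simp: bij_betw_def)

text \<open>The left Maurer-Cartan form of the group pulled back by \<open>c\<close>, with values in
  the algebra through \<open>\<phi>\<close>: the abstract counterpart of \<open>th\<close>.\<close>

definition thM :: "('a::euclidean_space => 'm) => 'a => 'a => 'n" where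
  "thM c x u = inv \<phi> (differential A (mul (iv (c x))) (pd A c x u))"

lemma thM_eq: "thM c x u = inv \<phi> (pd A (\<lambda>y. mul (iv (c x)) (c y)) x u)"
  by (simp add: thM_def differential_pd[OF atlas smooth_mul_left])

lemma \<phi>_thM:
  assumes "plot A S c" "x \<in> S"
  shows "\<phi> (thM c x u) = pd A (\<lambda>y. mul (iv (c x)) (c y)) x u"
proof -
  have p: "plot A S (\<lambda>y. mul (iv (c x)) (c y))" by (intro plot_mul plot_const assms plot_open[OF assms(1)])
  show ?thesis unfolding thM_eq
    by (rule \<phi>_inv_\<phi>) (use pd_tangent[OF atlas p assms(2), of u] in simp)
qed

lemma thM_eqI:
  assumes "\<phi> X = pd A (\<lambda>y. mul (iv (c x)) (c y)) x u"
  shows "thM c x u = X"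
  using assms by (metis thM_eq inv_\<phi>_\<phi>)

lemma thM_linear: "plot A S c ==> x \<in> S ==> linear (thM c x)"
proof -
  assume c: "plot A S c" "x \<in> S"
  have p: "plot A S (\<lambda>y. mul (iv (c x)) (c y))" by (intro plot_mul plot_const c plot_open[OF c(1)])
  show ?thesis
    by (auto simp: linear_iff intro!: thM_eqI simp: \<phi>_add \<phi>_scale \<phi>_thM[OF c] pd_linear[OF atlas p c(2)])
qed

lemma thM_mul_left [simp]: "thM (\<lambda>y. mul a (c y)) x u = thM c x u"
  by (simp add: thM_eq iv_mul mul_assoc)

lemma thM_compose:
  assumes "plot A S c" "h x \<in> S" "(h has_derivative h') (at x)"
  shows "thM (\<lambda>y. c (h y)) x u = thM c (h x) (h' u)"
proof -
  have p: "plot A S (\<lambda>y. mul (iv (c (h x))) (c y))" by (intro plot_mul plot_const assms plot_open[OF assms(1)])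
  show ?thesis unfolding thM_eq using pd_compose[OF atlas p assms(2,3)] by simp
qed

lemma thM_cong:
  assumes "open T" "x \<in> T" "\<And>y. y \<in> T ==> c y = d y" "plot A S c" "x \<in> S"
  shows "thM c x u = thM d x u"
  unfolding thM_def using pd_cong[OF atlas assms] assms(2,3) by simp

lemma pd_eq_mul_left_iff:
  assumes F: "pd A (\<lambda>y. mul a (c y)) x u = pd A (\<lambda>y. mul a (d y)) y v"
  shows "pd A c x u = pd A d y v"
  using arg_cong[OF F, of "differential A (mul (iv a))"] by (simp add: differential_pd[OF atlas smooth_mul_left])

lemma thM_eq_iff:
  assumes c: "plot A S c" "x \<in> S" and d: "plot A T d" "y \<in> T" "d y = c x"
  shows "thM c x u = thM d y v \<longleftrightarrow> pd A c x u = pd A d y v"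
proof
  assume "thM c x u = thM d y v"
  then have "pd A (\<lambda>y. mul (iv (c x)) (c y)) x u = pd A (\<lambda>z. mul (iv (c x)) (d z)) y v"
    using \<phi>_thM[OF c, of u] \<phi>_thM[OF d(1,2), of v] d(3) by simp
  then show "pd A c x u = pd A d y v" by (rule pd_eq_mul_left_iff)
qed (simp add: thM_def d)

text \<open>\<open>left_invariant_bracket\<close> applies a derivation to this function, and
  derivations are 0 on non-smooth ones. In charts it is a partial derivative of a smooth function of
  two points, composed from multiplication and \<open>f\<close>.\<close>

lemma smooth_fun_left_field:
  assumes f: "smooth_fun A f"
  shows "smooth_fun A (\<lambda>a. \<phi> Y (f \<circ> mul a))"
proof (rule smooth_funI[OF charts])
  fix V \<psi> assume V: "(V, \<psi>) \<in> A"
  obtain U \<nu> where U: "(U, \<nu>) \<in> A" "e \<in> U" using chart_at[OF charts] .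
  note u = chartsD[OF charts U(1)] and v = chartsD[OF charts V]
  obtain w where w: "\<phi> Y = pd A (inv_into U \<nu>) (\<nu> e) w"
    by (rule tangent_vector_chart[OF atlas \<phi>_tangent U])
  let ?g = "\<lambda>p. f (mul (inv_into V \<psi> (fst p)) (inv_into U \<nu> (snd p)))"
  let ?S = "\<psi> ` V \<times> \<nu> ` U"
  have S: "open ?S" using u(2) v(2) by (rule open_Times[rotated])
  have "plot A ?S (\<lambda>p. inv_into V \<psi> (fst p))" "plot A ?S (\<lambda>p. inv_into U \<nu> (snd p))"
    by (rule plot_compose[OF plot_inv_chart[OF atlas V] S Cinf_on_fst[OF S Cinf_on_id[OF S]] _ charts], force,
      rule plot_compose[OF plot_inv_chart[OF atlas U(1)] S Cinf_on_snd[OF S Cinf_on_id[OF S]] _ charts], force)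
  from smooth_fun_plot[OF charts f plot_mul[OF this]] have g: "Cinf_on ?g ?S" .
  have eq: "\<phi> Y (f \<circ> mul (inv_into V \<psi> x)) = fderiv ?g ((x, \<nu> e)) (0, w)" if x: "x \<in> \<psi> ` V" for x
  proof -
    have xe: "(x, \<nu> e) \<in> ?S" using x U by auto
    have "((\<lambda>y. (x, y)) has_derivative (\<lambda>w. (0, w))) (at (\<nu> e))" by (auto intro!: derivative_eq_intros)
    from has_derivative_compose[OF this, of ?g] Cinf_on_has_derivative[OF g xe]
    have d: "((\<lambda>y. f (mul (inv_into V \<psi> x) (inv_into U \<nu> y))) has_derivative (\<lambda>w. fderiv ?g ((x, \<nu> e)) (0, w))) (at (\<nu> e))"
      by simp
    have "smooth_fun A (\<lambda>b. f (mul (inv_into V \<psi> x) b))"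
      by (rule smooth_map_compose[OF atlas charts charts_euclidean_atlas smooth_mul_left f])
    from pd_eqI[OF atlas this d] show ?thesis by (simp add: w o_def)
  qed
  have "Cinf_on (\<lambda>x. fderiv ?g ((x, \<nu> e)) (0, w)) (\<psi> ` V)"
    by (rule Cinf_on_compose[OF v(2) S _ Cinf_on_frechet[OF g] Cinf_on_Pair[OF v(2) Cinf_on_id[OF v(2)] Cinf_on_const[OF v(2)]]])
      (use U in auto)
  from Cinf_on_cong[OF v(2) eq[symmetric] this] show "Cinf_on (\<lambda>x. \<phi> Y (f \<circ> mul (inv_into V \<psi> x))) (\<psi> ` V)" .
qed

end

text \<open>A chart around \<open>e\<close>, centred at 0, whose differential there is the
  identification \<open>\<phi>\<close>. The functions \<open>co b\<close> are globally smooth and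
  agree with the coordinates on the ball, because derivations can be tested on global functions
  only.\<close>

locale lie_chart = lie_model B pv pz N A mul e iv \<phi>
  for B :: "'n::euclidean_space" and pv pz N
    and A :: "('m::{t2_space,second_countable_topology}, 'e::euclidean_space) chart set"
    and mul e iv \<phi> +
  fixes \<kappa> :: "'n => 'm" and \<nu> :: "'m => 'n" and r :: real and co :: "'n => 'm => real"
  assumes r: "r > 0" and plot_\<kappa>: "plot A (ball 0 r) \<kappa>"
    and open_\<kappa>: "open T ==> T \<subseteq> ball 0 r ==> open (\<kappa> ` T)"
    and \<nu>_\<kappa>: "x \<in> ball 0 r ==> \<nu> (\<kappa> x) = x" and \<kappa>_0: "\<kappa> 0 = e"
    and smooth_\<nu>: "(U, \<psi>) \<in> A ==> Cinf_on (\<lambda>x. \<nu> (inv_into U \<psi> x)) (\<psi> ` (U \<inter> \<kappa> ` ball 0 r))"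
    and cont_\<nu>: "continuous_on (\<kappa> ` ball 0 r) \<nu>"
    and smooth_co: "smooth_fun A (co b)" and co_\<kappa>: "x \<in> ball 0 r ==> co b (\<kappa> x) = x \<bullet> b"
    and thM_\<kappa>_0: "thM \<kappa> 0 u = u"

context lie_model
begin

lemma lie_chart_exists: "\<exists>\<kappa> \<nu> r co. lie_chart B pv pz N A mul e iv \<phi> \<kappa> \<nu> r co"
proof -
  obtain U \<psi> where U: "(U, \<psi>) \<in> A" "e \<in> U" using chart_at[OF charts] .
  note u = chartsD[OF charts U(1)]
  define \<kappa>0 where "\<kappa>0 = inv_into U \<psi>"
  define x0 where "x0 = \<psi> e"
  have x0: "x0 \<in> \<psi> ` U" "\<kappa>0 x0 = e" using U u(6) by (auto simp: x0_def \<kappa>0_def)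
  note p0 = plot_inv_chart[OF atlas U(1), folded \<kappa>0_def]
  \<comment> \<open>The differential of the inverse chart at \<open>e\<close>, read in the algebra;
    precomposing with its inverse \<open>L\<close> normalizes the differential to the
    identity.\<close>
  define M where "M w = inv \<phi> (pd A \<kappa>0 x0 w)" for w
  have \<phi>M: "\<phi> (M w) = pd A \<kappa>0 x0 w" for w
    unfolding M_def by (rule \<phi>_inv_\<phi>) (use pd_tangent[OF atlas p0 x0(1), of w] x0(2) in simp)
  have \<phi>_inj: "\<phi> X = \<phi> Y ==> X = Y" for X Y by (metis inv_\<phi>_\<phi>)
  have M_lin: "linear M"
    by (auto simp: linear_iff \<phi>M \<phi>_add \<phi>_scale pd_linear[OF atlas p0 x0(1)] intro!: \<phi>_inj)
  have M_inj: "M w = M v ==> w = v" for w v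
    using pd_chart_inj[OF atlas U(1) x0(1)] \<phi>M unfolding \<kappa>0_def by metis
  have M_surj: "\<exists>w. M w = X" for X
  proof -
    obtain w where "\<phi> X = pd A \<kappa>0 x0 w"
      using tangent_vector_chart[OF atlas \<phi>_tangent U] unfolding \<kappa>0_def x0_def by metis
    then show ?thesis using \<phi>M \<phi>_inj by metis
  qed
  define L where "L X = (SOME w. M w = X)" for X
  have M_L: "M (L X) = X" for X unfolding L_def using M_surj by (rule someI_ex)
  have L_M: "L (M w) = w" for w using M_L M_inj by blast
  have L_lin: "linear L"
    by (auto simp: linear_iff intro!: M_inj simp: M_L linear_add[OF M_lin] linear_cmul[OF M_lin])
  obtain R where R: "R > 0" "ball x0 R \<subseteq> \<psi> ` U"
    using u(2) x0(1) openE by blast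
  obtain ext r1 where ext: "0 < r1" "r1 < R" "\<And>f. Cinf_on f (ball x0 R) ==> smooth_fun A (ext f)"
    "\<And>f q. q \<in> U ==> \<psi> q \<in> ball x0 r1 ==> ext f q = f (\<psi> q)"
    by (rule smooth_extension[OF atlas U(1) R[unfolded x0_def]]) (auto simp: x0_def)
  obtain K where K: "K > 0" "\<And>x. norm (L x) \<le> K * norm x" using linear_bounded_pos[OF L_lin] by metis
  \<comment> \<open>\<open>K\<close> bounds the norm of \<open>L\<close>, so this ball is mapped
    into the ball of radius \<open>r1\<close> on which the extended coordinates are exact.\<close>
  define r where "r = r1 / K"
  have r: "r > 0" using ext(1) K(1) by (simp add: r_def)
  have inb: "x0 + L x \<in> ball x0 r1" if "x \<in> ball 0 r" for x
    using K(2)[of x] that K(1) by (simp add: dist_norm r_def field_simps)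
  then have in_U: "x0 + L x \<in> \<psi> ` U" if "x \<in> ball 0 r" for x using that R(2) ext(2) by force
  define \<kappa> where "\<kappa> x = \<kappa>0 (x0 + L x)" for x
  define \<nu> where "\<nu> q = M (\<psi> q - x0)" for q
  define co where "co b = ext (\<lambda>x. M (x - x0) \<bullet> b)" for b
  have hd: "((\<lambda>x. x0 + L x) has_derivative L) (at x)" for x
    using bounded_linear_imp_has_derivative[OF L_lin[unfolded linear_conv_bounded_linear]]
    by (auto intro!: derivative_eq_intros)
  have \<kappa>: "plot A (ball 0 r) \<kappa>" unfolding \<kappa>_def
    by (rule plot_compose[OF p0 open_ball Cinf_on_add[OF open_ball Cinf_on_const[OF open_ball] Cinf_on_linear[OF L_lin open_ball]] _ charts])
      (use in_U in auto)
  have \<kappa>U: "\<kappa> x \<in> U" "\<psi> (\<kappa> x) = x0 + L x" if "x \<in> ball 0 r" for x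
    using u(7,8)[OF in_U[OF that]] by (auto simp: \<kappa>_def \<kappa>0_def)
  have \<nu>\<kappa>: "\<nu> (\<kappa> x) = x" if "x \<in> ball 0 r" for x using \<kappa>U[OF that] by (simp add: \<nu>_def M_L)
  have c\<nu>: "continuous_on U \<nu>" unfolding \<nu>_def
    by (rule bounded_linear.continuous_on[OF M_lin[unfolded linear_conv_bounded_linear] continuous_on_diff[OF u(4) continuous_on_const]])
  have oim: "open (\<kappa> ` T)" if "open T" "T \<subseteq> ball 0 r" for T
  proof -
    have "\<kappa> ` T = U \<inter> \<nu> -` T"
    proof
      show "\<kappa> ` T \<subseteq> U \<inter> \<nu> -` T" using \<kappa>U \<nu>\<kappa> that(2) by auto
      have "q \<in> \<kappa> ` T" if "q \<in> U" "\<nu> q \<in> T" for q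
        using that u(6)[OF that(1)] by (auto simp: \<kappa>_def \<nu>_def L_M \<kappa>0_def intro!: image_eqI[of _ _ "\<nu> q"])
      then show "U \<inter> \<nu> -` T \<subseteq> \<kappa> ` T" by auto
    qed
    then show ?thesis using open_preimage_Int[OF u(1) c\<nu> that(1)] by simp
  qed
  note bl = Cinf_on_bounded_linear[OF M_lin[unfolded linear_conv_bounded_linear]]
  have "lie_chart B pv pz N A mul e iv \<phi> \<kappa> \<nu> r co"
  proof unfold_locales
    show "open (\<kappa> ` T)" if "open T" "T \<subseteq> ball 0 r" for T by (rule oim[OF that])
    show "Cinf_on (\<lambda>x. \<nu> (inv_into V \<psi>' x)) (\<psi>' ` (V \<inter> \<kappa> ` ball 0 r))" if V: "(V, \<psi>') \<in> A" for V \<psi>'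
    proof -
      let ?T = "\<psi>' ` (V \<inter> \<kappa> ` ball 0 r)"
      have o: "open ?T" by (rule open_chart_image[OF charts V oim]) auto
      have p: "plot A ?T (inv_into V \<psi>')"
        by (rule plot_subset[OF plot_inv_chart[OF atlas V] charts o]) auto
      have "inv_into V \<psi>' ` ?T \<subseteq> U"
        using chartsD(6)[OF charts V] \<kappa>U(1) by auto
      then show ?thesis unfolding \<nu>_def
        by (rule bl[OF o Cinf_on_diff[OF o plot_Cinf_on[OF p U(1) subset_refl] Cinf_on_const[OF o]]])
    qed
    show "continuous_on (\<kappa> ` ball 0 r) \<nu>" by (rule continuous_on_subset[OF c\<nu>]) (use \<kappa>U in auto)
    show "smooth_fun A (co b)" for b unfolding co_def
      by (rule ext(3), rule Cinf_on_inner[OF open_ball bl[OF open_ball Cinf_on_diff[OF open_ball Cinf_on_id[OF open_ball]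
          Cinf_on_const[OF open_ball]]] Cinf_on_const[OF open_ball]])
    show "co b (\<kappa> x) = x \<bullet> b" if "x \<in> ball 0 r" for b x
      using ext(4)[OF \<kappa>U(1)[OF that]] inb[OF that] by (simp add: co_def \<kappa>U(2)[OF that] M_L)
    show \<kappa>0: "\<kappa> 0 = e" by (simp add: \<kappa>_def linear_0[OF L_lin] x0)
    show "thM \<kappa> 0 x = x" for x
    proof (rule thM_eqI)
      have "pd A (\<lambda>y. \<kappa>0 (x0 + L y)) 0 x = pd A \<kappa>0 (x0 + L 0) (L x)"
        by (rule pd_compose[OF atlas p0 _ hd]) (simp add: linear_0[OF L_lin] x0)
      then show "\<phi> x = pd A (\<lambda>y. mul (iv (\<kappa> 0)) (\<kappa> y)) 0 x"
        using \<phi>M[of "L x"] unfolding \<kappa>0 by (simp add: \<kappa>_def[abs_def] linear_0[OF L_lin] M_L)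
    qed
  qed (use r \<kappa> \<nu>\<kappa> in auto)
  then show ?thesis by blast
qed

end

section \<open>The Maurer-Cartan form and the left-invariant fields in a chart\<close>

context lie_chart
begin

lemma r0: "0 \<in> ball 0 r" using r by simp

lemma open_W: "open (\<kappa> ` ball 0 r)" by (rule open_\<kappa>) auto

lemma \<kappa>_\<nu>: "q \<in> \<kappa> ` ball 0 r ==> \<kappa> (\<nu> q) = q" and \<nu>_in: "q \<in> \<kappa> ` ball 0 r ==> \<nu> q \<in> ball 0 r"
  using \<nu>_\<kappa> by auto

lemma plot_prod_\<kappa>:
  "plot A (ball 0 r \<times> ball (0 :: 'n) r) (\<lambda>p. \<kappa> (fst p))" "plot A (ball (0 :: 'n) r \<times> ball 0 r) (\<lambda>p. \<kappa> (snd p))"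
proof -
  have o: "open (ball 0 r \<times> ball (0 :: 'n) r :: ('n \<times> 'n) set)" by (simp add: open_Times)
  show "plot A (ball 0 r \<times> ball (0 :: 'n) r) (\<lambda>p. \<kappa> (fst p))"
    by (rule plot_compose[OF plot_\<kappa> o Cinf_on_fst[OF o Cinf_on_id[OF o]] _ charts]) force
  show "plot A (ball (0 :: 'n) r \<times> ball 0 r) (\<lambda>p. \<kappa> (snd p))"
    by (rule plot_compose[OF plot_\<kappa> o Cinf_on_snd[OF o Cinf_on_id[OF o]] _ charts]) force
qed

lemma plot_\<nu>: "plot A T c ==> c ` T \<subseteq> \<kappa> ` ball 0 r ==> Cinf_on (\<lambda>x. \<nu> (c x)) T"
  by (rule plot_local_inverse[OF charts open_W smooth_\<nu>])

text \<open>Both the Maurer-Cartan form (at \<open>y = x\<close>) and the left-invariant fields (at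
  \<open>y = 0\<close>) are partial derivatives of this kind of a smooth two-variable map, which is
  why they are smooth in \<open>x\<close>.\<close>

lemma chart_partial:
  fixes c :: "'n \<times> 'n => 'm"
  assumes c: "plot A T c"
  defines "W \<equiv> T \<inter> c -` (\<kappa> ` ball 0 r)"
  shows "open W" "Cinf_on (\<lambda>p. \<nu> (c p)) W"
    "(x, y) \<in> W ==> pd A (\<lambda>y. c (x, y)) y w = pd A \<kappa> (\<nu> (c (x, y))) (fderiv (\<lambda>p. \<nu> (c p)) ((x, y)) (0, w))"
proof -
  show W: "open W" unfolding W_def by (rule open_preimage_Int[OF plot_open[OF c] plot_continuous[OF c] open_W])
  have cW: "plot A W c" by (rule plot_subset[OF c charts W]) (auto simp: W_def)
  show s: "Cinf_on (\<lambda>p. \<nu> (c p)) W" by (rule plot_\<nu>[OF cW]) (auto simp: W_def)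
  assume xy: "(x, y) \<in> W"
  let ?V = "(\<lambda>y. (x, y)) -` W"
  have V: "open ?V" by (rule open_vimage[OF W]) (intro continuous_intros)
  have d: "((\<lambda>y. \<nu> (c (x, y))) has_derivative (\<lambda>w. fderiv (\<lambda>p. \<nu> (c p)) ((x, y)) (0, w))) (at y)"
  proof -
    have "((\<lambda>y. (x, y)) has_derivative (\<lambda>w. (0, w))) (at y)" by (auto intro!: derivative_eq_intros)
    from has_derivative_compose[OF this, of "\<lambda>p. \<nu> (c p)"] Cinf_on_has_derivative[OF s xy] show ?thesis by simp
  qed
  have pV: "plot A ?V (\<lambda>y. c (x, y))"
    by (rule plot_compose[OF cW V _ _ charts]) (auto intro!: Cinf_on_Pair Cinf_on_const Cinf_on_id V)
  have "pd A (\<lambda>y. c (x, y)) y w = pd A (\<lambda>y. \<kappa> (\<nu> (c (x, y)))) y w"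
    by (rule pd_cong[OF atlas V _ _ pV]) (use xy \<kappa>_\<nu> in \<open>auto simp: W_def\<close>)
  also have "\<dots> = pd A \<kappa> (\<nu> (c (x, y))) (fderiv (\<lambda>p. \<nu> (c p)) ((x, y)) (0, w))"
    by (rule pd_compose[OF atlas plot_\<kappa> _ d]) (use xy \<nu>_in in \<open>auto simp: W_def\<close>)
  finally show "pd A (\<lambda>y. c (x, y)) y w = pd A \<kappa> (\<nu> (c (x, y))) (fderiv (\<lambda>p. \<nu> (c p)) ((x, y)) (0, w))" .
qed

lemma \<phi>_eq_pd_\<kappa>: "\<phi> X = pd A \<kappa> 0 X"
  using \<phi>_thM[OF plot_\<kappa> r0, of X] by (simp add: thM_\<kappa>_0 \<kappa>_0)

lemma thM_\<kappa>_smooth: "Cinf_on (\<lambda>x. thM \<kappa> x w) (ball 0 r)"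
proof -
  define c where "c p = mul (iv (\<kappa> (fst p))) (\<kappa> (snd p))" for p
  have c: "plot A (ball 0 r \<times> ball 0 r) c" unfolding c_def by (intro plot_mul plot_iv plot_prod_\<kappa>)
  let ?W = "(ball 0 r \<times> ball 0 r) \<inter> c -` (\<kappa> ` ball 0 r)"
  note cp = chart_partial[OF c]
  have in_W: "(x, x) \<in> ?W" if "x \<in> ball 0 r" for x
    using that r0 by (auto simp: c_def intro!: image_eqI[of _ _ 0] simp: \<kappa>_0)
  have \<nu>_e: "\<nu> e = 0" using \<nu>_\<kappa>[OF r0] \<kappa>_0 by simp
  have "thM \<kappa> x w = fderiv (\<lambda>p. \<nu> (c p)) ((x, x)) (0, w)" if "x \<in> ball 0 r" for x
  proof (rule thM_eqI)
    show "\<phi> (fderiv (\<lambda>p. \<nu> (c p)) ((x, x)) (0, w)) = pd A (\<lambda>y. mul (iv (\<kappa> x)) (\<kappa> y)) x w"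
      using cp(3)[OF in_W[OF that]] by (simp add: \<phi>_eq_pd_\<kappa> c_def[abs_def] \<nu>_e)
  qed
  moreover have "Cinf_on (\<lambda>x. fderiv (\<lambda>p. \<nu> (c p)) ((x, x)) (0, w)) (ball 0 r)"
    by (rule Cinf_on_compose[OF open_ball cp(1) _ Cinf_on_frechet[OF cp(2)] Cinf_on_Pair[OF open_ball Cinf_on_id[OF open_ball] Cinf_on_id[OF open_ball]]])
      (use in_W in auto)
  ultimately show ?thesis using Cinf_on_cong[OF open_ball] by (metis (no_types, lifting))
qed

definition \<xi> :: "'n => 'n => 'n" where
  "\<xi> X x = fderiv (\<lambda>p. \<nu> (mul (\<kappa> (fst p)) (\<kappa> (snd p)))) ((x, 0)) (0, X)"

lemma \<xi>_smooth: "Cinf_on (\<xi> X) (ball 0 r)"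
  and pd_\<xi>: "x \<in> ball 0 r ==> pd A \<kappa> x (\<xi> X x) = pd A (\<lambda>y. mul (\<kappa> x) (\<kappa> y)) 0 X"
proof -
  define c where "c p = mul (\<kappa> (fst p)) (\<kappa> (snd p))" for p
  have c: "plot A (ball 0 r \<times> ball 0 r) c" unfolding c_def by (intro plot_mul plot_prod_\<kappa>)
  let ?W = "(ball 0 r \<times> ball 0 r) \<inter> c -` (\<kappa> ` ball 0 r)"
  note cp = chart_partial[OF c]
  have in_W: "(x, 0) \<in> ?W" if "x \<in> ball 0 r" for x
    using that r0 by (auto simp: c_def \<kappa>_0)
  show "Cinf_on (\<xi> X) (ball 0 r)" unfolding \<xi>_def[abs_def] c_def[symmetric]
    by (rule Cinf_on_compose[OF open_ball cp(1) _ Cinf_on_frechet[OF cp(2)] Cinf_on_Pair[OF open_ball Cinf_on_id[OF open_ball] Cinf_on_const[OF open_ball]]])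
      (use in_W in auto)
  show "pd A \<kappa> x (\<xi> X x) = pd A (\<lambda>y. mul (\<kappa> x) (\<kappa> y)) 0 X" if "x \<in> ball 0 r"
    using cp(3)[OF in_W[OF that], of X] \<nu>_\<kappa>[OF that] unfolding \<xi>_def by (simp add: c_def \<kappa>_0)
qed

lemma thM_\<xi>: "x \<in> ball 0 r ==> thM \<kappa> x (\<xi> X x) = X"
  unfolding thM_def
  by (simp add: pd_\<xi> differential_pd[OF atlas smooth_mul_left] \<phi>_eq_pd_\<kappa>[symmetric])

lemma \<xi>_thM: "x \<in> ball 0 r ==> \<xi> (thM \<kappa> x w) x = w"
proof -
  assume x: "x \<in> ball 0 r"
  have "pd A \<kappa> x (\<xi> (thM \<kappa> x w) x) = pd A \<kappa> x w"
    using thM_\<xi>[OF x, of "thM \<kappa> x w"] thM_eq_iff[OF plot_\<kappa> x plot_\<kappa> x refl] by blast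
  then have "pd A \<kappa> x (\<xi> (thM \<kappa> x w) x) (co b) = pd A \<kappa> x w (co b)" for b by simp
  moreover have "pd A \<kappa> x w (co b) = w \<bullet> b" for w b
  proof (rule pd_eqI[OF atlas smooth_co])
    have "((\<lambda>y. y \<bullet> b) has_derivative (\<lambda>w. w \<bullet> b)) (at x)" by (auto intro!: derivative_eq_intros)
    then show "((\<lambda>y. co b (\<kappa> y)) has_derivative (\<lambda>w. w \<bullet> b)) (at x)"
      by (rule has_derivative_transform_within_open[OF _ open_ball x]) (simp add: co_\<kappa>)
  qed
  ultimately show ?thesis using euclidean_eqI by metis
qed

lemma \<xi>_field: "smooth_fun A f ==> x \<in> ball 0 r ==> \<phi> X (f \<circ> mul (\<kappa> x)) = fderiv (\<lambda>y. f (\<kappa> y)) x (\<xi> X x)"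
proof -
  assume f: "smooth_fun A f" and x: "x \<in> ball 0 r"
  have "\<phi> X (f \<circ> mul (\<kappa> x)) = differential A (mul (\<kappa> x)) (\<phi> X) f" using f by (simp add: differential_def)
  also have "\<dots> = pd A \<kappa> x (\<xi> X x) f"
    by (simp add: \<phi>_eq_pd_\<kappa> differential_pd[OF atlas smooth_mul_left] pd_\<xi>[OF x])
  finally show ?thesis using f by (simp add: pd_def)
qed

text \<open>Testing on the functions \<open>co b\<close> turns the abstract bracket of derivations
  into the commutator of coordinate vector fields.\<close>

lemma \<xi>_br:
  assumes x: "x \<in> ball 0 r"
  shows "\<xi> (br X Y) x = fderiv (\<xi> Y) x (\<xi> X x) - fderiv (\<xi> X) x (\<xi> Y x)"
proof -
  have co: "\<phi> X (co b \<circ> mul (\<kappa> y)) = \<xi> X y \<bullet> b" if "y \<in> ball 0 r" for X b y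
  proof -
    have "((\<lambda>y. y \<bullet> b) has_derivative (\<lambda>w. w \<bullet> b)) (at y)" by (auto intro!: derivative_eq_intros)
    then have "((\<lambda>y. co b (\<kappa> y)) has_derivative (\<lambda>w. w \<bullet> b)) (at y)"
      by (rule has_derivative_transform_within_open[OF _ open_ball that]) (simp add: co_\<kappa>)
    from frechet_derivative_at[OF this, symmetric] \<xi>_field[OF smooth_co that, of X b] show ?thesis by simp
  qed
  have second: "\<phi> X ((\<lambda>a. \<phi> Y (co b \<circ> mul a)) \<circ> mul (\<kappa> x)) = fderiv (\<xi> Y) x (\<xi> X x) \<bullet> b" for X Y b
  proof -
    have "((\<lambda>y. \<xi> Y y \<bullet> b) has_derivative (\<lambda>w. fderiv (\<xi> Y) x w \<bullet> b)) (at x)"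
      by (rule has_derivative_inner_left[OF Cinf_on_has_derivative[OF \<xi>_smooth x]])
    then have "((\<lambda>y. \<phi> Y (co b \<circ> mul (\<kappa> y))) has_derivative (\<lambda>w. fderiv (\<xi> Y) x w \<bullet> b)) (at x)"
      by (rule has_derivative_transform_within_open[OF _ open_ball x]) (simp add: co)
    from frechet_derivative_at[OF this, symmetric] \<xi>_field[OF smooth_fun_left_field[OF smooth_co] x, of X Y b] show ?thesis by simp
  qed
  have "\<xi> (br X Y) x \<bullet> b = (fderiv (\<xi> Y) x (\<xi> X x) - fderiv (\<xi> X) x (\<xi> Y x)) \<bullet> b" for b
  proof -
    let ?f = "co b \<circ> mul (\<kappa> x)"
    have "smooth_fun A ?f"
      using smooth_map_compose[OF atlas charts charts_euclidean_atlas smooth_mul_left smooth_co] by (simp add: o_def)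
    then have "\<phi> (br X Y) ?f = \<phi> X (\<lambda>a. \<phi> Y (?f \<circ> mul a)) - \<phi> Y (\<lambda>a. \<phi> X (?f \<circ> mul a))"
      by (simp add: \<phi>_br left_invariant_bracket_def)
    moreover have "?f \<circ> mul a = co b \<circ> mul (mul (\<kappa> x) a)" for a by (auto simp: mul_assoc)
    ultimately show ?thesis using co[OF x, of "br X Y" b] second[of X Y b] second[of Y X b]
      by (simp add: o_def inner_diff_left)
  qed
  then show ?thesis by (metis euclidean_eqI)
qed

text \<open>Differentiating the duality \<open>thM \<kappa> y (\<xi> X y) = X\<close> carries the
  commutator formula over from the fields to the dual form.\<close>

lemma thM_structure:
  assumes x: "x \<in> ball 0 r"
  shows "fderiv (\<lambda>y. thM \<kappa> y w) x u - fderiv (\<lambda>y. thM \<kappa> y u) x w = - br (thM \<kappa> x u) (thM \<kappa> x w)"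
proof -
  define D where "D w u = fderiv (\<lambda>y. thM \<kappa> y w) x u" for w u
  have lin: "linear (thM \<kappa> x)" if "x \<in> ball 0 r" for x by (rule thM_linear[OF plot_\<kappa> that])
  have d: "((\<lambda>y. thM \<kappa> y w) has_derivative D w) (at x)" for w
    using Cinf_on_has_derivative[OF thM_\<kappa>_smooth x, of w] by (simp add: D_def[abs_def])
  have Dlin: "D w u = (\<Sum>b\<in>Basis. (w \<bullet> b) *\<^sub>R D b u)" for w u
  proof -
    have "((\<lambda>y. \<Sum>b\<in>Basis. (w \<bullet> b) *\<^sub>R thM \<kappa> y b) has_derivative (\<lambda>u. \<Sum>b\<in>Basis. (w \<bullet> b) *\<^sub>R D b u)) (at x)"
      by (intro has_derivative_sum has_derivative_scaleR_right d)
    then have "((\<lambda>y. thM \<kappa> y w) has_derivative (\<lambda>u. \<Sum>b\<in>Basis. (w \<bullet> b) *\<^sub>R D b u)) (at x)"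
      by (rule has_derivative_transform_within_open[OF _ open_ball x]) (metis linear_apply_basis[OF lin])
    from has_derivative_unique[OF d this] show ?thesis by metis
  qed
  have key: "D (\<xi> X x) u = - thM \<kappa> x (fderiv (\<xi> X) x u)" for X u
  proof -
    have d\<xi>: "((\<lambda>y. \<xi> X y \<bullet> b) has_derivative (\<lambda>u. fderiv (\<xi> X) x u \<bullet> b)) (at x)" for b
      by (rule has_derivative_inner_left[OF Cinf_on_has_derivative[OF \<xi>_smooth x]])
    have "((\<lambda>y. \<Sum>b\<in>Basis. (\<xi> X y \<bullet> b) *\<^sub>R thM \<kappa> y b) has_derivative
        (\<lambda>u. \<Sum>b\<in>Basis. (\<xi> X x \<bullet> b) *\<^sub>R D b u + (fderiv (\<xi> X) x u \<bullet> b) *\<^sub>R thM \<kappa> x b)) (at x)"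
      by (intro has_derivative_sum has_derivative_scaleR d\<xi> d)
    then have "((\<lambda>y. X) has_derivative (\<lambda>u. \<Sum>b\<in>Basis. (\<xi> X x \<bullet> b) *\<^sub>R D b u + (fderiv (\<xi> X) x u \<bullet> b) *\<^sub>R thM \<kappa> x b)) (at x)"
      by (rule has_derivative_transform_within_open[OF _ open_ball x]) (metis linear_apply_basis[OF lin] thM_\<xi>)
    from has_derivative_unique[OF this has_derivative_const]
    have "(\<Sum>b\<in>Basis. (\<xi> X x \<bullet> b) *\<^sub>R D b u + (fderiv (\<xi> X) x u \<bullet> b) *\<^sub>R thM \<kappa> x b) = 0" by metis
    then show ?thesis
      using linear_apply_basis[OF lin[OF x], of "fderiv (\<xi> X) x u"] Dlin[of "\<xi> X x" u]
      by (simp add: sum.distrib eq_neg_iff_add_eq_0)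
  qed
  let ?X = "thM \<kappa> x w" and ?Y = "thM \<kappa> x u"
  have "D w u - D u w = - (thM \<kappa> x (fderiv (\<xi> ?X) x u) - thM \<kappa> x (fderiv (\<xi> ?Y) x w))"
    using key[of ?X u] key[of ?Y w] by (simp add: \<xi>_thM[OF x])
  also have "\<dots> = - thM \<kappa> x (\<xi> (br ?Y ?X) x)"
    unfolding linear_diff[OF lin[OF x], symmetric] by (simp add: \<xi>_br[OF x] \<xi>_thM[OF x])
  finally show ?thesis by (simp add: D_def thM_\<xi>[OF x])
qed

lemma local_coordinates:
  obtains F where "F 0 = 0" "Cinf_on F (ball 0 r)"
    "\<And>x u. x \<in> ball 0 r ==> th (F x) (fderiv F x u) = thM \<kappa> x u"
  by (rule maurer_cartan_integral[OF thM_\<kappa>_smooth thM_linear[OF plot_\<kappa>] thM_structure]) (assumption | (rule that; assumption))+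

end

section \<open>The local isomorphism with the model group\<close>

context lie_chart
begin

lemma \<xi>_basis: "x \<in> ball 0 r ==> \<xi> X x = (\<Sum>b\<in>Basis. (X \<bullet> b) *\<^sub>R \<xi> b x)"
proof -
  assume x: "x \<in> ball 0 r"
  note l = thM_linear[OF plot_\<kappa> x]
  have "thM \<kappa> x (\<Sum>b\<in>Basis. (X \<bullet> b) *\<^sub>R \<xi> b x) = X"
    by (simp add: linear_sum[OF l] linear_cmul[OF l] thM_\<xi>[OF x] euclidean_representation)
  then show ?thesis using \<xi>_thM[OF x, of "\<Sum>b\<in>Basis. (X \<bullet> b) *\<^sub>R \<xi> b x"] by simp
qed

text \<open>\<open>F\<close> pulls the model form back to the group form and is invertible near 0;
  \<open>G0\<close> is its inverse followed by \<open>\<kappa>\<close>. Multiplicativity holds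
  because \<open>gm x y\<close> and the coordinates of \<open>mul (G0 x) (G0 y)\<close> agree at
  \<open>y = 0\<close> and have the same pulled-back coframe in \<open>y\<close>.\<close>

lemma local_group_iso:
  obtains \<epsilon> G0 H where "\<epsilon> > 0" "plot A (ball 0 \<epsilon>) G0" "G0 0 = e"
    "\<And>x u. x \<in> ball 0 \<epsilon> ==> thM G0 x u = th x u"
    "\<And>T. open T ==> T \<subseteq> ball 0 \<epsilon> ==> open (G0 ` T)" "\<And>x. x \<in> ball 0 \<epsilon> ==> H (G0 x) = x"
    "\<And>U \<psi>. (U, \<psi>) \<in> A ==> Cinf_on (\<lambda>x. H (inv_into U \<psi> x)) (\<psi> ` (U \<inter> G0 ` ball 0 \<epsilon>))"
    "continuous_on (G0 ` ball 0 \<epsilon>) H"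
    "\<And>x y. x \<in> ball 0 \<epsilon> ==> y \<in> ball 0 \<epsilon> ==> G0 (gm x y) = mul (G0 x) (G0 y)"
proof -
  obtain F where F: "F 0 = 0" "Cinf_on F (ball 0 r)"
    "\<And>x u. x \<in> ball 0 r ==> th (F x) (fderiv F x u) = thM \<kappa> x u"
    by (rule local_coordinates) blast
  define F' where "F' x = Blinfun (fderiv F x)" for x
  have dF: "(F has_derivative fderiv F x) (at x)" if "x \<in> ball 0 r" for x
    by (rule Cinf_on_has_derivative[OF F(2) that])
  have bl: "bounded_linear (fderiv F x)" if "x \<in> ball 0 r" for x
    using dF[OF that] by (rule has_derivative_bounded_linear)
  have F': "blinfun_apply (F' x) = fderiv F x" if "x \<in> ball 0 r" for x
    unfolding F'_def by (rule bounded_linear_Blinfun_apply[OF bl[OF that]])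
  have dF': "(F has_derivative blinfun_apply (F' x)) (at x)" if "x \<in> ball 0 r" for x
    using dF[OF that] F'[OF that] by simp
  have cF: "continuous_on (ball 0 r) F'"
  proof -
    have "continuous_on (ball 0 r) (\<lambda>x. blinfun_of_matrix (\<lambda>i j. fderiv F x j \<bullet> i))"
      by (intro continuous_on_blinfun_of_matrix continuous_intros Cinf_on_continuous[OF Cinf_on_frechet[OF F(2)]])
    then show ?thesis
      by (rule continuous_on_eq) (simp add: F'_def Blinfun_eq_matrix[OF bl])
  qed
  have th0: "th 0 u = u" for u by (rule decomp_eqI) simp_all
  have "fderiv F 0 u = u" for u
    using F(3)[OF r0, of u] by (simp add: F(1) th0 thM_\<kappa>_0)
  then have id: "id_blinfun o\<^sub>L F' 0 = id_blinfun" by (intro blinfun_eqI) (simp add: F'[OF r0])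
  obtain U' V g g' where g: "open U'" "U' \<subseteq> ball 0 r" "0 \<in> U'" "open V" "F 0 \<in> V" "homeomorphism U' V F g"
    "\<And>y. y \<in> V ==> (g has_derivative (g' y)) (at y)" "\<And>y. y \<in> V ==> g' y = inv (blinfun_apply (F' (g y)))"
    "\<And>y. y \<in> V ==> bij (blinfun_apply (F' (g y)))"
    by (rule inverse_function_theorem[OF open_ball dF' cF r0 id]) (assumption | (rule that; assumption))+
  have gU: "g y \<in> U'" "F (g y) = y" if "y \<in> V" for y using g(6) that by (auto simp: homeomorphism_def)
  then have gr: "g y \<in> ball 0 r" if "y \<in> V" for y using g(2) that by blast
  have gF: "g (F x) = x" "F x \<in> V" if "x \<in> U'" for x using g(6) that by (auto simp: homeomorphism_def)
  \<comment> \<open>The derivative of the inverse is a smooth expression in \<open>y\<close> and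
    \<open>g y\<close>, so the differentiability class of \<open>g\<close> can be raised step by
    step.\<close>
  have g'_eq: "g' y w = \<xi> (th y w) (g y)" if y: "y \<in> V" for y w
  proof -
    have "th y (fderiv F ((g y)) (\<xi> (th y w) (g y))) = th y w"
      using F(3)[OF gr[OF y]] thM_\<xi>[OF gr[OF y]] gU(2)[OF y] by simp
    then have "Xm y (th y (fderiv F ((g y)) (\<xi> (th y w) (g y)))) = Xm y (th y w)" by simp
    then have "fderiv F ((g y)) (\<xi> (th y w) (g y)) = w" by (simp only: Xm_th)
    then show ?thesis
      using inv_f_eq[OF bij_is_inj[OF g(9)[OF y]]] unfolding g(8)[OF y] F'[OF gr[OF y]] by metis
  qed
  have g_sum: "g' y w = (\<Sum>b\<in>Basis. (th y w \<bullet> b) *\<^sub>R \<xi> b (g y))" if "y \<in> V" for y w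
    unfolding g'_eq[OF that] by (rule \<xi>_basis[OF gr[OF that]])
  have "Ck_on k g V" for k
  proof (induction k)
    case 0
    have "continuous_on V g" using g(6) by (simp add: homeomorphism_def)
    then show ?case by simp
  next
    case (Suc k)
    have "Ck_on k (\<lambda>y. \<Sum>b\<in>Basis. (th y w \<bullet> b) *\<^sub>R \<xi> b (g y)) V" for w
    proof (rule Ck_on_sum[OF g(4)], rule Ck_on_bilinear[OF bounded_bilinear_scaleR g(4)])
      show "Ck_on k (\<lambda>y. th y w \<bullet> b) V" for b
        by (rule Cinf_onD[OF Cinf_on_inner[OF g(4) Cinf_on_th[OF g(4) Cinf_on_id[OF g(4)] Cinf_on_const[OF g(4)]] Cinf_on_const[OF g(4)]]])
      show "Ck_on k (\<lambda>y. \<xi> b (g y)) V" for b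
        by (rule Ck_on_compose[OF g(4) open_ball _ Cinf_onD[OF \<xi>_smooth] Suc]) (use gr in auto)
    qed
    then show ?case
      by (intro Ck_onI[OF g(4), of _ "\<lambda>y w. \<Sum>b\<in>Basis. (th y w \<bullet> b) *\<^sub>R \<xi> b (g y)"])
        (use g(7) g_sum in \<open>metis (no_types, lifting) ext has_derivative_eq_rhs\<close>)
  qed
  then have cg: "Cinf_on g V" by (simp add: Cinf_on_def)
  define G0 where "G0 y = \<kappa> (g y)" for y
  define H where "H q = F (\<nu> q)" for q
  have G0: "plot A V G0" unfolding G0_def
    by (rule plot_compose[OF plot_\<kappa> g(4) cg _ charts]) (use gr in auto)
  have HG: "H (G0 y) = y" if "y \<in> V" for y using gr[OF that] gU[OF that] by (simp add: H_def G0_def \<nu>_\<kappa>)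
  have G0_0: "G0 0 = e" using gF[OF g(3)] by (simp add: G0_def F(1) \<kappa>_0)
  have V0: "0 \<in> V" using g(5) F(1) by simp
  have thG: "thM G0 y w = th y w" if "y \<in> V" for y w
    unfolding G0_def using thM_compose[OF plot_\<kappa> gr[OF that] g(7)[OF that], of w] g'_eq[OF that, of w] thM_\<xi>[OF gr[OF that]] by simp
  have G0_open: "open (G0 ` T)" if "open T" "T \<subseteq> V" for T
  proof -
    have "continuous_on U' F" using g(6) by (simp add: homeomorphism_def)
    moreover have "g ` T = U' \<inter> F -` T"
    proof
      show "g ` T \<subseteq> U' \<inter> F -` T" using gU that(2) by auto
      show "U' \<inter> F -` T \<subseteq> g ` T" using gF(1) by (metis IntE image_eqI subsetI vimageE)
    qed
    ultimately have "open (g ` T)" using open_preimage_Int[OF g(1) _ that(1)] by simp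
    moreover have "g ` T \<subseteq> ball 0 r" using gr that(2) by auto
    ultimately have "open (\<kappa> ` (g ` T))" by (rule open_\<kappa>)
    then show ?thesis by (simp add: G0_def image_image)
  qed
  have G0W: "G0 ` T \<subseteq> \<kappa> ` ball 0 r" if "T \<subseteq> V" for T using gr that by (auto simp: G0_def)
  have cH: "continuous_on (\<kappa> ` ball 0 r) H" unfolding H_def
    by (rule continuous_on_compose2[OF Cinf_on_continuous[OF F(2)] cont_\<nu>]) (use \<nu>_\<kappa> in auto)
  have sH: "Cinf_on (\<lambda>x. H (inv_into U \<psi> x)) (\<psi> ` (U \<inter> \<kappa> ` ball 0 r))" if "(U, \<psi>) \<in> A" for U \<psi>
    unfolding H_def
    by (rule Cinf_on_compose[OF open_chart_image[OF charts that open_W] open_ball _ F(2) smooth_\<nu>[OF that]])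
      (use chartsD(6)[OF charts that] \<nu>_\<kappa> in auto)
  obtain \<delta> where \<delta>: "\<delta> > 0" "ball 0 \<delta> \<subseteq> V" using g(4) V0 openE by blast
  \<comment> \<open>The pairs whose product lies in the image of a small ball;
    \<open>\<epsilon>\<close> is chosen so that \<open>H\<close> is defined on all products
    below.\<close>
  define O1 where "O1 = (V \<times> V) \<inter> (\<lambda>p. mul (G0 (fst p)) (G0 (snd p))) -` (G0 ` ball 0 \<delta>)"
  have cG: "continuous_on (V \<times> V) (\<lambda>p. mul (G0 (fst p)) (G0 (snd p)))"
    by (intro continuous_mul continuous_on_compose2[OF plot_continuous[OF G0]] continuous_intros) auto
  have o1: "open O1" unfolding O1_def
    by (rule open_preimage_Int[OF open_Times[OF g(4) g(4)] cG G0_open[OF open_ball \<delta>(2)]])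
  have "(0, 0) \<in> O1" using V0 G0_0 \<delta>(1) by (auto simp: O1_def intro!: image_eqI[of _ _ 0])
  then obtain S1 S2 where S12: "open S1" "open S2" "0 \<in> S1" "0 \<in> S2" "S1 \<times> S2 \<subseteq> O1"
    using o1 by (auto elim!: open_prod_elim)
  obtain \<epsilon> where \<epsilon>: "\<epsilon> > 0" "ball 0 \<epsilon> \<subseteq> S1 \<inter> S2 \<inter> ball 0 \<delta>"
    using S12(1-4) \<delta>(1) openE[of "S1 \<inter> S2 \<inter> ball 0 \<delta>" 0] by auto
  have \<epsilon>V: "ball 0 \<epsilon> \<subseteq> V" using \<epsilon>(2) \<delta>(2) by blast
  have hom: "G0 (gm x y) = mul (G0 x) (G0 y)" if x: "x \<in> ball 0 \<epsilon>" and y: "y \<in> ball 0 \<epsilon>" for x y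
  proof -
    let ?c = "\<lambda>y. mul (G0 x) (G0 y)"
    have c: "plot A (ball 0 \<epsilon>) ?c"
      by (intro plot_mul plot_const open_ball plot_subset[OF G0 charts open_ball \<epsilon>V])
    have in_im: "?c y \<in> G0 ` ball 0 \<delta>" if "y \<in> ball 0 \<epsilon>" for y
    proof -
      have "(x, y) \<in> O1" using x that \<epsilon>(2) S12(5) by blast
      then show ?thesis by (simp add: O1_def)
    qed
    let ?F = "\<lambda>y. H (?c y)"
    have F2: "G0 (?F y) = ?c y" "?F y \<in> V" if y: "y \<in> ball 0 \<epsilon>" for y
    proof -
      obtain z where z: "z \<in> ball 0 \<delta>" "?c y = G0 z" using in_im[OF y] by blast
      then have "z \<in> V" using \<delta>(2) by blast
      with z show "G0 (?F y) = ?c y" "?F y \<in> V" using HG by auto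
    qed
    have "?c ` ball 0 \<epsilon> \<subseteq> \<kappa> ` ball 0 r" using in_im G0W[OF \<delta>(2)] by blast
    from plot_local_inverse[OF charts open_W sH c this] have F2s: "Cinf_on ?F (ball 0 \<epsilon>)" .
    have "gm x y = ?F y"
    proof (rule th_unique[OF open_ball _ _ _ gm_has_derivative Cinf_on_has_derivative[OF F2s]])
      show "connected (ball (0::'n) \<epsilon>)" by simp
      show "0 \<in> ball (0::'n) \<epsilon>" using \<epsilon>(1) by simp
      show "gm x 0 = ?F 0" using HG[of x] x \<epsilon>V by (auto simp: G0_0)
      show "th (gm x y) (Xm x u) = th (?F y) (fderiv ?F y u)" if y: "y \<in> ball 0 \<epsilon>" for y u
      proof -
        have "th (?F y) (fderiv ?F y u) = thM G0 (?F y) (fderiv ?F y u)"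
          using thG[OF F2(2)[OF y]] by simp
        also have "\<dots> = thM (\<lambda>y. G0 (?F y)) y u"
          by (rule thM_compose[OF G0 F2(2)[OF y] Cinf_on_has_derivative[OF F2s y], symmetric])
        also have "\<dots> = thM ?c y u"
          by (rule thM_cong[OF open_ball y _ c y, symmetric]) (simp add: F2(1))
        also have "\<dots> = th y u" using thG y \<epsilon>V by auto
        finally show ?thesis by (simp add: th_left_invariant)
      qed
    qed (use y in auto)
    then show ?thesis using F2(1)[OF y] by simp
  qed
  show ?thesis
  proof (rule that[OF \<epsilon>(1) plot_subset[OF G0 charts open_ball \<epsilon>V] G0_0])
    show "Cinf_on (\<lambda>x. H (inv_into U \<psi> x)) (\<psi> ` (U \<inter> G0 ` ball 0 \<epsilon>))" if "(U, \<psi>) \<in> A" for U \<psi>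
      by (rule Cinf_on_subset[OF sH[OF that]]) (use G0W[OF \<epsilon>V] in blast)
    show "continuous_on (G0 ` ball 0 \<epsilon>) H" by (rule continuous_on_subset[OF cH G0W[OF \<epsilon>V]])
  qed (use thG HG G0_open hom \<epsilon>V in auto)
qed

end

section \<open>Global coordinates of the group\<close>

lemma plot_open_cover:
  assumes A: "charts A" and S: "open S" and T: "\<And>x. x \<in> S ==> \<exists>T. open T \<and> x \<in> T \<and> plot A T c"
  shows "plot A S c"
proof -
  have "\<exists>T. open T \<and> x \<in> T \<and> Cinf_on (\<lambda>x. \<phi> (c x)) T" if U: "(U, \<phi>) \<in> A" and x: "x \<in> S \<inter> c -` U" for U \<phi> x
  proof -
    obtain T where T: "open T" "x \<in> T" "plot A T c" using T x by blast
    have "open (T \<inter> c -` U)"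
      by (rule open_preimage_Int[OF T(1) plot_continuous[OF T(3)] chartsD(1)[OF A U]])
    moreover have "Cinf_on (\<lambda>x. \<phi> (c x)) (T \<inter> c -` U)" by (rule plot_Cinf_on[OF T(3) U]) auto
    ultimately show ?thesis using T(2) x by blast
  qed
  then have "Cinf_on (\<lambda>x. \<phi> (c x)) (S \<inter> c -` U)" if "(U, \<phi>) \<in> A" for U \<phi>
    using that by (intro Cinf_on_open_cover) simp
  moreover have "isCont c x" if "x \<in> S" for x
    using T[OF that] plot_continuous continuous_on_eq_continuous_at by blast
  then have "continuous_on S c" by (simp add: continuous_at_imp_continuous_on)
  ultimately show ?thesis using S by (auto simp: plot_def)
qed

lemma plot_cong:
  assumes c: "plot A T c" and A: "charts A" and eq: "\<And>y. y \<in> T ==> c y = d y"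
  shows "plot A T d"
proof -
  have "continuous_on T d" using plot_continuous[OF c] eq by (rule continuous_on_eq)
  moreover have "Cinf_on (\<lambda>x. \<phi> (d x)) (T \<inter> d -` U)" if "(U, \<phi>) \<in> A" for U \<phi>
  proof -
    have o: "open (T \<inter> d -` U)"
      by (rule open_preimage_Int[OF plot_open[OF c] \<open>continuous_on T d\<close> chartsD(1)[OF A that]])
    have "Cinf_on (\<lambda>x. \<phi> (c x)) (T \<inter> d -` U)" by (rule plot_Cinf_on[OF c that]) (auto simp: eq)
    then show ?thesis by (rule Cinf_on_cong[OF o, rotated]) (simp add: eq)
  qed
  ultimately show ?thesis using plot_open[OF c] by (auto simp: plot_def)
qed

locale lie_local = lie_model B pv pz N A mul e iv \<phi>
  for B :: "'n::euclidean_space" and pv pz N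
    and A :: "('m::{t2_space,second_countable_topology}, 'e::euclidean_space) chart set"
    and mul e iv \<phi> +
  fixes \<epsilon> :: real and G0 :: "'n => 'm" and H :: "'m => 'n"
  assumes \<epsilon>: "\<epsilon> > 0" and plot_G0: "plot A (ball 0 \<epsilon>) G0" and G0_0 [simp]: "G0 0 = e"
    and thM_G0: "x \<in> ball 0 \<epsilon> ==> thM G0 x u = th x u"
    and G0_open: "open T ==> T \<subseteq> ball 0 \<epsilon> ==> open (G0 ` T)" and H_G0: "x \<in> ball 0 \<epsilon> ==> H (G0 x) = x"
    and smooth_H: "(U, \<psi>) \<in> A ==> Cinf_on (\<lambda>x. H (inv_into U \<psi> x)) (\<psi> ` (U \<inter> G0 ` ball 0 \<epsilon>))"
    and cont_H: "continuous_on (G0 ` ball 0 \<epsilon>) H"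
    and G0_hom: "x \<in> ball 0 \<epsilon> ==> y \<in> ball 0 \<epsilon> ==> G0 (gm x y) = mul (G0 x) (G0 y)"

lemma (in lie_model) lie_local_exists: "\<exists>\<epsilon> G0 H. lie_local B pv pz N A mul e iv \<phi> \<epsilon> G0 H"
proof -
  obtain \<kappa> \<nu> r co where c: "lie_chart B pv pz N A mul e iv \<phi> \<kappa> \<nu> r co"
    using lie_chart_exists by blast
  interpret lie_chart B pv pz N A mul e iv \<phi> \<kappa> \<nu> r co by (rule c)
  obtain \<epsilon> G0 H where h: "\<epsilon> > 0" "plot A (ball 0 \<epsilon>) G0" "G0 0 = e"
    "\<And>x u. x \<in> ball 0 \<epsilon> ==> thM G0 x u = th x u"
    "\<And>T. open T ==> T \<subseteq> ball 0 \<epsilon> ==> open (G0 ` T)" "\<And>x. x \<in> ball 0 \<epsilon> ==> H (G0 x) = x"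
    "\<And>U \<psi>. (U, \<psi>) \<in> A ==> Cinf_on (\<lambda>x. H (inv_into U \<psi> x)) (\<psi> ` (U \<inter> G0 ` ball 0 \<epsilon>))"
    "continuous_on (G0 ` ball 0 \<epsilon>) H"
    "\<And>x y. x \<in> ball 0 \<epsilon> ==> y \<in> ball 0 \<epsilon> ==> G0 (gm x y) = mul (G0 x) (G0 y)"
    by (rule local_group_iso) (rule that; assumption)
  have "lie_local B pv pz N A mul e iv \<phi> \<epsilon> G0 H"
    by unfold_locales (rule h; assumption?)+
  then show ?thesis by blast
qed

context lie_local
begin

text \<open>The condition on a continuation of \<open>G0\<close>: values at nearby points differ by
  the image of the quotient of these points in the model group. The radius may depend on the
  point.\<close>

definition rel :: "('n => 'm) => 'n set => bool" where
  "rel f S \<longleftrightarrow> (\<forall>x\<in>S. \<exists>\<delta>>0. \<forall>y\<in>S. dist x y < \<delta> \<longrightarrow> f y = mul (f x) (G0 (gm (gi x) y)))"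

lemma mul_right_cancel: "mul b a = mul c a \<longleftrightarrow> b = c"
  by (metis mul_assoc mul_iv(2) mul_e(2))

text \<open>Since the common right factor can be cancelled, both agreement and disagreement at a
  point spread to a neighbourhood.\<close>

lemma rel_unique:
  assumes S: "connected S" "x0 \<in> S" "x \<in> S" and f: "rel f S" and g: "rel g S" and eq: "f x0 = g x0"
  shows "f x = g x"
proof -
  have "\<forall>\<^sub>F y in at x within S. (f x = g x) = (f y = g y)" if x: "x \<in> S" for x
  proof -
    obtain d1 where "d1 > 0" "\<And>y. y \<in> S ==> dist x y < d1 ==> f y = mul (f x) (G0 (gm (gi x) y))"
      using f x unfolding rel_def by blast
    moreover obtain d2 where "d2 > 0" "\<And>y. y \<in> S ==> dist x y < d2 ==> g y = mul (g x) (G0 (gm (gi x) y))"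
      using g x unfolding rel_def by blast
    ultimately show ?thesis unfolding eventually_at
      by (intro exI[of _ "min d1 d2"]) (auto simp: mul_right_cancel dist_commute)
  qed
  then have "(f x0 = g x0) = (f x = g x)"
    by (intro connected_local_const[OF S, of "\<lambda>x. f x = g x"]) blast
  then show ?thesis using eq by simp
qed

lemma relD: "rel f S ==> x \<in> S ==> \<exists>\<delta>>0. \<forall>y\<in>S. dist x y < \<delta> \<longrightarrow> f y = mul (f x) (G0 (gm (gi x) y))"
  by (simp add: rel_def)

lemma rel_subset:
  assumes f: "rel f S" and "T \<subseteq> S"
  shows "rel f T"
  unfolding rel_def
proof
  fix x assume "x \<in> T"
  then obtain \<delta> where "\<delta> > 0" "\<forall>y\<in>S. dist x y < \<delta> \<longrightarrow> f y = mul (f x) (G0 (gm (gi x) y))"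
    using f assms(2) unfolding rel_def by blast
  then show "\<exists>\<delta>>0. \<forall>y\<in>T. dist x y < \<delta> \<longrightarrow> f y = mul (f x) (G0 (gm (gi x) y))"
    using assms(2) by (intro exI[of _ \<delta>]) auto
qed

primrec pprod :: "(nat => 'n) => nat => 'm" where
  "pprod a 0 = e"
| "pprod a (Suc i) = mul (pprod a i) (G0 (gm (gi (a i)) (a (Suc i))))"

lemma gm_gi_gm: "gm (gm (gi x) y) (gm (gi y) w) = gm (gi x) w"
  by (metis gm_assoc gm_cancel(2))

text \<open>A ladder argument: each small square between the chains \<open>a\<close> and
  \<open>b\<close> commutes because \<open>G0\<close> is multiplicative on the ball, so the two
  products differ only by the last rung.\<close>

lemma pprod_shift:
  assumes "a 0 = b 0" and ab: "\<And>i. i \<le> n ==> gm (gi (a i)) (b i) \<in> ball 0 \<epsilon>"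
    and aa: "\<And>i. i < n ==> gm (gi (a i)) (a (Suc i)) \<in> ball 0 \<epsilon>" and bb: "\<And>i. i < n ==> gm (gi (b i)) (b (Suc i)) \<in> ball 0 \<epsilon>"
  shows "i \<le> n ==> pprod b i = mul (pprod a i) (G0 (gm (gi (a i)) (b i)))"
proof (induction i)
  case 0 then show ?case using assms(1) by simp
next
  case (Suc i)
  have "mul (G0 (gm (gi (a i)) (b i))) (G0 (gm (gi (b i)) (b (Suc i)))) = G0 (gm (gi (a i)) (b (Suc i)))"
    using G0_hom[OF ab[of i] bb[of i]] Suc.prems by (simp add: gm_gi_gm)
  also have "\<dots> = mul (G0 (gm (gi (a i)) (a (Suc i)))) (G0 (gm (gi (a (Suc i))) (b (Suc i))))"
    using G0_hom[OF aa[of i] ab[of "Suc i"]] Suc.prems by (simp add: gm_gi_gm)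
  finally show ?case using Suc by (simp add: mul_assoc)
qed

text \<open>The value at \<open>x\<close> is the product along the ray from 0, cut into
  \<open>Suc n\<close> equal pieces. Uniform continuity on the compact ball makes the quotients
  along each ray and between neighbouring rays small, as the ladder requires.\<close>

lemma rel_exists_ball: "\<exists>f. rel f (ball 0 R) \<and> f 0 = e"
proof -
  let ?K = "cball (0 :: 'n) R"
  let ?P = "\<lambda>p :: 'n \<times> real \<times> real. gm (gi (fst (snd p) *\<^sub>R fst p)) (snd (snd p) *\<^sub>R fst p)"
  have "uniformly_continuous_on (?K \<times> {0..1} \<times> {0..1}) ?P"
    by (intro compact_uniformly_continuous compact_Times continuous_on_gm continuous_on_gi continuous_intros) auto
  then obtain d1 where d1: "d1 > 0" "\<And>p q. p \<in> ?K \<times> {0..1} \<times> {0..1} ==> q \<in> ?K \<times> {0..1} \<times> {0..1} ==> dist q p < d1 ==> dist (?P q) (?P p) < \<epsilon>"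
    using \<epsilon> unfolding uniformly_continuous_on_def by meson
  let ?Q = "\<lambda>p :: 'n \<times> 'n \<times> real. gm (gi (snd (snd p) *\<^sub>R fst p)) (snd (snd p) *\<^sub>R fst (snd p))"
  have "uniformly_continuous_on (?K \<times> ?K \<times> {0..1}) ?Q"
    by (intro compact_uniformly_continuous compact_Times continuous_on_gm continuous_on_gi continuous_intros) auto
  then obtain d2 where d2: "d2 > 0" "\<And>p q. p \<in> ?K \<times> ?K \<times> {0..1} ==> q \<in> ?K \<times> ?K \<times> {0..1} ==> dist q p < d2 ==> dist (?Q q) (?Q p) < \<epsilon>"
    using \<epsilon> unfolding uniformly_continuous_on_def by meson
  have near: "gm (gi (t *\<^sub>R x)) (t *\<^sub>R y) \<in> ball 0 \<epsilon>" if "x \<in> ?K" "y \<in> ?K" "dist x y < d2" "t \<in> {0..1}" for x y t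
    using d2(2)[of "(x, x, t)" "(x, y, t)"] that by (auto simp: dist_Pair_Pair dist_commute)
  obtain n where n: "inverse (real (Suc n)) < d1" using reals_Archimedean[OF d1(1)] by blast
  define a where "a x i = (real i / real (Suc n)) *\<^sub>R x" for x :: 'n and i
  have step: "gm (gi (a x i)) (a x (Suc i)) \<in> ball 0 \<epsilon>" if "x \<in> ?K" "i < Suc n" for x i
  proof -
    have "real i / real (Suc n) \<in> {0..1}" "real (Suc i) / real (Suc n) \<in> {0..1}"
      "\<bar>real (Suc i) / real (Suc n) - real i / real (Suc n)\<bar> < d1"
      using that n by (auto simp: field_simps simp flip: diff_divide_distrib)
    then show ?thesis
      using d1(2)[of "(x, real i / real (Suc n), real i / real (Suc n))" "(x, real i / real (Suc n), real (Suc i) / real (Suc n))"] that(1)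
      by (auto simp: dist_Pair_Pair dist_real_def a_def)
  qed
  define f where "f x = pprod (a x) (Suc n)" for x
  have "f y = mul (f x) (G0 (gm (gi x) y))" if xy: "x \<in> ball 0 R" "y \<in> ball 0 R" "dist x y < d2" for x y
  proof -
    have "gm (gi (a x i)) (a y i) \<in> ball 0 \<epsilon>" if "i \<le> Suc n" for i
      unfolding a_def using xy that by (intro near) auto
    from pprod_shift[of "a x" "a y" "Suc n", OF _ this, of "Suc n"] step[of x] step[of y] xy
    show ?thesis by (simp add: f_def a_def del: pprod.simps)
  qed
  then have "rel f (ball 0 R)" using d2(1) unfolding rel_def by blast
  moreover have "pprod (a 0) i = e" for i by (induction i) (auto simp: a_def)
  then have "f 0 = e" by (simp add: f_def del: pprod.simps)
  ultimately show ?thesis by blast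
qed

lemma rel_exists: "\<exists>G. rel G UNIV \<and> G 0 = e"
proof -
  obtain f where f: "\<And>R. rel (f R) (ball 0 R)" "\<And>R. f R 0 = e" using rel_exists_ball by metis
  have agree: "f R x = f R' x" if "norm x < R" "R \<le> R'" for R R' x
  proof (rule rel_unique[of "ball 0 R" 0])
    show "rel (f R') (ball 0 R)" by (rule rel_subset[OF f(1)[of R']]) (use that(2) in auto)
    show "0 \<in> ball 0 R" using that(1) by (simp add: le_less_trans[OF norm_ge_zero])
  qed (use that f in auto)
  define G where "G x = f (norm x + 1) x" for x
  have "\<exists>\<delta>>0. \<forall>y\<in>UNIV. dist x y < \<delta> \<longrightarrow> G y = mul (G x) (G0 (gm (gi x) y))" for x
  proof -
    let ?R = "norm x + 2"
    have "x \<in> ball 0 ?R" by simp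
    from relD[OF f(1) this] obtain d where d: "d > 0" "\<And>y. y \<in> ball 0 ?R ==> dist x y < d ==> f ?R y = mul (f ?R x) (G0 (gm (gi x) y))"
      by blast
    have st: "G y = mul (G x) (G0 (gm (gi x) y))" if "dist x y < min d 1" for y
    proof -
      have "norm y < norm x + 1" using that norm_triangle_ineq2[of y x] by (simp add: dist_norm norm_minus_commute)
      then show ?thesis using d(2)[of y] that agree[of y "norm y + 1" ?R] agree[of x "norm x + 1" ?R] by (simp add: G_def)
    qed
    show ?thesis
    proof (intro exI[of _ "min d 1"] conjI ballI impI)
      show "0 < min d 1" using d(1) by simp
    qed (rule st)
  qed
  moreover have "G 0 = e" by (simp add: G_def f)
  ultimately show ?thesis unfolding rel_def by blast
qed

definition G :: "'n => 'm" where "G = (SOME G. rel G UNIV \<and> G 0 = e)"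

lemma G_rel: "rel G UNIV" and G_0 [simp]: "G 0 = e"
  using someI_ex[OF rel_exists] unfolding G_def by auto

lemma G_near: "\<exists>\<delta>>0. \<forall>y. dist x y < \<delta> \<longrightarrow> G y = mul (G x) (G0 (gm (gi x) y))"
  using relD[OF G_rel, of x] by simp

lemma plot_G: "plot A UNIV G" and thM_G: "thM G x u = th x u"
proof -
  have loc: "\<exists>T. open T \<and> x \<in> T \<and> plot A T G \<and> thM G x u = th x u" for x u
  proof -
    obtain \<delta> where \<delta>: "\<delta> > 0" "\<And>y. dist x y < \<delta> ==> G y = mul (G x) (G0 (gm (gi x) y))" using G_near[of x] by blast
    let ?h = "\<lambda>y. gm (gi x) y"
    define T where "T = ball x \<delta> \<inter> ?h -` ball 0 \<epsilon>"
    have ch: "continuous_on UNIV ?h" by (intro continuous_on_gm continuous_intros)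
    have T: "open T" "x \<in> T" unfolding T_def
      using \<delta>(1) \<epsilon> by (auto intro!: open_Int open_vimage ch)
    have ph: "plot A T (\<lambda>y. G0 (?h y))"
      by (rule plot_compose[OF plot_G0 T(1) Cinf_on_gm[OF T(1) Cinf_on_const[OF T(1)] Cinf_on_id[OF T(1)]] _ charts])
        (auto simp: T_def)
    then have p: "plot A T (\<lambda>y. mul (G x) (G0 (?h y)))" by (intro plot_mul plot_const T)
    have eq: "mul (G x) (G0 (?h y)) = G y" if "y \<in> T" for y using \<delta>(2)[of y] that by (simp add: T_def)
    have "plot A T G" by (rule plot_cong[OF p charts]) (rule eq)
    moreover have "thM G x u = th x u"
    proof -
      have "thM G x u = thM (\<lambda>y. mul (G x) (G0 (?h y))) x u"
        by (rule thM_cong[OF T eq p T(2), symmetric])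
      also have "\<dots> = thM G0 (?h x) (Xm (gi x) u)"
        using thM_compose[OF plot_G0 _ gm_has_derivative, of "gi x" x u] \<epsilon> by simp
      also have "\<dots> = th (gm (gi x) x) (Xm (gi x) u)" using \<epsilon> by (simp add: thM_G0)
      finally show ?thesis by (simp only: th_left_invariant)
    qed
    ultimately show ?thesis using T by blast
  qed
  show "plot A UNIV G" by (rule plot_open_cover[OF charts open_UNIV]) (use loc in blast)
  show "thM G x u = th x u" using loc by blast
qed

lemma G_continuous: "continuous_on S G"
  by (rule continuous_on_subset[OF plot_continuous[OF plot_G]]) simp

text \<open>Both \<open>G\<close> and \<open>y \<mapsto> mul (iv (G x)) (G (gm x y))\<close>
  continue \<open>G0\<close> and take the value \<open>e\<close> at 0, so uniqueness
  applies.\<close>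

lemma G_hom: "G (gm x y) = mul (G x) (G y)"
proof -
  define f where "f y = mul (iv (G x)) (G (gm x y))" for y
  have "rel f UNIV" unfolding rel_def
  proof
    fix y
    obtain \<delta> where \<delta>: "\<delta> > 0" "\<And>w. dist (gm x y) w < \<delta> ==> G w = mul (G (gm x y)) (G0 (gm (gi (gm x y)) w))"
      using G_near[of "gm x y"] by blast
    have "continuous_on UNIV (gm x)" using continuous_on_gm[OF continuous_on_const continuous_on_id] by simp
    then have "isCont (gm x) y" by (simp add: continuous_on_eq_continuous_at)
    then obtain d where d: "d > 0" "\<And>w. dist w y < d ==> dist (gm x w) (gm x y) < \<delta>"
      using \<delta>(1) unfolding continuous_at_eps_delta by blast
    have "f w = mul (f y) (G0 (gm (gi y) w))" if "dist y w < d" for w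
    proof -
      have "gm (gi (gm x y)) (gm x w) = gm (gi y) w" by (simp add: gi_gm gm_assoc gm_cancel)
      then show ?thesis using \<delta>(2)[of "gm x w"] d(2)[of w] that by (simp add: f_def dist_commute mul_assoc)
    qed
    then show "\<exists>\<delta>>0. \<forall>w\<in>UNIV. dist y w < \<delta> \<longrightarrow> f w = mul (f y) (G0 (gm (gi y) w))" using d(1) by blast
  qed
  from rel_unique[OF connected_UNIV UNIV_I UNIV_I this G_rel, of 0 y]
  have "f y = G y" by (simp add: f_def)
  then show ?thesis by (metis f_def mul_cancel(2))
qed

lemma G_gi: "G (gi x) = iv (G x)"
  by (metis G_0 G_hom gm_gi(1) iv_unique)

lemma G_eq_G0: obtains \<delta> where "0 < \<delta>" "\<delta> \<le> \<epsilon>" "\<And>y. y \<in> ball 0 \<delta> ==> G y = G0 y"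
proof -
  obtain \<delta> where "\<delta> > 0" "\<And>y. dist 0 y < \<delta> ==> G y = mul (G 0) (G0 (gm (gi 0) y))" using G_near[of 0] by blast
  then show ?thesis using that[of "min \<delta> \<epsilon>"] \<epsilon> by simp
qed

lemma open_mul_left: "open T ==> open (mul a ` T)"
proof -
  assume T: "open T"
  have "mul a ` T = mul (iv a) -` T"
    by (auto simp: image_iff) (metis mul_cancel(2))
  moreover have "continuous_on UNIV (mul (iv a))" using smooth_mul_left by (simp add: smooth_map_def)
  ultimately show ?thesis using open_vimage[OF T] by simp
qed

text \<open>The image is a subgroup containing a neighbourhood of \<open>e\<close>; translating that
  neighbourhood shows that the image and its complement are open.\<close>

lemma G_surj:
  assumes "connected (UNIV :: 'm set)"
  shows "\<exists>x. G x = q"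
proof -
  obtain \<delta> where \<delta>: "0 < \<delta>" "\<delta> \<le> \<epsilon>" "\<And>y. y \<in> ball 0 \<delta> ==> G y = G0 y" by (rule G_eq_G0) blast
  define W where "W = G0 ` ball 0 \<delta>"
  have W: "open W" unfolding W_def using \<delta> by (intro G0_open) auto
  have We: "e \<in> W" using \<delta>(1) by (auto simp: W_def intro!: image_eqI[of _ _ 0])
  have WG: "W \<subseteq> range G" using \<delta>(3) by (auto simp: W_def image_iff) metis
  have sub: "a \<in> range G ==> b \<in> range G ==> mul a b \<in> range G" "a \<in> range G ==> iv a \<in> range G" for a b
    by (auto simp: G_hom[symmetric] G_gi[symmetric])
  have "open (range G)"
  proof (subst open_subopen, intro ballI)
    fix a assume "a \<in> range G"
    then have "mul a ` W \<subseteq> range G" using sub(1) WG by blast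
    then show "\<exists>T. open T \<and> a \<in> T \<and> T \<subseteq> range G"
      using open_mul_left[OF W, of a] We by (intro exI[of _ "mul a ` W"]) (auto simp: image_iff intro!: bexI[of _ e])
  qed
  moreover have "open (- range G)"
  proof (subst open_subopen, intro ballI)
    fix a assume a: "a \<in> - range G"
    have "mul a w \<in> - range G" if "w \<in> W" for w
      using a sub(1)[of "mul a w" "iv w"] sub(2)[of w] WG that by (auto simp: mul_assoc)
    then have "mul a ` W \<subseteq> - range G" by (rule image_subsetI)
    then show "\<exists>T. open T \<and> a \<in> T \<and> T \<subseteq> - range G"
      using open_mul_left[OF W, of a] We by (intro exI[of _ "mul a ` W"]) (auto simp: image_iff intro!: bexI[of _ e])
  qed
  ultimately have "closed (range G)" "open (range G)" by (simp_all add: closed_def)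
  then have "range G = UNIV"
    using assms[unfolded connected_clopen, rule_format, of "range G"] by auto
  then show ?thesis by (metis surjD)
qed

end

section \<open>Injectivity from simple connectedness\<close>

context lie_local
begin

text \<open>Near 0 the map \<open>G\<close> equals the injective \<open>G0\<close>, so its kernel is
  discrete and a continuous curve in it cannot move.\<close>

lemma G_fibre_locally_const:
  assumes S: "connected S" "a \<in> S" "b \<in> S" and c: "continuous_on S c" "\<And>s. s \<in> S ==> G (c s) = e"
  shows "c a = c b"
proof (rule connected_local_const[OF S], intro ballI)
  fix s assume s: "s \<in> S"
  obtain \<delta> where \<delta>: "0 < \<delta>" "\<delta> \<le> \<epsilon>" "\<And>y. y \<in> ball 0 \<delta> ==> G y = G0 y" by (rule G_eq_G0) blast
  have ker: "y = 0" if "y \<in> ball 0 \<delta>" "G y = e" for y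
    using H_G0[of y] H_G0[of 0] \<delta> \<epsilon> that by simp
  have "continuous_on S (\<lambda>t. gm (gi (c s)) (c t))" by (intro continuous_on_gm continuous_on_const c)
  from bspec[OF this[unfolded continuous_on_def] s]
  have "((\<lambda>t. gm (gi (c s)) (c t)) \<longlongrightarrow> 0) (at s within S)" by simp
  then have "\<forall>\<^sub>F t in at s within S. gm (gi (c s)) (c t) \<in> ball 0 \<delta>"
    using \<delta>(1) by (intro topological_tendstoD) auto
  moreover have "\<forall>\<^sub>F t in at s within S. t \<in> S" by (simp add: eventually_at_filter)
  ultimately show "\<forall>\<^sub>F t in at s within S. c s = c t"
  proof eventually_elim
    case (elim t)
    then have "gm (gi (c s)) (c t) = 0" by (intro ker) (simp_all add: G_hom G_gi c(2) s)
    then show ?case by (metis gm_0(2) gm_cancel(2))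
  qed
qed

primrec qprod :: "(nat => 'm) => nat => 'n" where
  "qprod a 0 = 0"
| "qprod a (Suc i) = gm (qprod a i) (H (mul (iv (a i)) (a (Suc i))))"

text \<open>A square in the group whose vertical lines start at the identity is lifted by multiplying the local lifts
  of its increments.\<close>

lemma lift_square:
  fixes k :: "real \<times> real => 'm"
  assumes k: "continuous_on ({0..1} \<times> {0..1}) k" and k0: "\<And>s. s \<in> {0..1} ==> k (s, 0) = e"
  obtains L where "continuous_on ({0..1} \<times> {0..1}) L" "\<And>p. p \<in> {0..1} \<times> {0..1} ==> G (L p) = k p"
    "\<And>s. s \<in> {0..1} ==> L (s, 0) = 0"
proof -
  obtain \<delta> where \<delta>: "0 < \<delta>" "\<delta> \<le> \<epsilon>" "\<And>y. y \<in> ball 0 \<delta> ==> G y = G0 y" by (rule G_eq_G0) blast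
  define W where "W = G0 ` ball 0 \<delta>"
  have W: "open W" unfolding W_def using \<delta> by (intro G0_open) auto
  have We: "e \<in> W" using \<delta>(1) by (auto simp: W_def intro!: image_eqI[of _ _ 0])
  have cH: "continuous_on W H" by (rule continuous_on_subset[OF cont_H]) (use \<delta> in \<open>auto simp: W_def\<close>)
  have GH: "G (H w) = w" if "w \<in> W" for w using that \<delta> by (auto simp: W_def H_G0)
  have He: "H e = 0" using H_G0[of 0] \<epsilon> by simp
  let ?C = "{0..1} \<times> {0..1} \<times> {0..1} :: (real \<times> real \<times> real) set"
  let ?f = "\<lambda>p. mul (iv (k (fst p, fst (snd p)))) (k (fst p, snd (snd p)))"
  have cf: "continuous_on ?C ?f"
    by (intro continuous_mul continuous_iv continuous_on_compose2[OF k] continuous_intros) auto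
  have cl: "closed (?C \<inter> ?f -` (- W))"
    using W by (intro continuous_closed_preimage[OF cf] closed_Times) auto
  have cp: "compact ((\<lambda>(s, t). (s, t, t)) ` ({0..1} \<times> {0..1} :: (real \<times> real) set))"
    by (intro compact_continuous_image compact_Times) (auto simp: split_beta intro!: continuous_intros)
  have dj: "(\<lambda>(s, t). (s, t, t)) ` ({0..1} \<times> {0..1} :: (real \<times> real) set) \<inter> (?C \<inter> ?f -` (- W)) = {}"
    using We by auto
  \<comment> \<open>The triples \<open>(s, t, t)\<close> have quotient \<open>e\<close> in
    \<open>W\<close>. They form a compact set disjoint from the closed set of triples with quotient
    outside \<open>W\<close>; their distance bounds the mesh of the subdivision.\<close>
  obtain d where d: "d > 0" "\<And>x y. x \<in> (\<lambda>(s, t). (s, t, t)) ` ({0..1} \<times> {0..1}) ==> y \<in> ?C \<inter> ?f -` (- W) ==> d \<le> dist x y"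
    using separate_compact_closed[OF cp cl dj] by blast
  have inW: "mul (iv (k (s, t))) (k (s, t')) \<in> W" if "s \<in> {0..1}" "t \<in> {0..1}" "t' \<in> {0..1}" "\<bar>t - t'\<bar> < d" for s t t'
  proof (rule ccontr)
    assume "mul (iv (k (s, t))) (k (s, t')) \<notin> W"
    then have "d \<le> dist (s, t, t) (s, t, t')" using that by (intro d(2)) auto
    then show False using that(4) by (simp add: dist_Pair_Pair dist_real_def)
  qed
  obtain n where n: "inverse (real (Suc n)) < d" using reals_Archimedean[OF d(1)] by blast
  define a where "a p i = k (fst p, real i / real (Suc n) * snd p)" for p i
  define L where "L p = qprod (a p) (Suc n)" for p
  have frac: "real i / real (Suc n) * t \<in> {0..1}" if "i \<le> Suc n" "t \<in> {0..1}" for i t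
  proof -
    have "real i / real (Suc n) \<le> 1" "0 \<le> real i / real (Suc n)" using that by (auto simp: divide_simps)
    moreover from this have "real i / real (Suc n) * t \<le> 1 * 1" using that(2) by (intro mult_mono) auto
    ultimately show ?thesis using that(2) by simp
  qed
  have step: "mul (iv (a p i)) (a p (Suc i)) \<in> W" if "p \<in> {0..1} \<times> {0..1}" "i < Suc n" for p i
  proof -
    have "real (Suc i) / real (Suc n) * snd p - real i / real (Suc n) * snd p =
        (real (Suc i) - real i) * (inverse (real (Suc n)) * snd p)"
      by (simp only: divide_inverse left_diff_distrib mult.assoc)
    then have "real (Suc i) / real (Suc n) * snd p - real i / real (Suc n) * snd p = inverse (real (Suc n)) * snd p"
      by simp
    moreover have "inverse (real (Suc n)) * snd p \<le> inverse (real (Suc n)) * 1" "0 \<le> inverse (real (Suc n)) * snd p"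
      using that(1) by (auto intro!: mult_left_mono)
    ultimately have "\<bar>real i / real (Suc n) * snd p - real (Suc i) / real (Suc n) * snd p\<bar> < d"
      using n by linarith
    then show ?thesis unfolding a_def using that frac[of i "snd p"] frac[of "Suc i" "snd p"]
      by (intro inW) (auto simp: mem_Times_iff)
  qed
  have ca: "continuous_on ({0..1} \<times> {0..1}) (\<lambda>p. a p i)" if "i \<le> Suc n" for i
    unfolding a_def using frac[OF that]
    by (intro continuous_on_compose2[OF k] continuous_intros) (auto simp: mem_Times_iff)
  have "continuous_on ({0..1} \<times> {0..1}) (\<lambda>p. qprod (a p) i)" if "i \<le> Suc n" for i
    using that
  proof (induction i)
    case (Suc i)
    have "continuous_on ({0..1} \<times> {0..1}) (\<lambda>p. H (mul (iv (a p i)) (a p (Suc i))))"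
      by (rule continuous_on_compose2[OF cH continuous_mul[OF continuous_iv[OF ca] ca]]) (use Suc step in auto)
    then show ?case using Suc by (auto intro!: continuous_on_gm)
  qed auto
  then have 1: "continuous_on ({0..1} \<times> {0..1}) L" unfolding L_def by blast
  have 2: "G (L p) = k p" if p: "p \<in> {0..1} \<times> {0..1}" for p
  proof -
    have "G (qprod (a p) i) = a p i" if "i \<le> Suc n" for i
      using that
    proof (induction i)
      case 0 show ?case using p k0[of "fst p"] by (auto simp: a_def)
    next
      case (Suc i)
      then show ?case using step[OF p, of i] by (simp add: G_hom GH)
    qed
    then show ?thesis unfolding L_def using p by (simp add: a_def del: qprod.simps)
  qed
  have "qprod (a (s, 0)) i = 0" if "s \<in> {0..1}" for s i
    by (induction i) (simp_all add: a_def k0[OF that] He)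
  then show ?thesis using that[OF 1 2] by (simp add: L_def del: qprod.simps)
qed

text \<open>If \<open>G x = e\<close>, then \<open>t \<mapsto> G (t *\<^sub>R x)\<close> is a loop.
  Lifting a contraction of it to a square, one gets \<open>x\<close> at the corner
  \<open>(0, 1)\<close>; along the sides to \<open>(1, 1)\<close> and \<open>(1, 0)\<close> the lift
  stays in the kernel and is constant, and it ends at 0.\<close>

lemma G_inj:
  assumes sc: "simply_connected (UNIV :: 'm set)" and eq: "G x = G y"
  shows "x = y"
proof -
  have ker: "x = 0" if x: "G x = e" for x
  proof -
    let ?p = "\<lambda>t. G (t *\<^sub>R x)" and ?q = "\<lambda>t::real. e"
    have cp: "continuous_on {0..1} ?p"
      by (rule continuous_on_compose2[OF G_continuous[of UNIV]]) (auto intro!: continuous_intros)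
    have "homotopic_loops UNIV ?p ?q"
      using sc cp x unfolding simply_connected_def
      by (auto simp: path_def pathfinish_def pathstart_def)
    then obtain h where h: "continuous_on ({0..1::real} \<times> {0..1::real}) h" "\<forall>t\<in>{0..1}. h (0, t) = ?p t"
      "\<forall>t\<in>{0..1}. h (1, t) = ?q t" "\<forall>s\<in>{0..1}. pathfinish (h \<circ> Pair s) = pathstart (h \<circ> Pair s)"
      unfolding homotopic_loops by blast
    \<comment> \<open>The homotopy of loops may move the base point; multiplication by the inverse
      of \<open>h (s, 0)\<close> pins it to \<open>e\<close>, as \<open>lift_square\<close>
      requires.\<close>
    define k where "k p = mul (iv (h (fst p, 0))) (h p)" for p
    have ck: "continuous_on ({0..1} \<times> {0..1}) k" unfolding k_def
      by (intro continuous_mul continuous_iv h(1) continuous_on_compose2[OF h(1)] continuous_intros) auto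
    obtain L where L: "continuous_on ({0..1} \<times> {0..1}) L" "\<And>p. p \<in> {0..1} \<times> {0..1} ==> G (L p) = k p"
      "\<And>s. s \<in> {0..1} ==> L (s, 0) = 0"
      by (rule lift_square[OF ck]) (auto simp: k_def)
    have k: "k (0, t) = G (t *\<^sub>R x)" "k (1, t) = e" "k (t, 1) = e" if "t \<in> {0..1}" for t
      using h(2-4) that by (auto simp: k_def pathfinish_def pathstart_def)
    have cL: "continuous_on {0..1} (\<lambda>t. L (s, t))" "continuous_on {0..1} (\<lambda>t. L (t, s))" if "s \<in> {0..1}" for s
      using that by (auto intro!: continuous_on_compose2[OF L(1)] continuous_intros)
    have "gm (gi (L (0, 0))) (0 *\<^sub>R x) = gm (gi (L (0, 1))) (1 *\<^sub>R x)"
      by (rule G_fibre_locally_const[of "{0..1}" 0 1 "\<lambda>t. gm (gi (L (0, t))) (t *\<^sub>R x)"])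
        (auto intro!: continuous_on_gm continuous_on_gi cL continuous_intros simp: G_hom G_gi L(2) k)
    then have "gm (gi (L (0, 1))) x = 0" using L(3)[of 0] by simp
    then have x: "x = L (0, 1)" by (metis gm_0(2) gm_cancel(2))
    have "L (0, 1) = L (1, 1)"
      by (rule G_fibre_locally_const[of "{0..1}" 0 1 "\<lambda>s. L (s, 1)"]) (auto intro!: cL simp: L(2) k)
    also have "L (1, 1) = L (1, 0)"
      by (rule G_fibre_locally_const[of "{0..1}" 1 0 "\<lambda>t. L (1, t)"]) (auto intro!: cL simp: L(2) k)
    finally show ?thesis using x L(3)[of 1] by simp
  qed
  have "gm (gi x) y = 0" using eq by (intro ker) (simp add: G_hom G_gi)
  then show ?thesis by (metis gm_0(2) gm_cancel(2))
qed

end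

text \<open>\<open>Psi\<close> is \<open>G\<close> followed by left translation to \<open>p\<close>.
  The Maurer-Cartan form is unaffected, and the isotropy group at an arbitrary point can be treated
  at the origin.\<close>

lemma (in lie_model) coordinates_exist:
  assumes sc: "simply_connected (UNIV :: 'm set)"
  obtains Psi :: "'n => 'm" and Phi where "Psi 0 = p" "\<And>x. Phi (Psi x) = x" "\<And>q. Psi (Phi q) = q"
    "plot A UNIV Psi" "continuous_on UNIV Phi"
    "\<And>U \<psi>. (U, \<psi>) \<in> A ==> Cinf_on (\<lambda>x. Phi (inv_into U \<psi> x)) (\<psi> ` U)" "\<And>x u. thM Psi x u = th x u"
proof -
  obtain \<epsilon> G0 H where "lie_local B pv pz N A mul e iv \<phi> \<epsilon> G0 H" using lie_local_exists by blast
  then interpret lie_local B pv pz N A mul e iv \<phi> \<epsilon> G0 H .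
  \<comment> \<open>Simple connectedness says that any two loops are homotopic; for constant loops
    at different points the homotopy contains a path between them.\<close>
  have "connected (UNIV :: 'm set)"
  proof (subst connected_iff_connected_component, intro ballI)
    fix a b :: 'm
    have "homotopic_loops UNIV (\<lambda>_::real. a) (\<lambda>_::real. b)"
      using sc unfolding simply_connected_def by (auto simp: path_def pathfinish_def pathstart_def)
    then obtain h where h: "continuous_on ({0..1::real} \<times> {0..1::real}) h" "\<forall>t\<in>{0..1}. h (0, t) = a" "\<forall>t\<in>{0..1}. h (1, t) = b"
      unfolding homotopic_loops by blast
    have "connected ((\<lambda>s. h (s, 0)) ` {0..1})"
      by (intro connected_continuous_image continuous_on_compose2[OF h(1)] continuous_intros) auto
    moreover have "a \<in> (\<lambda>s. h (s, 0)) ` {0..1}" using h(2) by (intro image_eqI[of _ _ 0]) auto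
    moreover have "b \<in> (\<lambda>s. h (s, 0)) ` {0..1}" using h(3) by (intro image_eqI[of _ _ 1]) auto
    ultimately show "connected_component UNIV a b" unfolding connected_component_def by blast
  qed
  then have bij: "bij G" using G_surj G_inj[OF sc] by (metis bijI injI surjI surj_def)
  define Psi where "Psi x = mul p (G x)" for x
  define Phi where "Phi q = inv G (mul (iv p) q)" for q
  have 1: "Phi (Psi x) = x" "Psi (Phi q) = q" for x q
    using bij by (simp_all add: Psi_def Phi_def bij_is_inj bij_is_surj surj_f_inv_f)
  have pl: "plot A UNIV Psi" unfolding Psi_def by (intro plot_mul plot_const plot_G open_UNIV)
  define W where "W = G0 ` ball 0 \<epsilon>"
  have W: "open W" unfolding W_def by (rule G0_open) auto
  obtain \<delta> where \<delta>: "0 < \<delta>" "\<delta> \<le> \<epsilon>" "\<And>y. y \<in> ball 0 \<delta> ==> G y = G0 y" by (rule G_eq_G0) blast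
  define W' where "W' = G0 ` ball 0 \<delta>"
  have "open W'" unfolding W'_def using \<delta> by (intro G0_open) auto
  moreover have "e \<in> W'" unfolding W'_def using \<delta>(1) by (intro image_eqI[of _ _ 0]) auto
  moreover have "W' \<subseteq> W" unfolding W'_def W_def using \<delta>(2) by auto
  ultimately have W': "open W'" "e \<in> W'" "W' \<subseteq> W" by blast+
  have local: "Phi (mul (Psi a) w) = gm a (H w)" if "w \<in> W'" for a w
  proof -
    obtain y where y: "y \<in> ball 0 \<delta>" "w = G0 y" using \<open>w \<in> W'\<close> by (auto simp: W'_def)
    then have "mul (Psi a) w = Psi (gm a y)" using \<delta> by (simp add: Psi_def G_hom mul_assoc)
    moreover have "H w = y" using y \<delta> by (simp add: H_G0)
    ultimately show ?thesis by (simp add: 1)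
  qed
  have near: "\<exists>T. open T \<and> q \<in> T \<and> (\<forall>q'\<in>T. mul (iv q) q' \<in> W' \<and> Phi q' = gm (Phi q) (H (mul (iv q) q')))" for q
  proof (intro exI[of _ "mul (iv q) -` W'"] conjI ballI)
    have "continuous_on UNIV (mul (iv q))" using smooth_mul_left by (simp add: smooth_map_def)
    then show "open (mul (iv q) -` W')" by (rule open_vimage[OF W'(1)])
    show "Phi q' = gm (Phi q) (H (mul (iv q) q'))" if "q' \<in> mul (iv q) -` W'" for q'
      using local[of "mul (iv q) q'" "Phi q"] that by (simp add: 1)
  qed (use W' in auto)
  have smooth: "Cinf_on (\<lambda>x. Phi (inv_into U \<psi> x)) (\<psi> ` U)" if U: "(U, \<psi>) \<in> A" for U \<psi>
  proof (rule Cinf_on_open_cover)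
    fix x assume x: "x \<in> \<psi> ` U"
    note u = chartsD[OF charts U]
    let ?q = "inv_into U \<psi> x"
    obtain T where T: "open T" "?q \<in> T" "\<And>q'. q' \<in> T ==> mul (iv ?q) q' \<in> W'"
      "\<And>q'. q' \<in> T ==> Phi q' = gm (Phi ?q) (H (mul (iv ?q) q'))" using near by meson
    let ?T = "\<psi> ` U \<inter> inv_into U \<psi> -` T"
    have oT: "open ?T" by (rule open_preimage_Int[OF u(2,5) T(1)])
    have pT: "plot A ?T (\<lambda>y. mul (iv ?q) (inv_into U \<psi> y))"
      by (intro plot_mul plot_const oT plot_subset[OF plot_inv_chart[OF atlas U] charts oT]) auto
    have sm: "Cinf_on (\<lambda>y. H (mul (iv ?q) (inv_into U \<psi> y))) ?T"
      by (rule plot_local_inverse[OF charts W _ pT]) (use smooth_H T(3) W'(3) in \<open>auto simp: W_def\<close>)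
    have "Cinf_on (\<lambda>y. Phi (inv_into U \<psi> y)) ?T"
      by (rule Cinf_on_cong[OF oT _ Cinf_on_gm[OF oT Cinf_on_const[OF oT] sm]]) (use T(4) in auto)
    then show "\<exists>T. open T \<and> x \<in> T \<and> Cinf_on (\<lambda>x. Phi (inv_into U \<psi> x)) T" using oT T(2) x by blast
  qed
  have "isCont Phi q" for q
  proof -
    obtain T where T: "open T" "q \<in> T" "\<And>q'. q' \<in> T ==> mul (iv q) q' \<in> W'"
      "\<And>q'. q' \<in> T ==> Phi q' = gm (Phi q) (H (mul (iv q) q'))" using near by meson
    have "continuous_on T (\<lambda>q'. H (mul (iv q) q'))"
      by (rule continuous_on_compose2[OF cont_H continuous_mul[OF continuous_on_const continuous_on_id]])
        (use T(3) W'(3) in \<open>auto simp: W_def\<close>)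
    then have "continuous_on T (\<lambda>q'. gm (Phi q) (H (mul (iv q) q')))" by (intro continuous_on_gm continuous_on_const)
    then have "continuous_on T Phi" by (rule continuous_on_eq) (rule T(4)[symmetric])
    then show ?thesis using continuous_on_eq_continuous_at[OF T(1), of Phi] T(2) by blast
  qed
  then have cont: "continuous_on UNIV Phi" by (simp add: continuous_at_imp_continuous_on)
  have metric: "thM Psi x u = th x u" for x u
    unfolding Psi_def[abs_def] by (simp add: thM_G)
  have "Psi 0 = p" by (simp add: Psi_def)
  then show ?thesis by (rule that[OF _ 1 pl cont smooth metric])
qed

section \<open>Automorphisms and skew derivations\<close>

context heisenberg_model
begin

text \<open>Orthogonal automorphisms of the algebra respecting the splitting. By
  \<open>aut_th\<close> they are at the same time linear isometries of the model fixing 0.\<close>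

definition aut :: "('n => 'n) => bool" where
  "aut h \<longleftrightarrow> linear h \<and> (\<forall>x y. h x \<bullet> h y = x \<bullet> y) \<and> h B = B \<and> (\<forall>x. pv (h x) = h (pv x)) \<and> (\<forall>x. pz (h x) = h (pz x)) \<and>
    (\<forall>x y. N (h x) (h y) = h (N x y))"

definition der :: "('n => 'n) => bool" where
  "der D \<longleftrightarrow> linear D \<and> (\<forall>x y. D x \<bullet> y = - (x \<bullet> D y)) \<and> D B = 0 \<and> (\<forall>x. pv (D x) = D (pv x)) \<and> (\<forall>x. pz (D x) = D (pz x)) \<and>
    (\<forall>x y. D (N x y) = N (D x) y + N x (D y))"

lemma autD:
  assumes "aut h"
  shows "linear h" "h x \<bullet> h y = x \<bullet> y" "h B = B" "pv (h x) = h (pv x)" "pz (h x) = h (pz x)" "N (h x) (h y) = h (N x y)"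
    "lam (h x) = lam x" "norm (h x) = norm x"
  using assms unfolding aut_def lam_def by (auto simp: norm_eq) metis

lemma derD:
  assumes "der D"
  shows "linear D" "D x \<bullet> y = - (x \<bullet> D y)" "D B = 0" "pv (D x) = D (pv x)" "pz (D x) = D (pz x)"
    "D (N x y) = N (D x) y + N x (D y)" "lam (D x) = 0" "D x \<bullet> x = 0"
proof -
  show "linear D" "D x \<bullet> y = - (x \<bullet> D y)" "D B = 0" "pv (D x) = D (pv x)" "pz (D x) = D (pz x)"
    "D (N x y) = N (D x) y + N x (D y)" for x y
    using assms unfolding der_def by blast+
  then have "D x \<bullet> B = - (x \<bullet> D B)" "D x \<bullet> x = - (x \<bullet> D x)" by blast+
  then show "lam (D x) = 0" "D x \<bullet> x = 0" using \<open>D B = 0\<close> by (simp_all add: lam_def inner_commute)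
qed

lemma aut_id: "aut id"
  by (simp add: aut_def linear_id)

lemma aut_compose: "aut h ==> aut k ==> aut (h \<circ> k)"
  by (simp add: aut_def linear_compose)

lemma aut_bij: "aut h ==> bij h"
proof -
  assume h: "aut h"
  have "inj h" using autD(8)[OF h] linear_injective_0[OF autD(1)[OF h]] by (metis norm_eq_zero)
  then show ?thesis using linear_injective_imp_surjective[OF autD(1)[OF h]] by (simp add: bij_def)
qed

lemma aut_inv: "aut h ==> aut (inv h)"
proof -
  assume h: "aut h"
  have s: "h (inv h x) = x" for x using aut_bij[OF h] by (simp add: bij_is_surj surj_f_inv_f)
  have i: "h x = h y ==> x = y" for x y using aut_bij[OF h] by (simp add: bij_is_inj inj_eq)
  note d = autD[OF h]
  have "linear (inv h)"
    unfolding linear_iff by (intro conjI allI; rule i) (simp_all add: s linear_add[OF d(1)] linear_cmul[OF d(1)])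
  moreover have "inv h x \<bullet> inv h y = x \<bullet> y" for x y using d(2)[of "inv h x" "inv h y"] by (simp add: s)
  moreover have "inv h B = B" by (rule i) (simp only: s d(3))
  moreover have "pv (inv h x) = inv h (pv x)" for x by (rule i) (simp only: s flip: d(4))
  moreover have "pz (inv h x) = inv h (pz x)" for x by (rule i) (simp only: s flip: d(5))
  moreover have "N (inv h x) (inv h y) = inv h (N x y)" for x y by (rule i) (simp only: s flip: d(6))
  ultimately show ?thesis by (simp add: aut_def)
qed

lemma aut_th: "aut h ==> th (h x) (h u) = h (th x u)"
  by (simp add: th_def autD linear_add[OF autD(1)] linear_cmul[OF autD(1)] linear_diff[OF autD(1)])

lemma der_compose_aut: "aut h ==> der D ==> der (\<lambda>x. h (D (inv h x)))"
proof -
  assume h: "aut h" and D: "der D"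
  have s: "h (inv h x) = x" for x using aut_bij[OF h] by (simp add: bij_is_surj surj_f_inv_f)
  note d = autD[OF h] and k = autD[OF aut_inv[OF h]] and dD = derD[OF D]
  have "linear (\<lambda>x. h (D (inv h x)))"
    using linear_compose[OF linear_compose[OF k(1) dD(1)] d(1)] by (simp add: o_def)
  moreover have "h (D (inv h x)) \<bullet> y = - (x \<bullet> h (D (inv h y)))" for x y
    using d(2)[of "D (inv h x)" "inv h y"] d(2)[of "inv h x" "D (inv h y)"] dD(2)[of "inv h x" "inv h y"] by (simp add: s)
  moreover have "h (D (inv h (N x y))) = N (h (D (inv h x))) y + N x (h (D (inv h y)))" for x y
    using d(6)[of "D (inv h x)" "inv h y"] d(6)[of "inv h x" "D (inv h y)"]
    by (simp add: s dD(6) linear_add[OF d(1)] flip: k(6))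
  ultimately show ?thesis
    by (simp add: der_def d(4,5) k(3,4,5) dD(3,4,5) linear_0[OF d(1)])
qed

lemma der_scale: "der D ==> der (\<lambda>x. c *\<^sub>R D x)"
  by (auto simp: der_def linear_iff algebra_simps)

text \<open>\<open>flow D t x = exp (t D) x\<close>, componentwise as a power series.\<close>

definition flow :: "('n => 'n) => real => 'n => 'n" where
  "flow D t x = (\<Sum>b\<in>Basis. (\<Sum>n. ((D ^^ n) x \<bullet> b) / fact n * t ^ n) *\<^sub>R b)"

lemma flow_series:
  assumes "linear D"
  shows "summable (\<lambda>n. ((D ^^ n) x \<bullet> w) / fact n * t ^ n)"
    and "flow D t x \<bullet> w = (\<Sum>n. ((D ^^ n) x \<bullet> w) / fact n * t ^ n)"
proof -
  obtain K where K: "K > 0" "\<And>x. norm (D x) \<le> K * norm x" using linear_bounded_pos[OF assms] by metis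
  have bd: "norm ((D ^^ n) x) \<le> K ^ n * norm x" for n
  proof (induction n)
    case (Suc n)
    have "norm ((D ^^ Suc n) x) \<le> K * norm ((D ^^ n) x)" using K(2) by simp
    also have "\<dots> \<le> K * (K ^ n * norm x)" using Suc K(1) by (intro mult_left_mono) auto
    finally show ?case by simp
  qed simp
  have sm: "summable (\<lambda>n. ((D ^^ n) x \<bullet> w) / fact n * t ^ n)" for w
  proof (rule summable_comparison_test')
    show "summable (\<lambda>n. (norm x * norm w) * (inverse (fact n) * (K * \<bar>t\<bar>) ^ n))"
      by (intro summable_mult summable_exp)
    fix n :: nat
    have "\<bar>(D ^^ n) x \<bullet> w\<bar> \<le> norm ((D ^^ n) x) * norm w" by (rule Cauchy_Schwarz_ineq2)
    also have "\<dots> \<le> (K ^ n * norm x) * norm w" by (intro mult_right_mono bd) simp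
    finally have "\<bar>(D ^^ n) x \<bullet> w\<bar> * (\<bar>t\<bar> ^ n / fact n) \<le> ((K ^ n * norm x) * norm w) * (\<bar>t\<bar> ^ n / fact n)"
      by (intro mult_right_mono) auto
    then show "norm (((D ^^ n) x \<bullet> w) / fact n * t ^ n) \<le> (norm x * norm w) * (inverse (fact n) * (K * \<bar>t\<bar>) ^ n)"
      by (simp add: abs_mult power_abs power_mult_distrib divide_inverse mult_ac)
  qed
  then show "summable (\<lambda>n. ((D ^^ n) x \<bullet> w) / fact n * t ^ n)" .
  have "flow D t x \<bullet> w = (\<Sum>b\<in>Basis. (\<Sum>n. ((D ^^ n) x \<bullet> b) / fact n * t ^ n) * (b \<bullet> w))"
    by (simp add: flow_def inner_sum_left)
  also have "\<dots> = (\<Sum>b\<in>Basis. (\<Sum>n. ((D ^^ n) x \<bullet> b) / fact n * t ^ n * (b \<bullet> w)))"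
    using suminf_mult2[OF sm] by simp
  also have "\<dots> = (\<Sum>n. \<Sum>b\<in>Basis. ((D ^^ n) x \<bullet> b) / fact n * t ^ n * (b \<bullet> w))"
    by (rule suminf_sum[symmetric]) (rule summable_mult2[OF sm])
  also have "\<dots> = (\<Sum>n. ((D ^^ n) x \<bullet> w) / fact n * t ^ n)"
  proof (rule suminf_cong)
    fix n
    have "(\<Sum>b\<in>Basis. ((D ^^ n) x \<bullet> b) / fact n * t ^ n * (b \<bullet> w)) = (\<Sum>b\<in>Basis. ((D ^^ n) x \<bullet> b) * (w \<bullet> b)) * (t ^ n / fact n)"
      unfolding sum_distrib_right by (rule sum.cong) (simp_all add: inner_commute)
    then show "(\<Sum>b\<in>Basis. ((D ^^ n) x \<bullet> b) / fact n * t ^ n * (b \<bullet> w)) = ((D ^^ n) x \<bullet> w) / fact n * t ^ n"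
      by (simp flip: euclidean_inner)
  qed
  finally show "flow D t x \<bullet> w = (\<Sum>n. ((D ^^ n) x \<bullet> w) / fact n * t ^ n)" .
qed

lemma flow_0 [simp]: "linear D ==> flow D 0 x = x"
proof -
  assume D: "linear D"
  have "flow D 0 x \<bullet> w = x \<bullet> w" for w
    unfolding flow_series(2)[OF D] using powser_zero[of "\<lambda>n. ((D ^^ n) x \<bullet> w) / fact n"] by simp
  then show ?thesis using vector_eq_rdot by blast
qed

lemma flow_has_derivative:
  assumes D: "der D"
  shows "((\<lambda>t. flow D t x) has_vector_derivative D (flow D t x)) (at t)"
proof -
  note lin = derD(1)[OF D]
  have "((\<lambda>t. flow D t x \<bullet> w) has_real_derivative D (flow D t x) \<bullet> w) (at t)" for w
  proof -
    have "((\<lambda>t. \<Sum>n. ((D ^^ n) x \<bullet> w) / fact n * t ^ n) has_real_derivative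
        (\<Sum>n. diffs (\<lambda>n. ((D ^^ n) x \<bullet> w) / fact n) n * t ^ n)) (at t)"
      by (rule termdiffs_strong_converges_everywhere) (rule flow_series(1)[OF lin])
    moreover have "diffs (\<lambda>n. ((D ^^ n) x \<bullet> w) / fact n) n = - (((D ^^ n) x \<bullet> D w) / fact n)" for n
      using derD(2)[OF D, of "(D ^^ n) x" w] by (simp add: diffs_def field_simps del: of_nat_Suc)
    ultimately have "((\<lambda>t. flow D t x \<bullet> w) has_real_derivative - (flow D t x \<bullet> D w)) (at t)"
      using suminf_minus[OF flow_series(1)[OF lin, of x "D w" t]] by (simp add: flow_series(2)[OF lin])
    then show ?thesis by (simp add: derD(2)[OF D, of "flow D t x" w])
  qed
  then show ?thesis
    unfolding has_vector_derivative_def has_field_derivative_def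
    by (subst has_derivative_componentwise_within) (auto simp: mult_commute_abs)
qed

text \<open>Skewness of \<open>D\<close> keeps the distance between two solutions constant in
  time.\<close>

lemma skew_ode_unique:
  assumes D: "der D" and u: "\<And>t. (u has_vector_derivative D (u t)) (at t)" and v: "\<And>t. (v has_vector_derivative D (v t)) (at t)"
    and eq: "u 0 = v 0"
  shows "u t = v t"
proof -
  have "((\<lambda>t. (u t - v t) \<bullet> (u t - v t)) has_real_derivative 0) (at t)" for t
  proof -
    have "((\<lambda>t. u t - v t) has_vector_derivative D (u t - v t)) (at t)"
      using has_vector_derivative_diff[OF u v] by (simp add: linear_diff[OF derD(1)[OF D]])
    from bounded_bilinear.has_vector_derivative[OF bounded_bilinear_inner this this]
    show ?thesis using derD(8)[OF D] by (simp add: has_real_derivative_iff_has_vector_derivative inner_commute)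
  qed
  then have "(u t - v t) \<bullet> (u t - v t) = (u 0 - v 0) \<bullet> (u 0 - v 0)"
    by (intro DERIV_isconst_all) blast
  then show ?thesis using eq by simp
qed

text \<open>The inner product of two trajectories has derivative 0. In every other identity both
  sides solve the equation of \<open>D\<close> with the same initial value, the derivation property
  of \<open>D\<close> being what makes them solutions.\<close>

lemma aut_flow:
  assumes D: "der D"
  shows "aut (flow D t)"
proof -
  note d = derD[OF D] and f = flow_has_derivative[OF D]
  have f0: "flow D 0 x = x" for x by (rule flow_0[OF d(1)])
  note bl = bounded_linear.has_vector_derivative
  have "flow D t (x + y) = flow D t x + flow D t y" for x y
    by (rule skew_ode_unique[OF D f, where v = "\<lambda>t. flow D t x + flow D t y"])
      (auto intro!: has_vector_derivative_eq_rhs[OF has_vector_derivative_add[OF f f]] simp: f0 linear_add[OF d(1)])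
  moreover have "flow D t (c *\<^sub>R x) = c *\<^sub>R flow D t x" for c x
    by (rule skew_ode_unique[OF D f, where v = "\<lambda>t. c *\<^sub>R flow D t x"])
      (auto intro!: has_vector_derivative_eq_rhs[OF bl[OF bounded_linear_scaleR_right f]] simp: f0 linear_cmul[OF d(1)])
  ultimately have "linear (flow D t)" by (simp add: linear_iff)
  moreover have "flow D t x \<bullet> flow D t y = x \<bullet> y" for x y
  proof -
    have "((\<lambda>t. flow D t x \<bullet> flow D t y) has_real_derivative 0) (at t)" for t
      using bounded_bilinear.has_vector_derivative[OF bounded_bilinear_inner f[where x = x and t = t] f[where x = y and t = t]] d(2)[of "flow D t x" "flow D t y"]
      by (simp add: has_real_derivative_iff_has_vector_derivative)
    then have "flow D t x \<bullet> flow D t y = flow D 0 x \<bullet> flow D 0 y" by (intro DERIV_isconst_all) blast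
    then show ?thesis by (simp add: f0)
  qed
  moreover have "flow D t B = B"
    by (rule skew_ode_unique[OF D f, where v = "\<lambda>t. B"]) (auto simp: f0 d(3))
  moreover have "pv (flow D t x) = flow D t (pv x)" for x
    by (rule skew_ode_unique[OF D _ f, where u = "\<lambda>t. pv (flow D t x)"])
      (auto intro!: has_vector_derivative_eq_rhs[OF bl[OF bounded_linears(2) f]] simp: f0 d(4))
  moreover have "pz (flow D t x) = flow D t (pz x)" for x
    by (rule skew_ode_unique[OF D _ f, where u = "\<lambda>t. pz (flow D t x)"])
      (auto intro!: has_vector_derivative_eq_rhs[OF bl[OF bounded_linears(3) f]] simp: f0 d(5))
  moreover have "N (flow D t x) (flow D t y) = flow D t (N x y)" for x y
    by (rule skew_ode_unique[OF D _ f, where u = "\<lambda>t. N (flow D t x) (flow D t y)"])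
      (auto intro!: has_vector_derivative_eq_rhs[OF bounded_bilinear.has_vector_derivative[OF bounded_bilinear_N f f]] simp: f0 d(6))
  ultimately show ?thesis by (simp add: aut_def)
qed

end

section \<open>Tangent vectors of a submanifold of the model\<close>

text \<open>The coordinate version of \<open>tangent_of_subset\<close>; as there, curves are defined
  on the whole real line.\<close>

definition tvec :: "'a::euclidean_space set => 'a => 'a set" where
  "tvec S x = {c' | c c'. Cinf_on c UNIV \<and> range c \<subseteq> S \<and> c (0::real) = x \<and> (c has_vector_derivative c') (at 0)}"

text \<open>The scales \<open>\<eta> j\<close> are arbitrary nonzero numbers and
  \<open>y j = x\<close> may occur. The remainder is therefore written as the convergent factor
  \<open>norm (y j - x) / \<eta> j\<close>, up to sign, times a relative error \<open>q\<close>
  tending to 0.\<close>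

lemma secant_limit:
  fixes f :: "'a::real_normed_vector => 'b::real_normed_vector"
  assumes f: "(f has_derivative D) (at x)" and y: "y \<longlonglongrightarrow> x" and e: "(\<lambda>j. (y j - x) /\<^sub>R \<eta> j) \<longlonglongrightarrow> e" and \<eta>: "\<And>j::nat. \<eta> j \<noteq> 0"
  shows "(\<lambda>j. (f (y j) - f x) /\<^sub>R \<eta> j) \<longlonglongrightarrow> D e"
proof -
  define q where "q z = (f z - f x - D (z - x)) /\<^sub>R norm (z - x)" for z
  have bl: "bounded_linear D" using f by (rule has_derivative_bounded_linear)
  note l = bounded_linear.linear[OF bl]
  have "(q \<longlongrightarrow> 0) (at x)"
    using f unfolding has_derivative_at_within q_def by (simp add: diff_diff_eq algebra_simps)
  then have "isCont q x" by (simp add: isCont_def q_def linear_0[OF l])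
  then have "(\<lambda>j. q (y j)) \<longlonglongrightarrow> q x" using y by (rule isCont_tendsto_compose)
  then have q: "(\<lambda>j. q (y j)) \<longlonglongrightarrow> 0" by (simp add: q_def linear_0[OF l])
  have "(\<lambda>j. norm ((y j - x) /\<^sub>R \<eta> j) * norm (q (y j))) \<longlonglongrightarrow> norm e * norm (0 :: 'b)"
    by (intro tendsto_mult tendsto_norm e q)
  then have "(\<lambda>j. (norm (y j - x) / \<eta> j) *\<^sub>R q (y j)) \<longlonglongrightarrow> 0"
    by (intro tendsto_norm_zero_cancel[of "\<lambda>j. (norm (y j - x) / \<eta> j) *\<^sub>R q (y j)"]) (simp add: divide_inverse mult.commute abs_mult)
  then have "(\<lambda>j. D ((y j - x) /\<^sub>R \<eta> j) + (norm (y j - x) / \<eta> j) *\<^sub>R q (y j)) \<longlonglongrightarrow> D e + 0"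
    by (intro tendsto_add bounded_linear.tendsto[OF bl e])
  moreover have "D ((y j - x) /\<^sub>R \<eta> j) + (norm (y j - x) / \<eta> j) *\<^sub>R q (y j) = (f (y j) - f x) /\<^sub>R \<eta> j" for j
  proof (cases "y j = x")
    case True then show ?thesis by (simp add: q_def linear_0[OF l])
  next
    case False
    then have eq: "(norm (y j - x) / \<eta> j) *\<^sub>R q (y j) = (f (y j) - f x - D (y j - x)) /\<^sub>R \<eta> j"
      by (simp add: q_def divide_inverse)
    show ?thesis unfolding linear_cmul[OF l] eq by (simp add: scaleR_diff_right)
  qed
  ultimately show ?thesis by simp
qed

lemma tvec_secant:
  assumes "e \<in> tvec S x"
  obtains y \<eta> where "\<And>j::nat. y j \<in> S" "y \<longlonglongrightarrow> x" "\<And>j. \<eta> j \<noteq> 0" "\<eta> \<longlonglongrightarrow> 0" "(\<lambda>j. (y j - x) /\<^sub>R \<eta> j) \<longlonglongrightarrow> e"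
proof -
  obtain c where c: "Cinf_on c UNIV" "range c \<subseteq> S" "c (0::real) = x" "(c has_vector_derivative e) (at 0)"
    using assms by (auto simp: tvec_def)
  define \<eta> where "\<eta> j = inverse (real (Suc j))" for j
  have \<eta>: "\<eta> \<longlonglongrightarrow> 0" "\<eta> j \<noteq> 0" for j unfolding \<eta>_def[abs_def] by (rule LIMSEQ_inverse_real_of_nat) simp
  have "(\<lambda>j. (c (\<eta> j) - c 0) /\<^sub>R \<eta> j) \<longlonglongrightarrow> 1 *\<^sub>R e"
    by (rule secant_limit[OF c(4)[unfolded has_vector_derivative_def] \<eta>(1)]) (use \<eta>(2) in auto)
  moreover have "(\<lambda>j. c (\<eta> j)) \<longlonglongrightarrow> c 0"
    using isCont_tendsto_compose[OF _ \<eta>(1), of c] Cinf_on_continuous[OF c(1)] by (simp add: continuous_on_eq_continuous_at)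
  ultimately show ?thesis using that[of "\<lambda>j. c (\<eta> j)" \<eta>] c \<eta> by auto
qed

locale slice =
  fixes S :: "'a::euclidean_space set" and W :: "'a set" and \<psi> :: "'a => 'e::euclidean_space"
    and \<psi>' :: "'e => 'a" and L :: "'e set"
  assumes W: "open W" and \<psi>: "Cinf_on \<psi> W" and \<psi>'_open: "open (\<psi> ` W)" and \<psi>': "Cinf_on \<psi>' (\<psi> ` W)"
    and inv: "\<And>y. y \<in> W ==> \<psi>' (\<psi> y) = y" and L: "subspace L" and slice: "\<psi> ` (W \<inter> S) = \<psi> ` W \<inter> L"
begin

abbreviation "D\<psi> x \<equiv> fderiv \<psi> x"
abbreviation "D\<psi>' u \<equiv> fderiv \<psi>' u"

lemma D_inv: "x \<in> W ==> D\<psi>' (\<psi> x) (D\<psi> x e) = e"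
proof -
  assume x: "x \<in> W"
  from has_derivative_compose[OF Cinf_on_has_derivative[OF \<psi> x], of \<psi>' ] Cinf_on_has_derivative[OF \<psi>' imageI[OF x]]
  have "((\<lambda>y. \<psi>' (\<psi> y)) has_derivative (\<lambda>e. D\<psi>' (\<psi> x) (D\<psi> x e))) (at x)" by simp
  moreover have "((\<lambda>y. \<psi>' (\<psi> y)) has_derivative (\<lambda>e. e)) (at x)"
    by (rule has_derivative_transform_within_open[OF has_derivative_ident W x]) (simp add: inv)
  ultimately show ?thesis by (metis has_derivative_unique)
qed

lemma \<psi>'_S: "u \<in> \<psi> ` W ==> u \<in> L ==> \<psi>' u \<in> S \<and> \<psi>' u \<in> W \<and> \<psi> (\<psi>' u) = u"
  using slice inv by (metis (no_types, lifting) IntE IntI image_iff)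

lemma \<psi>_L: "y \<in> W ==> y \<in> S ==> \<psi> y \<in> L"
  using slice by blast

lemma tvecI:
  assumes y: "y \<in> W" "y \<in> S" and u: "u \<in> L"
  shows "D\<psi>' (\<psi> y) u \<in> tvec S y"
proof -
  obtain R where R: "R > 0" "ball (\<psi> y) R \<subseteq> \<psi> ` W" using \<psi>'_open y openE by blast
  define \<delta> where "\<delta> = R / (norm u + 1)"
  have nu: "norm u + 1 > 0" by (simp add: add_nonneg_pos)
  have \<delta>: "\<delta> > 0" using R nu by (simp add: \<delta>_def)
  \<comment> \<open>The curve has to stay in the slice for all times: this parameter has derivative
    1 at 0 and is bounded by \<open>\<delta>\<close>, where
    \<open>\<delta> * norm u < R\<close>.\<close>
  define s where "s t = \<delta> * sin (t * inverse \<delta>)" for t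
  have sc: "Cinf_on s UNIV" unfolding s_def
    by (intro Cinf_on_mult Cinf_on_const open_UNIV Cinf_on_compose[OF _ _ _ Cinf_on_sin] Cinf_on_id) auto
  have sd: "(s has_real_derivative 1) (at 0)" unfolding s_def using \<delta> by (auto intro!: derivative_eq_intros)
  have inW: "\<psi> y + s t *\<^sub>R u \<in> \<psi> ` W" for t
  proof -
    have "\<bar>s t\<bar> \<le> \<delta> * 1" unfolding s_def abs_mult using \<delta> by (intro mult_mono) auto
    then have "norm (s t *\<^sub>R u) \<le> \<delta> * norm u" by (simp add: mult_right_mono)
    also have "\<dots> < \<delta> * (norm u + 1)" using \<delta> by simp
    also have "\<dots> = R" using nu by (simp add: \<delta>_def)
    finally show ?thesis using R(2) by (auto simp: dist_norm)
  qed
  have inL: "\<psi> y + s t *\<^sub>R u \<in> L" for t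
    using \<psi>_L[OF y] u L by (simp add: subspace_add subspace_scale)
  define c where "c t = \<psi>' (\<psi> y + s t *\<^sub>R u)" for t
  have "Cinf_on c UNIV" unfolding c_def
    by (rule Cinf_on_compose[OF open_UNIV \<psi>'_open _ \<psi>' Cinf_on_add[OF open_UNIV Cinf_on_const[OF open_UNIV] Cinf_on_scaleR[OF open_UNIV sc Cinf_on_const[OF open_UNIV]]]])
      (use inW in auto)
  moreover have "range c \<subseteq> S" using \<psi>'_S[OF inW inL] by (auto simp: c_def)
  moreover have "c 0 = y" using inv[OF y(1)] by (simp add: c_def s_def)
  moreover have "(c has_vector_derivative D\<psi>' (\<psi> y) u) (at 0)"
  proof -
    have s0: "\<psi> y + s 0 *\<^sub>R u = \<psi> y" by (simp add: s_def)
    have "((\<lambda>t. \<psi> y + s t *\<^sub>R u) has_derivative (\<lambda>t. t *\<^sub>R u)) (at 0)"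
      using sd unfolding has_field_derivative_def by (auto intro!: derivative_eq_intros)
    from has_derivative_compose[OF this, of \<psi>'] Cinf_on_has_derivative[OF \<psi>' imageI[OF y(1)]]
    have "(c has_derivative (\<lambda>t. D\<psi>' (\<psi> y) (t *\<^sub>R u))) (at 0)" by (simp add: c_def[abs_def] s0)
    then show ?thesis unfolding has_vector_derivative_def
      by (simp add: linear_cmul[OF has_derivative_linear[OF Cinf_on_has_derivative[OF \<psi>' imageI[OF y(1)]]]])
  qed
  ultimately show ?thesis by (auto simp: tvec_def)
qed

text \<open>In slice coordinates eventually all secants lie in the closed subspace \<open>L\<close>,
  so their limit does, and \<open>tvecI\<close> supplies a curve.\<close>

lemma secant_tvec:
  assumes x: "x \<in> W" "x \<in> S" and y: "\<And>j. y j \<in> S" "y \<longlonglongrightarrow> x" and \<eta>: "\<And>j. \<eta> j \<noteq> 0" and e: "(\<lambda>j. (y j - x) /\<^sub>R \<eta> j) \<longlonglongrightarrow> e"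
  shows "D\<psi> x e \<in> L" "e \<in> tvec S x"
proof -
  have "(\<lambda>j. (\<psi> (y j) - \<psi> x) /\<^sub>R \<eta> j) \<longlonglongrightarrow> D\<psi> x e"
    by (rule secant_limit[OF Cinf_on_has_derivative[OF \<psi> x(1)] y(2) e \<eta>])
  moreover have "\<forall>\<^sub>F j in sequentially. y j \<in> W" using topological_tendstoD[OF y(2) W x(1)] .
  then have "\<forall>\<^sub>F j in sequentially. (\<psi> (y j) - \<psi> x) /\<^sub>R \<eta> j \<in> L"
    by eventually_elim (use \<psi>_L x y(1) L in \<open>auto intro: subspace_scale subspace_diff\<close>)
  moreover have "closed L" using L by (rule closed_subspace)
  ultimately show "D\<psi> x e \<in> L"
    by (metis Lim_in_closed_set trivial_limit_sequentially)
  from tvecI[OF x this] show "e \<in> tvec S x" by (simp add: D_inv[OF x(1)])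
qed

text \<open>A one-form vanishing on the tangent vectors has zero exterior derivative on them:
  differentiating \<open>\<omega> (\<psi>' a) (D\<psi>' a u) = 0\<close> along \<open>u'\<close>
  expresses the derivative of \<open>\<omega>\<close> by a second derivative of
  \<open>\<psi>'\<close>, which is symmetric in \<open>u\<close> and \<open>u'\<close>.\<close>

lemma second_order:
  fixes \<omega> :: "'a => 'a => real"
  assumes x: "x \<in> W" "x \<in> S" and \<omega>: "\<And>w. Cinf_on (\<lambda>y. \<omega> y w) UNIV" "\<And>y. linear (\<omega> y)"
    and zero: "\<And>y w. y \<in> S ==> w \<in> tvec S y ==> \<omega> y w = 0" and e: "e \<in> tvec S x" "e' \<in> tvec S x"
  shows "fderiv (\<lambda>y. \<omega> y e) x e' = fderiv (\<lambda>y. \<omega> y e') x e"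
proof -
  have uL: "D\<psi> x e \<in> L" if e: "e \<in> tvec S x" for e
  proof -
    obtain y \<eta> where "\<And>j::nat. y j \<in> S" "y \<longlonglongrightarrow> x" "\<And>j. \<eta> j \<noteq> 0" "(\<lambda>j. (y j - x) /\<^sub>R \<eta> j) \<longlonglongrightarrow> e"
      by (rule tvec_secant[OF e]) blast
    then show ?thesis by (rule secant_tvec(1)[OF x])
  qed
  have fd: "linear (\<lambda>v. fderiv (\<lambda>y. \<omega> y w) y v)" for w y
    using Cinf_on_has_derivative[OF \<omega>(1)] has_derivative_linear by blast
  have key: "fderiv (\<lambda>y. \<omega> y (D\<psi>' (\<psi> x) u)) x (D\<psi>' (\<psi> x) u') =
      - \<omega> x (fderiv (\<lambda>v. D\<psi>' v u) ((\<psi> x)) u')" if u: "u \<in> L" "u' \<in> L" for u u'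
  proof -
    define a where "a = \<psi> x"
    have aW: "a \<in> \<psi> ` W" using x by (simp add: a_def)
    let ?l = "\<lambda>s. a + s *\<^sub>R u'"
    have l: "(?l has_derivative (\<lambda>s. s *\<^sub>R u')) (at 0)" by (auto intro!: derivative_eq_intros)
    have \<psi>'a: "\<psi>' a = x" using inv x by (simp add: a_def)
    have d1: "((\<lambda>s. \<psi>' (?l s)) has_derivative (\<lambda>s. D\<psi>' a (s *\<^sub>R u'))) (at 0)"
      using has_derivative_compose[OF l, of \<psi>'] Cinf_on_has_derivative[OF \<psi>' aW] by simp
    have d2: "((\<lambda>s. D\<psi>' (?l s) u) has_derivative (\<lambda>s. fderiv (\<lambda>v. D\<psi>' v u) a (s *\<^sub>R u'))) (at 0)"
      using has_derivative_compose[OF l, of "\<lambda>v. D\<psi>' v u"] Cinf_on_has_derivative[OF Cinf_on_frechet[OF \<psi>'] aW] by simp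
    have d3: "((\<lambda>s. \<omega> (\<psi>' (?l s)) b) has_derivative (\<lambda>s. fderiv (\<lambda>y. \<omega> y b) x (D\<psi>' a (s *\<^sub>R u')))) (at 0)" for b
      using has_derivative_compose[OF d1, of "\<lambda>y. \<omega> y b"] Cinf_on_has_derivative[OF \<omega>(1) UNIV_I, of b x] by (simp add: \<psi>'a)
    have d4: "((\<lambda>s. \<Sum>b\<in>Basis. (D\<psi>' (?l s) u \<bullet> b) *\<^sub>R \<omega> (\<psi>' (?l s)) b) has_derivative
        (\<lambda>s. \<Sum>b\<in>Basis. (D\<psi>' (?l 0) u \<bullet> b) *\<^sub>R fderiv (\<lambda>y. \<omega> y b) x (D\<psi>' a (s *\<^sub>R u')) +
          (fderiv (\<lambda>v. D\<psi>' v u) a (s *\<^sub>R u') \<bullet> b) *\<^sub>R \<omega> (\<psi>' (?l 0)) b)) (at 0)"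
      by (intro has_derivative_sum has_derivative_scaleR has_derivative_inner_left d2 d3)
    have d5: "((\<lambda>s. \<Sum>b\<in>Basis. (D\<psi>' (?l s) u \<bullet> b) *\<^sub>R \<omega> (\<psi>' (?l s)) b) has_derivative (\<lambda>s. 0)) (at 0)"
    proof -
      have o: "open (?l -` (\<psi> ` W))" by (rule open_vimage[OF \<psi>'_open]) (intro continuous_intros)
      have "0 = (\<Sum>b\<in>Basis. (D\<psi>' (?l s) u \<bullet> b) *\<^sub>R \<omega> (\<psi>' (?l s)) b)" if s: "s \<in> ?l -` (\<psi> ` W)" for s
      proof -
        have "?l s \<in> L" using \<psi>_L[OF x] u L by (simp add: a_def subspace_add subspace_scale)
        with s have y: "\<psi>' (?l s) \<in> S" "\<psi>' (?l s) \<in> W" "\<psi> (\<psi>' (?l s)) = ?l s" using \<psi>'_S[of "?l s"] by auto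
        have "\<omega> (\<psi>' (?l s)) (D\<psi>' (?l s) u) = 0" using zero[OF y(1)] tvecI[OF y(2,1) u(1)] y(3) by simp
        then show ?thesis using linear_apply_basis[OF \<omega>(2), of "\<psi>' (?l s)" "D\<psi>' (?l s) u"] by simp
      qed
      from has_derivative_transform_within_open[OF has_derivative_const o _ this] show ?thesis using aW by simp
    qed
    have "(\<Sum>b\<in>Basis. (D\<psi>' a u \<bullet> b) *\<^sub>R fderiv (\<lambda>y. \<omega> y b) x (D\<psi>' a u') +
          (fderiv (\<lambda>v. D\<psi>' v u) a u' \<bullet> b) *\<^sub>R \<omega> x b) = 0"
      using fun_cong[OF has_derivative_unique[OF d4 d5], of 1] by (simp add: \<psi>'a)
    moreover have "(\<Sum>b\<in>Basis. (D\<psi>' a u \<bullet> b) *\<^sub>R fderiv (\<lambda>y. \<omega> y b) x w) = fderiv (\<lambda>y. \<omega> y (D\<psi>' a u)) x w" for w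
    proof -
      have d6: "((\<lambda>y. \<Sum>b\<in>Basis. (D\<psi>' a u \<bullet> b) *\<^sub>R \<omega> y b) has_derivative (\<lambda>w. \<Sum>b\<in>Basis. (D\<psi>' a u \<bullet> b) *\<^sub>R fderiv (\<lambda>y. \<omega> y b) x w)) (at x)"
        by (intro has_derivative_sum has_derivative_scaleR_right Cinf_on_has_derivative[OF \<omega>(1) UNIV_I])
      have eq: "(\<lambda>y. \<Sum>b\<in>Basis. (D\<psi>' a u \<bullet> b) *\<^sub>R \<omega> y b) = (\<lambda>y. \<omega> y (D\<psi>' a u))"
        by (rule ext) (rule linear_apply_basis[OF \<omega>(2), symmetric])
      show ?thesis using fun_cong[OF frechet_derivative_at[OF d6[unfolded eq]], of w] by simp
    qed
    moreover have "(\<Sum>b\<in>Basis. (fderiv (\<lambda>v. D\<psi>' v u) a u' \<bullet> b) *\<^sub>R \<omega> x b) = \<omega> x (fderiv (\<lambda>v. D\<psi>' v u) a u')"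
      by (rule linear_apply_basis[OF \<omega>(2), symmetric])
    ultimately show ?thesis by (simp add: sum.distrib a_def)
  qed
  have sym: "fderiv (\<lambda>v. D\<psi>' v u) ((\<psi> x)) u' = fderiv (\<lambda>v. D\<psi>' v u') ((\<psi> x)) u" for u u'
    by (rule Cinf_on_frechet_sym[OF \<psi>' \<psi>'_open]) (use x in auto)
  show ?thesis
    using key[OF uL[OF e(1)] uL[OF e(2)]] key[OF uL[OF e(2)] uL[OF e(1)]] sym[of "D\<psi> x e" "D\<psi> x e'"]
    by (simp add: D_inv[OF x(1)])
qed

end

section \<open>Sections of an action by automorphisms\<close>

text \<open>\<open>A\<close> is arbitrary. If all points of its graph over \<open>{1..2}\<close>
  were isolated, one isolation radius would serve uncountably many of them; but an infinite bounded
  set has a limit point, near which two of its points are too close.\<close>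

lemma condensation_sequence:
  fixes A :: "real => 'b::{real_normed_vector,heine_borel}"
  assumes bd: "\<And>r. r \<in> {1..2} ==> norm (A r) \<le> M"
  obtains r0 and r :: "nat => real" where "r0 \<in> {1..2}" "\<And>j. r j \<in> {1..2}" "\<And>j. r j \<noteq> r0" "r \<longlonglongrightarrow> r0" "(\<lambda>j. A (r j)) \<longlonglongrightarrow> A r0"
proof -
  define G where "G r = (r, A r)" for r
  have "\<exists>r0\<in>{1..2}. \<forall>n::nat. \<exists>r\<in>{1..2}. r \<noteq> r0 \<and> dist (G r) (G r0) < inverse (real (Suc n))"
  proof (rule ccontr)
    assume neg: "\<not> ?thesis"
    define R where "R n = {r0 \<in> {1..2}. \<forall>r\<in>{1..2}. r \<noteq> r0 \<longrightarrow> inverse (real (Suc n)) \<le> dist (G r) (G r0)}" for n :: nat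
    have cover: "{1..2} \<subseteq> (\<Union>n. R n)"
    proof
      fix x :: real assume x: "x \<in> {1..2}"
      then obtain n :: nat where "\<forall>r\<in>{1..2}. \<not> (r \<noteq> x \<and> dist (G r) (G x) < inverse (real (Suc n)))"
        using neg by blast
      then have "x \<in> R n" using x unfolding R_def by (simp add: not_less) metis
      then show "x \<in> (\<Union>n. R n)" by blast
    qed
    have "\<exists>n. uncountable (R n)"
    proof (rule ccontr)
      assume "\<not> ?thesis"
      then have "countable (\<Union>n. R n)" by (intro countable_UN) auto
      then have "countable {1..2::real}" using cover countable_subset by blast
      then show False using uncountable_closed_interval[of 1 2] by simp
    qed
    then obtain n where "uncountable (R n)" by blast
    then have inf: "infinite (R n)" by (meson countable_finite)
    have injG: "inj G" by (auto simp: G_def inj_def)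
    have "bounded (G ` R n)"
    proof (rule boundedI)
      fix p assume "p \<in> G ` R n"
      then obtain r where "p = (r, A r)" "r \<in> {1..2}" by (auto simp: G_def R_def)
      then show "norm p \<le> 2 + M" using norm_Pair_le[of r "A r"] bd[of r] by auto
    qed
    moreover have "infinite (G ` R n)" using inf injG by (simp add: finite_image_iff inj_on_subset)
    ultimately obtain l where l: "l islimpt (G ` R n)"
      by (metis bounded_infinite_imp_islimpt subset_refl)
    let ?e = "inverse (real (Suc n)) / 2"
    have e: "?e > 0" by simp
    obtain p where p: "p \<in> G ` R n" "p \<noteq> l" "dist p l < ?e" using l e unfolding islimpt_approachable by blast
    obtain q where q: "q \<in> G ` R n" "q \<noteq> l" "dist q l < min ?e (dist p l)"
      using l p(2) e unfolding islimpt_approachable by (metis min_less_iff_conj zero_less_dist_iff)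
    have "p \<noteq> q" using q by auto
    moreover have "dist p q < inverse (real (Suc n))"
      using dist_triangle2[of p q l] p q by simp
    moreover obtain x y where "p = G x" "q = G y" "x \<in> {1..2}" "y \<in> R n" using p(1) q(1) by (auto simp: R_def)
    ultimately show False unfolding R_def by force
  qed
  then obtain r0 where r0: "r0 \<in> {1..2}" "\<And>n::nat. \<exists>r\<in>{1..2}. r \<noteq> r0 \<and> dist (G r) (G r0) < inverse (real (Suc n))" by blast
  then obtain r where r: "\<And>n::nat. r n \<in> {1..2} \<and> r n \<noteq> r0 \<and> dist (G (r n)) (G r0) < inverse (real (Suc n))" by metis
  have "(\<lambda>n. dist (G (r n)) (G r0)) \<longlonglongrightarrow> 0"
    by (rule tendsto_sandwich[OF _ _ tendsto_const LIMSEQ_inverse_real_of_nat])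
      (use r in \<open>auto intro!: always_eventually less_imp_le\<close>)
  then have "(\<lambda>n. G (r n)) \<longlonglongrightarrow> G r0" using tendsto_dist_iff by blast
  then have "r \<longlonglongrightarrow> r0" "(\<lambda>j. A (r j)) \<longlonglongrightarrow> A r0" using tendsto_fst tendsto_snd by (fastforce simp: G_def)+
  then show ?thesis using that r0 r by blast
qed

section \<open>Limits of automorphisms\<close>

context heisenberg_model
begin

lemma blinfun_linear: "linear h ==> blinfun_apply (Blinfun h) = h" for h :: "'n => 'n"
  by (simp add: bounded_linear_Blinfun_apply linear_conv_bounded_linear)

lemma norm_aut: "aut (blinfun_apply A) ==> norm A \<le> 1"
  by (rule norm_blinfun_bound) (auto simp: autD)

lemma bounded_linear_limits:
  "A \<longlonglongrightarrow> a ==> (\<lambda>j. blinfun_apply (A j) x) \<longlonglongrightarrow> a x" for A :: "nat => 'n \<Rightarrow>\<^sub>L 'n"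
  by (intro blinfun.tendsto tendsto_const)

lemmas pv_tendsto = bounded_linear.tendsto[OF bounded_linears(2)]
lemmas pz_tendsto = bounded_linear.tendsto[OF bounded_linears(3)]
lemmas N_tendsto = bounded_bilinear.tendsto[OF bounded_bilinear_N]

lemma aut_limit:
  fixes A :: "nat => 'n \<Rightarrow>\<^sub>L 'n"
  assumes A: "\<And>j. aut (A j)" and lim: "A \<longlonglongrightarrow> a"
  shows "aut a"
proof -
  note l = bounded_linear_limits[OF lim] and d = autD[OF A]
  have "linear a" by (simp add: bounded_linear.linear blinfun.bounded_linear_right)
  moreover have "a x \<bullet> a y = x \<bullet> y" for x y
    by (rule LIMSEQ_unique[OF tendsto_inner[OF l l]]) (simp add: d)
  moreover have "a B = B" by (rule LIMSEQ_unique[OF l]) (simp add: d)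
  moreover have "pv (a x) = a (pv x)" for x
    by (rule LIMSEQ_unique[OF pv_tendsto[OF l]]) (simp add: d l)
  moreover have "pz (a x) = a (pz x)" for x
    by (rule LIMSEQ_unique[OF pz_tendsto[OF l]]) (simp add: d l)
  moreover have "N (a x) (a y) = a (N x y)" for x y
    by (rule LIMSEQ_unique[OF N_tendsto[OF l l]]) (simp add: d l)
  ultimately show ?thesis by (simp add: aut_def)
qed

text \<open>With \<open>E j\<close> the difference quotient, the quadratic identities of
  automorphisms become those of derivations plus \<open>\<gamma> j\<close> times a quadratic term in
  \<open>E j\<close>, which disappears in the limit.\<close>

lemma der_limit:
  fixes A :: "nat => 'n \<Rightarrow>\<^sub>L 'n"
  assumes A: "\<And>j. aut (A j)" and \<gamma>: "\<And>j. \<gamma> j \<noteq> 0" "\<gamma> \<longlonglongrightarrow> 0" and lim: "(\<lambda>j. (A j - id_blinfun) /\<^sub>R \<gamma> j) \<longlonglongrightarrow> D"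
  shows "der D"
proof -
  define E where "E j = (A j - id_blinfun) /\<^sub>R \<gamma> j" for j
  note l = bounded_linear_limits[OF lim[folded E_def]] and d = autD[OF A]
  have A_eq: "A j x = x + \<gamma> j *\<^sub>R E j x" for j x
    using \<gamma>(1)[of j] by (simp add: E_def blinfun.bilinear_simps)
  have sc: "\<gamma> j *\<^sub>R x = 0 ==> x = 0" for j and x :: 'n using \<gamma>(1)[of j] by simp
  have lin: "linear (E j)" for j by (simp add: bounded_linear.linear blinfun.bounded_linear_right)
  have "linear D" by (simp add: bounded_linear.linear blinfun.bounded_linear_right)
  moreover have "D x \<bullet> y = - (x \<bullet> D y)" for x y
  proof -
    have "E j x \<bullet> y + x \<bullet> E j y + \<gamma> j * (E j x \<bullet> E j y) = 0" for j
    proof -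
      have "\<gamma> j * (E j x \<bullet> y + x \<bullet> E j y + \<gamma> j * (E j x \<bullet> E j y)) = A j x \<bullet> A j y - x \<bullet> y"
        unfolding A_eq by (simp add: inner_add_left inner_add_right algebra_simps)
      then show ?thesis using \<gamma>(1)[of j] by (simp add: d)
    qed
    moreover have "(\<lambda>j. E j x \<bullet> y + x \<bullet> E j y + \<gamma> j * (E j x \<bullet> E j y)) \<longlonglongrightarrow> D x \<bullet> y + x \<bullet> D y + 0 * (D x \<bullet> D y)"
      by (intro tendsto_intros l \<gamma>)
    ultimately have "D x \<bullet> y + x \<bullet> D y + 0 * (D x \<bullet> D y) = 0" by (simp add: LIMSEQ_const_iff)
    then show ?thesis by simp
  qed
  moreover have "D B = 0"
  proof (rule LIMSEQ_unique[OF l])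
    have "E j B = 0" for j using A_eq[of j B] by (simp add: d \<gamma>)
    then show "(\<lambda>j. E j B) \<longlonglongrightarrow> 0" by simp
  qed
  moreover have "pv (D x) = D (pv x)" for x
  proof (rule LIMSEQ_unique[OF pv_tendsto[OF l]])
    have "pv (E j x) = E j (pv x)" for j
    proof -
      have "\<gamma> j *\<^sub>R (pv (E j x) - E j (pv x)) = pv (A j x) - A j (pv x)" unfolding A_eq by (simp add: algebra_simps)
      then show ?thesis using sc[of j "pv (E j x) - E j (pv x)"] by (simp add: d)
    qed
    then show "(\<lambda>j. pv (E j x)) \<longlonglongrightarrow> D (pv x)" by (simp add: l)
  qed
  moreover have "pz (D x) = D (pz x)" for x
  proof (rule LIMSEQ_unique[OF pz_tendsto[OF l]])
    have "pz (E j x) = E j (pz x)" for j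
    proof -
      have "\<gamma> j *\<^sub>R (pz (E j x) - E j (pz x)) = pz (A j x) - A j (pz x)" unfolding A_eq by (simp add: algebra_simps)
      then show ?thesis using sc[of j "pz (E j x) - E j (pz x)"] by (simp add: d)
    qed
    then show "(\<lambda>j. pz (E j x)) \<longlonglongrightarrow> D (pz x)" by (simp add: l)
  qed
  moreover have "D (N x y) = N (D x) y + N x (D y)" for x y
  proof -
    have "E j (N x y) = N (E j x) y + N x (E j y) + \<gamma> j *\<^sub>R N (E j x) (E j y)" for j
    proof -
      have "\<gamma> j *\<^sub>R (E j (N x y) - (N (E j x) y + N x (E j y) + \<gamma> j *\<^sub>R N (E j x) (E j y))) = A j (N x y) - N (A j x) (A j y)"
        unfolding A_eq by (simp add: algebra_simps)
      then show ?thesis using sc[of j "E j (N x y) - (N (E j x) y + N x (E j y) + \<gamma> j *\<^sub>R N (E j x) (E j y))"] by (simp add: d)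
    qed
    moreover have "(\<lambda>j. N (E j x) y + N x (E j y) + \<gamma> j *\<^sub>R N (E j x) (E j y)) \<longlonglongrightarrow> N (D x) y + N x (D y) + 0 *\<^sub>R N (D x) (D y)"
      by (intro tendsto_add tendsto_scaleR N_tendsto l \<gamma> tendsto_const)
    ultimately have "(\<lambda>j. E j (N x y)) \<longlonglongrightarrow> N (D x) y + N x (D y) + 0 *\<^sub>R N (D x) (D y)" by simp
    from LIMSEQ_unique[OF l this] show ?thesis by simp
  qed
  ultimately show ?thesis by (simp add: der_def)
qed

text \<open>Compactness allows the distance to the identity to be minimized over the
  stabilizer.\<close>

lemma compact_stabilizer: "compact {T :: 'n \<Rightarrow>\<^sub>L 'n. aut T \<and> T x = x}"
  unfolding compact_eq_bounded_closed
proof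
  show "bounded {T :: 'n \<Rightarrow>\<^sub>L 'n. aut T \<and> T x = x}" using norm_aut by (auto simp: bounded_iff)
  show "closed {T :: 'n \<Rightarrow>\<^sub>L 'n. aut T \<and> T x = x}"
    unfolding closed_sequential_limits
  proof safe
    fix A :: "nat => 'n \<Rightarrow>\<^sub>L 'n" and a assume A: "\<forall>n. A n \<in> {T :: 'n \<Rightarrow>\<^sub>L 'n. aut T \<and> T x = x}" "A \<longlonglongrightarrow> a"
    show "aut a" by (rule aut_limit[OF _ A(2)]) (use A(1) in auto)
    show "a x = x" by (rule LIMSEQ_unique[OF bounded_linear_limits[OF A(2)]]) (use A(1) in auto)
  qed
qed

end

text \<open>A section in coordinates: \<open>secant\<close> and \<open>exterior\<close> carry the
  submanifold structure, \<open>meets\<close> expresses that the isotropy group acts by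
  automorphisms, and \<open>orth\<close> is orthogonality to the orbit directions given by
  flows.\<close>

locale polar_section = heisenberg_model +
  fixes S :: "'a set"
  assumes closed: "closed S" and meets: "\<exists>h. aut h \<and> h x \<in> S"
    and secant: "(\<And>j. y j \<in> S) ==> y \<longlonglongrightarrow> x ==> (\<And>j. \<eta> j \<noteq> 0) ==> (\<lambda>j. (y j - x) /\<^sub>R \<eta> j) \<longlonglongrightarrow> e' ==> e' \<in> tvec S x"
    and exterior: "x \<in> S ==> (\<And>w. Cinf_on (\<lambda>y. \<omega> y w) UNIV) ==> (\<And>y. linear (\<omega> y)) ==>
      (\<And>y w. y \<in> S ==> w \<in> tvec S y ==> \<omega> y w = (0 :: real)) ==> e1 \<in> tvec S x ==> e2 \<in> tvec S x ==>
      fderiv (\<lambda>y. \<omega> y e1) x e2 = fderiv (\<lambda>y. \<omega> y e2) x e1"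
    and orth: "der D ==> x \<in> S ==> w \<in> tvec S x ==> th x (D x) \<bullet> th x w = 0"
begin

text \<open>Up to the stabilizer of \<open>x\<close> the automorphisms \<open>C j\<close> can be chosen closest to the identity; then
  they move \<open>x\<close> at a speed comparable to that of \<open>x j\<close>, since otherwise a flow inside the stabilizer would bring
  them closer still.\<close>

lemma tangent_mod_der:
  fixes C :: "nat => 'a \<Rightarrow>\<^sub>L 'a"
  assumes C: "\<And>j. aut (C j)" "C \<longlonglongrightarrow> id_blinfun" and xs: "xs \<longlonglongrightarrow> x" "\<And>j. C j (xs j) \<in> S"
    and \<eta>: "\<And>j. \<eta> j \<noteq> 0" "\<eta> \<longlonglongrightarrow> 0" and e: "(\<lambda>j. (xs j - x) /\<^sub>R \<eta> j) \<longlonglongrightarrow> e"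
  shows "x \<in> S" "\<exists>D. der D \<and> e + D x \<in> tvec S x"
proof -
  have Cxs: "(\<lambda>j. C j (xs j)) \<longlonglongrightarrow> x"
    using blinfun.tendsto[OF C(2) xs(1)] by simp
  show xS: "x \<in> S" using closed_sequentially[OF closed _ Cxs] xs(2) by blast
  define K where "K = {T :: 'a \<Rightarrow>\<^sub>L 'a. aut T \<and> T x = x}"
  have idK: "id_blinfun \<in> K" using aut_id by (simp add: K_def id_def)
  have "\<exists>T\<in>K. \<forall>T'\<in>K. norm ((C j o\<^sub>L T) - id_blinfun) \<le> norm ((C j o\<^sub>L T') - id_blinfun)" for j
  proof (rule continuous_attains_inf)
    show "compact K" unfolding K_def by (rule compact_stabilizer)
  qed (use idK in \<open>auto intro!: continuous_intros\<close>)
  then obtain T where T: "\<And>j. T j \<in> K" "\<And>j T'. T' \<in> K ==> norm ((C j o\<^sub>L T j) - id_blinfun) \<le> norm ((C j o\<^sub>L T') - id_blinfun)"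
    by metis
  define Bj where "Bj j = C j o\<^sub>L T j" for j
  define \<beta> where "\<beta> j = norm (Bj j - id_blinfun)" for j
  have autB: "aut (Bj j)" for j
    using aut_compose[OF C(1)[of j], of "T j"] T(1)[of j] by (simp add: Bj_def K_def blinfun_compose.rep_eq)
  have Bx: "Bj j x = C j x" for j using T(1)[of j] by (simp add: Bj_def K_def)
  have "\<beta> j \<le> norm (C j - id_blinfun)" for j
  proof -
    have "C j o\<^sub>L id_blinfun = C j" by (rule blinfun_eqI) simp
    then show ?thesis using T(2)[OF idK, of j] unfolding \<beta>_def Bj_def by metis
  qed
  moreover have "(\<lambda>j. norm (C j - id_blinfun)) \<longlonglongrightarrow> 0"
    using C(2) by (intro tendsto_norm_zero) (simp add: LIM_zero)
  ultimately have \<beta>0: "\<beta> \<longlonglongrightarrow> 0"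
    by (intro tendsto_sandwich[of "\<lambda>_. 0" \<beta> sequentially "\<lambda>j. norm (C j - id_blinfun)"]) (auto simp: \<beta>_def)
  \<comment> \<open>Dividing by the larger of the two scales keeps both quotients bounded, so a
    subsequence converges to a pair \<open>(D, c)\<close>. The case \<open>c = 0\<close>, in which
    the automorphisms move on a larger scale than the points, has to be excluded.\<close>
  define \<gamma> where "\<gamma> j = max (\<beta> j) \<bar>\<eta> j\<bar>" for j
  have \<gamma>: "\<gamma> j > 0" "\<beta> j \<le> \<gamma> j" "\<bar>\<eta> j\<bar> \<le> \<gamma> j" for j using \<eta>(1)[of j] by (auto simp: \<gamma>_def)
  have \<gamma>0: "\<gamma> \<longlonglongrightarrow> 0" unfolding \<gamma>_def using tendsto_max[OF \<beta>0 tendsto_rabs[OF \<eta>(2)]] by simp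
  define u where "u j = ((Bj j - id_blinfun) /\<^sub>R \<gamma> j, \<eta> j / \<gamma> j)" for j
  have "bounded (range u)"
  proof (rule boundedI)
    fix p assume "p \<in> range u"
    then obtain j where j: "p = u j" by blast
    have "norm ((Bj j - id_blinfun) /\<^sub>R \<gamma> j) \<le> 1" "norm (\<eta> j / \<gamma> j) \<le> 1"
      using \<gamma>[of j] by (simp_all add: \<beta>_def[symmetric] divide_simps mult.commute)
    then show "norm p \<le> 2" using norm_Pair_le[of "(Bj j - id_blinfun) /\<^sub>R \<gamma> j" "\<eta> j / \<gamma> j"] by (simp add: j u_def)
  qed
  then obtain l s where s: "strict_mono (s :: nat => nat)" "(u \<circ> s) \<longlonglongrightarrow> l"
    using bounded_imp_convergent_subsequence by blast
  obtain D c where l: "l = (D, c)" by (cases l)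
  have lD: "(\<lambda>j. (Bj (s j) - id_blinfun) /\<^sub>R \<gamma> (s j)) \<longlonglongrightarrow> D" and lc: "(\<lambda>j. \<eta> (s j) / \<gamma> (s j)) \<longlonglongrightarrow> c"
    using tendsto_fst[OF s(2)] tendsto_snd[OF s(2)] by (simp_all add: u_def l o_def)
  have sub: "f \<longlonglongrightarrow> a ==> (\<lambda>j. f (s j)) \<longlonglongrightarrow> a" for f :: "nat => 'z::topological_space" and a
    using LIMSEQ_subseq_LIMSEQ[OF _ s(1)] by (simp add: o_def)
  have dD: "der D"
    by (rule der_limit[OF autB _ sub[OF \<gamma>0] lD]) (use \<gamma>(1) in \<open>auto simp: less_imp_neq[symmetric]\<close>)
  have main: "(\<lambda>j. (C (s j) (xs (s j)) - x) /\<^sub>R \<gamma> (s j)) \<longlonglongrightarrow> c *\<^sub>R e + D x"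
  proof -
    have "(\<lambda>j. (\<eta> (s j) / \<gamma> (s j)) *\<^sub>R C (s j) ((xs (s j) - x) /\<^sub>R \<eta> (s j)) + ((Bj (s j) - id_blinfun) /\<^sub>R \<gamma> (s j)) x) \<longlonglongrightarrow>
        c *\<^sub>R id_blinfun e + D x"
      by (intro tendsto_add tendsto_scaleR lc blinfun.tendsto sub[OF C(2)] sub[OF e] lD tendsto_const)
    moreover have "(\<eta> j / \<gamma> j) *\<^sub>R C j ((xs j - x) /\<^sub>R \<eta> j) + ((Bj j - id_blinfun) /\<^sub>R \<gamma> j) x = (C j (xs j) - x) /\<^sub>R \<gamma> j" for j
    proof -
      have e: "\<eta> j * inverse (\<gamma> j) * inverse (\<eta> j) = inverse (\<gamma> j)" using \<eta>(1)[of j] by (simp add: mult.commute)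
      show ?thesis by (simp add: blinfun.bilinear_simps Bx divide_inverse scaleR_diff_right e)
    qed
    ultimately show ?thesis by simp
  qed
  show "\<exists>D. der D \<and> e + D x \<in> tvec S x"
  proof (cases "c = 0")
    case False
    have M: "(\<lambda>j. inverse (\<eta> (s j) / \<gamma> (s j)) *\<^sub>R ((C (s j) (xs (s j)) - x) /\<^sub>R \<gamma> (s j))) \<longlonglongrightarrow> inverse c *\<^sub>R (c *\<^sub>R e + D x)"
      by (intro tendsto_scaleR tendsto_inverse lc False main)
    have eq: "inverse (\<eta> j / \<gamma> j) *\<^sub>R ((C j (xs j) - x) /\<^sub>R \<gamma> j) = (C j (xs j) - x) /\<^sub>R \<eta> j" for j
      using \<gamma>(1)[of j] by (simp add: divide_inverse)
    have "(\<lambda>j. (C (s j) (xs (s j)) - x) /\<^sub>R \<eta> (s j)) \<longlonglongrightarrow> e + inverse c *\<^sub>R D x"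
      using M[unfolded eq] False by (simp add: scaleR_add_right)
    then have "e + inverse c *\<^sub>R D x \<in> tvec S x"
      by (intro secant[of "\<lambda>j. C (s j) (xs (s j))" x "\<lambda>j. \<eta> (s j)"]) (use xs(2) sub[OF Cxs] \<eta>(1) in auto)
    then show ?thesis using der_scale[OF dD] by blast
  next
    case True
    \<comment> \<open>Here \<open>D x\<close> is tangent to the section and also an orbit direction,
      so it is orthogonal to itself; hence the flow of \<open>D\<close> lies in the stabilizer of
      \<open>x\<close>.\<close>
    have "D x \<in> tvec S x"
      by (rule secant[OF _ sub[OF Cxs], of "\<lambda>j. \<gamma> (s j)"])
        (use xs(2) \<gamma>(1) main True in \<open>auto simp: less_imp_neq[symmetric]\<close>)
    from orth[OF dD xS this] have "th x (D x) = 0" by simp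
    then have "Xm x (th x (D x)) = Xm x 0" by simp
    then have Dx: "D x = 0" by (simp add: linear_0[OF lin_Xm])
    \<comment> \<open>To first order this factor cancels the deviation of \<open>Bj\<close> from the
      identity, so the new distance divided by \<open>\<gamma>\<close> tends to 0. By minimality it
      is at least \<open>\<beta>\<close>, which eventually equals \<open>\<gamma>\<close>.\<close>
    define F where "F j = Blinfun (flow D (- \<gamma> (s j)))" for j
    have F: "blinfun_apply (F j) = flow D (- \<gamma> (s j))" for j
      unfolding F_def by (rule blinfun_linear[OF autD(1)[OF aut_flow[OF dD]]])
    have "flow D t x = x" for t
      by (rule skew_ode_unique[OF dD flow_has_derivative[OF dD], where v = "\<lambda>t. x"])
        (auto simp: Dx flow_0[OF derD(1)[OF dD]])
    then have FK: "T (s j) o\<^sub>L F j \<in> K" for j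
      using T(1)[of "s j"] aut_compose[OF _ aut_flow[OF dD], of "T (s j)" "- \<gamma> (s j)"] F[of j] by (simp add: K_def blinfun_compose.rep_eq)
    have "(\<lambda>j. (F j - id_blinfun) /\<^sub>R \<gamma> (s j)) \<longlonglongrightarrow> - D"
    proof (rule tendsto_componentwise1)
      fix b :: 'a
      have 1: "(\<lambda>j. - \<gamma> (s j)) \<longlonglongrightarrow> 0" using tendsto_minus[OF sub[OF \<gamma>0]] by simp
      have 2: "(\<lambda>j. (- \<gamma> (s j) - 0) /\<^sub>R \<gamma> (s j)) \<longlonglongrightarrow> -1"
        using \<gamma>(1) by (simp add: less_imp_neq[symmetric])
      have "(\<lambda>j. (flow D (- \<gamma> (s j)) b - flow D 0 b) /\<^sub>R \<gamma> (s j)) \<longlonglongrightarrow> (-1) *\<^sub>R D (flow D 0 b)"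
        by (rule secant_limit[OF flow_has_derivative[OF dD, unfolded has_vector_derivative_def] 1 2])
          (use \<gamma>(1) in \<open>auto simp: less_imp_neq[symmetric]\<close>)
      then show "(\<lambda>j. ((F j - id_blinfun) /\<^sub>R \<gamma> (s j)) b) \<longlonglongrightarrow> (- D) b"
        by (simp add: F blinfun.bilinear_simps flow_0[OF derD(1)[OF dD]])
    qed
    then have "(\<lambda>j. (Bj (s j) o\<^sub>L ((F j - id_blinfun) /\<^sub>R \<gamma> (s j))) + (Bj (s j) - id_blinfun) /\<^sub>R \<gamma> (s j)) \<longlonglongrightarrow> (id_blinfun o\<^sub>L (- D)) + D"
    proof (intro tendsto_add bounded_bilinear.tendsto[OF bounded_bilinear_blinfun_compose] lD)
      have "(\<lambda>j. Bj j - id_blinfun) \<longlonglongrightarrow> 0" using \<beta>0 unfolding \<beta>_def by (rule tendsto_norm_zero_cancel)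
      then show "(\<lambda>j. Bj (s j)) \<longlonglongrightarrow> id_blinfun" using sub LIM_zero_cancel by blast
    qed
    moreover have "(Bj (s j) o\<^sub>L ((F j - id_blinfun) /\<^sub>R \<gamma> (s j))) + (Bj (s j) - id_blinfun) /\<^sub>R \<gamma> (s j) =
        ((C (s j) o\<^sub>L (T (s j) o\<^sub>L F j)) - id_blinfun) /\<^sub>R \<gamma> (s j)" for j
      by (rule blinfun_eqI) (simp add: Bj_def blinfun.bilinear_simps algebra_simps)
    moreover have "(id_blinfun o\<^sub>L (- D)) + D = 0" by (rule blinfun_eqI) (simp add: blinfun.bilinear_simps)
    ultimately have "(\<lambda>j. ((C (s j) o\<^sub>L (T (s j) o\<^sub>L F j)) - id_blinfun) /\<^sub>R \<gamma> (s j)) \<longlonglongrightarrow> 0"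
      by simp
    then have lim: "(\<lambda>j. norm (((C (s j) o\<^sub>L (T (s j) o\<^sub>L F j)) - id_blinfun) /\<^sub>R \<gamma> (s j))) \<longlonglongrightarrow> 0"
      by (rule tendsto_norm_zero)
    have "\<beta> j \<le> norm ((C j o\<^sub>L T') - id_blinfun)" if "T' \<in> K" for j T' using T(2)[OF that] by (simp add: \<beta>_def Bj_def)
    then have ge: "\<beta> (s j) / \<gamma> (s j) \<le> norm (((C (s j) o\<^sub>L (T (s j) o\<^sub>L F j)) - id_blinfun) /\<^sub>R \<gamma> (s j))" for j
      using FK[of j] \<gamma>(1)[of "s j"] by (simp add: divide_inverse mult.commute)
    have "\<forall>\<^sub>F j in sequentially. \<bar>\<eta> (s j) / \<gamma> (s j)\<bar> < 1"
      using tendsto_rabs[OF lc] True by (intro order_tendstoD) auto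
    then have "\<forall>\<^sub>F j in sequentially. 1 \<le> norm (((C (s j) o\<^sub>L (T (s j) o\<^sub>L F j)) - id_blinfun) /\<^sub>R \<gamma> (s j))"
    proof eventually_elim
      case (elim j)
      have "\<bar>\<eta> (s j)\<bar> < \<gamma> (s j)" using elim \<gamma>(1)[of "s j"] by (simp add: abs_divide)
      then have "\<beta> (s j) = \<gamma> (s j)" by (auto simp: \<gamma>_def max_def split: if_splits)
      then show ?case using ge[of j] \<gamma>(1)[of "s j"] by simp
    qed
    from tendsto_lowerbound[OF lim this] show ?thesis by simp
  qed
qed

end

section \<open>Skew derivations of the algebra\<close>

context heisenberg_model
begin

lemma decomp_pz_span: "pz x = x ==> lam x = 0 \<and> pv x = 0"
  using lam_pz[of x] pv_pz[of x] by simp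

lemma unit_vectors: "\<exists>u. pv u = u \<and> u \<bullet> u = 1" "\<exists>a. pz a = a \<and> a \<bullet> a = 1"
proof -
  have n: "(x /\<^sub>R norm x) \<bullet> (x /\<^sub>R norm x) = 1" if "x \<noteq> 0" for x :: 'n
    using that by (simp add: dot_square_norm power2_eq_square)
  obtain x where "pv x \<noteq> 0" using nontrivial(1) by blast
  then show "\<exists>u. pv u = u \<and> u \<bullet> u = 1" using n[of "pv x"] by (intro exI[of _ "pv x /\<^sub>R norm (pv x)"]) simp
  obtain x where "pz x \<noteq> 0" using nontrivial(2) by blast
  then show "\<exists>a. pz a = a \<and> a \<bullet> a = 1" using n[of "pz x"] by (intro exI[of _ "pz x /\<^sub>R norm (pz x)"]) simp
qed


text \<open>Pairing with \<open>w\<close> turns the product rule for \<open>N\<close> into the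
  commutator rule for \<open>J\<close>, which is easier to check on Clifford products.\<close>

lemma derI:
  assumes lin: "linear C" and skew: "\<And>x y. C x \<bullet> y = - (x \<bullet> C y)" and C: "C B = 0" "\<And>x. pv (C x) = C (pv x)" "\<And>x. pz (C x) = C (pz x)"
    and J: "\<And>w x. C (J w x) - J w (C x) = J (C w) x"
  shows "der C"
  unfolding der_def
proof (intro conjI allI lin skew C)
  fix x y
  have "C (N x y) \<bullet> w = (N (C x) y + N x (C y)) \<bullet> w" for w
  proof -
    have "C (N x y) \<bullet> w = - (J (C w) x \<bullet> y)" by (simp add: skew J_inner)
    also have "\<dots> = J w (C x) \<bullet> y - C (J w x) \<bullet> y" by (simp add: inner_diff_left flip: J)
    also have "\<dots> = (N (C x) y + N x (C y)) \<bullet> w" by (simp add: skew J_inner inner_add_left)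
    finally show ?thesis .
  qed
  then show "C (N x y) = N (C x) y + N x (C y)" using vector_eq_rdot by blast
qed

lemma J_move: "J a (J b x) = - J b (J a x) - (2 * (pz a \<bullet> pz b)) *\<^sub>R pv x"
  using J_anticommute[of a b x] by (simp add: algebra_simps eq_neg_iff_add_eq_0)

lemma inner_pz: "pz a = a ==> pz w \<bullet> a = w \<bullet> a"
  using pz_sym[of w a] by simp

text \<open>An infinitesimal rotation in the plane of \<open>a\<close>, \<open>b\<close>, lifted to
  \<open>v\<close>: the commutator of \<open>J a\<close> composed with \<open>J b\<close> and
  \<open>J w\<close> is \<open>2 * (w \<bullet> a)\<close> times \<open>J b\<close> minus
  \<open>2 * (w \<bullet> b)\<close> times \<open>J a\<close>, whence the factor 2 on
  \<open>z\<close>.\<close>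

lemma der_rotation:
  assumes ab: "pz a = a" "pz b = b" "a \<bullet> b = 0"
  shows "der (\<lambda>x. J a (J b x) + 2 *\<^sub>R ((x \<bullet> a) *\<^sub>R b - (x \<bullet> b) *\<^sub>R a))"
proof (rule derI)
  show "linear (\<lambda>x. J a (J b x) + 2 *\<^sub>R ((x \<bullet> a) *\<^sub>R b - (x \<bullet> b) *\<^sub>R a))"
    by (auto simp: linear_iff inner_add_left algebra_simps)
  have sk: "J a (J b x) \<bullet> y = - (x \<bullet> J a (J b y))" for x y
    using J_skew[of a "J b x" y] J_skew[of b x "J a y"] J_move[of b a y] ab by (simp add: inner_commute)
  show "(J a (J b x) + 2 *\<^sub>R ((x \<bullet> a) *\<^sub>R b - (x \<bullet> b) *\<^sub>R a)) \<bullet> y = - (x \<bullet> (J a (J b y) + 2 *\<^sub>R ((y \<bullet> a) *\<^sub>R b - (y \<bullet> b) *\<^sub>R a)))" for x y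
    using sk[of x y] by (simp add: inner_add_left inner_add_right inner_diff_left inner_diff_right inner_commute[of a] inner_commute[of b] algebra_simps)
  have z: "B \<bullet> a = 0" "B \<bullet> b = 0" "pv x \<bullet> a = 0" "pv x \<bullet> b = 0" "pv a = 0" "pv b = 0" "J w x \<bullet> a = 0" "J w x \<bullet> b = 0" for x w
    using pz_sym[of B a] pz_sym[of B b] pz_sym[of "pv x" a] pz_sym[of "pv x" b] decomp_pz_span[OF ab(1)] decomp_pz_span[OF ab(2)]
      pz_sym[of "J w x" a] pz_sym[of "J w x" b] ab by (simp_all add: inner_commute)
  show "J a (J b B) + 2 *\<^sub>R ((B \<bullet> a) *\<^sub>R b - (B \<bullet> b) *\<^sub>R a) = 0" by (simp add: z)
  show "pv (J a (J b x) + 2 *\<^sub>R ((x \<bullet> a) *\<^sub>R b - (x \<bullet> b) *\<^sub>R a)) = J a (J b (pv x)) + 2 *\<^sub>R ((pv x \<bullet> a) *\<^sub>R b - (pv x \<bullet> b) *\<^sub>R a)" for x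
    by (simp add: z)
  show "pz (J a (J b x) + 2 *\<^sub>R ((x \<bullet> a) *\<^sub>R b - (x \<bullet> b) *\<^sub>R a)) = J a (J b (pz x)) + 2 *\<^sub>R ((pz x \<bullet> a) *\<^sub>R b - (pz x \<bullet> b) *\<^sub>R a)" for x
    by (simp add: ab inner_pz)
  show "J a (J b (J w x)) + 2 *\<^sub>R ((J w x \<bullet> a) *\<^sub>R b - (J w x \<bullet> b) *\<^sub>R a) -
      J w (J a (J b x) + 2 *\<^sub>R ((x \<bullet> a) *\<^sub>R b - (x \<bullet> b) *\<^sub>R a)) =
      J (J a (J b w) + 2 *\<^sub>R ((w \<bullet> a) *\<^sub>R b - (w \<bullet> b) *\<^sub>R a)) x" for w x
  proof -
    have "J a (J b (J w x)) = J w (J a (J b x)) + (2 * (w \<bullet> a)) *\<^sub>R J b x - (2 * (w \<bullet> b)) *\<^sub>R J a x"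
    proof -
      have p: "pz b \<bullet> pz w = w \<bullet> b" "pz a \<bullet> pz w = w \<bullet> a" by (simp_all add: ab inner_pz inner_commute[of _ "pz w"])
      have "J b (J w x) = - J w (J b x) - (2 * (w \<bullet> b)) *\<^sub>R pv x" "J a (J w (J b x)) = - J w (J a (J b x)) - (2 * (w \<bullet> a)) *\<^sub>R J b x"
        using J_move[of b w x] J_move[of a w "J b x"] unfolding p by simp_all
      then show ?thesis by simp
    qed
    moreover have "J w a = 0" "J w b = 0" for w using J_of_pz[of w a] J_of_pz[of w b] ab by simp_all
    ultimately show ?thesis by (simp add: z algebra_simps)
  qed
qed

lemma der_J:
  assumes a: "pz a = a" "a \<bullet> a = 1" and one: "\<And>x. pz x = (x \<bullet> a) *\<^sub>R a"
  shows "der (J a)"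
proof (rule derI[OF lin_J J_skew])
  show "J a (J w x) - J w (J a x) = J (J a w) x" for w x
  proof -
    have w: "J w x = (w \<bullet> a) *\<^sub>R J a x" for x using J_pz[of w x] one[of w] by simp
    show ?thesis by (simp add: w)
  qed
qed simp_all

text \<open>With \<open>u\<close>, \<open>J a u\<close>, \<open>J b u\<close>,
  \<open>J a (J b u)\<close> read as 1, i, j, k, this is right multiplication by i on the
  quaternionic line of \<open>u\<close>, and 0 on its complement. It commutes with the left
  multiplications \<open>J a\<close>, \<open>J b\<close>, so it can act as 0 on
  \<open>z\<close>.\<close>

lemma der_quaternionic:
  assumes ab: "pz a = a" "pz b = b" "a \<bullet> a = 1" "b \<bullet> b = 1" "a \<bullet> b = 0"
    and two: "\<And>x. pz x = (x \<bullet> a) *\<^sub>R a + (x \<bullet> b) *\<^sub>R b" and u: "pv u = u"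
  shows "der (\<lambda>x. (x \<bullet> u) *\<^sub>R J a u - (x \<bullet> J a u) *\<^sub>R u - (x \<bullet> J b u) *\<^sub>R J a (J b u) + (x \<bullet> J a (J b u)) *\<^sub>R J b u)"
    (is "der ?C")
proof (rule derI)
  show "linear ?C" by (auto simp: linear_iff inner_add_left algebra_simps)
  show "?C x \<bullet> y = - (x \<bullet> ?C y)" for x y
    by (simp add: inner_add_left inner_add_right inner_diff_left inner_diff_right inner_commute algebra_simps)
  have J: "x \<bullet> J c w = pv x \<bullet> J c w" "x \<bullet> u = pv x \<bullet> u" for x c w
    using pv_sym[of x "J c w"] pv_sym[of x u] u by simp_all
  show "?C B = 0" using J[of B] by simp
  show "pv (?C x) = ?C (pv x)" for x using J[of x] by (simp add: u)
  show "pz (?C x) = ?C (pz x)" for x using J[of "pz x"] pz_pv[of u] by (simp add: u)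
  have ba: "J b (J a w) = - J a (J b w)" for w using J_move[of b a w] ab by (simp add: inner_commute)
  have sq: "J a (J a w) = - pv w" "J b (J b w) = - pv w" for w by (simp_all add: J_J ab)
  have in': "J a x \<bullet> w = - (x \<bullet> J a w)" "J b x \<bullet> w = - (x \<bullet> J b w)" for x w by (rule J_skew)+
  have Ca: "?C (J a x) = J a (?C x)" and Cb: "?C (J b x) = J b (?C x)" for x
    by (simp_all add: in' ba sq u algebra_simps)
  show "?C (J w x) - J w (?C x) = J (?C w) x" for w x
  proof -
    have w: "J w x = (w \<bullet> a) *\<^sub>R J a x + (w \<bullet> b) *\<^sub>R J b x" for x
      using J_pz[of w x] two[of w] by simp
    have lin: "?C (c *\<^sub>R x + d *\<^sub>R y) = c *\<^sub>R ?C x + d *\<^sub>R ?C y" for c d x y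
      by (simp add: inner_add_left algebra_simps)
    have "?C (J w x) = J w (?C x)" unfolding w[of x] w[of "?C x"] lin Ca Cb ..
    moreover have "J (?C w) x = 0" using J_of_pv[of u x] by (simp add: u)
    ultimately show ?thesis by simp
  qed
qed

text \<open>As \<open>N u (C u) \<bullet> a\<close> equals \<open>J a u \<bullet> C u\<close>, a
  derivation moving \<open>u\<close> partly along \<open>J a u\<close> is wanted. The dimensions 1,
  2 and at least 3 of \<open>z\<close> are served by \<open>der_J\<close>,
  \<open>der_quaternionic\<close> and \<open>der_rotation\<close>.\<close>

lemma exists_nontrivial_derivation: "\<exists>C u a. der C \<and> pv u = u \<and> u \<bullet> u = 1 \<and> pz a = a \<and> N u (C u) \<bullet> a \<noteq> 0"
proof -
  obtain u where u: "pv u = u" "u \<bullet> u = 1" using unit_vectors(1) by blast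
  obtain a where a: "pz a = a" "a \<bullet> a = 1" using unit_vectors(2) by blast
  have Na: "N u w \<bullet> a = J a u \<bullet> w" for w a by (simp add: J_inner)
  have norm1: "\<exists>b. pz b = b \<and> b \<bullet> b = 1 \<and> (\<forall>c. y \<bullet> c = 0 \<longrightarrow> b \<bullet> c = 0)" if "pz y = y" "y \<noteq> 0" for y
    by (rule exI[of _ "y /\<^sub>R norm y"]) (use that in \<open>simp add: dot_square_norm power2_eq_square\<close>)
  show ?thesis
  proof (cases "\<forall>x. pz x = (x \<bullet> a) *\<^sub>R a")
    case True
    have "N u (J a u) \<bullet> a = 1" by (simp add: N_J u a)
    then have "N u (J a u) \<bullet> a \<noteq> 0" by simp
    with der_J[OF a] True u a show ?thesis by blast
  next
    case False
    then obtain x where x: "pz x - (x \<bullet> a) *\<^sub>R a \<noteq> 0" by auto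
    have "(pz x - (x \<bullet> a) *\<^sub>R a) \<bullet> a = 0" by (simp add: inner_diff_left inner_pz a)
    then obtain b where b: "pz b = b" "b \<bullet> b = 1" "b \<bullet> a = 0"
      using norm1[OF _ x] a by auto
    show ?thesis
    proof (cases "\<forall>x. pz x = (x \<bullet> a) *\<^sub>R a + (x \<bullet> b) *\<^sub>R b")
      case True
      let ?C = "\<lambda>x. (x \<bullet> u) *\<^sub>R J a u - (x \<bullet> J a u) *\<^sub>R u - (x \<bullet> J b u) *\<^sub>R J a (J b u) + (x \<bullet> J a (J b u)) *\<^sub>R J b u"
      have "u \<bullet> J a u = 0" "u \<bullet> J b u = 0" "u \<bullet> J a (J b u) = 0"
        using J_skew[of a u u] J_skew[of b u u] J_skew[of a u "J b u"] J_inner_J[of a u b] a b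
        by (simp_all add: inner_commute)
      then have C: "?C u = J a u" by (simp add: u)
      have NC: "N u (?C u) \<bullet> a \<noteq> 0" by (simp only: C) (simp add: N_J u a)
      have CD: "der ?C"
        by (rule der_quaternionic[OF a(1) b(1) a(2) b(2) _ _ u(1)]) (use True b(3) in \<open>auto simp: inner_commute\<close>)
      show ?thesis by (intro exI conjI) (rule CD u a NC)+
    next
      case False
      then obtain x where x: "pz x - (x \<bullet> a) *\<^sub>R a - (x \<bullet> b) *\<^sub>R b \<noteq> 0" by (auto simp: algebra_simps)
      let ?y = "pz x - (x \<bullet> a) *\<^sub>R a - (x \<bullet> b) *\<^sub>R b"
      have "?y \<bullet> a = 0" "?y \<bullet> b = 0" by (simp_all add: inner_diff_left inner_pz a b inner_commute[of a b])
      then obtain c where c: "pz c = c" "c \<bullet> c = 1" "c \<bullet> a = 0" "c \<bullet> b = 0"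
        using norm1[OF _ x] a b by auto
      \<comment> \<open>With a third unit vector \<open>c\<close> the pairing for this derivation
        is, up to sign, the quadratic form of the product \<open>T\<close> of three anticommuting
        skew operators. \<open>T\<close> is symmetric with square 1 on \<open>v\<close>, so its form
        is not identically 0.\<close>
      let ?C = "\<lambda>x. J a (J b x) + 2 *\<^sub>R ((x \<bullet> a) *\<^sub>R b - (x \<bullet> b) *\<^sub>R a)"
      define T where "T w = J c (J a (J b w))" for w
      have orth: "w \<bullet> a = 0" "w \<bullet> b = 0" if "pv w = w" for w
        using that pz_sym[of w a] pz_sym[of w b] pz_pv[of w] a b by simp_all
      have NT: "N w (?C w) \<bullet> c = - (w \<bullet> T w)" if "pv w = w" for w
        using J_skew[of c w "J a (J b w)"] by (simp add: orth[OF that] T_def flip: J_inner)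
      have m: "J b (J a w) = - J a (J b w)" "J c (J a w) = - J a (J c w)" "J c (J b w) = - J b (J c w)" for w
        using J_move[of b a w] J_move[of c a w] J_move[of c b w] a b c by (simp_all add: inner_commute)
      have sq: "J a (J a w) = - pv w" "J b (J b w) = - pv w" "J c (J c w) = - pv w" for w by (simp_all add: J_J a b c)
      have TT: "T (T w) = w" if "pv w = w" for w unfolding T_def by (simp add: m sq that)
      have sym: "x \<bullet> T y = T x \<bullet> y" for x y
      proof -
        have "T x \<bullet> y = - (x \<bullet> J b (J a (J c y)))"
          unfolding T_def by (simp add: J_skew[of c] J_skew[of a] J_skew[of b])
        then show ?thesis unfolding T_def by (simp add: m)
      qed
      have pT: "pv (T w) = T w" for w by (simp add: T_def)
      have Tadd: "T (x + y) = T x + T y" for x y by (simp add: T_def)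
      have "\<exists>w. pv w = w \<and> w \<bullet> T w \<noteq> 0"
      proof (rule ccontr)
        assume "\<not> ?thesis"
        then have "u \<bullet> T u = 0" "T u \<bullet> T (T u) = 0" "(u + T u) \<bullet> T (u + T u) = 0" using u pT by auto
        then have "u \<bullet> T (T u) + T u \<bullet> T u = 0" by (simp add: Tadd inner_add_left inner_add_right)
        then show False using u by (simp add: sym TT[OF u(1)] flip: sym)
      qed
      then obtain w where w: "pv w = w" "w \<bullet> T w \<noteq> 0" by blast
      then have "w \<noteq> 0" by auto
      define w' where "w' = w /\<^sub>R norm w"
      have "pv w' = w'" "w' \<bullet> w' = 1" "w' \<bullet> T w' \<noteq> 0"
        using w \<open>w \<noteq> 0\<close> by (simp_all add: w'_def dot_square_norm power2_eq_square T_def)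
      note w' = this
      have NC: "N w' (?C w') \<bullet> c \<noteq> 0" by (simp only: NT[OF w'(1)]) (use w'(3) in simp)
      have CD: "der ?C" by (rule der_rotation) (use a b in \<open>auto simp: inner_commute\<close>)
      show ?thesis by (intro exI conjI) (rule CD w'(1,2) c(1) NC)+
    qed
  qed
qed

end

section \<open>Exclusion of a section\<close>

context polar_section
begin

lemma th_lam_0: "lam y = 0 ==> th y u = u - (1/2) *\<^sub>R N y u"
  by (rule decomp_eqI) (auto simp: algebra_simps)

lemma false: False
proof -
  obtain C0 u a where C0: "der C0" "pv u = u" "u \<bullet> u = 1" "pz a = a" "N u (C0 u) \<bullet> a \<noteq> 0"
    using exists_nontrivial_derivation by blast
  have "\<exists>A :: 'a \<Rightarrow>\<^sub>L 'a. aut A \<and> A (r *\<^sub>R u) \<in> S \<and> (\<exists>D. der D \<and> A a + D (A (r *\<^sub>R u)) \<in> tvec S (A (r *\<^sub>R u)))" for r :: real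
  proof -
    \<comment> \<open>Points approaching \<open>r *\<^sub>R u\<close> in direction \<open>a\<close>.
      The automorphisms moving them into \<open>S\<close> have a limit \<open>A\<close> along a
      subsequence; after composition with its inverse they tend to the identity, and
      \<open>tangent_mod_der\<close> applies with direction \<open>A a\<close>.\<close>
    define xs where "xs j = r *\<^sub>R u + inverse (real (Suc j)) *\<^sub>R a" for j
    have xs: "xs \<longlonglongrightarrow> r *\<^sub>R u" unfolding xs_def
      using tendsto_add[OF tendsto_const tendsto_scaleR[OF LIMSEQ_inverse_real_of_nat tendsto_const], of "r *\<^sub>R u" a] by simp
    have "\<exists>h :: 'a \<Rightarrow>\<^sub>L 'a. aut h \<and> h (xs j) \<in> S" for j
    proof -
      obtain h where "aut h" "h (xs j) \<in> S" using meets by blast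
      then show ?thesis using blinfun_linear[OF autD(1)] by (intro exI[of _ "Blinfun h"]) auto
    qed
    then obtain h :: "nat => 'a \<Rightarrow>\<^sub>L 'a" where h: "\<And>j. aut (h j)" "\<And>j. h j (xs j) \<in> S" by metis
    have "bounded (range h)" using norm_aut[OF h(1)] by (auto simp: bounded_iff)
    then obtain A s where s: "strict_mono (s :: nat => nat)" "(h \<circ> s) \<longlonglongrightarrow> A"
      using bounded_imp_convergent_subsequence by blast
    have A: "aut A" by (rule aut_limit[of "h \<circ> s"]) (use h(1) s(2) in auto)
    define A' where "A' = Blinfun (inv (blinfun_apply A))"
    have A': "blinfun_apply A' = inv (blinfun_apply A)"
      unfolding A'_def by (rule blinfun_linear[OF autD(1)[OF aut_inv[OF A]]])
    have AA: "A' (A x) = x" "A (A' x) = x" for x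
      using aut_bij[OF A] by (simp_all add: A' bij_is_inj bij_is_surj surj_f_inv_f)
    define Cs where "Cs j = h (s j) o\<^sub>L A'" for j
    have Cs: "aut (Cs j)" for j
      using aut_compose[OF h(1)[of "s j"] aut_inv[OF A]] by (simp add: Cs_def blinfun_compose.rep_eq A')
    have "Cs \<longlonglongrightarrow> (A o\<^sub>L A')" unfolding Cs_def
      using s(2) by (intro bounded_bilinear.tendsto[OF bounded_bilinear_blinfun_compose] tendsto_const) (simp add: o_def)
    moreover have "A o\<^sub>L A' = id_blinfun" by (rule blinfun_eqI) (simp add: AA)
    ultimately have Cs1: "Cs \<longlonglongrightarrow> id_blinfun" by simp
    have xss: "(\<lambda>j. xs (s j)) \<longlonglongrightarrow> r *\<^sub>R u" using LIMSEQ_subseq_LIMSEQ[OF xs s(1)] by (simp add: o_def)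
    have l1: "(\<lambda>j. A (xs (s j))) \<longlonglongrightarrow> A (r *\<^sub>R u)" by (intro blinfun.tendsto tendsto_const xss)
    have l2: "Cs j (A (xs (s j))) \<in> S" for j using h(2) by (simp add: Cs_def AA)
    have l3: "(\<lambda>j. inverse (real (Suc (s j)))) \<longlonglongrightarrow> 0"
      using LIMSEQ_subseq_LIMSEQ[OF LIMSEQ_inverse_real_of_nat s(1)] by (simp add: o_def)
    have l4: "(\<lambda>j. (A (xs (s j)) - A (r *\<^sub>R u)) /\<^sub>R inverse (real (Suc (s j)))) \<longlonglongrightarrow> A a"
      by (simp add: xs_def blinfun.bilinear_simps del: of_nat_Suc)
    from tangent_mod_der[OF Cs Cs1 l1 l2 _ l3 l4] A show ?thesis by auto
  qed
  then obtain A :: "real => 'a \<Rightarrow>\<^sub>L 'a" where A: "\<And>r. aut (A r)" "\<And>r. A r (r *\<^sub>R u) \<in> S"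
    "\<And>r. \<exists>D. der D \<and> A r a + D (A r (r *\<^sub>R u)) \<in> tvec S (A r (r *\<^sub>R u))" by metis
  \<comment> \<open>The choice of \<open>A\<close> has no regularity in \<open>r\<close>;
    convergence along the single sequence \<open>rs\<close> is enough to produce the tangent
    direction \<open>V\<close>.\<close>
  obtain r rs where r: "r \<in> {1..2}" "\<And>j. rs j \<noteq> r" "rs \<longlonglongrightarrow> r" "(\<lambda>j. A (rs j)) \<longlonglongrightarrow> A r"
    using condensation_sequence[of A 1] norm_aut[OF A(1)] by metis
  define V where "V = A r u"
  define Z where "Z = A r a"
  define y where "y = r *\<^sub>R V"
  note dA = autD[OF A(1)[of r]]
  have y: "A r (r *\<^sub>R u) = y" by (simp add: y_def V_def blinfun.bilinear_simps)
  have V: "pv V = V" "V \<bullet> V = 1" "lam V = 0" "pz V = 0" and Z: "pz Z = Z" "lam Z = 0" "pv Z = 0"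
    using dA C0 decomp_pz_span[OF C0(4)] lam_pv[of u] pz_pv[of u] by (simp_all add: V_def Z_def blinfun.zero_right)
  have yS: "y \<in> S" using A(2)[of r] y by simp
  have ly: "lam y = 0" "pz y = 0" "N y w = r *\<^sub>R N V w" for w by (simp_all add: y_def V)
  obtain D where D: "der D" "Z + D y \<in> tvec S y" using A(3)[of r] y by (auto simp: Z_def)
  have "\<exists>D'. der D' \<and> V + D' y \<in> tvec S y"
  proof -
    define A' where "A' = Blinfun (inv (blinfun_apply (A r)))"
    have A': "blinfun_apply A' = inv (blinfun_apply (A r))"
      unfolding A'_def by (rule blinfun_linear[OF autD(1)[OF aut_inv[OF A(1)]]])
    have AA: "A' (A r x) = x" "A r (A' x) = x" for x
      using aut_bij[OF A(1)[of r]] by (simp_all add: A' bij_is_inj bij_is_surj surj_f_inv_f)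
    define Cs where "Cs j = A (rs j) o\<^sub>L A'" for j
    have Cs: "aut (Cs j)" for j
      using aut_compose[OF A(1)[of "rs j"] aut_inv[OF A(1)[of r]]] by (simp add: Cs_def blinfun_compose.rep_eq A')
    have "Cs \<longlonglongrightarrow> (A r o\<^sub>L A')" unfolding Cs_def
      by (intro bounded_bilinear.tendsto[OF bounded_bilinear_blinfun_compose] tendsto_const r)
    moreover have "A r o\<^sub>L A' = id_blinfun" by (rule blinfun_eqI) (simp add: AA)
    ultimately have Cs1: "Cs \<longlonglongrightarrow> id_blinfun" by simp
    have l1: "(\<lambda>j. rs j *\<^sub>R V) \<longlonglongrightarrow> y" unfolding y_def by (intro tendsto_scaleR tendsto_const r)
    have l2: "Cs j (rs j *\<^sub>R V) \<in> S" for j using A(2)[of "rs j"] by (simp add: Cs_def V_def AA blinfun.bilinear_simps)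
    have l3: "(\<lambda>j. rs j - r) \<longlonglongrightarrow> 0" using r(3) by (simp add: LIM_zero)
    have l4: "(\<lambda>j. (rs j *\<^sub>R V - y) /\<^sub>R (rs j - r)) \<longlonglongrightarrow> V"
      using r(2) by (simp add: y_def flip: scaleR_diff_left)
    show ?thesis using tangent_mod_der(2)[OF Cs Cs1 l1 l2 _ l3 l4] r(2) by auto
  qed
  then obtain D' where D': "der D'" "V + D' y \<in> tvec S y" by blast
  have Dy: "E y = r *\<^sub>R E V" if "der E" for E by (simp add: y_def linear_cmul[OF derD(1)[OF that]])
  have EV: "pv (E V) = E V" "lam (E V) = 0" "pz (E V) = 0" "E V \<bullet> V = 0" if "der E" for E
    using derD[OF that] V by (auto simp: linear_0)
  have thE: "th y (E y) = r *\<^sub>R E V - (r\<^sup>2 / 2) *\<^sub>R N V (E V)" if "der E" for E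
    by (simp add: th_lam_0[OF ly(1)] ly Dy[OF that] power2_eq_square)
  have thV: "th y V = V" by (simp add: th_lam_0[OF ly(1)] ly)
  have NV: "N x w \<bullet> v = 0" "v \<bullet> N x w = 0" if "pv v = v" for x w v
    using pv_orth_pz(3)[of v x w] that by (simp_all add: inner_commute)
  \<comment> \<open>\<open>th y V = V\<close> is orthogonal to \<open>th y (D' y)\<close>, so
    orthogonality of \<open>V + D' y\<close> to the orbit direction \<open>D' y\<close> forces the
    latter to vanish.\<close>
  have "th y (V + D' y) = V + th y (D' y)" using thV by (simp add: linear_add[OF lin_th])
  then have "th y (D' y) \<bullet> V + th y (D' y) \<bullet> th y (D' y) = 0"
    using orth[OF D'(1) yS D'(2)] by (simp add: inner_add_right)
  moreover have "th y (D' y) \<bullet> V = 0"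
    by (simp add: thE[OF D'(1)] inner_diff_left EV[OF D'(1)] NV[OF V(1)])
  ultimately have "th y (D' y) = 0" by simp
  then have "Xm y (th y (D' y)) = Xm y 0" by simp
  then have "D' y = 0" by (simp add: linear_0[OF lin_Xm])
  then have Vt: "V \<in> tvec S y" using D'(2) by simp
  define W where "W = Z + r *\<^sub>R D V"
  have Wt: "W \<in> tvec S y" using D Dy[OF D(1)] by (simp add: W_def)
  have W: "lam W = 0" "N V W = r *\<^sub>R N V (D V)" "N W V = - (r *\<^sub>R N V (D V))"
    using Z EV[OF D(1)] N_skew[of "D V" V] N_pz[of Z V] N_pz(2)[of V Z] by (simp_all add: W_def)
  have thW: "th y W = Z + r *\<^sub>R D V - (r\<^sup>2 / 2) *\<^sub>R N V (D V)"
    unfolding th_lam_0[OF ly(1)] ly(3) W(2) by (simp add: W_def power2_eq_square)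
  have r0: "r > 0" using r(1) by simp
  have dth0: "dth y k w = - (1/2) *\<^sub>R N k w" if "lam k = 0" for k w by (simp add: dth_def that ly)
  \<comment> \<open>The one-form \<open>\<omega>\<close> is dual to the orbit direction of
    \<open>E\<close> and vanishes on tangent vectors of \<open>S\<close>. The symmetry of its
    derivatives is evaluated on the tangent vectors \<open>V\<close> and \<open>W\<close> at
    \<open>y = r *\<^sub>R V\<close>.\<close>
  have exteriorC: "N V (E V) \<bullet> Z = 2 * (E V \<bullet> D V) + r\<^sup>2 * (N V (E V) \<bullet> N V (D V))" if E: "der E" for E
  proof -
    define \<omega> where "\<omega> z w = th z (E z) \<bullet> th z w" for z w
    have cE: "Cinf_on (\<lambda>z. E z) UNIV" by (rule Cinf_on_linear[OF derD(1)[OF E] open_UNIV])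
    have 1: "Cinf_on (\<lambda>z. \<omega> z w) UNIV" for w unfolding \<omega>_def
      by (intro Cinf_on_inner Cinf_on_th cE Cinf_on_id Cinf_on_const open_UNIV)
    have 2: "linear (\<omega> z)" for z
      by (auto simp: linear_iff \<omega>_def linear_add[OF lin_th] linear_cmul[OF lin_th] inner_add_right)
    have d\<omega>: "fderiv (\<lambda>z. \<omega> z w) y k = (dth y k (E y) + th y (E k)) \<bullet> th y w + th y (E y) \<bullet> dth y k w" for w k
    proof -
      have d1: "((\<lambda>z. th z w) has_derivative (\<lambda>k. dth y k w)) (at y)" for w by (rule th_has_derivative)
      have dE: "(E has_derivative E) (at y)"
        by (rule bounded_linear_imp_has_derivative) (use derD(1)[OF E] in \<open>simp add: linear_conv_bounded_linear\<close>)
      have "((\<lambda>z. \<Sum>b\<in>Basis. (E z \<bullet> b) *\<^sub>R th z b) has_derivative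
          (\<lambda>k. \<Sum>b\<in>Basis. (E y \<bullet> b) *\<^sub>R dth y k b + (E k \<bullet> b) *\<^sub>R th y b)) (at y)"
        by (intro has_derivative_sum has_derivative_scaleR has_derivative_inner_left dE d1)
      moreover have "(\<lambda>z. \<Sum>b\<in>Basis. (E z \<bullet> b) *\<^sub>R th z b) = (\<lambda>z. th z (E z))"
        by (rule ext) (rule linear_apply_basis[OF lin_th, symmetric])
      moreover have "linear (dth y k)" for k by (auto simp: linear_iff dth_def algebra_simps)
      then have "(\<lambda>k. \<Sum>b\<in>Basis. (E y \<bullet> b) *\<^sub>R dth y k b + (E k \<bullet> b) *\<^sub>R th y b) = (\<lambda>k. dth y k (E y) + th y (E k))"
        by (simp only: sum.distrib) (simp only: linear_apply_basis[of "dth y _" "E y", symmetric] linear_apply_basis[OF lin_th, symmetric])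
      ultimately have "((\<lambda>z. th z (E z)) has_derivative (\<lambda>k. dth y k (E y) + th y (E k))) (at y)" by simp
      from has_derivative_inner[OF this d1[of w]]
      have "((\<lambda>z. \<omega> z w) has_derivative (\<lambda>k. th y (E y) \<bullet> dth y k w + (dth y k (E y) + th y (E k)) \<bullet> th y w)) (at y)"
        by (simp add: \<omega>_def)
      from fun_cong[OF frechet_derivative_at[OF this], of k] show ?thesis by simp
    qed
    have "fderiv (\<lambda>z. \<omega> z V) y W = fderiv (\<lambda>z. \<omega> z W) y V"
      by (rule exterior[OF yS 1 2 _ Vt Wt]) (use orth[OF E] in \<open>auto simp: \<omega>_def\<close>)
    then have eq: "(dth y W (E y) + th y (E W)) \<bullet> th y V + th y (E y) \<bullet> dth y W V =
        (dth y V (E y) + th y (E V)) \<bullet> th y W + th y (E y) \<bullet> dth y V W"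
      by (simp add: d\<omega>)
    define n where "n = N V (E V) \<bullet> N V (D V)"
    define m where "m = E V \<bullet> D V"
    note e = EV[OF E] and dd = EV[OF D(1)]
    have EZ: "pz (E Z) = E Z" using derD(5)[OF E, of Z] Z(1) by simp
    have EZV: "E Z \<bullet> V = 0" using pv_orth_pz(2)[of "E Z" V] unfolding EZ V(1) .
    have l1: "(dth y W (E y) + th y (E W)) \<bullet> th y V = - (r * m)"
    proof -
      have "E (D V) \<bullet> V = - m" using derD(2)[OF E, of "D V" V] by (simp add: m_def inner_commute)
      then show ?thesis unfolding dth0[OF W(1)] thV th_lam_0[OF ly(1), of "E W"]
        by (simp add: inner_add_left inner_diff_left NV[OF V(1)] W_def
            linear_add[OF derD(1)[OF E]] linear_cmul[OF derD(1)[OF E]] EZV)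
    qed
    have l2: "th y (E y) \<bullet> dth y W V = - (r ^ 3 / 4) * n"
      by (simp add: thE[OF E] dth0[OF W(1)] W(3) inner_diff_left NV[OF e(1)] n_def power3_eq_cube power2_eq_square)
    have ZE: "E V \<bullet> Z = 0" "D V \<bullet> N x w = 0" "N x w \<bullet> E V = 0" "N x w \<bullet> D V = 0" "E V \<bullet> N x w = 0" for x w
      using NV[OF e(1)] NV[OF dd(1)] pv_orth_pz(1)[of "E V" Z] e(1) Z(1) by simp_all
    have r1: "(dth y V (E y) + th y (E V)) \<bullet> th y W = r * m - r * (N V (E V) \<bullet> Z) + (r ^ 3 / 2) * n"
      unfolding thW
      by (simp add: dth0[OF V(3)] th_lam_0[OF ly(1)] ly Dy[OF E] inner_add_left inner_diff_left inner_add_right inner_diff_right ZE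
          flip: m_def n_def) (simp add: power3_eq_cube power2_eq_square algebra_simps)
    have r2: "th y (E y) \<bullet> dth y V W = (r ^ 3 / 4) * n"
      by (simp add: thE[OF E] dth0[OF V(3)] W(2) inner_diff_left ZE power3_eq_cube power2_eq_square flip: n_def)
    from eq have "r * (N V (E V) \<bullet> Z) = r * (2 * m + r\<^sup>2 * n)"
      unfolding l1 l2 r1 r2 by (simp add: power3_eq_cube power2_eq_square algebra_simps)
    then show ?thesis using r0 by (simp add: m_def n_def)
  qed
  \<comment> \<open>Orthogonality of \<open>W\<close> to the orbit direction of \<open>D\<close>
    gives the relation \<open>exteriorC\<close> for \<open>E = D\<close>, but with
    \<open>r\<^sup>2 / 2\<close> in place of \<open>r\<^sup>2\<close> before the square of
    \<open>N V (D V)\<close>. So this vector vanishes, and with it \<open>D V\<close>.\<close>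
  have "th y (D y) \<bullet> th y W = 0" by (rule orth[OF D(1) yS Wt])
  then have "r\<^sup>2 * (D V \<bullet> D V) - (r\<^sup>2 / 2) * (N V (D V) \<bullet> Z) + (r ^ 4 / 4) * (N V (D V) \<bullet> N V (D V)) = 0"
    unfolding thE[OF D(1)] thW
    using NV[OF EV(1)[OF D(1)]] pv_orth_pz(1)[of "D V" Z] EV(1)[OF D(1)] Z(1)
    by (simp add: inner_diff_left inner_diff_right inner_add_right power2_eq_square power4_eq_xxxx algebra_simps)
  then have "r\<^sup>2 * (2 * (D V \<bullet> D V) + r\<^sup>2 / 2 * (N V (D V) \<bullet> N V (D V)) - N V (D V) \<bullet> Z) = 0"
    by (simp add: power2_eq_square power4_eq_xxxx algebra_simps)
  then have "2 * (D V \<bullet> D V) + r\<^sup>2 / 2 * (N V (D V) \<bullet> N V (D V)) = N V (D V) \<bullet> Z" using r0 by simp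
  with exteriorC[OF D(1)] have "r\<^sup>2 * (N V (D V) \<bullet> N V (D V)) = 0" by simp
  then have NVD: "N V (D V) = 0" using r0 by simp
  with exteriorC[OF D(1)] have "D V = 0" by simp
  with NVD exteriorC have key: "N V (E V) \<bullet> Z = 0" if "der E" for E using that by simp
  \<comment> \<open>The automorphism \<open>A r\<close> carries \<open>u\<close>, \<open>a\<close>
    to \<open>V\<close>, \<open>Z\<close>, so the conjugate of \<open>C0\<close> violates
    \<open>key\<close>.\<close>
  have "N V (A r (C0 (inv (A r) V))) \<bullet> Z = N u (C0 u) \<bullet> a"
    using dA(2)[of "N u (C0 u)" a] dA(6)[of u "C0 u"] aut_bij[OF A(1)[of r]]
    by (simp add: V_def Z_def bij_is_inj)
  with key[OF der_compose_aut[OF A(1)[of r] C0(1)]] C0(5) show False by simp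
qed

end

section \<open>Connection and curvature of the model\<close>

context heisenberg_model
begin

text \<open>The Levi-Civita connection on left-invariant fields (from the Koszul formula), its curvature and the covariant
  derivative of the curvature.\<close>

definition Gm :: "'n => 'n => 'n" where
  "Gm x y = (1/2) *\<^sub>R N x y - (1/2) *\<^sub>R J x y - (1/2) *\<^sub>R J y x + ((1/2) * (pv x \<bullet> pv y) + pz x \<bullet> pz y) *\<^sub>R B
     - lam y *\<^sub>R ((1/2) *\<^sub>R pv x + pz x)"

definition Rm :: "'n => 'n => 'n => 'n" where
  "Rm a b c = Gm a (Gm b c) - Gm b (Gm a c) - Gm (br a b) c"

definition nab :: "'n => 'n => 'n => 'n => 'n" where
  "nab d a b c = Gm d (Rm a b c) - Rm (Gm d a) b c - Rm a (Gm d b) c - Rm a b (Gm d c)"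

lemma lin_Gm: "linear (Gm x)" and lin_Gm_left: "linear (\<lambda>x. Gm x y)"
  by (auto simp: linear_iff Gm_def inner_add_left inner_add_right add_divide_distrib algebra_simps)

lemmas Gm_simps = linear_add[OF lin_Gm] linear_add[OF lin_Gm_left] linear_diff[OF lin_Gm] linear_diff[OF lin_Gm_left]
  linear_cmul[OF lin_Gm] linear_cmul[OF lin_Gm_left] linear_neg[OF lin_Gm] linear_neg[OF lin_Gm_left]
  linear_0[OF lin_Gm] linear_0[OF lin_Gm_left]

lemma lin_br: "linear (br x)" and lin_br_left: "linear (\<lambda>x. br x y)"
  by (auto simp: linear_iff br_def add_divide_distrib algebra_simps)

lemmas br_simps = linear_add[OF lin_br] linear_add[OF lin_br_left] linear_diff[OF lin_br] linear_diff[OF lin_br_left]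
  linear_cmul[OF lin_br] linear_cmul[OF lin_br_left] linear_0[OF lin_br] linear_0[OF lin_br_left]

lemma lin_Rm: "linear (\<lambda>x. Rm x b c)" "linear (\<lambda>x. Rm a x c)" "linear (Rm a b)"
  by (auto simp: linear_iff Rm_def Gm_simps br_simps algebra_simps)

lemmas Rm_simps = lin_Rm[THEN linear_add] lin_Rm[THEN linear_diff] lin_Rm[THEN linear_cmul] lin_Rm[THEN linear_neg]

lemma lin_nab: "linear (\<lambda>d. nab d a b c)"
  by (auto simp: linear_iff nab_def Gm_simps Rm_simps algebra_simps)

lemma br_skew: "br x y = - br y x"
  using N_skew[of x y] by (simp add: br_def)

lemma half_add_half [simp]: "(1/2) *\<^sub>R x + (1/2) *\<^sub>R x = (x :: 'n)"
  by (simp flip: scaleR_left_distrib)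

lemma quarter_add_quarter [simp]: "(c/4) *\<^sub>R x + (c/4) *\<^sub>R x = (c/2) *\<^sub>R (x :: 'n)"
  by (simp flip: scaleR_left_distrib)

lemma Gm_torsion_free: "Gm x y - Gm y x = br x y"
  unfolding Gm_def br_def using N_skew[of x y] by (simp add: inner_commute algebra_simps)

lemma br_inner: "br x y \<bullet> w = N x y \<bullet> w + lam x * ((1/2) * (pv y \<bullet> pv w) + pz y \<bullet> pz w) - lam y * ((1/2) * (pv x \<bullet> pv w) + pz x \<bullet> pz w)"
  using inner_decomp[of "pv x" w] inner_decomp[of "pz x" w] inner_decomp[of "pv y" w] inner_decomp[of "pz y" w]
  by (simp add: br_def inner_add_left inner_diff_left)

lemma Gm_koszul: "2 * (Gm a b \<bullet> c) = br a b \<bullet> c - br b c \<bullet> a + br c a \<bullet> b"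
proof -
  have N: "N b c \<bullet> a = J a b \<bullet> c" "N c a \<bullet> b = - (J b a \<bullet> c)"
    using J_inner[of a b c] J_inner[of b a c] N_skew[of a c] by simp_all
  have c: "pv a \<bullet> c = pv a \<bullet> pv c" "pz a \<bullet> c = pz a \<bullet> pz c" "B \<bullet> c = lam c"
    using inner_decomp[of "pv a" c] inner_decomp[of "pz a" c] by (simp_all add: lam_def inner_commute)
  have "2 * (Gm a b \<bullet> c) = N a b \<bullet> c - J a b \<bullet> c - J b a \<bullet> c + (pv a \<bullet> pv b + 2 * (pz a \<bullet> pz b)) * lam c
      - lam b * (pv a \<bullet> pv c + 2 * (pz a \<bullet> pz c))"
    by (simp add: Gm_def inner_add_left inner_diff_left c algebra_simps)
  then show ?thesis
    unfolding br_inner[of a b c] br_inner[of b c a] br_inner[of c a b] N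
    by (simp add: inner_commute[of "pv c"] inner_commute[of "pz c"] inner_commute[of "pv b" "pv a"] inner_commute[of "pz b" "pz a"] algebra_simps)
qed

lemma Gm_skew: "Gm a b \<bullet> c = - (b \<bullet> Gm a c)"
proof -
  have "br b c \<bullet> a = - (br c b \<bullet> a)" "br c a \<bullet> b = - (br a c \<bullet> b)" "br b a \<bullet> c = - (br a b \<bullet> c)"
    by (subst br_skew, simp)+
  then have "2 * (Gm a b \<bullet> c) + 2 * (Gm a c \<bullet> b) = 0"
    unfolding Gm_koszul[of a b c] Gm_koszul[of a c b] by linarith
  then show ?thesis by (simp add: inner_commute[of b])
qed

section \<open>Ricci curvature in the Heisenberg case\<close>

definition tr :: "('n => 'n) => real" where "tr L = (\<Sum>b\<in>Basis. L b \<bullet> b)"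

lemma inner_Basis_sum: "x \<bullet> y = (\<Sum>c\<in>Basis. (x \<bullet> c) * (y \<bullet> c))" for x y :: 'n
  by (rule euclidean_inner)

lemma tr_commute:
  assumes "linear L" "linear M"
  shows "tr (\<lambda>x. L (M x)) = tr (\<lambda>x. M (L x))"
proof -
  have 1: "L (M b) \<bullet> b = (\<Sum>c\<in>Basis. (M b \<bullet> c) * (L c \<bullet> b))" if "linear L" for L M :: "'n => 'n" and b
    by (subst linear_apply_basis[OF that]) (simp add: inner_sum_left)
  have "tr (\<lambda>x. L (M x)) = (\<Sum>b\<in>Basis. \<Sum>c\<in>Basis. (M b \<bullet> c) * (L c \<bullet> b))"
    unfolding tr_def by (rule sum.cong[OF refl]) (rule 1[OF assms(1)])
  also have "\<dots> = (\<Sum>c\<in>Basis. \<Sum>b\<in>Basis. (L c \<bullet> b) * (M b \<bullet> c))"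
    by (subst sum.swap) (simp add: mult.commute)
  also have "\<dots> = tr (\<lambda>x. M (L x))"
    unfolding tr_def by (rule sum.cong[OF refl]) (rule 1[OF assms(2), symmetric])
  finally show ?thesis .
qed

lemma tr_diff: "tr (\<lambda>x. L x - M x) = tr L - tr M"
  and tr_scale: "tr (\<lambda>x. c *\<^sub>R L x) = c * tr L" and tr_zero: "tr (\<lambda>x. 0) = 0"
  by (simp_all add: tr_def inner_add_left inner_diff_left sum.distrib sum_subtractf sum_distrib_left)

text \<open>\<open>L\<close> takes its values in the range of \<open>P\<close> and vanishes there,
  so it is nilpotent.\<close>

lemma tr_off_diagonal:
  assumes "linear L" "linear P" "\<And>x. P (L x) = L x" "\<And>x. L (P x) = 0"
  shows "tr L = 0"
proof -
  have "tr L = tr (\<lambda>x. P (L x))" by (simp add: assms)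
  also have "\<dots> = tr (\<lambda>x. L (P x))" by (rule tr_commute[OF assms(2,1)])
  finally show ?thesis by (simp add: assms tr_zero)
qed

lemma tr_conj:
  assumes "linear L" "linear Q" "linear Q'" "\<And>x. Q (Q' x) = x" "\<And>x. Q' (Q x) = x"
  shows "tr (\<lambda>x. Q (L (Q' x))) = tr L"
proof -
  have "tr (\<lambda>x. Q (L (Q' x))) = tr (\<lambda>x. L (Q' (Q x)))"
    using tr_commute[OF assms(2) linear_compose[OF assms(3,1)]] by (simp add: o_def)
  then show ?thesis by (simp add: assms(5))
qed

definition Ric :: "'n => 'n => real" where "Ric c d = tr (\<lambda>b. Rm b c d)"

lemma J_self: "J a u \<bullet> u = 0"
  using J_skew[of a u u] by (simp add: inner_commute)

text \<open>The traces are the dimensions of \<open>z\<close> and \<open>v\<close>, so the Ricci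
  form is negative on \<open>v\<close> and positive on \<open>z\<close>; maps preserving it can be
  recognized as preserving the splitting.\<close>

lemma Ric_heisenberg:
  assumes B: "B = 0"
  shows "Ric c d = - (tr pz / 2) * (pv c \<bullet> pv d) + (tr pv / 4) * (pz c \<bullet> pz d)"
proof -
  have l0: "lam x = 0" for x using B unfolding lam_def by simp
  have G: "Gm x y = (1/2) *\<^sub>R (N x y - J x y - J y x)" for x y
  proof -
    have sB: "r *\<^sub>R B = 0" for r by (simp add: B)
    show ?thesis unfolding Gm_def l0 sB by (simp add: algebra_simps)
  qed
  have br: "br x y = N x y" for x y by (simp add: br_def l0)
  have trace: "tr pz = (\<Sum>b\<in>Basis. pz b \<bullet> pz b)" "tr pv = (\<Sum>b\<in>Basis. pv b \<bullet> pv b)"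
    using pz_sym[of "pz _"] pv_sym[of "pv _"] by (simp_all add: tr_def)
  have t1: "tr (\<lambda>b. Gm b (Gm c d)) = 0"
  proof -
    have "tr (\<lambda>b. N b (Gm c d)) = 0" by (rule tr_off_diagonal[OF lin_N_left lin_pz]) simp_all
    moreover have "tr (\<lambda>b. J b (Gm c d)) = 0" by (rule tr_off_diagonal[OF lin_J_left lin_pv]) simp_all
    moreover have "tr (\<lambda>b. J (Gm c d) b) = 0" by (simp add: tr_def J_self)
    ultimately show ?thesis unfolding G[of _ "Gm c d"] by (simp add: tr_scale tr_diff)
  qed
  have p: "(\<Sum>b\<in>Basis. N c b \<bullet> N d b) = tr pz * (pv c \<bullet> pv d)"
  proof -
    have "(\<Sum>b\<in>Basis. N c b \<bullet> N d b) = (\<Sum>b\<in>Basis. \<Sum>e\<in>Basis. (J e c \<bullet> b) * (J e d \<bullet> b))"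
      by (rule sum.cong[OF refl], subst inner_Basis_sum) (simp add: J_inner)
    also have "\<dots> = (\<Sum>e\<in>Basis. J e c \<bullet> J e d)" by (subst sum.swap) (simp flip: inner_Basis_sum)
    also have "\<dots> = tr pz * (pv c \<bullet> pv d)" by (simp add: J_inner_J' trace sum_distrib_right)
    finally show ?thesis .
  qed
  have x: "(\<Sum>b\<in>Basis. J b d \<bullet> J c b) = 0" for c d
  proof -
    have "tr (\<lambda>b. J c (J b d)) = 0"
      by (rule tr_off_diagonal[OF _ lin_pv]) (auto simp: linear_iff)
    then show ?thesis by (simp add: tr_def J_skew sum_negf)
  qed
  have t2: "tr (\<lambda>b. Gm c (Gm b d)) = - (tr pv / 4) * (pz c \<bullet> pz d)"
  proof -
    have "tr (\<lambda>b. Gm c (Gm b d)) = (\<Sum>b\<in>Basis. - (Gm b d \<bullet> Gm c b))"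
      by (simp add: tr_def Gm_skew)
    also have "\<dots> = (\<Sum>b\<in>Basis. (1/4) * (N c b \<bullet> N d b) - (1/4) * (J b d \<bullet> J c b) - (1/4) * ((pz b \<bullet> pz b) * (pv d \<bullet> pv c))
        - (1/4) * ((pz d \<bullet> pz c) * (pv b \<bullet> pv b)) - (1/4) * (J b c \<bullet> J d b))"
    proof (rule sum.cong[OF refl])
      fix b :: 'n
      have o: "N x y \<bullet> J a u = 0" "J a u \<bullet> N x y = 0" for x y a u
        using pv_orth_pz(3)[of "J a u" x y] by (simp_all add: inner_commute)
      have "Gm b d \<bullet> Gm c b = (1/4) * (N b d \<bullet> N c b + (J b d + J d b) \<bullet> (J c b + J b c))"
        unfolding G by (simp add: inner_diff_left inner_diff_right inner_add_left inner_add_right o) argo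
      also have "N b d = - N d b" by (rule N_skew)
      finally show "- (Gm b d \<bullet> Gm c b) = (1/4) * (N c b \<bullet> N d b) - (1/4) * (J b d \<bullet> J c b) - (1/4) * ((pz b \<bullet> pz b) * (pv d \<bullet> pv c))
        - (1/4) * ((pz d \<bullet> pz c) * (pv b \<bullet> pv b)) - (1/4) * (J b c \<bullet> J d b)"
        by (simp add: inner_add_left inner_add_right J_inner_J' J_inner_J inner_commute[of "J d b" "J b c"] inner_commute[of "N d b"] algebra_simps)
    qed
    also have "\<dots> = (1/4) * (\<Sum>b\<in>Basis. N c b \<bullet> N d b) - (1/4) * (\<Sum>b\<in>Basis. J b d \<bullet> J c b) - (1/4) * (tr pz * (pv d \<bullet> pv c))
        - (1/4) * ((pz d \<bullet> pz c) * tr pv) - (1/4) * (\<Sum>b\<in>Basis. J b c \<bullet> J d b)"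
      by (simp add: sum_subtractf sum_distrib_left sum_distrib_right trace)
    also have "\<dots> = - (tr pv / 4) * (pz c \<bullet> pz d)" unfolding p x by (simp add: inner_commute)
    finally show ?thesis .
  qed
  have t3: "tr (\<lambda>b. Gm (br b c) d) = (tr pz / 2) * (pv c \<bullet> pv d)"
  proof -
    have "tr (\<lambda>b. Gm (br b c) d) = (\<Sum>b\<in>Basis. (1/2) * (N c b \<bullet> N d b))"
      unfolding tr_def
    proof (rule sum.cong[OF refl])
      fix b :: 'n
      show "Gm (br b c) d \<bullet> b = (1/2) * (N c b \<bullet> N d b)"
        using N_skew[of b c] J_inner[of "N c b" d b] by (simp add: G br inner_commute[of _ b] inner_commute[of "N d b"])
    qed
    then show ?thesis by (simp only: sum_distrib_left[symmetric] p)
  qed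
  show ?thesis unfolding Ric_def Rm_def tr_diff t1 t2 t3 by simp
qed

lemma tr_pv_pos: "tr pv > 0" and tr_pz_pos: "tr pz > 0"
proof -
  have pos: "(\<Sum>b\<in>Basis. L b \<bullet> L b) > 0" if "linear L" "L x \<noteq> 0" for L :: "'n => 'n" and x
  proof (rule ccontr)
    assume "\<not> ?thesis"
    then have "(\<Sum>b\<in>Basis. L b \<bullet> L b) = 0" by (simp add: not_less antisym sum_nonneg)
    then have "L b = 0" if "b \<in> Basis" for b using that by (simp add: sum_nonneg_eq_0_iff)
    then show False using linear_apply_basis[OF that(1), of x] that(2) by simp
  qed
  have "tr pz = (\<Sum>b\<in>Basis. pz b \<bullet> pz b)" "tr pv = (\<Sum>b\<in>Basis. pv b \<bullet> pv b)"
    using pz_sym[of "pz _"] pv_sym[of "pv _"] by (simp_all add: tr_def)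
  then show "tr pv > 0" "tr pz > 0" using pos[OF lin_pv] pos[OF lin_pz] nontrivial by auto
qed

section \<open>Curvature and its covariant derivative in the Damek-Ricci case\<close>

lemma vD:
  assumes "pv U = U"
  shows "lam U = 0" "pz U = 0" "J U x = 0" "U \<bullet> B = 0" "B \<bullet> U = 0" "U \<bullet> N x y = 0" "N x y \<bullet> U = 0" "pv U \<bullet> U = U \<bullet> U"
  using lam_pv[of U] pz_pv[of U] J_of_pv[of U x] pv_orth_pz(3,4,5,6)[of U] assms by (simp_all add: inner_commute)

lemma zD:
  assumes "pz Z = Z"
  shows "lam Z = 0" "pv Z = 0" "N Z x = 0" "N x Z = 0" "J x Z = 0"
  using lam_pz[of Z] pv_pz[of Z] N_pz(1)[of Z x] N_pz(2)[of x Z] J_of_pz[of x Z] assms by simp_all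

lemma Gm_vv: "pv U = U ==> pv V = V ==> Gm U V = (1/2) *\<^sub>R N U V + ((1/2) * (U \<bullet> V)) *\<^sub>R B"
  and Gm_vz: "pv U = U ==> pz Z = Z ==> Gm U Z = - (1/2) *\<^sub>R J Z U"
  and Gm_zv: "pv U = U ==> pz Z = Z ==> Gm Z U = - (1/2) *\<^sub>R J Z U"
  and Gm_zz: "pz W = W ==> pz Z = Z ==> Gm Z W = (Z \<bullet> W) *\<^sub>R B"
  and Gm_vB: "B \<bullet> B = 1 ==> pv U = U ==> Gm U B = - (1/2) *\<^sub>R U"
  and Gm_zB: "B \<bullet> B = 1 ==> pz Z = Z ==> Gm Z B = - Z"
  and Gm_B: "Gm B x = 0"
  by (simp_all add: Gm_def vD zD lam_def[of B])

lemma br_vz: "pv U = U ==> pz Z = Z ==> br U Z = 0" and br_zz: "pz W = W ==> pz Z = Z ==> br W Z = 0"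
  and br_vv: "pv U = U ==> pv V = V ==> br U V = N U V" and br_Bz: "B \<bullet> B = 1 ==> pz Z = Z ==> br B Z = Z"
  by (simp_all add: br_def vD zD lam_def[of B])

lemma Rm_vvv:
  assumes B: "B \<bullet> B = 1" and v: "pv X = X" "pv Y = Y" "pv W = W"
  shows "Rm X Y W = (1/2) *\<^sub>R J (N X Y) W + (1/4) *\<^sub>R (J (N X W) Y - J (N Y W) X + (X \<bullet> W) *\<^sub>R Y - (Y \<bullet> W) *\<^sub>R X)"
  by (simp add: Rm_def Gm_vv Gm_vz Gm_zv Gm_vB br_vv B v Gm_simps algebra_simps)

lemma Rm_vzv:
  assumes B: "B \<bullet> B = 1" and v: "pv U = U" "pv W = W" and Z: "pz Z = Z"
  shows "Rm U Z W = - (1/4) *\<^sub>R N U (J Z W) + ((1/2) * (U \<bullet> W)) *\<^sub>R Z - ((1/4) * (N U W \<bullet> Z)) *\<^sub>R B"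
proof -
  have "U \<bullet> J Z W = - (N U W \<bullet> Z)" using J_skew[of Z U W] J_inner[of Z U W] by simp
  then show ?thesis
    by (simp add: Rm_def Gm_vv Gm_zv Gm_zz Gm_zB br_vz Gm_simps B v Z inner_commute[of Z] algebra_simps flip: scaleR_left_diff_distrib)
qed

lemma Rm_zzv: "pv U = U ==> pz W = W ==> pz Z = Z ==> Rm W Z U = (1/4) *\<^sub>R (J W (J Z U) - J Z (J W U))"
  by (simp add: Rm_def Gm_zv br_zz Gm_simps algebra_simps)

lemma Rm_vzz: "B \<bullet> B = 1 ==> pv U = U ==> pz W = W ==> pz Z = Z ==> Rm U Z W = - (1/2 * (Z \<bullet> W)) *\<^sub>R U - (1/4) *\<^sub>R J Z (J W U)"
  by (simp add: Rm_def Gm_zz Gm_vz Gm_zv Gm_vB br_vz Gm_simps)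

text \<open>Left-invariant fields are parallel along \<open>B\<close>, because \<open>Gm B\<close>
  vanishes.\<close>

lemma nab_B: "B \<bullet> B = 1 ==> nab B a b c = 0"
  by (simp add: nab_def Gm_B Gm_simps br_simps Rm_def)

text \<open>This component is singled out because for \<open>V = J b U\<close> and
  \<open>U \<noteq> 0\<close> its vanishing says that \<open>J Z (J b U)\<close> has the form
  \<open>J c U\<close>, an instance of \<open>J2\<close>.\<close>

lemma nab_Z:
  assumes B: "B \<bullet> B = 1" and U: "pv U = U" and V: "pv V = V" and Z: "pz Z = Z" and UV: "U \<bullet> V = 0" "N U V \<bullet> Z = 0"
  shows "nab Z U V U = - (3/4) *\<^sub>R (J Z (J (N U V) U) - J (N U (J Z V)) U)"
proof -
  have n: "N (J Z U) U = - (U \<bullet> U) *\<^sub>R Z" "N U (J Z U) = (U \<bullet> U) *\<^sub>R Z" "J Z U \<bullet> U = 0" "U \<bullet> J Z U = 0"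
    using N_skew[of "J Z U" U] by (simp_all add: N_J U Z J_self inner_commute[of U "J Z U"])
  have m: "N (J Z U) V = N U (J Z V)"
  proof -
    have "N (J Z U) V \<bullet> w = N U (J Z V) \<bullet> w" for w
    proof -
      have "N (J Z U) V \<bullet> w - N U (J Z V) \<bullet> w = (J w (J Z U) + J Z (J w U)) \<bullet> V"
        using J_skew[of Z "J w U" V] by (simp add: J_inner inner_add_left flip: J_inner)
      then show ?thesis by (simp add: J_anticommute U UV)
    qed
    then show ?thesis using vector_eq_rdot by blast
  qed
  have k: "J Z U \<bullet> V = 0" "U \<bullet> J Z V = 0" "J Z V \<bullet> U = 0" "V \<bullet> J Z U = 0" "V \<bullet> U = 0"
    using J_inner[of Z U V] J_skew[of Z U V] UV by (simp_all add: inner_commute)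
  have a: "J (N U V) (J Z U) = - J Z (J (N U V) U)"
    using J_move[of "N U V" Z U] UV by (simp add: Z)
  have s: "N V U = - N U V" "N V (J Z U) = - N U (J Z V)" "N (J Z V) U = - N U (J Z V)"
    using N_skew[of V U] N_skew[of V "J Z U"] N_skew[of "J Z V" U] m by simp_all
  have r: "Rm U V U = (3/4) *\<^sub>R J (N U V) U + (1/4) *\<^sub>R ((U \<bullet> U) *\<^sub>R V)"
    by (simp add: Rm_vvv B U V s UV k algebra_simps flip: scaleR_left_distrib)
  have Gr: "Gm Z (Rm U V U) = - (3/8) *\<^sub>R J Z (J (N U V) U) - (1/8) *\<^sub>R ((U \<bullet> U) *\<^sub>R J Z V)"
    unfolding r by (simp add: Gm_simps Gm_zv U V Z)
  show ?thesis unfolding nab_def Gr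
    by (simp add: Gm_zv U V Z Rm_simps Rm_vvv B n m k UV s a algebra_simps flip: scaleR_left_distrib)
qed

text \<open>The corresponding component for a direction in \<open>v\<close>; its vanishing is the
  hypothesis from which \<open>J2_from_v\<close> starts.\<close>

lemma nab_V:
  assumes B: "B \<bullet> B = 1" and U: "pv U = U" and V: "pv V = V" and Z: "pz Z = Z" and UV: "U \<bullet> V = 0" "N V U \<bullet> Z = 0"
  shows "nab V U Z U = (3/8) *\<^sub>R (J Z (J (N V U) U) + J (N U (J Z V)) U)"
proof -
  have k: "J Z U \<bullet> V = 0" "U \<bullet> J Z V = 0" "J Z V \<bullet> U = 0" "V \<bullet> J Z U = 0" "V \<bullet> U = 0" "N U V \<bullet> Z = 0"
    using J_inner[of Z V U] J_skew[of Z U V] UV N_skew[of U V] by (simp_all add: inner_commute)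
  have a: "J (N V U) (J Z U) = - J Z (J (N V U) U)"
    using J_move[of "N V U" Z U] UV by (simp add: Z)
  have r: "Rm U Z U = (1/4) *\<^sub>R ((U \<bullet> U) *\<^sub>R Z)"
    by (simp add: Rm_vzv B U Z N_J algebra_simps flip: scaleR_left_diff_distrib)
  have Gr: "Gm V (Rm U Z U) = - (1/8) *\<^sub>R ((U \<bullet> U) *\<^sub>R J Z V)"
    unfolding r by (simp add: Gm_simps Gm_vz V Z)
  have GVU: "Gm V U = (1/2) *\<^sub>R N V U" by (simp add: Gm_vv U V k)
  have GVZ: "Gm V Z = - (1/2) *\<^sub>R J Z V" by (simp add: Gm_vz V Z)
  have s: "N (J Z V) U = - N U (J Z V)" by (rule N_skew)
  show ?thesis unfolding nab_def Gr GVU GVZ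
    by (simp add: Rm_simps Rm_zzv Rm_vvv Rm_vzz B U V Z k UV a s inner_commute[of Z] algebra_simps flip: scaleR_left_distrib)
qed

end

section \<open>The \<open>J2\<close> condition and the parallel directions of the curvature\<close>

context heisenberg_model
begin

text \<open>The condition of Cowling, Dooley, Koranyi and Ricci that characterizes the symmetric Damek-Ricci spaces.\<close>

definition J2 :: bool where
  "J2 \<longleftrightarrow> (\<forall>a b u. pz a = a \<longrightarrow> pz b = b \<longrightarrow> a \<bullet> b = 0 \<longrightarrow> pv u = u \<longrightarrow> (\<exists>c. pz c = c \<and> J a (J b u) = J c u))"

lemma J_eq_0_iff: "pz w = w ==> pv u = u ==> J w u = 0 \<longleftrightarrow> w = 0 \<or> u = 0"
  using J_inner_J[of w u w] by (metis inner_eq_zero_iff mult_eq_0_iff linear_0[OF lin_J] linear_0[OF lin_J_left])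

lemma norm_J: "pz w = w ==> pv u = u ==> norm (J w u) = norm w * norm u"
  using J_inner_J[of w u w] by (simp add: norm_eq_sqrt_inner real_sqrt_mult)

text \<open>\<open>J a (J b u)\<close> is orthogonal to \<open>u\<close>, which removes the multiple
  of \<open>u\<close>, and \<open>N u\<close> recovers \<open>c\<close> from
  \<open>J c u\<close>.\<close>

lemma J2_at:
  assumes "pz a = a" "pz b = b" "a \<bullet> b = 0" "pv u = u" "u \<bullet> u = 1" and "J a (J b u) = s *\<^sub>R u + J c u"
  shows "J a (J b u) = J (N u (J a (J b u))) u"
proof -
  have "J a (J b u) \<bullet> u = 0"
    using J_skew[of a "J b u" u] J_inner_J[of b u a] assms(1-5) by (simp add: inner_commute)
  then have "s = 0" using assms(4-6) by (simp add: inner_add_left J_self)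
  then have e: "J a (J b u) = J c u" using assms(6) by simp
  have "N u (J c u) = pz c" using assms(4,5) by (simp add: N_J)
  then show ?thesis unfolding e by simp
qed

lemma J2I_unit:
  assumes "\<And>a b u. pz a = a ==> pz b = b ==> a \<bullet> b = 0 ==> a \<noteq> 0 ==> b \<noteq> 0 ==> pv u = u ==> u \<bullet> u = 1 ==> \<exists>c. pz c = c \<and> J a (J b u) = J c u"
  shows J2
  unfolding J2_def
proof (intro allI impI)
  fix a b u assume h: "pz a = a" "pz b = b" "a \<bullet> b = 0" "pv u = u"
  show "\<exists>c. pz c = c \<and> J a (J b u) = J c u"
  proof (cases "a = 0 \<or> b = 0 \<or> u = 0")
    case True
    then show ?thesis by (intro exI[of _ 0]) auto
  next
    case False
    let ?u = "u /\<^sub>R norm u"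
    have "?u \<bullet> ?u = 1" using False by (simp add: dot_square_norm power2_eq_square)
    then obtain c where c: "pz c = c" "J a (J b ?u) = J c ?u"
      using assms[of a b ?u] h False by auto
    from arg_cong[OF c(2), of "\<lambda>x. norm u *\<^sub>R x"] have "J a (J b u) = J c u" using False by simp
    then show ?thesis using c(1) by blast
  qed
qed

text \<open>For a fixed unit \<open>u\<close> the hypothesis yields
  \<open>J Z (J b u) = J (t b) u\<close> with a map \<open>t\<close> behaving like a complex
  structure on the complement of \<open>Z\<close>. For \<open>f\<close> orthogonal to
  \<open>e\<close> the product \<open>J f (J e u)\<close> is treated by splitting \<open>f\<close>
  into a multiple of \<open>t e\<close> and a rest; for the rest, \<open>pair\<close> applies the
  hypothesis to a vector other than \<open>u\<close>.\<close>

lemma J2_from_z: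
  assumes Z: "pz Z = Z" "Z \<bullet> Z = 1"
    and nab: "\<And>U b. pv U = U ==> pz b = b ==> b \<bullet> Z = 0 ==> \<exists>c. pz c = c \<and> J Z (J b U) = J c U"
  shows J2
proof (rule J2I_unit)
  fix a b u assume h: "pz a = a" "pz b = b" "a \<bullet> b = 0" "pv u = u" "u \<bullet> u = 1"
  define t where "t b = N u (J Z (J b u))" for b
  have t: "pz (t b) = t b" "J Z (J b u) = J (t b) u" "t b \<bullet> Z = 0" "t b \<bullet> b = 0" "J Z (J (t b) u) = - J b u"
    if b: "pz b = b" "b \<bullet> Z = 0" for b
  proof -
    obtain c where c: "pz c = c" "J Z (J b u) = J c u" using nab[OF h(4) b] by blast
    then have tb: "t b = c" using h(4,5) by (simp add: t_def N_J)
    show "pz (t b) = t b" "J Z (J b u) = J (t b) u" using c tb by simp_all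
    then have "J Z (J (t b) u) = J Z (J Z (J b u))" by simp
    then show "J Z (J (t b) u) = - J b u" using Z by (simp add: J_J)
    have "t b \<bullet> w = J Z (J b u) \<bullet> J w u" if "pz w = w" for w
      using J_inner_J[of c u w] c tb that h(4,5) by simp
    then show "t b \<bullet> Z = 0" "t b \<bullet> b = 0"
      using Z b J_inner_J'[of Z "J b u" u] J_skew[of b u u] J_skew[of Z "J b u" "J b u"]
      by (simp_all add: J_self h(4) inner_commute[of _ u])
  qed
  have pair: "\<exists>c. pz c = c \<and> J f (J e u) = J c u" if e: "pz e = e" "e \<bullet> Z = 0" and f: "pz f = f" "f \<bullet> Z = 0" "f \<bullet> e = 0" "f \<bullet> t e = 0" "f \<bullet> f = 1" for e f
  proof -
    \<comment> \<open>Apply the hypothesis to \<open>u + J f u\<close>; equality in Cauchy-Schwarz identifies \<open>J c (J f u)\<close>.\<close>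
    define b where "b = t e"
    have b: "pz b = b" "b \<bullet> Z = 0" "J Z (J b u) = - J e u" using t[OF e] by (simp_all add: b_def)
    have fb: "f \<bullet> b = 0" using f by (simp add: b_def)
    let ?W = "u + J f u"
    obtain c where c: "pz c = c" "J Z (J b ?W) = J c ?W" using nab[of ?W b] h(4) b by auto
    have "J Z (J b (J f u)) = J f (J Z (J b u))"
      using J_move[of b f u] J_move[of Z f "J b u"] b Z f fb by (simp add: inner_commute)
    then have eq: "- J e u - J f (J e u) = J c u + J c (J f u)" using c(2) b(3) by simp
    have ef: "J f (J e u) = - J e (J f u)" using J_move[of f e u] e f by (simp add: inner_commute)
    have "norm (J Z (J b ?W)) = norm (J c ?W)" using c by simp
    then have "norm Z * (norm b * norm ?W) = norm c * norm ?W"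
      using norm_J[of Z "J b ?W"] norm_J[of b ?W] norm_J[OF c(1), of ?W] Z(1) b(1) h(4) by simp
    moreover have "norm ?W \<noteq> 0"
    proof -
      have "?W \<bullet> ?W = 1 + 1"
        using J_inner_J[of f u f] J_skew[of f u u] h(4,5) f(1,5) J_self[of f u] by (simp add: inner_add_left inner_add_right)
      then show ?thesis by auto
    qed
    moreover have "norm Z = 1" using Z by (simp add: norm_eq_sqrt_inner)
    moreover have "norm (J Z (J b u)) = norm (J e u)" using b(3) by simp
    then have "norm Z * norm b = norm e"
      using norm_J[of Z "J b u"] norm_J[of b u] norm_J[of e u] Z(1) b(1) e(1) h(4,5) by (simp add: norm_eq_sqrt_inner)
    ultimately have nce: "c \<bullet> c = e \<bullet> e" by (simp add: norm_eq)
    have uu: "J x u \<bullet> J y u = x \<bullet> y" if "pz x = x" "pz y = y" for x y using that h J_inner_J[of x u y] by simp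
    have ff: "J x (J f u) \<bullet> J y (J f u) = x \<bullet> y" if "pz x = x" "pz y = y" for x y
      using that J_inner_J[of x "J f u" y] uu[OF f(1) f(1)] f(5) by simp
    have eq1: "J (e + c) u = J (e - c) (J f u)" using eq ef by (simp add: algebra_simps)
    have "(e + c) \<bullet> (e + c) = (e - c) \<bullet> (e - c)"
      using arg_cong[OF eq1, of "\<lambda>x. x \<bullet> x"] uu[of "e + c" "e + c"] ff[of "e - c" "e - c"] e c by simp
    then have ec: "e \<bullet> c = 0" by (simp add: inner_add_left inner_add_right inner_diff_left inner_diff_right inner_commute)
    have "J (e + c) u \<bullet> J e u = J (e - c) (J f u) \<bullet> J e u" using eq1 by simp
    moreover have "J (e + c) u \<bullet> J e u = e \<bullet> e" using uu[of "e + c" e] e c ec by (simp add: inner_add_left inner_commute[of c e])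
    moreover have "J e (J f u) \<bullet> J e u = 0" using J_inner_J'[of e "J f u" u] J_self[of f u] h by simp
    ultimately have CS: "- (J c (J f u) \<bullet> J e u) = e \<bullet> e" by (simp add: inner_diff_left)
    have "(J c (J f u) + J e u) \<bullet> (J c (J f u) + J e u) = 0"
      using ff[OF c(1) c(1)] uu[OF e(1) e(1)] nce CS by (simp add: inner_add_left inner_add_right inner_commute)
    then have "J c (J f u) = - J e u" by (simp add: eq_neg_iff_add_eq_0)
    then have "- J f (J e u) = J c u" using eq by (simp add: algebra_simps)
    moreover have "J (- c) u = - J c u" by simp
    ultimately have "J f (J e u) = J (- c) u" by (metis minus_minus)
    then show ?thesis using c(1) by (intro exI[of _ "- c"]) simp
  qed
  have lin2: "\<exists>c. pz c = c \<and> x + y = J c u" if "\<exists>c. pz c = c \<and> x = J c u" "\<exists>c. pz c = c \<and> y = J c u" for x y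
  proof -
    obtain c d where "pz c = c" "x = J c u" "pz d = d" "y = J d u" using \<open>\<exists>c. pz c = c \<and> x = J c u\<close> \<open>\<exists>c. pz c = c \<and> y = J c u\<close> by blast
    then show ?thesis by (intro exI[of _ "c + d"]) simp
  qed
  have lin1: "\<exists>c. pz c = c \<and> k *\<^sub>R x = J c u" if "\<exists>c. pz c = c \<and> x = J c u" for k x
  proof -
    obtain c where "pz c = c" "x = J c u" using \<open>\<exists>c. pz c = c \<and> x = J c u\<close> by blast
    then show ?thesis by (intro exI[of _ "k *\<^sub>R c"]) simp
  qed
  have perp: "\<exists>c. pz c = c \<and> J f (J e u) = J c u" if e: "pz e = e" "e \<bullet> Z = 0" and f: "pz f = f" "f \<bullet> Z = 0" "f \<bullet> e = 0" for e f
  proof (cases "e = 0")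
    case True then show ?thesis by (intro exI[of _ 0]) simp
  next
    case False
    note te = t[OF e]
    have tt: "t e \<bullet> t e = e \<bullet> e"
      using J_inner_J[of "t e" u "t e"] J_inner_J'[of Z "J e u" "J e u"] J_inner_J[of e u e] te(1,2) e(1) Z h(4,5) by simp
    have ee: "e \<bullet> e \<noteq> 0" using False by simp
    define k where "k = (f \<bullet> t e) / (e \<bullet> e)"
    define g where "g = f - k *\<^sub>R t e"
    have g: "pz g = g" "g \<bullet> Z = 0" "g \<bullet> e = 0" "g \<bullet> t e = 0"
      using f te(1,3,4) ee tt by (simp_all add: g_def k_def inner_diff_left)
    \<comment> \<open>Up to scale \<open>Z\<close>, \<open>e\<close> and \<open>t e\<close> multiply
      like quaternion units on \<open>u\<close>, so the part of \<open>f\<close> along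
      \<open>t e\<close> leads back to \<open>J Z u\<close>.\<close>
    have "J (t e) (J e u) = (- (e \<bullet> e)) *\<^sub>R J Z u"
    proof -
      have "J (t e) (J e u) = - J e (J (t e) u)" using J_move[of "t e" e u] te(1,4) e(1) by (simp add: inner_commute)
      also have "\<dots> = - J e (J Z (J e u))" using te(2) by simp
      also have "\<dots> = J Z (J e (J e u))" using J_move[of e Z "J e u"] e Z by (simp add: inner_commute)
      also have "\<dots> = - ((e \<bullet> e) *\<^sub>R J Z u)" by (simp add: J_J e h(4))
      finally show ?thesis by simp
    qed
    then have 1: "\<exists>c. pz c = c \<and> J (t e) (J e u) = J c u" using Z by (intro exI[of _ "(- (e \<bullet> e)) *\<^sub>R Z"]) simp
    have 2: "\<exists>c. pz c = c \<and> J g (J e u) = J c u"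
    proof (cases "g = 0")
      case True then show ?thesis by (intro exI[of _ 0]) simp
    next
      case False
      let ?g = "g /\<^sub>R norm g"
      have "\<exists>c. pz c = c \<and> J ?g (J e u) = J c u"
        by (rule pair[OF e]) (use g False in \<open>auto simp: dot_square_norm power2_eq_square\<close>)
      from lin1[OF this, of "norm g"] show ?thesis using False by simp
    qed
    have "J f (J e u) = k *\<^sub>R J (t e) (J e u) + J g (J e u)" by (simp add: g_def)
    then show ?thesis using lin2[OF lin1[OF 1] 2] by simp
  qed
  \<comment> \<open>General \<open>a\<close>, \<open>b\<close> are reduced to the complement of
    \<open>Z\<close>. The multiples of \<open>u\<close> coming from the squares of
    \<open>J Z\<close> and \<open>J b'\<close> cancel because
    \<open>a \<bullet> b = 0\<close>.\<close>
  define a' where "a' = a - (a \<bullet> Z) *\<^sub>R Z"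
  define b' where "b' = b - (b \<bullet> Z) *\<^sub>R Z"
  have a': "pz a' = a'" "a' \<bullet> Z = 0" and b': "pz b' = b'" "b' \<bullet> Z = 0"
    using h Z by (simp_all add: a'_def b'_def inner_diff_left)
  have aa: "a = (a \<bullet> Z) *\<^sub>R Z + a'" "b = (b \<bullet> Z) *\<^sub>R Z + b'" by (simp_all add: a'_def b'_def)
  show "\<exists>c. pz c = c \<and> J a (J b u) = J c u"
  proof (cases "b' = 0")
    case True
    then have bZ: "b = (b \<bullet> Z) *\<^sub>R Z" using aa(2) by simp
    show ?thesis
    proof (cases "b \<bullet> Z = 0")
      case True then show ?thesis using bZ by (intro exI[of _ 0]) simp
    next
      case False
      have "a \<bullet> b = (b \<bullet> Z) * (a \<bullet> Z)" by (subst bZ) simp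
      then have aZ: "a \<bullet> Z = 0" using h(3) False by simp
      have "J a (J Z u) = - J Z (J a u)" using J_move[of a Z u] h Z aZ by simp
      then have "J a (J b u) = (- (b \<bullet> Z)) *\<^sub>R J Z (J a u)" by (subst bZ) simp
      then show ?thesis using lin1[OF nab[OF h(4,1) aZ], of "- (b \<bullet> Z)"] by simp
    qed
  next
    case False
    define k where "k = (a' \<bullet> b') / (b' \<bullet> b')"
    define f where "f = a' - k *\<^sub>R b'"
    have f: "pz f = f" "f \<bullet> Z = 0" "f \<bullet> b' = 0" using a' b' False by (simp_all add: f_def k_def inner_diff_left)
    have "a' \<bullet> b' = a \<bullet> b'" using b' by (simp add: a'_def inner_diff_left inner_commute[of Z b'])
    also have "\<dots> = a \<bullet> b - (a \<bullet> Z) * (b \<bullet> Z)" by (simp add: b'_def inner_diff_right)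
    finally have ab: "a' \<bullet> b' = - ((a \<bullet> Z) * (b \<bullet> Z))" using h(3) by simp
    have a_eq: "a = (a \<bullet> Z) *\<^sub>R Z + k *\<^sub>R b' + f" using aa(1) by (simp add: f_def)
    have fZ: "J f (J Z u) = - J Z (J f u)" using J_move[of f Z u] f Z by simp
    have bZ: "J b' (J Z u) = - J Z (J b' u)" using J_move[of b' Z u] b' Z by simp
    have kb: "k * (b' \<bullet> b') = - ((a \<bullet> Z) * (b \<bullet> Z))" using False ab by (simp add: k_def)
    have "J a (J b u) = J ((a \<bullet> Z) *\<^sub>R Z + k *\<^sub>R b' + f) (J ((b \<bullet> Z) *\<^sub>R Z + b') u)" using a_eq aa(2) by metis
    also have "\<dots> = ((a \<bullet> Z) - k * (b \<bullet> Z)) *\<^sub>R J Z (J b' u) + ((- (b \<bullet> Z)) *\<^sub>R J Z (J f u) + J f (J b' u))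
        - ((a \<bullet> Z) * (b \<bullet> Z) + k * (b' \<bullet> b')) *\<^sub>R u"
      by (simp add: fZ bZ J_J Z b' h(4) algebra_simps)
    also have "(a \<bullet> Z) * (b \<bullet> Z) + k * (b' \<bullet> b') = 0" using kb by simp
    finally have e: "J a (J b u) = ((a \<bullet> Z) - k * (b \<bullet> Z)) *\<^sub>R J Z (J b' u) + ((- (b \<bullet> Z)) *\<^sub>R J Z (J f u) + J f (J b' u))" by simp
    show ?thesis unfolding e
      by (rule lin2[OF lin1[OF nab[OF h(4) b']] lin2[OF lin1[OF nab[OF h(4) f(1,2)]] perp[OF b' f]]])
  qed
qed

text \<open>\<open>rest\<close> projects to the complement of the span of \<open>V\<close> and all
  \<open>J c V\<close>. If this complement is 0, a dimension count transports the decomposition from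
  \<open>V\<close> to \<open>u\<close>. Otherwise a nonzero \<open>K0\<close> in it forces
  \<open>z\<close> to be spanned by \<open>a\<close>, \<open>b\<close>, \<open>d\<close>, and
  \<open>J a (J b u) = - J d u\<close> can be verified on each part of \<open>v\<close>.\<close>

lemma J2_from_v:
  assumes V: "pv V = V" "V \<bullet> V = 1"
    and nab: "\<And>U Z. pv U = U ==> pz Z = Z ==> U \<bullet> V = 0 ==> N V U \<bullet> Z = 0 ==> J Z (J (N V U) U) + J (N U (J Z V)) U = 0"
  shows J2
proof (rule J2I_unit)
  fix a b u assume h: "pz a = a" "pz b = b" "a \<bullet> b = 0" "a \<noteq> 0" "b \<noteq> 0" "pv u = u" "u \<bullet> u = 1"
  have JV: "J x V \<bullet> J y V = x \<bullet> y" if "pz x = x" "pz y = y" for x y using that V J_inner_J[of x V y] by simp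
  define rest where "rest x = x - (x \<bullet> V) *\<^sub>R V - J (N V x) V" for x
  have rest: "pv (rest x) = rest x" "rest x \<bullet> V = 0" "N V (rest x) = 0" if "pv x = x" for x
  proof -
    show "pv (rest x) = rest x" using that V by (simp add: rest_def)
    show "rest x \<bullet> V = 0" using V by (simp add: rest_def inner_diff_left J_self)
    show "N V (rest x) = 0" using V by (simp add: rest_def N_J)
  qed
  have restV: "rest V = 0" using V by (simp add: rest_def)
  have at_V: "rest (J y (J x V)) = 0" if xy: "pz x = x" "pz y = y" for x y
  proof -
    define U where "U = rest (J y (J x V))"
    have U: "pv U = U" "U \<bullet> V = 0" "N V U = 0" unfolding U_def by (rule rest, simp)+
    have "J (N U (J x V)) U = 0" using nab[OF U(1) xy(1) U(2)] U(3) by simp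
    then have "N U (J x V) = 0" using J_eq_0_iff[of "N U (J x V)" U] U(1) by auto
    then have "J y U \<bullet> J x V = 0" using J_inner[of y U "J x V"] by simp
    then have 1: "U \<bullet> J y (J x V) = 0" using J_skew[of y U "J x V"] by simp
    have "U \<bullet> J w V = 0" for w using J_inner[of w V U] U(3) by (simp add: inner_commute)
    then have "U \<bullet> U = 0" using 1 U(2) unfolding U_def[of ] by (simp add: rest_def inner_diff_right)
    then show ?thesis by (simp add: U_def)
  qed
  show "\<exists>c. pz c = c \<and> J a (J b u) = J c u"
  proof (cases "\<exists>K. pv K = K \<and> rest K = K \<and> K \<noteq> 0")
    case True
    then obtain K0 where K0: "pv K0 = K0" "rest K0 = K0" "K0 \<noteq> 0" by blast
    have restI: "K \<bullet> V = 0 \<and> N V K = 0" if "pv K = K" "rest K = K" for K using rest(2,3)[OF that(1)] that(2) by simp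
    \<comment> \<open>The candidate for \<open>J a (J b x) = - J d x\<close>: it is what the
      hypothesis with \<open>Z = a\<close> produces for \<open>U = J b V + K\<close>, for every
      \<open>K\<close> in the complement.\<close>
    define d where "d = N (J b V) (J a V)"
    have VaV: "J b V \<bullet> J a V = 0" using JV[OF h(2,1)] h(3) by (simp add: inner_commute)
    have main: "J a (J b (J b V + K)) + J d (J b V + K) = 0" if K: "pv K = K" "rest K = K" for K
    proof -
      let ?U = "J b V + K"
      note k = restI[OF K]
      have "N V ?U = b" using V h(2) k by (simp add: N_J)
      moreover have "?U \<bullet> V = 0" using k by (simp add: inner_add_left J_self)
      moreover have "N K (J a V) = 0"
      proof -
        have "N K (J a V) \<bullet> w = 0" for w
        proof -
          have "N K (J a V) \<bullet> w = - (K \<bullet> J w (J a V))" using J_inner[of w K "J a V"] J_skew[of w K "J a V"] by simp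
          moreover have "J w (J a V) = J (pz w) (J a V)" by simp
          then have "rest (J w (J a V)) = 0" using at_V[OF h(1), of "pz w"] by simp
          then have "J w (J a V) = (J w (J a V) \<bullet> V) *\<^sub>R V + J (N V (J w (J a V))) V" by (simp add: rest_def algebra_simps)
          then have "K \<bullet> J w (J a V) = (J w (J a V) \<bullet> V) * (K \<bullet> V) + K \<bullet> J (N V (J w (J a V))) V"
            by (metis inner_add_right inner_scaleR_right)
          moreover have "K \<bullet> J x V = 0" for x using J_inner[of x V K] k by (simp add: inner_commute)
          ultimately show ?thesis using k by simp
        qed
        then show ?thesis using vector_eq_rdot[of "N K (J a V)" 0] by simp
      qed
      then have "N ?U (J a V) = d" by (simp add: d_def)
      ultimately show ?thesis using nab[of ?U a] h K V by (simp add: inner_commute)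
    qed
    have mainV: "J a (J b (J b V)) + J d (J b V) = 0" using main[of 0] restV by (simp add: rest_def)
    have mainK: "J a (J b K) + J d K = 0" if "pv K = K" "rest K = K" for K
      using main[OF that] mainV by (simp add: algebra_simps)
    have pd: "pz d = d" by (simp add: d_def)
    have da: "d \<bullet> a = 0" and db: "d \<bullet> b = 0"
    proof -
      have "d \<bullet> a = J a (J b V) \<bullet> J a V" "d \<bullet> b = J b (J b V) \<bullet> J a V" unfolding d_def by (simp_all add: J_inner)
      then show "d \<bullet> a = 0" "d \<bullet> b = 0" using J_inner_J'[of a "J b V" V] by (simp_all add: J_J J_self V inner_commute[of V])
    qed
    have atV: "J a (J b V) + J d V = 0"
    proof -
      have "J d (J b V) = - J b (J d V)" using J_move[of d b V] pd h db by simp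
      then have "- (- J b (J d V)) = - ((b \<bullet> b) *\<^sub>R J a V)" using mainV h V by (simp add: J_J algebra_simps del: minus_minus)
      then have "J b (J d V) = - ((b \<bullet> b) *\<^sub>R J a V)" by simp
      then have "J b (J b (J d V)) = - ((b \<bullet> b) *\<^sub>R J b (J a V))" by simp
      moreover have "J b (J a V) = - J a (J b V)" using J_move[of b a V] h by (simp add: inner_commute)
      ultimately have "(b \<bullet> b) *\<^sub>R (J a (J b V) + J d V) = 0" using h V by (simp add: J_J scaleR_add_right neg_eq_iff_add_eq_0 add.commute)
      then show ?thesis using h(5) by simp
    qed
    \<comment> \<open>For such \<open>f\<close> the operator \<open>J f\<close> preserves the
      complement, commutes with \<open>J a\<close> composed with \<open>J b\<close>, and
      anticommutes with \<open>J d\<close>. Comparing at \<open>J f K0\<close> leaves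
      \<open>2 *\<^sub>R J f (J d K0) = 0\<close>, while \<open>J d K0 = - J a (J b K0)\<close> is
      nonzero.\<close>
    have span: "f = 0" if f: "pz f = f" "f \<bullet> a = 0" "f \<bullet> b = 0" "f \<bullet> d = 0" for f
    proof -
      have K1: "pv (J f K0) = J f K0" "rest (J f K0) = J f K0"
      proof -
        have k: "K0 \<bullet> V = 0" "N V K0 = 0" using restI[OF K0(1,2)] by simp_all
        have "J f K0 \<bullet> V = 0" using J_skew[of f K0 V] J_inner[of f V K0] k by (simp add: inner_commute)
        moreover have "N V (J f K0) = 0"
        proof -
          have "N V (J f K0) \<bullet> w = 0" for w
          proof -
            have "N V (J f K0) \<bullet> w = - (J f (J (pz w) V) \<bullet> K0)"
              using J_inner[of w V "J f K0"] J_skew[of f "J w V" K0] by (simp add: inner_commute)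
            moreover have "J f (J (pz w) V) = (J f (J (pz w) V) \<bullet> V) *\<^sub>R V + J (N V (J f (J (pz w) V))) V"
              using at_V[of "pz w" f] f(1) by (simp add: rest_def algebra_simps)
            then have "J f (J (pz w) V) \<bullet> K0 = (J f (J (pz w) V) \<bullet> V) * (V \<bullet> K0) + J (N V (J f (J (pz w) V))) V \<bullet> K0"
              by (metis inner_add_left inner_scaleR_left)
            moreover have "J x V \<bullet> K0 = 0" for x using J_inner[of x V K0] k by simp
            ultimately show ?thesis using k by (simp add: inner_commute)
          qed
          then show ?thesis using vector_eq_rdot[of "N V (J f K0)" 0] by simp
        qed
        ultimately show "pv (J f K0) = J f K0" "rest (J f K0) = J f K0" by (simp_all add: rest_def)
      qed
      have "J a (J b (J f K0)) = J f (J a (J b K0))"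
        using J_move[of b f K0] J_move[of a f "J b K0"] h f by (simp add: inner_commute)
      moreover have "J d (J f K0) = - J f (J d K0)" using J_move[of d f K0] pd f by (simp add: inner_commute)
      moreover have "J a (J b K0) = - J d K0" using mainK[OF K0(1,2)] by (simp add: eq_neg_iff_add_eq_0)
      ultimately have "2 *\<^sub>R J f (J d K0) = 0" using mainK[OF K1] by (simp add: scaleR_2) (simp add: neg_eq_iff_add_eq_0)
      then have "f = 0 \<or> J d K0 = 0" using J_eq_0_iff[of f "J d K0"] f by simp
      moreover have "J d K0 \<noteq> 0"
      proof
        assume "J d K0 = 0"
        then have "J a (J b K0) = 0" using mainK[OF K0(1,2)] by simp
        then show False using J_eq_0_iff[of a "J b K0"] J_eq_0_iff[of b K0] h K0 by simp
      qed
      ultimately show ?thesis by simp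
    qed
    define T where "T x = J a (J b x) + J d x" for x
    have Tl: "T (x + y) = T x + T y" "T (k *\<^sub>R x) = k *\<^sub>R T x" for x y k by (simp_all add: T_def algebra_simps)
    have Jsym: "J b (J a V) = - J a (J b V)" using J_move[of b a V] h by (simp add: inner_commute)
    have TJ: "T (J w V) = 0" for w
    proof -
      have TJa: "T (J a V) = 0"
      proof -
        have "J a (J b (J a V)) = - J a (J a (J b V))" by (simp add: Jsym)
        moreover have "J d (J a V) = - J a (J d V)" using J_move[of d a V] pd h da by simp
        moreover have "J d V = - J a (J b V)" using atV by (simp add: eq_neg_iff_add_eq_0 add.commute)
        ultimately show ?thesis by (simp add: T_def)
      qed
      have TJb: "T (J b V) = 0" using mainV by (simp add: T_def)
      have TJd: "T (J d V) = 0"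
      proof -
        have "J a (J b (J d V)) = J d (J a (J b V))"
          using J_move[of b d V] J_move[of a d "J b V"] h pd da db by (simp add: inner_commute)
        then have "T (J d V) = J d (T V)" by (simp add: T_def)
        then show ?thesis using atV by (simp add: T_def)
      qed
      define f where "f = pz w - ((w \<bullet> a) / (a \<bullet> a)) *\<^sub>R a - ((w \<bullet> b) / (b \<bullet> b)) *\<^sub>R b - (if d = 0 then 0 else ((w \<bullet> d) / (d \<bullet> d)) *\<^sub>R d)"
      have "f = 0"
      proof (rule span)
        have o: "a \<bullet> b = 0" "b \<bullet> a = 0" "d \<bullet> a = 0" "a \<bullet> d = 0" "d \<bullet> b = 0" "b \<bullet> d = 0"
          using h(3) da db by (simp_all add: inner_commute)
        have w: "pz w \<bullet> a = w \<bullet> a" "pz w \<bullet> b = w \<bullet> b" "pz w \<bullet> d = w \<bullet> d"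
          using pz_sym[of w a] pz_sym[of w b] pz_sym[of w d] h(1,2) pd by simp_all
        have ne: "a \<bullet> a \<noteq> 0" "b \<bullet> b \<noteq> 0" using h(4,5) by simp_all
        show "pz f = f" using h(1,2) pd by (simp add: f_def)
        show "f \<bullet> a = 0" "f \<bullet> b = 0" using ne by (simp_all add: f_def inner_diff_left o w)
        show "f \<bullet> d = 0" by (simp add: f_def inner_diff_left o w)
      qed
      then have "pz w = ((w \<bullet> a) / (a \<bullet> a)) *\<^sub>R a + ((w \<bullet> b) / (b \<bullet> b)) *\<^sub>R b + (if d = 0 then 0 else ((w \<bullet> d) / (d \<bullet> d))) *\<^sub>R d"
        by (simp add: f_def algebra_simps split: if_splits)
      then have "J w V = ((w \<bullet> a) / (a \<bullet> a)) *\<^sub>R J a V + ((w \<bullet> b) / (b \<bullet> b)) *\<^sub>R J b V + (if d = 0 then 0 else ((w \<bullet> d) / (d \<bullet> d))) *\<^sub>R J d V"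
        using J_pz[of w V] by (metis J_simps(2,4))
      then show ?thesis by (simp add: Tl TJa TJb TJd)
    qed
    have "T (rest u) = 0"
      using mainK[of "rest u"] rest[OF h(6)] by (simp add: T_def rest_def V N_J)
    moreover have "u = (u \<bullet> V) *\<^sub>R V + J (N V u) V + rest u" by (simp add: rest_def)
    moreover have "T V = 0" using atV by (simp add: T_def)
    ultimately have "T u = 0" using Tl TJ by (metis add.right_neutral scaleR_zero_right)
    then have "J a (J b u) = J (- d) u" by (simp add: T_def eq_neg_iff_add_eq_0)
    then show ?thesis using pd by (intro exI[of _ "- d"]) simp
  next
    case False
    have r0: "rest x = 0" if "pv x = x" for x
    proof -
      have "rest (rest x) = rest x" using rest[OF that] by (simp add: rest_def[of "rest x"])
      then show ?thesis using False rest(1)[OF that] by blast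
    qed
    \<comment> \<open>\<open>L\<close> carries the decomposition of \<open>v\<close> along
      \<open>V\<close> to the one along \<open>u\<close>; it is injective, hence surjective, so
      \<open>J a (J b u)\<close> is a multiple of \<open>u\<close> plus some
      \<open>J c u\<close>.\<close>
    define L where "L x = (x \<bullet> V) *\<^sub>R u + J (N V x) u + (x - pv x)" for x
    have lL: "linear L" by (auto simp: linear_iff L_def inner_add_left algebra_simps)
    have pL: "pv (L x) = (x \<bullet> V) *\<^sub>R u + J (N V x) u" for x by (simp add: L_def h(6))
    have "inj L"
      unfolding linear_injective_0[OF lL]
    proof (intro allI impI)
      fix x assume x: "L x = 0"
      then have p: "(x \<bullet> V) *\<^sub>R u + J (N V x) u = 0" using pL[of x] by simp
      then have "((x \<bullet> V) *\<^sub>R u + J (N V x) u) \<bullet> u = 0" by simp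
      then have s: "x \<bullet> V = 0" using h by (simp add: inner_add_left J_self)
      then have "N V x = 0" using p J_eq_0_iff[of "N V x" u] h by auto
      moreover have "pv x = (pv x \<bullet> V) *\<^sub>R V + J (N V (pv x)) V" using r0[of "pv x"] by (simp add: rest_def algebra_simps)
      moreover have "pv x \<bullet> V = x \<bullet> V" using pv_sym[of x V] V by simp
      ultimately have "pv x = 0" using s by simp
      then show "x = 0" using x s \<open>N V x = 0\<close> by (simp add: L_def)
    qed
    then have "surj L" using linear_injective_imp_surjective[OF lL] by simp
    then obtain x where "L x = J a (J b u)" by (metis surjD)
    then have "J a (J b u) = (x \<bullet> V) *\<^sub>R u + J (N V x) u" using pL[of x] by simp
    then have "J a (J b u) = J (N u (J a (J b u))) u" by (rule J2_at[OF h(1-3,6,7)])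
    then show ?thesis by (metis pz_N)
  qed
qed

text \<open>Adding and subtracting \<open>parity\<close> shows that \<open>pv d\<close> and
  \<open>pz d\<close> are parallel directions separately, as \<open>B\<close> is one by
  \<open>nab_B\<close>; and one of the two is nonzero.\<close>

lemma parallel_curvature_imp_J2:
  assumes B: "B \<bullet> B = 1" and d: "\<And>a b c. nab d a b c = 0" and nd: "d \<noteq> (d \<bullet> B) *\<^sub>R B"
    and parity: "\<And>a b c. nab (lam d *\<^sub>R B - pv d + pz d) a b c = 0"
  shows J2
proof -
  have l: "nab (k *\<^sub>R x + m *\<^sub>R y) a b c = k *\<^sub>R nab x a b c + m *\<^sub>R nab y a b c" for k m x y a b c
    by (simp add: linear_add[OF lin_nab] linear_cmul[OF lin_nab])
  have dd: "d = lam d *\<^sub>R B + pv d + pz d" using decomp[of d] by (simp add: lam_def)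
  have zero: "lam d *\<^sub>R nab B a b c + nab (pv d) a b c + nab (pz d) a b c = 0"
    "lam d *\<^sub>R nab B a b c - nab (pv d) a b c + nab (pz d) a b c = 0" for a b c
    using d[of a b c] parity[of a b c] dd
    by (metis linear_add[OF lin_nab] linear_cmul[OF lin_nab], simp add: linear_add[OF lin_nab] linear_cmul[OF lin_nab] linear_diff[OF lin_nab])
  have v: "nab (pv d) a b c = 0" and z: "nab (pz d) a b c = 0" for a b c
  proof -
    have "nab (pv d) a b c + nab (pz d) a b c = 0" "nab (pz d) a b c = nab (pv d) a b c"
      using zero[of a b c] nab_B[OF B] by (simp_all add: algebra_simps)
    then have "2 *\<^sub>R nab (pv d) a b c = 0" by (simp add: scaleR_2)
    then show "nab (pv d) a b c = 0" by simp
    then show "nab (pz d) a b c = 0" using \<open>nab (pz d) a b c = nab (pv d) a b c\<close> by simp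
  qed
  have unit: "(x /\<^sub>R norm x) \<bullet> (x /\<^sub>R norm x) = 1" if "x \<noteq> 0" for x :: 'n
    using that by (simp add: dot_square_norm power2_eq_square)
  show ?thesis
  proof (cases "pz d = 0")
    case False
    define Z where "Z = pz d /\<^sub>R norm (pz d)"
    have Z: "pz Z = Z" "Z \<bullet> Z = 1" using unit[OF False] by (simp_all add: Z_def)
    have nZ: "nab Z a b c = 0" for a b c using z by (simp add: Z_def linear_cmul[OF lin_nab])
    show ?thesis
    proof (rule J2_from_z[OF Z])
      fix U b assume U: "pv U = U" and b: "pz b = b" "b \<bullet> Z = 0"
      show "\<exists>c. pz c = c \<and> J Z (J b U) = J c U"
      proof (cases "U = 0")
        case True then show ?thesis by (intro exI[of _ 0]) simp
      next
        case False
        have NU: "N U (J b U) = (U \<bullet> U) *\<^sub>R b" by (simp add: N_J U b)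
        have 1: "U \<bullet> J b U = 0" "N U (J b U) \<bullet> Z = 0" using J_self[of b U] b by (simp_all add: NU inner_commute)
        have e: "(U \<bullet> U) *\<^sub>R J Z (J b U) = J (N U (J Z (J b U))) U"
          using nab_Z[OF B U _ Z(1) 1] nZ unfolding NU by simp
        have "J Z (J b U) = inverse (U \<bullet> U) *\<^sub>R ((U \<bullet> U) *\<^sub>R J Z (J b U))" using False by simp
        also have "\<dots> = J (inverse (U \<bullet> U) *\<^sub>R N U (J Z (J b U))) U" by (simp only: e J_simps(4))
        finally have "J Z (J b U) = J (inverse (U \<bullet> U) *\<^sub>R N U (J Z (J b U))) U" .
        then show ?thesis by (intro exI[of _ "inverse (U \<bullet> U) *\<^sub>R N U (J Z (J b U))"]) simp
      qed
    qed
  next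
    case True
    then have nv: "pv d \<noteq> 0" using nd dd by (auto simp: lam_def)
    define V where "V = pv d /\<^sub>R norm (pv d)"
    have V: "pv V = V" "V \<bullet> V = 1" using unit[OF nv] by (simp_all add: V_def)
    have nV: "nab V a b c = 0" for a b c using v by (simp add: V_def linear_cmul[OF lin_nab])
    show ?thesis
    proof (rule J2_from_v[OF V])
      fix U Z assume "pv U = U" "pz Z = Z" "U \<bullet> V = 0" "N V U \<bullet> Z = 0"
      from nab_V[OF B this(1) V(1) this(2,3,4)] nV
      show "J Z (J (N V U) U) + J (N U (J Z V)) U = 0" by simp
    qed
  qed
qed

end

section \<open>Isometries of the model are automorphisms\<close>

text \<open>Both the base point and the direction vary; expanding the direction in
  \<open>Basis\<close> reduces the claim to fixed directions.\<close>

lemma frechet_apply_has_derivative: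
  fixes f :: "'a::euclidean_space => 'b::euclidean_space" and g :: "'c::euclidean_space => 'a"
  assumes f: "Cinf_on f UNIV" and k: "(k has_derivative k') (at x)" and g: "(g has_derivative g') (at x)"
  shows "((\<lambda>y. fderiv f ((k y)) (g y)) has_derivative
    (\<lambda>u. fderiv (\<lambda>z. fderiv f z (g x)) ((k x)) (k' u) + fderiv f ((k x)) (g' u))) (at x)"
proof -
  let ?D = "\<lambda>z. fderiv f z"
  have lin: "linear (?D z)" for z using has_derivative_linear[OF Cinf_on_has_derivative[OF f UNIV_I]] .
  have d: "((\<lambda>z. ?D z b) has_derivative fderiv (\<lambda>z. ?D z b) z) (at z)" for b z
    by (rule Cinf_on_has_derivative[OF Cinf_on_frechet[OF f] UNIV_I])
  have eq: "?D z w = (\<Sum>b\<in>Basis. (w \<bullet> b) *\<^sub>R ?D z b)" for z w by (rule linear_apply_basis[OF lin])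
  have 1: "fderiv (\<lambda>z. ?D z w) z u = (\<Sum>b\<in>Basis. (w \<bullet> b) *\<^sub>R fderiv (\<lambda>z. ?D z b) z u)" for z w u
  proof -
    have "((\<lambda>z. ?D z w) has_derivative (\<lambda>u. \<Sum>b\<in>Basis. (w \<bullet> b) *\<^sub>R fderiv (\<lambda>z. ?D z b) z u)) (at z)"
      by (subst eq) (intro has_derivative_sum has_derivative_scaleR_right d)
    from frechet_derivative_at[OF this] show ?thesis by (simp add: fun_eq_iff)
  qed
  have "((\<lambda>y. \<Sum>b\<in>Basis. (g y \<bullet> b) *\<^sub>R ?D (k y) b) has_derivative
    (\<lambda>u. \<Sum>b\<in>Basis. (g x \<bullet> b) *\<^sub>R fderiv (\<lambda>z. ?D z b) ((k x)) (k' u) + (g' u \<bullet> b) *\<^sub>R ?D (k x) b)) (at x)"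
    by (intro has_derivative_sum has_derivative_scaleR has_derivative_compose[OF k d] has_derivative_inner_left g)
  moreover have "(\<lambda>y. ?D (k y) (g y)) = (\<lambda>y. \<Sum>b\<in>Basis. (g y \<bullet> b) *\<^sub>R ?D (k y) b)" by (rule ext) (rule eq)
  ultimately show ?thesis
    by (auto intro: has_derivative_eq_rhs simp: fun_eq_iff sum.distrib 1[of "g x" "k x"] eq[of "k x" "g' _", symmetric])
qed

context heisenberg_model
begin

lemma aut_J: "aut h ==> J (h a) (h u) = h (J a u)"
proof -
  assume h: "aut h"
  note d = autD[OF h]
  have "J (h a) (h u) \<bullet> w = h (J a u) \<bullet> w" for w
  proof -
    have "w = h (inv h w)" using aut_bij[OF h] by (simp add: bij_is_surj surj_f_inv_f)
    then show ?thesis by (metis J_inner d(2,6))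
  qed
  then show ?thesis using vector_eq_rdot by blast
qed

lemma aut_Gm: "aut h ==> Gm (h x) (h y) = h (Gm x y)"
proof -
  assume h: "aut h"
  note d = autD[OF h]
  show ?thesis
    unfolding Gm_def by (simp only: d aut_J[OF h] linear_add[OF d(1)] linear_diff[OF d(1)] linear_cmul[OF d(1)])
qed

lemma aut_nab: "aut h ==> nab (h d) (h a) (h b) (h c) = h (nab d a b c)"
proof -
  assume h: "aut h"
  note G = aut_Gm[OF h] and s = linear_diff[OF autD(1)[OF h]]
  have "Rm (h a) (h b) (h c) = h (Rm a b c)" for a b c
    by (simp only: Rm_def Gm_torsion_free[symmetric] G s[symmetric])
  then show ?thesis by (simp only: nab_def G s)
qed

text \<open>\<open>N\<close> is bilinear on \<open>v\<close> with values in \<open>z\<close>, so the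
  change of sign on \<open>v\<close> respects it.\<close>

lemma aut_parity: "aut (\<lambda>x. lam x *\<^sub>R B - pv x + pz x)"
proof -
  have "(lam x *\<^sub>R B - pv x + pz x) \<bullet> (lam y *\<^sub>R B - pv y + pz y) = x \<bullet> y" for x y
    unfolding inner_decomp[of "lam x *\<^sub>R B - pv x + pz x"] inner_decomp[of x y] by simp
  then show ?thesis
    unfolding aut_def by (auto simp: linear_iff algebra_simps)
qed

text \<open>Vacuous for \<open>B = 0\<close>; for a unit \<open>B\<close> it excludes the spaces on
  which the geodesic inversion is an isometry.\<close>

definition rigid :: bool where "rigid \<longleftrightarrow> (B \<bullet> B = 1 \<longrightarrow> \<not> J2)"

text \<open>Characterizes the line of \<open>B\<close> by the curvature alone, so that a map
  preserving the curvature and its derivative must preserve this line.\<close>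

lemma parallel_direction:
  assumes "B \<bullet> B = 1" "rigid" "\<And>a b c. nab d a b c = 0"
  shows "d = (d \<bullet> B) *\<^sub>R B"
proof (rule ccontr)
  define e where "e = (\<lambda>x. lam x *\<^sub>R B - pv x + pz x)"
  have aut: "aut e" unfolding e_def by (rule aut_parity)
  assume "d \<noteq> (d \<bullet> B) *\<^sub>R B"
  moreover have "nab (e d) a b c = 0" for a b c
  proof -
    have i: "e (inv e x) = x" for x using aut_bij[OF aut] by (simp add: bij_is_surj surj_f_inv_f)
    have "nab (e d) (e (inv e a)) (e (inv e b)) (e (inv e c)) = 0"
      unfolding aut_nab[OF aut] assms(3) by (rule linear_0[OF autD(1)[OF aut]])
    then show ?thesis by (simp only: i)
  qed
  ultimately have J2 using parallel_curvature_imp_J2[OF assms(1,3)] by (simp add: e_def)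
  then show False using assms(1,2) by (simp add: rigid_def)
qed

lemma bounded_bilinear_Gm: "bounded_bilinear Gm"
  by (auto simp: bilinear_conv_bounded_bilinear[symmetric] bilinear_def lin_Gm lin_Gm_left)

lemmas Gm_has_derivative = bounded_bilinear.FDERIV[OF bounded_bilinear_Gm]

lemma th_apply_has_derivative:
  assumes "(f has_derivative f') (at x)" "(g has_derivative g') (at x)"
  shows "((\<lambda>y. th (f y) (g y)) has_derivative (\<lambda>u. dth (f x) (f' u) (g x) + th (f x) (g' u))) (at x)"
  unfolding th_def dth_def
  by (rule has_derivative_eq_rhs, (rule derivative_intros lam_has_derivative pv_has_derivative pz_has_derivative N_has_derivative assms | simp)+)
    (auto simp: fun_eq_iff algebra_simps)

end

locale model_isometry = heisenberg_model +
  fixes h :: "'a => 'a"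
  assumes smooth: "Cinf_on h UNIV" and fix_0: "h 0 = 0"
    and isometric: "th (h x) (fderiv h x u) \<bullet> th (h x) (fderiv h x w) = th x u \<bullet> th x w"
begin

abbreviation Dh :: "'a => 'a => 'a" where "Dh x \<equiv> fderiv h x"

text \<open>The differential in left-invariant frames.\<close>

definition Q :: "'a => 'a => 'a" where "Q x a = th (h x) (Dh x (Xm x a))"

definition dQ :: "'a => 'a => 'a => 'a" where "dQ x a b = fderiv (\<lambda>y. Q y b) x (Xm x a)"

lemma Dh: "(h has_derivative Dh x) (at x)" and lin_Dh: "linear (Dh x)"
  using Cinf_on_has_derivative[OF smooth UNIV_I] has_derivative_linear by blast+

lemma lin_Q: "linear (Q x)"
  using linear_compose[OF linear_compose[OF lin_Xm[of x] lin_Dh[of x]] lin_th[of "h x"]] by (simp add: o_def Q_def[abs_def])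

lemmas Q_simps = linear_add[OF lin_Q] linear_diff[OF lin_Q] linear_cmul[OF lin_Q] linear_0[OF lin_Q]

lemma Q_inner: "Q x a \<bullet> Q x b = a \<bullet> b"
  by (simp add: Q_def isometric)

lemma Q_surj: "\<exists>a. Q x a = w"
proof -
  have "inj (Q x)" unfolding linear_injective_0[OF lin_Q] using Q_inner by (metis inner_eq_zero_iff)
  then have "surj (Q x)" using linear_injective_imp_surjective[OF lin_Q] by simp
  then show ?thesis by (metis surjD)
qed

lemma Q_eqI: "(\<And>c. u \<bullet> Q x c = w \<bullet> Q x c) ==> u = w"
  using Q_surj vector_eq_rdot by metis

lemma Cinf_Q: "Cinf_on (\<lambda>x. Q x b) UNIV"
proof -
  have "(\<lambda>x. Dh x (Xm x b)) = (\<lambda>x. \<Sum>c\<in>Basis. (Xm x b \<bullet> c) *\<^sub>R Dh x c)"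
    by (rule ext) (rule linear_apply_basis[OF lin_Dh])
  moreover have "Cinf_on (\<lambda>x. \<Sum>c\<in>Basis. (Xm x b \<bullet> c) *\<^sub>R Dh x c) UNIV"
    by (intro Cinf_on_sum Cinf_on_scaleR Cinf_on_inner Cinf_on_Xm Cinf_on_id Cinf_on_const Cinf_on_frechet smooth open_UNIV)
  ultimately show ?thesis unfolding Q_def by (intro Cinf_on_th smooth open_UNIV) simp
qed

lemma Q_has_derivative: "((\<lambda>y. Q y b) has_derivative fderiv (\<lambda>y. Q y b) x) (at x)"
  by (rule Cinf_on_has_derivative[OF Cinf_Q UNIV_I])

lemma dQ_eqI: "((\<lambda>y. Q y b) has_derivative D) (at x) ==> dQ x a b = D (Xm x a)"
  unfolding dQ_def by (drule frechet_derivative_at) simp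

lemma derivative_unique_along: "(f has_derivative D) (at x) ==> (f has_derivative E) (at x) ==> D (Xm x a) = E (Xm x a)"
  using has_derivative_unique by metis

lemma Xm_has_derivative:
  "((\<lambda>y. Xm y b) has_derivative fderiv (\<lambda>y. Xm y b) x) (at x)"
  by (rule Cinf_on_has_derivative[OF Cinf_on_Xm[OF open_UNIV Cinf_on_id Cinf_on_const] UNIV_I]) simp_all

text \<open>Differentiate the constant \<open>th y (Xm y b) = b\<close> and insert the Maurer-Cartan
  equation.\<close>

lemma Xm_bracket:
  "fderiv (\<lambda>y. Xm y b) x (Xm x a) - fderiv (\<lambda>y. Xm y a) x (Xm x b) = Xm x (br a b)"
proof -
  define X where "X b = fderiv (\<lambda>y. Xm y b) x" for b
  have 1: "dth x (Xm x a) (Xm x b) + th x (X b (Xm x a)) = 0" for a b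
  proof -
    have "((\<lambda>y. th y (Xm y b)) has_derivative (\<lambda>u. dth x u (Xm x b) + th x (X b u))) (at x)"
      unfolding X_def by (rule th_apply_has_derivative[OF has_derivative_ident Xm_has_derivative])
    moreover have "((\<lambda>y. th y (Xm y b)) has_derivative (\<lambda>u. 0)) (at x)" by simp
    ultimately show ?thesis using has_derivative_unique by (metis (no_types, lifting))
  qed
  have "th x (X b (Xm x a)) = - dth x (Xm x a) (Xm x b)" for a b
    using 1[of a b] by (simp only: eq_neg_iff_add_eq_0 add.commute)
  then have "th x (X b (Xm x a) - X a (Xm x b)) = - (dth x (Xm x a) (Xm x b) - dth x (Xm x b) (Xm x a))"
    by (simp add: linear_diff[OF lin_th])
  also have "\<dots> = br a b" unfolding th_maurer_cartan by simp
  finally have "th x (X b (Xm x a) - X a (Xm x b)) = br a b" .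
  then show ?thesis unfolding X_def by (metis Xm_th)
qed

text \<open>Second derivatives of \<open>F\<close> are symmetric, so only the commutator of the
  frame fields survives.\<close>

lemma commutator:
  assumes F: "Cinf_on F UNIV" and FX: "\<And>b y. FX b y = fderiv F y (Xm y b)"
    and d: "(FX b has_derivative Db) (at x)" "(FX a has_derivative Da) (at x)"
  shows "Db (Xm x a) - Da (Xm x b) = fderiv F x (Xm x (br a b))"
proof -
  let ?D = "\<lambda>z. fderiv F z" and ?X = "\<lambda>b. fderiv (\<lambda>y. Xm y b) x"
  have e: "FX b = (\<lambda>y. ?D y (Xm y b))" for b using FX by auto
  note f = frechet_apply_has_derivative[OF F has_derivative_ident Xm_has_derivative]
  have "Db (Xm x a) = fderiv (\<lambda>z. ?D z (Xm x b)) x (Xm x a) + ?D x (?X b (Xm x a))"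
    using derivative_unique_along[OF d(1) f[folded e]] .
  moreover have "Da (Xm x b) = fderiv (\<lambda>z. ?D z (Xm x a)) x (Xm x b) + ?D x (?X a (Xm x b))"
    using derivative_unique_along[OF d(2) f[folded e]] .
  moreover have "fderiv (\<lambda>z. ?D z (Xm x b)) x (Xm x a) = fderiv (\<lambda>z. ?D z (Xm x a)) x (Xm x b)"
    by (rule Cinf_on_frechet_sym[OF F open_UNIV UNIV_I])
  ultimately show ?thesis
    using has_derivative_linear[OF Cinf_on_has_derivative[OF F UNIV_I, of x]]
    by (simp add: linear_diff flip: Xm_bracket)
qed

text \<open>Pulling back by \<open>h\<close> commutes with the exterior derivative: the
  Maurer-Cartan equation at \<open>h x\<close> is compared with the bracket of the frame fields at
  \<open>x\<close>.\<close>

lemma dQ_bracket: "dQ x a b - dQ x b a = Q x (br a b) - br (Q x a) (Q x b)"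
proof -
  define E where "E y b = Dh y (Xm y b)" for y b
  let ?X = "\<lambda>b. fderiv (\<lambda>y. Xm y b) x"
  have dE: "((\<lambda>y. E y b) has_derivative (\<lambda>u. fderiv (\<lambda>z. Dh z (Xm x b)) x u + Dh x (?X b u))) (at x)" for b
    unfolding E_def by (rule frechet_apply_has_derivative[OF smooth has_derivative_ident Xm_has_derivative])
  have dE': "((\<lambda>y. E y b) has_derivative fderiv (\<lambda>y. E y b) x) (at x)" for b
    using dE[of b] frechet_derivative_at[OF dE[of b]] by simp
  have dQ: "dQ x a b = dth (h x) (E x a) (E x b) + th (h x) (fderiv (\<lambda>y. E y b) x (Xm x a))" for a b
    unfolding frechet_derivative_at[OF dE, symmetric]
    by (rule dQ_eqI[OF th_apply_has_derivative[OF Dh dE, folded Q_def[unfolded E_def[symmetric]], unfolded E_def[symmetric]], THEN trans])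
      (simp add: E_def frechet_derivative_at[OF dE, symmetric])
  have "fderiv (\<lambda>y. E y b) x (Xm x a) - fderiv (\<lambda>y. E y a) x (Xm x b) = Dh x (Xm x (br a b))"
    by (rule commutator[OF smooth _ dE' dE']) (simp add: E_def)
  then have "dQ x a b - dQ x b a = dth (h x) (E x a) (E x b) - dth (h x) (E x b) (E x a) + Q x (br a b)"
    unfolding dQ Q_def by (simp add: linear_add[OF lin_th] algebra_simps)
  then show ?thesis unfolding th_maurer_cartan by (simp add: Q_def E_def)
qed

text \<open>The uniqueness argument for the Levi-Civita connection: the defect \<open>t\<close> is
  symmetric in the first two slots by \<open>dQ_bracket\<close> and skew in the last two because
  \<open>Q\<close> is orthogonal, so it vanishes.\<close>

lemma dQ_eq: "dQ x a b = Q x (Gm a b) - Gm (Q x a) (Q x b)"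
proof -
  define T where "T a b = dQ x a b + Gm (Q x a) (Q x b) - Q x (Gm a b)" for a b
  define t where "t a b c = T a b \<bullet> Q x c" for a b c
  have skew: "dQ x a b \<bullet> Q x c + Q x b \<bullet> dQ x a c = 0" for a b c
  proof -
    have "((\<lambda>y. Q y b \<bullet> Q y c) has_derivative (\<lambda>u. Q x b \<bullet> fderiv (\<lambda>y. Q y c) x u +
        fderiv (\<lambda>y. Q y b) x u \<bullet> Q x c)) (at x)"
      by (rule has_derivative_inner[OF Q_has_derivative Q_has_derivative])
    moreover have "((\<lambda>y. Q y b \<bullet> Q y c) has_derivative (\<lambda>u. 0)) (at x)" by (simp add: Q_inner)
    ultimately have "Q x b \<bullet> dQ x a c + dQ x a b \<bullet> Q x c = 0" unfolding dQ_def by (rule derivative_unique_along)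
    then show ?thesis by simp
  qed
  have "T a b = T b a" for a b
  proof -
    have "T a b - T b a = (dQ x a b - dQ x b a) + (Gm (Q x a) (Q x b) - Gm (Q x b) (Q x a)) - Q x (Gm a b - Gm b a)"
      by (simp add: T_def Q_simps)
    then show ?thesis unfolding dQ_bracket Gm_torsion_free by simp
  qed
  then have s: "t a b c = t b a c" for a b c by (simp add: t_def)
  have k: "t a b c = - t a c b" for a b c
    using skew[of a b c] Gm_skew[of "Q x a" "Q x b" "Q x c"] Gm_skew[of a b c] Q_inner[of x "Gm a b" c] Q_inner[of x b "Gm a c"]
    by (simp add: t_def T_def inner_add_left inner_diff_left inner_commute[of "Q x b"] inner_commute[of b])
  have "t a b c = 0" for a b c
    using k[of a b c] s[of a c b] k[of c a b] s[of c b a] k[of b c a] s[of b a c] by linarith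
  then have "T a b = 0" by (intro Q_eqI[of _ x]) (simp add: t_def)
  then show ?thesis by (simp add: T_def algebra_simps)
qed

text \<open>The integrability condition of \<open>dQ_eq\<close>: differentiate it once more and
  antisymmetrize.\<close>

lemma Q_Rm: "Q x (Rm a b c) = Rm (Q x a) (Q x b) (Q x c)"
proof -
  define F where "F b y = Q y (Gm b c) - Gm (Q y b) (Q y c)" for b y
  define D where "D b a = dQ x a (Gm b c) - (Gm (Q x b) (dQ x a c) + Gm (dQ x a b) (Q x c))" for a b
  let ?q = "\<lambda>b. fderiv (\<lambda>y. Q y b) x"
  have d: "(F b has_derivative (\<lambda>u. ?q (Gm b c) u - (Gm (Q x b) (?q c u) + Gm (?q b u) (Q x c)))) (at x)" for b
    unfolding F_def by (intro has_derivative_diff Q_has_derivative Gm_has_derivative)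
  have "D b a - D a b = dQ x (br a b) c"
    using commutator[where F = "\<lambda>y. Q y c" and FX = F and a = a and b = b, OF Cinf_Q _ d d] dQ_eq by (simp add: D_def dQ_def F_def)
  moreover have "D b a - D a b = (dQ x a (Gm b c) - dQ x b (Gm a c)) - (Gm (Q x b) (dQ x a c) - Gm (Q x a) (dQ x b c))
      - Gm (dQ x a b - dQ x b a) (Q x c)"
    by (simp add: D_def Gm_simps)
  ultimately have "dQ x (br a b) c = (dQ x a (Gm b c) - dQ x b (Gm a c)) - (Gm (Q x b) (dQ x a c) - Gm (Q x a) (dQ x b c))
      - Gm (dQ x a b - dQ x b a) (Q x c)" by simp
  then show ?thesis
    unfolding dQ_bracket unfolding dQ_eq by (simp add: Rm_def Q_simps Gm_simps algebra_simps)
qed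

text \<open>The derivative of \<open>Q_Rm\<close> along \<open>d\<close>, with \<open>dQ_eq\<close>
  inserted.\<close>

lemma Q_nab: "Q x (nab d a b c) = nab (Q x d) (Q x a) (Q x b) (Q x c)"
proof -
  let ?q = "\<lambda>b. fderiv (\<lambda>y. Q y b) x"
  have br: "br u w = Gm u w - Gm w u" for u w by (simp add: Gm_torsion_free)
  have Rm: "Rm u v w = Gm u (Gm v w) - Gm v (Gm u w) - Gm (Gm u v - Gm v u) w" for u v w
    by (simp add: Rm_def br)
  have "((\<lambda>y. Rm (Q y a) (Q y b) (Q y c)) has_derivative
      (\<lambda>u. Rm (?q a u) (Q x b) (Q x c) + Rm (Q x a) (?q b u) (Q x c) + Rm (Q x a) (Q x b) (?q c u))) (at x)"
    unfolding Rm
    by (rule has_derivative_eq_rhs, (rule has_derivative_diff Gm_has_derivative Q_has_derivative)+)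
      (auto simp: fun_eq_iff Gm_simps algebra_simps)
  then have "dQ x d (Rm a b c) = Rm (dQ x d a) (Q x b) (Q x c) + Rm (Q x a) (dQ x d b) (Q x c) + Rm (Q x a) (Q x b) (dQ x d c)"
    unfolding Q_Rm[symmetric] by (subst dQ_eqI) (auto simp: dQ_def)
  then show ?thesis unfolding dQ_eq by (simp add: nab_def Q_Rm Q_simps Rm_simps algebra_simps)
qed

lemma Q_B:
  assumes "B \<bullet> B = 1" rigid
  shows "Q x B = (Q x B \<bullet> B) *\<^sub>R B"
proof (rule parallel_direction[OF assms])
  fix a b c
  obtain a' b' c' where "Q x a' = a" "Q x b' = b" "Q x c' = c" using Q_surj by metis
  then show "nab (Q x B) a b c = 0" using Q_nab[of x B a' b' c'] nab_B[OF assms(1)] by (simp add: Q_simps)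
qed

text \<open>The Ricci form and the inner product are two independent combinations of the inner
  products on \<open>v\<close> and \<open>z\<close>. \<open>Q\<close> preserves both, hence also
  each of the latter.\<close>

lemma Q_heisenberg:
  assumes B: "B = 0"
  shows "pz (Q x a) = Q x (pz a)"
proof -
  obtain Q' where Q': "linear Q'" "\<And>a. Q' (Q x a) = a" "\<And>a. Q x (Q' a) = a"
  proof -
    have inj: "inj (Q x)" unfolding linear_injective_0[OF lin_Q] using Q_inner by (metis inner_eq_zero_iff)
    then obtain Q' where Q': "linear Q'" "Q' \<circ> Q x = id" using linear_injective_left_inverse[OF lin_Q] by blast
    moreover have "Q x (Q' a) = a" for a using Q_surj[of x a] Q'(2) by (auto simp: fun_eq_iff)
    ultimately show thesis using that by (simp add: fun_eq_iff)
  qed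
  have "Ric (Q x c) (Q x d) = Ric c d" for c d
  proof -
    have "Ric (Q x c) (Q x d) = tr (\<lambda>b. Q x (Rm (Q' b) c d))" by (simp add: Ric_def Q_Rm Q')
    also have "\<dots> = Ric c d" unfolding Ric_def by (rule tr_conj) (simp_all add: lin_Rm lin_Q Q')
    finally show ?thesis .
  qed
  then have R: "- (tr pz / 2) * (pv (Q x c) \<bullet> pv (Q x d)) + (tr pv / 4) * (pz (Q x c) \<bullet> pz (Q x d)) =
      - (tr pz / 2) * (pv c \<bullet> pv d) + (tr pv / 4) * (pz c \<bullet> pz d)" for c d
    unfolding Ric_heisenberg[OF B] .
  have l0: "lam x = 0" for x unfolding lam_def using B by simp
  have "pz (Q x c) \<bullet> pz (Q x d) = pz c \<bullet> pz d" for c d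
  proof -
    have "pv (Q x c) \<bullet> pv (Q x d) = pv c \<bullet> pv d + pz c \<bullet> pz d - pz (Q x c) \<bullet> pz (Q x d)"
      using Q_inner[of x c d] inner_decomp[of "Q x c" "Q x d"] inner_decomp[of c d] l0 by simp
    with R[of c d] have "(tr pz / 2 + tr pv / 4) * (pz (Q x c) \<bullet> pz (Q x d) - pz c \<bullet> pz d) = 0"
      by (simp add: algebra_simps)
    then show ?thesis using tr_pv_pos tr_pz_pos by simp
  qed
  then have "pz (Q x a) \<bullet> Q x c = Q x (pz a) \<bullet> Q x c" for c
    using pz_sym[of "pz (Q x a)" "Q x c"] pz_sym[of "pz a" c] by (simp add: Q_inner)
  then show ?thesis by (rule Q_eqI)
qed

text \<open>\<open>Q x B = s *\<^sub>R B\<close> with \<open>s * s = 1\<close>, so the derivative of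
  \<open>Q x B\<close> vanishes. Then \<open>dQ_eq\<close> makes \<open>Q x\<close> intertwine
  \<open>a \<mapsto> (1/2) *\<^sub>R pv a + pz a\<close> with \<open>s\<close> times itself; the
  eigenvalues 1/2 on \<open>v\<close> and 1 on \<open>z\<close> force \<open>s = 1\<close> and
  preservation of both spaces.\<close>

lemma Q_damek_ricci:
  assumes B1: "B \<bullet> B = 1" and rigid
  shows "Q x B = B" "pv (Q x a) = Q x (pv a)" "pz (Q x a) = Q x (pz a)"
proof -
  note QB = Q_B[OF B1 \<open>rigid\<close>]
  define s where "s = Q x B \<bullet> B"
  have s: "Q x B = s *\<^sub>R B" using QB[of x] by (simp add: s_def)
  have ss: "(Q y B \<bullet> B) * (Q y B \<bullet> B) = 1" for y using Q_inner[of y B B] B1 by (subst (asm) (1 2) QB) simp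
  let ?q = "fderiv (\<lambda>y. Q y B) x"
  have dQB: "dQ x a B = 0" for a
  proof -
    have d: "((\<lambda>y. Q y B \<bullet> B) has_derivative (\<lambda>u. ?q u \<bullet> B)) (at x)" by (rule has_derivative_inner_left[OF Q_has_derivative])
    have "((\<lambda>y. (Q y B \<bullet> B) * (Q y B \<bullet> B)) has_derivative (\<lambda>u. (Q x B \<bullet> B) * (?q u \<bullet> B) + (?q u \<bullet> B) * (Q x B \<bullet> B))) (at x)"
      by (rule has_derivative_mult[OF d d])
    moreover have "((\<lambda>y. (Q y B \<bullet> B) * (Q y B \<bullet> B)) has_derivative (\<lambda>u. 0)) (at x)" by (simp add: ss)
    ultimately have "(Q x B \<bullet> B) * (dQ x a B \<bullet> B) + (dQ x a B \<bullet> B) * (Q x B \<bullet> B) = 0"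
      unfolding dQ_def by (rule derivative_unique_along)
    moreover have "Q x B \<bullet> B \<noteq> 0" using ss[of x] by auto
    ultimately have "dQ x a B \<bullet> B = 0" by simp
    moreover have "((\<lambda>y. Q y B) has_derivative (\<lambda>u. (?q u \<bullet> B) *\<^sub>R B)) (at x)"
      by (subst QB) (rule has_derivative_scaleR_left[OF d])
    then have "dQ x a B = (dQ x a B \<bullet> B) *\<^sub>R B" by (subst dQ_eqI) (auto simp: dQ_def)
    ultimately show ?thesis by simp
  qed
  have GB: "Gm a B = - ((1/2) *\<^sub>R pv a + pz a)" for a by (simp add: Gm_def lam_def B1)
  have key: "Q x ((1/2) *\<^sub>R pv a + pz a) = s *\<^sub>R ((1/2) *\<^sub>R pv (Q x a) + pz (Q x a))" for a
  proof -
    have "Q x (Gm a B) = Gm (Q x a) (s *\<^sub>R B)" using dQB[of a] unfolding dQ_eq s by simp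
    then show ?thesis by (simp only: GB Gm_simps linear_neg[OF lin_Q] scaleR_minus_right neg_equal_iff_equal)
  qed
  have s0: "s \<noteq> 0" using ss[of x] by (auto simp: s_def)
  have s2: "s * s = 1" using ss[of x] by (simp add: s_def)
  have v: "pz (Q x (pv a)) = 0" "(s - 1) *\<^sub>R pv (Q x (pv a)) = 0" "lam (Q x (pv a)) = 0" for a
  proof -
    have k: "(1/2) *\<^sub>R Q x (pv a) = s *\<^sub>R ((1/2) *\<^sub>R pv (Q x (pv a)) + pz (Q x (pv a)))"
      using key[of "pv a"] by (simp add: Q_simps)
    have "(1/2) *\<^sub>R pz (Q x (pv a)) = s *\<^sub>R pz (Q x (pv a))" using arg_cong[OF k, of pz] by simp
    then have "(1/2 - s) *\<^sub>R pz (Q x (pv a)) = 0" by (simp add: scaleR_left_diff_distrib)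
    moreover have "1/2 - s \<noteq> 0"
    proof
      assume "1/2 - s = 0"
      then have s: "s = 1/2" by simp
      show False using s2 unfolding s by simp
    qed
    ultimately show "pz (Q x (pv a)) = 0" by simp
    have "(1/2) *\<^sub>R pv (Q x (pv a)) = (s/2) *\<^sub>R pv (Q x (pv a))" using arg_cong[OF k, of pv] by simp
    from arg_cong[OF this, of "\<lambda>x. 2 *\<^sub>R x"] show "(s - 1) *\<^sub>R pv (Q x (pv a)) = 0"
      by (simp add: scaleR_left_diff_distrib)
    show "lam (Q x (pv a)) = 0" using arg_cong[OF k, of lam] by simp
  qed
  have v': "pv (Q x (pv a)) = Q x (pv a)" for a by (rule decomp_eqI) (simp_all add: v)
  have s1: "s = 1"
  proof -
    obtain a where "pv a \<noteq> 0" using nontrivial(1) by blast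
    then have "Q x (pv a) \<noteq> 0" using Q_inner[of x "pv a" "pv a"] by (metis inner_eq_zero_iff)
    then show ?thesis using v(2)[of a] v' by simp
  qed
  show QxB: "Q x B = B" by (simp add: s s1)
  have z: "pz (Q x (pz a)) = Q x (pz a)" "pv (Q x (pz a)) = 0" for a
  proof -
    have k: "Q x (pz a) = (1/2) *\<^sub>R pv (Q x (pz a)) + pz (Q x (pz a))" using key[of "pz a"] by (simp add: Q_simps s1)
    have "pv (Q x (pz a)) = (1/2) *\<^sub>R pv (Q x (pz a))" using arg_cong[OF k, of pv] by simp
    then show "pv (Q x (pz a)) = 0" using scaleR_cancel_right[of 1 "pv (Q x (pz a))" "1/2"] by simp
    then show "pz (Q x (pz a)) = Q x (pz a)" using k by simp
  qed
  have e: "Q x a = lam a *\<^sub>R B + Q x (pv a) + Q x (pz a)"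
    using decomp[of a] QxB by (metis Q_simps(1,3) lam_def)
  show "pv (Q x a) = Q x (pv a)" by (subst e) (simp add: v' z)
  show "pz (Q x a) = Q x (pz a)" by (subst e) (simp add: v z)
qed

theorem isometry_aut:
  assumes rigid
  shows "aut h"
proof -
  have QB: "Q x B = B" for x
    using B Q_damek_ricci(1)[OF _ assms] Q_simps(4) by metis
  have Qz: "pz (Q x a) = Q x (pz a)" for x a
    using B Q_damek_ricci(3)[OF _ assms] Q_heisenberg by blast
  have Ql: "lam (Q x a) = lam a" for x a
    using Q_inner[of x a B] by (simp add: QB lam_def)
  have Qv: "pv (Q x a) = Q x (pv a)" for x a
  proof -
    have "Q x (lam a *\<^sub>R B + pv a + pz a) = Q x a" using decomp[of a] by (simp add: lam_def)
    then have "lam a *\<^sub>R B + Q x (pv a) + Q x (pz a) = Q x a" by (simp add: Q_simps QB)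
    moreover have "lam a *\<^sub>R B + pv (Q x a) + pz (Q x a) = Q x a" using decomp[of "Q x a"] by (simp add: lam_def[symmetric] Ql)
    ultimately show ?thesis by (simp add: Qz) (metis add_left_cancel add_right_cancel)
  qed
  \<comment> \<open>\<open>Q\<close> maps \<open>v\<close> into \<open>v\<close> at every point, so
    the \<open>pz\<close>-part of \<open>dQ x (pv a) (pv b)\<close> vanishes; by
    \<open>dQ_eq\<close> it is half the difference of the two sides.\<close>
  have "N (Q x a) (Q x b) = Q x (N a b)" for x a b
  proof -
    let ?q = "fderiv (\<lambda>y. Q y (pv b)) x"
    have "((\<lambda>y. pz (Q y (pv b))) has_derivative (\<lambda>u. pz (?q u))) (at x)" by (rule pz_has_derivative[OF Q_has_derivative])
    moreover have "((\<lambda>y. pz (Q y (pv b))) has_derivative (\<lambda>u. 0)) (at x)" by (simp add: Qz Q_simps)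
    ultimately have "pz (dQ x (pv a) (pv b)) = 0" unfolding dQ_def by (rule derivative_unique_along)
    moreover have "pz (Gm (pv a) (pv b)) = (1/2) *\<^sub>R N a b" "pz (Gm (Q x (pv a)) (Q x (pv b))) = (1/2) *\<^sub>R N (Q x a) (Q x b)"
      by (simp_all add: Gm_def flip: Qv)
    ultimately show ?thesis unfolding dQ_eq by (simp add: Qz Q_simps)
  qed
  then have aut: "aut (Q x)" for x
    unfolding aut_def using lin_Q Q_inner QB Qv Qz by blast
  then have dQ0: "dQ x a b = 0" for x a b by (simp add: dQ_eq aut_Gm)
  have const: "Q x b = Q 0 b" for x b
  proof -
    have "((\<lambda>y. Q y b) has_derivative (\<lambda>u. 0)) (at x)" for x
    proof -
      have "fderiv (\<lambda>y. Q y b) x u = 0" for u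
        using dQ0[of x "th x u" b] by (simp add: dQ_def)
      then have "fderiv (\<lambda>y. Q y b) x = (\<lambda>u. 0)" by (rule ext)
      then show ?thesis using Q_has_derivative[of b x] by simp
    qed
    then show ?thesis using has_derivative_zero_unique[of UNIV "\<lambda>y. Q y b" x 0] by simp
  qed
  \<comment> \<open>Both \<open>h\<close> and the linear map \<open>Q 0\<close> fix 0 and pull the
    coframe back to the same form, so \<open>th_unique\<close> identifies them.\<close>
  have "h x = Q 0 x" for x
  proof -
    have "th (h x) (Dh x u) = th (Q 0 x) (Q 0 u)" for x u
      using const[of x "th x u"] by (simp add: Q_def[of x] aut_th[OF aut])
    then show ?thesis
      using th_unique[of UNIV 0 h "Q 0" Dh "\<lambda>_. Q 0" x] Dh linear_imp_has_derivative[OF lin_Q]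
      by (simp add: fix_0 Q_simps convex_connected)
  qed
  then have "Q 0 = h" by (intro ext) (rule sym)
  moreover obtain L where "L = Q 0" by blast
  ultimately have "L = h" "aut L" using aut[of 0] by simp_all
  then show ?thesis by simp
qed

end

section \<open>The geodesic inversion in the symmetric case\<close>

text \<open>With \<open>t = exp (lam x)\<close>, \<open>X = pv x\<close>, \<open>Z = pz x\<close> and \<open>p = (t + norm X ^ 2 / 4) B + Z\<close>, and elements of
  \<open>R B + z\<close> acting on \<open>v\<close> as Clifford numbers, the geodesic inversion at the identity sends
  \<open>p\<close> to \<open>1/p\<close> and \<open>X\<close> to \<open>- (1/p) X\<close>.\<close>

locale damek_ricci_model = heisenberg_model +
  assumes unit_B: "B \<bullet> B = 1"
begin

lemma lam_B [simp]: "lam B = 1"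
  by (simp add: lam_def unit_B)

definition act :: "'a => 'a => 'a" where "act w u = lam w *\<^sub>R u + J w u"

text \<open>Acts as the adjoint of \<open>w\<close> (\<open>act_cj\<close>); hence
  \<open>cj p\<close> divided by \<open>p \<bullet> p\<close> acts as the inverse of
  \<open>p\<close>.\<close>

definition cj :: "'a => 'a" where "cj w = lam w *\<^sub>R B - pz w"

lemma lin_act: "linear (act w)" and lin_act_left: "linear (\<lambda>w. act w u)" and lin_cj: "linear cj"
  by (auto simp: linear_iff act_def cj_def algebra_simps)

lemmas act_simps = linear_add[OF lin_act] linear_add[OF lin_act_left] linear_cmul[OF lin_act] linear_cmul[OF lin_act_left]
  linear_diff[OF lin_act] linear_diff[OF lin_act_left] linear_neg[OF lin_act] linear_neg[OF lin_act_left]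
  linear_0[OF lin_act] linear_0[OF lin_act_left]

lemma bounded_bilinear_act: "bounded_bilinear act"
  by (auto simp: bilinear_conv_bounded_bilinear[symmetric] bilinear_def lin_act lin_act_left)

lemma bounded_linear_cj: "bounded_linear cj"
  using lin_cj by (simp add: linear_conv_bounded_linear)

lemma pv_act [simp]: "pv u = u ==> pv (act w u) = act w u" and cj_components [simp]: "pv (cj w) = 0" "pz (cj w) = - pz w" "lam (cj w) = lam w"
  by (simp_all add: act_def cj_def)

lemma inner_w: "pv w = 0 ==> w \<bullet> w' = lam w * lam w' + pz w \<bullet> pz w'"
  using inner_decomp[of w w'] by simp

lemma cj_inner: "pv w = 0 ==> cj w \<bullet> w' = w \<bullet> cj w'" "pv w = 0 ==> cj w \<bullet> cj w' = w \<bullet> w'"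
  by (simp_all add: inner_w[of "cj w" w'] inner_w[of w "cj w'"] inner_w[of "cj w" "cj w'"] inner_w[of w w'])

lemma act_inner: "pv w = 0 ==> pv u = u ==> pv v = v ==> act w u \<bullet> act w v = (w \<bullet> w) * (u \<bullet> v)"
  using J_skew[of w u v] J_inner_J'[of w u v]
  by (simp add: act_def inner_w[of w w] inner_add_left inner_add_right algebra_simps)

lemma act_inner_polar:
  assumes "pv w = 0" "pv w' = 0" "pv u = u" "pv v = v"
  shows "act w u \<bullet> act w' v + act w' u \<bullet> act w v = 2 * (w \<bullet> w') * (u \<bullet> v)"
proof -
  have "act (w + w') u \<bullet> act (w + w') v = ((w + w') \<bullet> (w + w')) * (u \<bullet> v)"
    by (rule act_inner) (simp_all add: assms)
  then show ?thesis using act_inner[OF assms(1,3,4)] act_inner[OF assms(2,3,4)]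
    by (simp add: act_simps inner_add_left inner_add_right inner_commute[of w' w] algebra_simps)
qed

lemma act_inner_same:
  assumes "pv w = 0" "pv w' = 0" "pv u = u"
  shows "act w u \<bullet> act w' u = (w \<bullet> w') * (u \<bullet> u)"
  using act_inner_polar[OF assms assms(3)] by (simp add: inner_commute[of "act w' u"])

lemma J_cj [simp]: "J (cj w) u = - J w u"
  using J_pz[of "cj w" u] linear_neg[OF lin_J_left, of "pz w" u] by simp

lemma act_cj: "act w u \<bullet> v = u \<bullet> act (cj w) v"
  using J_skew[of w u v] by (simp add: act_def inner_add_left inner_diff_right)

lemma act_inverse:
  assumes "pv w = 0" "pv u = u"
  shows "act (cj w) (act w u) = (w \<bullet> w) *\<^sub>R u" "act w (act (cj w) u) = (w \<bullet> w) *\<^sub>R u"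
proof -
  show "act (cj w) (act w u) = (w \<bullet> w) *\<^sub>R u" "act w (act (cj w) u) = (w \<bullet> w) *\<^sub>R u"
    by (simp_all add: act_def J_J assms inner_w[of w w] algebra_simps)
qed

text \<open>A polarization of \<open>act_inverse\<close>; up to sign and scale the left side is the
  derivative of the inverse of \<open>p\<close> in direction \<open>\<delta>\<close>.\<close>

lemma act_sandwich:
  assumes "pv p = 0" "pv \<delta> = 0" "pv u = u"
  shows "act (cj p) (act \<delta> (act (cj p) u)) = (2 * (p \<bullet> \<delta>)) *\<^sub>R act (cj p) u - (p \<bullet> p) *\<^sub>R act (cj \<delta>) u"
proof -
  have cl: "act (cj p) (act \<delta> x) + act (cj \<delta>) (act p x) = (2 * (p \<bullet> \<delta>)) *\<^sub>R x" if x: "pv x = x" for x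
  proof -
    have "act (cj (p + \<delta>)) (act (p + \<delta>) x) = ((p + \<delta>) \<bullet> (p + \<delta>)) *\<^sub>R x"
      by (rule act_inverse) (simp_all add: assms x)
    then show ?thesis using act_inverse(1)[OF assms(1) x] act_inverse(1)[OF assms(2) x]
      by (simp add: act_simps linear_add[OF lin_cj] inner_add_left inner_add_right inner_commute[of \<delta> p] algebra_simps)
  qed
  have "act (cj \<delta>) (act p (act (cj p) u)) = (p \<bullet> p) *\<^sub>R act (cj \<delta>) u"
    by (simp add: act_inverse assms act_simps)
  then show ?thesis using cl[of "act (cj p) u"] assms by (simp add: algebra_simps)
qed

text \<open>Under \<open>J2\<close> the vectors \<open>act w u\<close> form a space stable under the
  Clifford action. Since \<open>J2\<close> speaks of orthogonal pairs, the part of \<open>a\<close>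
  along \<open>b\<close> is split off; it contributes a multiple of \<open>u\<close>.\<close>

lemma act_closed:
  assumes J2 and u: "pv u = u" and w: "pv w = 0" "pv w' = 0"
  shows "\<exists>w''. pv w'' = 0 \<and> act w (act w' u) = act w'' u"
proof -
  have J: "\<exists>s c. J a (J b u) = s *\<^sub>R u + J c u" if ab: "pz a = a" "pz b = b" for a b
  proof (cases "b = 0")
    case True
    then show ?thesis by (intro exI[of _ 0]) simp
  next
    case False
    define k where "k = (a \<bullet> b) / (b \<bullet> b)"
    have "pz (a - k *\<^sub>R b) = a - k *\<^sub>R b" "(a - k *\<^sub>R b) \<bullet> b = 0"
      using ab False by (simp_all add: k_def inner_diff_left)
    then obtain c where "J (a - k *\<^sub>R b) (J b u) = J c u" using \<open>J2\<close> ab(2) u unfolding J2_def by blast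
    then have "J a (J b u) = (- k * (b \<bullet> b)) *\<^sub>R u + J c u" using ab(2) u by (simp add: J_J algebra_simps)
    then show ?thesis by blast
  qed
  obtain s c where c: "J (pz w) (J (pz w') u) = s *\<^sub>R u + J c u" using J[of "pz w" "pz w'"] by auto
  let ?w = "(lam w * lam w' + s) *\<^sub>R B + lam w *\<^sub>R pz w' + lam w' *\<^sub>R pz w + pz c"
  have "act w (act w' u) = act ?w u" using c by (simp add: act_def algebra_simps)
  moreover have "pv ?w = 0" by simp
  ultimately show ?thesis by blast
qed

text \<open>\<open>\<theta>\<close> and \<open>\<eta>\<close> are the components along \<open>R B + z\<close> and \<open>v\<close> of a tangent vector, \<open>\<delta>\<close> is the derivative of
  \<open>p\<close> along it, and primes denote the images under the inversion.\<close>

lemma inversion_identity: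
  assumes J2
    and w: "pv p = 0" "pv \<delta> = 0" "pv \<theta> = 0" "pv \<theta>' = 0" and v: "pv X = X" "pv X' = X'" "pv \<eta> = \<eta>" "pv \<eta>' = \<eta>'"
    and lam_p: "lam p = t + (X \<bullet> X) / 4" and D: "D = p \<bullet> p" "D > 0"
    and X': "act p X' = - X" and eta: "act p \<eta>' = - (\<eta> + act \<delta> X')"
    and theta: "\<And>w. pv w = 0 ==> \<theta> \<bullet> w = \<delta> \<bullet> w - (1/2) * (act w X \<bullet> \<eta>)"
    and theta': "\<And>w. pv w = 0 ==> \<theta>' \<bullet> w = ((cj \<delta> - (2 * (p \<bullet> \<delta>) / D) *\<^sub>R cj p) \<bullet> w) / D - (1/2) * (act w X' \<bullet> \<eta>')"
  shows "D ^ 2 * (\<theta>' \<bullet> \<theta>') + t * D * (\<eta>' \<bullet> \<eta>') = \<theta> \<bullet> \<theta> + t * (\<eta> \<bullet> \<eta>)"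
proof -
  define m where "m = X \<bullet> X"
  define c where "c = lam p"
  have c: "c = t + m / 4" by (simp add: c_def m_def lam_p)
  have D0: "D \<noteq> 0" using D by simp
  have X'_eq: "D *\<^sub>R X' = - act (cj p) X"
    using arg_cong[OF X', of "act (cj p)"] act_inverse(1)[OF w(1) v(2)] D(1) by (simp add: act_simps)
  have mX': "D * (X' \<bullet> X') = m" using act_inner[OF w(1) v(2,2)] X' D(1) by (simp add: m_def)
  have XX': "D * (X \<bullet> X') = - c * m"
  proof -
    have "D * (X \<bullet> X') = X \<bullet> (D *\<^sub>R X')" by simp
    also have "\<dots> = - (X \<bullet> act (cj p) X)" unfolding X'_eq by simp
    also have "X \<bullet> act (cj p) X = c * m" using J_self[of p X] by (simp add: act_def c_def m_def inner_diff_right inner_commute[of X "J p X"])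
    finally show ?thesis by simp
  qed
  have eta2: "D * (\<eta>' \<bullet> \<eta>') = \<eta> \<bullet> \<eta> + 2 * (\<eta> \<bullet> act \<delta> X') + (\<delta> \<bullet> \<delta>) * (X' \<bullet> X')"
    using act_inner[OF w(1) v(4,4)] act_inner[OF w(2) v(2,2)] eta D(1)
    by (simp add: inner_diff_left inner_diff_right inner_commute[of "act \<delta> X'" \<eta>])
  have pw: "act w X' \<bullet> \<eta>' = - (act p (act w X') \<bullet> (\<eta> + act \<delta> X')) / D" if "pv w = 0" for w
  proof -
    have "D * (act w X' \<bullet> \<eta>') = act p (act w X') \<bullet> act p \<eta>'" using act_inner[OF w(1), of "act w X'" \<eta>'] v D(1) by simp
    then show ?thesis using D0 by (simp add: eta field_simps inner_add_right inner_diff_right)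
  qed
  \<comment> \<open>\<open>eta2\<close> settles the \<open>v\<close>-part. What remains is
    \<open>\<theta>'\<close>, which is accessible only through its pairings.\<close>
  have key: "D ^ 2 * (\<theta>' \<bullet> \<theta>') = \<theta> \<bullet> \<theta> - 2 * t * (\<eta> \<bullet> act \<delta> X') - t * (\<delta> \<bullet> \<delta>) * (X' \<bullet> X')"
  proof (cases "X = 0")
    case True
    then have X'0: "X' = 0" using X'_eq D0 by (simp add: act_simps)
    have "\<theta> \<bullet> \<theta> = \<delta> \<bullet> \<theta>" "\<delta> \<bullet> \<theta> = \<delta> \<bullet> \<delta>" using theta[OF w(3)] theta[OF w(2)] by (simp_all add: True act_simps inner_commute[of \<theta> \<delta>])
    then have th: "\<theta> \<bullet> \<theta> = \<delta> \<bullet> \<delta>" by simp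
    let ?q = "cj \<delta> - (2 * (p \<bullet> \<delta>) / D) *\<^sub>R cj p"
    have "\<theta>' \<bullet> \<theta>' = (?q \<bullet> \<theta>') / D" using theta'[OF w(4)] by (simp add: X'0 act_simps)
    moreover have "\<theta>' \<bullet> ?q = (?q \<bullet> ?q) / D" using theta'[of ?q] by (simp add: X'0 act_simps)
    moreover have "?q \<bullet> ?q = \<delta> \<bullet> \<delta>"
      using D0 by (simp add: inner_diff_left inner_diff_right cj_inner(2) w inner_commute[of \<delta> p] D(1) power2_eq_square field_simps)
    ultimately have "\<theta>' \<bullet> \<theta>' = (\<delta> \<bullet> \<delta>) / D / D" by (metis inner_commute)
    then show ?thesis using D0 by (simp add: X'0 th power2_eq_square act_simps)
  next
    case False
    then have m: "m > 0" by (simp add: m_def)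
    \<comment> \<open>\<open>act e X\<close> is the orthogonal projection of \<open>\<eta>\<close>
      to the space of all \<open>act w X\<close>, and \<open>\<nu>\<close> is the rest.\<close>
    define e where "e = ((X \<bullet> \<eta>) / m) *\<^sub>R B + (1/m) *\<^sub>R N X \<eta>"
    define \<nu> where "\<nu> = \<eta> - act e X"
    have e: "pv e = 0" by (simp add: e_def)
    have perp: "act w X \<bullet> \<nu> = 0" if "pv w = 0" for w
    proof -
      have "act w X \<bullet> \<eta> = lam w * (X \<bullet> \<eta>) + N X \<eta> \<bullet> w" by (simp add: act_def inner_add_left J_inner)
      moreover have "w \<bullet> e = lam w * ((X \<bullet> \<eta>) / m) + (w \<bullet> N X \<eta>) / m"
        using inner_w[OF that, of e] pz_sym[of w "N X \<eta>"] unfolding e_def by simp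
      then have "lam w * (X \<bullet> \<eta>) + N X \<eta> \<bullet> w = m * (w \<bullet> e)"
        using m by (simp add: field_simps inner_commute[of w "N X \<eta>"])
      ultimately show ?thesis using act_inner_same[OF that e v(1)] by (simp add: \<nu>_def inner_diff_right m_def)
    qed
    \<comment> \<open>By \<open>J2\<close> this space is stable under the Clifford action. It
      contains \<open>X\<close> and \<open>X'\<close>, and \<open>\<nu>\<close> is orthogonal to it,
      so in pairings with its elements \<open>\<eta>\<close> may be replaced by
      \<open>act e X\<close>.\<close>
    define E where "E = {act w X' | w. pv w = 0}"
    have E_act: "y \<in> E ==> pv w = 0 ==> act w y \<in> E" for y w
      unfolding E_def using act_closed[OF \<open>J2\<close> v(2)] by auto
    have E_add: "y \<in> E ==> z \<in> E ==> y + z \<in> E" for y z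
      unfolding E_def using act_simps(2) lin_simps(2) by (smt (verit) add_0 mem_Collect_eq)
    have E_scale: "y \<in> E ==> k *\<^sub>R y \<in> E" for y k
      unfolding E_def using act_simps(4) by (smt (verit) lin_simps(7) mem_Collect_eq scaleR_zero_right)
    have X'E: "X' \<in> E" unfolding E_def by (auto intro!: exI[of _ B] simp: act_def)
    have XE: "X \<in> E" using E_scale[OF E_act[OF X'E w(1)], of "-1"] X' by simp
    have nuE: "y \<bullet> \<nu> = 0" if "y \<in> E" for y
    proof -
      obtain w' where w': "y = act w' X'" "pv w' = 0" using \<open>y \<in> E\<close> unfolding E_def by blast
      obtain w'' where "pv w'' = 0" "act w' (act (cj p) X) = act w'' X" using act_closed[OF \<open>J2\<close> v(1) w'(2), of "cj p"] by auto
      then have "D * (y \<bullet> \<nu>) = - (act w'' X \<bullet> \<nu>)"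
        using X'_eq by (metis act_simps(3,7) inner_minus_left inner_scaleR_left w'(1))
      then show ?thesis using perp[OF \<open>pv w'' = 0\<close>] D0 by simp
    qed
    have etaE: "y \<bullet> \<eta> = y \<bullet> act e X" if "y \<in> E" for y
      using nuE[OF that] by (simp add: \<nu>_def inner_diff_right)
    have del: "\<delta> = \<theta> + (m/2) *\<^sub>R e"
    proof -
      have "\<delta> \<bullet> w' = (\<theta> + (m/2) *\<^sub>R e) \<bullet> w'" if "pv w' = 0" for w'
        using theta[OF that] perp[OF that] act_inner_same[OF that e v(1)]
        by (simp add: inner_add_left \<nu>_def inner_diff_right m_def inner_commute[of w' e])
      then have "(\<delta> - (\<theta> + (m/2) *\<^sub>R e)) \<bullet> (\<delta> - (\<theta> + (m/2) *\<^sub>R e)) = 0"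
        using w e by (simp add: inner_diff_left)
      then show ?thesis by simp
    qed
    \<comment> \<open>Chosen so that its pairings with the vectors \<open>act p (act w' X')\<close>
      give multiples of \<open>\<theta>' \<bullet> w'\<close>. As \<open>D *\<^sub>R Y\<close> is
      itself such a vector, \<open>Y \<bullet> Y\<close> yields
      \<open>\<theta>' \<bullet> \<theta>'\<close>, while expanding \<open>Y\<close> expresses it by
      the unprimed data.\<close>
    define Y where "Y = act \<theta> (X + (2*t) *\<^sub>R X') + (t * m) *\<^sub>R act e X'"
    have YE: "Y \<in> E" unfolding Y_def by (intro E_add E_act E_scale XE X'E w e)
    have Yw: "Y \<bullet> act p (act w' X') = - (D * m) * (\<theta>' \<bullet> w')" if w': "pv w' = 0" for w'
    proof -
      have pE: "act p (act w' X') \<in> E" using w' w(1) by (intro E_act X'E)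
      have "(m/2) *\<^sub>R (act e X + act \<delta> X') + Y = act \<delta> X + (2*c) *\<^sub>R act \<delta> X'"
        by (simp add: Y_def del c act_simps algebra_simps)
      also have "act \<delta> X = - act \<delta> (act p X')" by (simp add: X' act_simps)
      also have "- act \<delta> (act p X') + (2*c) *\<^sub>R act \<delta> X' = act \<delta> (act (cj p) X')"
      proof -
        have "act (cj p) X' = (2*c) *\<^sub>R X' - act p X'"
          by (simp add: act_def c_def algebra_simps flip: scaleR_left_distrib)
        then show ?thesis by (simp add: act_simps)
      qed
      finally have "((m/2) *\<^sub>R (act e X + act \<delta> X') + Y) \<bullet> act p (act w' X') = act \<delta> (act (cj p) X') \<bullet> act p (act w' X')" by simp
      also have "\<dots> = act (cj p) (act \<delta> (act (cj p) X')) \<bullet> act w' X'"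
        using act_cj[of p "act w' X'" "act \<delta> (act (cj p) X')"] by (simp add: inner_commute)
      also have "\<dots> = (2 * (p \<bullet> \<delta>)) * ((cj p \<bullet> w') * (X' \<bullet> X')) - D * ((cj \<delta> \<bullet> w') * (X' \<bullet> X'))"
        by (simp add: act_sandwich w v w' inner_diff_left act_inner_same D(1))
      finally have 1: "Y \<bullet> act p (act w' X') = (X' \<bullet> X') * (2 * (p \<bullet> \<delta>) * (cj p \<bullet> w') - D * (cj \<delta> \<bullet> w'))
          - (m/2) * (act p (act w' X') \<bullet> (\<eta> + act \<delta> X'))"
        using etaE[OF pE] by (simp add: inner_add_left inner_add_right inner_commute[of "act p (act w' X')" \<eta>] inner_commute[of "act p (act w' X')" "act e X"] inner_commute[of "act p (act w' X')" "act \<delta> X'"] algebra_simps)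
      have "D * m * (\<theta>' \<bullet> w') = m * ((cj \<delta> \<bullet> w') - (2 * (p \<bullet> \<delta>) / D) * (cj p \<bullet> w')) + (m/2) * (act p (act w' X') \<bullet> (\<eta> + act \<delta> X'))"
        unfolding theta'[OF w'] pw[OF w'] using D0 by (simp add: inner_diff_left field_simps)
      moreover have "m * ((cj \<delta> \<bullet> w') - (2 * (p \<bullet> \<delta>) / D) * (cj p \<bullet> w')) = (X' \<bullet> X') * (D * (cj \<delta> \<bullet> w') - 2 * (p \<bullet> \<delta>) * (cj p \<bullet> w'))"
        unfolding mX'[symmetric] using D0 by (simp add: field_simps)
      ultimately show ?thesis using 1 by (simp add: algebra_simps)
    qed
    have "act (cj p) Y \<in> E" using YE by (intro E_act) simp_all
    then obtain w0 where w0: "act (cj p) Y = act w0 X'" "pv w0 = 0" by (auto simp: E_def)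
    have pvY: "pv Y = Y" using YE v(2) by (auto simp: E_def)
    have YY: "D *\<^sub>R Y = act p (act w0 X')" using act_inverse(2)[OF w(1) pvY] w0(1) D(1) by simp
    have Y1: "D * (Y \<bullet> Y) = - (D * m) * (\<theta>' \<bullet> w0)" using Yw[OF w0(2)] by (simp flip: YY)
    have Y2: "D * (Y \<bullet> Y) = (w0 \<bullet> w0) * (X' \<bullet> X')"
    proof -
      have "D * (D * (Y \<bullet> Y)) = (D *\<^sub>R Y) \<bullet> (D *\<^sub>R Y)" by simp
      also have "\<dots> = D * ((w0 \<bullet> w0) * (X' \<bullet> X'))" unfolding YY using v w0(2) w(1) by (simp add: act_inner D(1))
      finally show ?thesis using D0 by simp
    qed
    have Y3: "(w0 \<bullet> \<theta>') * (X' \<bullet> X') = - (D * m) * (\<theta>' \<bullet> \<theta>')"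
    proof -
      have "D * ((w0 \<bullet> \<theta>') * (X' \<bullet> X')) = act p (act w0 X') \<bullet> act p (act \<theta>' X')"
        using v w0(2) w by (simp add: act_inner act_inner_same D(1))
      also have "\<dots> = D * (Y \<bullet> act p (act \<theta>' X'))" by (simp flip: YY)
      finally show ?thesis using D0 Yw[OF w(4)] mult_left_cancel by metis
    qed
    have "Y \<bullet> Y = m * (D ^ 2 * (\<theta>' \<bullet> \<theta>'))"
    proof -
      have "D * (Y \<bullet> Y) = D * (- m * (\<theta>' \<bullet> w0))" using Y1 by simp
      then have a: "Y \<bullet> Y = - m * (\<theta>' \<bullet> w0)" using D0 mult_left_cancel by metis
      have "(w0 \<bullet> \<theta>') * m = D * ((w0 \<bullet> \<theta>') * (X' \<bullet> X'))" unfolding mX'[symmetric] by simp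
      also have "\<dots> = D * (- (D * m) * (\<theta>' \<bullet> \<theta>'))" by (simp only: Y3)
      finally show ?thesis using a by (simp add: inner_commute[of \<theta>' w0] power2_eq_square algebra_simps)
    qed
    moreover have "Y \<bullet> Y = m * (\<theta> \<bullet> \<theta> - 2 * t * (\<eta> \<bullet> act \<delta> X') - t * (\<delta> \<bullet> \<delta>) * (X' \<bullet> X'))"
    proof -
      have u: "pv (X + (2*t) *\<^sub>R X') = X + (2*t) *\<^sub>R X'" using v by simp
      define a where "a = act \<theta> X \<bullet> act e X'"
      define b where "b = act e X \<bullet> act \<theta> X'"
      have ab: "a + b = 2 * (\<theta> \<bullet> e) * (X \<bullet> X')" using act_inner_polar[OF w(3) e v(1,2)] by (simp add: a_def b_def)
      have y: "Y \<bullet> Y = (\<theta> \<bullet> \<theta>) * ((X + (2*t) *\<^sub>R X') \<bullet> (X + (2*t) *\<^sub>R X')) + 2 * (t*m) * (a + 2 * t * (\<theta> \<bullet> e) * (X' \<bullet> X'))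
          + (t*m)^2 * ((e \<bullet> e) * (X' \<bullet> X'))"
      proof -
        have 1: "act \<theta> (X + (2*t) *\<^sub>R X') \<bullet> act \<theta> (X + (2*t) *\<^sub>R X') = (\<theta> \<bullet> \<theta>) * ((X + (2*t) *\<^sub>R X') \<bullet> (X + (2*t) *\<^sub>R X'))"
          by (rule act_inner[OF w(3) u u])
        have 2: "act \<theta> (X + (2*t) *\<^sub>R X') \<bullet> act e X' = a + 2 * t * (\<theta> \<bullet> e) * (X' \<bullet> X')"
          using act_inner_same[OF w(3) e v(2)] by (simp add: act_simps inner_add_left a_def)
        have sq: "(y + k *\<^sub>R z) \<bullet> (y + k *\<^sub>R z) = y \<bullet> y + 2 * k * (y \<bullet> z) + k^2 * (z \<bullet> z)" for y z :: 'a and k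
          by (simp add: inner_add_left inner_add_right inner_commute[of z y] power2_eq_square algebra_simps)
        show ?thesis unfolding Y_def sq 1 2 act_inner[OF e v(2,2)] by simp
      qed
      have x: "(X + (2*t) *\<^sub>R X') \<bullet> (X + (2*t) *\<^sub>R X') = m + 4 * t * (X \<bullet> X') + 4 * t^2 * (X' \<bullet> X')"
        by (simp add: inner_add_left inner_add_right inner_commute[of X' X] power2_eq_square m_def algebra_simps)
      have ed: "\<eta> \<bullet> act \<delta> X' = b + (m/2) * ((e \<bullet> e) * (X \<bullet> X'))"
        using etaE[OF E_act[OF X'E w(2)]] act_inner[OF e v(1,2)]
        by (simp add: del act_simps inner_add_right b_def inner_commute)
      have dd: "\<delta> \<bullet> \<delta> = \<theta> \<bullet> \<theta> + m * (\<theta> \<bullet> e) + (m^2/4) * (e \<bullet> e)"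
        by (simp add: del inner_add_left inner_add_right inner_commute[of e \<theta>] power2_eq_square field_simps)
      have b: "b = 2 * (\<theta> \<bullet> e) * (X \<bullet> X') - a" using ab by simp
      have xx: "X \<bullet> X' = - c * (X' \<bullet> X')" using XX' mX' D0 by (metis (no_types, opaque_lifting) mult.left_commute mult_left_cancel)
      show ?thesis unfolding y x ed dd b xx c by (simp add: field_simps power2_eq_square)
    qed
    ultimately show ?thesis using m by simp
  qed
  have "t * D * (\<eta>' \<bullet> \<eta>') = t * (\<eta> \<bullet> \<eta> + 2 * (\<eta> \<bullet> act \<delta> X') + (\<delta> \<bullet> \<delta>) * (X' \<bullet> X'))"
    by (simp only: mult.assoc eta2)
  then show ?thesis unfolding key by (simp add: algebra_simps)
qed

section \<open>The inversion map and its isometry property\<close>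

definition pp :: "'a => 'a" where "pp x = (exp (lam x) + (pv x \<bullet> pv x) / 4) *\<^sub>R B + pz x"

definition dpp :: "'a => 'a => 'a" where "dpp x u = (exp (lam x) * lam u + (pv x \<bullet> pv u) / 2) *\<^sub>R B + pz u"

text \<open>\<open>lam\<close> is the logarithm of \<open>t\<close>, so division of \<open>t\<close>
  by \<open>p \<bullet> p\<close> becomes subtraction of a logarithm.\<close>

definition inversion :: "'a => 'a" where
  "inversion x = (lam x - ln (pp x \<bullet> pp x)) *\<^sub>R B - inverse (pp x \<bullet> pp x) *\<^sub>R (act (cj (pp x)) (pv x) + pz x)"

lemma pp_components [simp]: "pv (pp x) = 0" "lam (pp x) = exp (lam x) + (pv x \<bullet> pv x) / 4" "pz (pp x) = pz x"
  and pv_dpp [simp]: "pv (dpp x u) = 0"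
  by (simp_all add: pp_def dpp_def)

lemma pp_pos: "pp x \<bullet> pp x > 0"
proof -
  have "lam (pp x) > 0" by (simp add: add_pos_nonneg)
  then show ?thesis using inner_w[of "pp x" "pp x"] by (simp add: add_pos_nonneg del: pp_components(2))
qed

lemma inversion_components [simp]:
  "lam (inversion x) = lam x - ln (pp x \<bullet> pp x)" "pv (inversion x) = - inverse (pp x \<bullet> pp x) *\<^sub>R act (cj (pp x)) (pv x)"
  "pz (inversion x) = - inverse (pp x \<bullet> pp x) *\<^sub>R pz x"
  by (simp_all add: inversion_def act_def)

lemma exp_lam_inversion: "exp (lam (inversion x)) = exp (lam x) / (pp x \<bullet> pp x)"
  using pp_pos[of x] by (simp add: exp_diff)

lemma act_pp_inversion: "act (pp x) (pv (inversion x)) = - pv x"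
  using pp_pos[of x] act_inverse(2)[of "pp x" "pv x"] by (simp add: act_simps del: pp_components(2,3))

lemma pp_inversion: "(pp x \<bullet> pp x) *\<^sub>R pp (inversion x) = cj (pp x)"
proof -
  define D where "D = pp x \<bullet> pp x"
  have D: "D > 0" using pp_pos[of x] by (simp add: D_def)
  have pvi: "pv (inversion x) = - inverse D *\<^sub>R act (cj (pp x)) (pv x)" by (simp add: D_def)
  have aa: "act (cj (pp x)) (pv x) \<bullet> act (cj (pp x)) (pv x) = D * (pv x \<bullet> pv x)"
    using act_inner[of "cj (pp x)" "pv x" "pv x"] cj_inner(2)[of "pp x" "pp x"] by (simp add: D_def)
  have q: "pv (inversion x) \<bullet> pv (inversion x) = (pv x \<bullet> pv x) / D"
    unfolding pvi inner_scaleR_left inner_scaleR_right aa using D by (simp add: field_simps)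
  have "lam (D *\<^sub>R pp (inversion x)) = D * (exp (lam x) / D + (pv x \<bullet> pv x) / D / 4)"
    by (simp only: lin_simps pp_components exp_lam_inversion q D_def[symmetric] real_scaleR_def)
  also have "\<dots> = lam (cj (pp x))" using D by (simp add: field_simps)
  finally have "lam (D *\<^sub>R pp (inversion x)) = lam (cj (pp x))" .
  moreover have "pv (D *\<^sub>R pp (inversion x)) = pv (cj (pp x))" by simp
  moreover have "pz (inversion x) = - inverse D *\<^sub>R pz x" by (simp add: D_def)
  then have "pz (D *\<^sub>R pp (inversion x)) = pz (cj (pp x))" using D by (simp del: inversion_components)
  ultimately show ?thesis unfolding D_def[symmetric] by (rule decomp_eqI)
qed

text \<open>By \<open>pp_inversion\<close> the new \<open>p\<close> is the inverse of the old one,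
  so \<open>p \<bullet> p\<close> is inverted, and the operator of the new \<open>p\<close> takes
  \<open>X\<close> to minus the new \<open>X\<close>.\<close>

lemma inversion_inversion: "inversion (inversion x) = x"
proof -
  let ?D = "pp x \<bullet> pp x" and ?y = "inversion x"
  have "?D * ?D * (pp ?y \<bullet> pp ?y) = ?D"
    using arg_cong[OF pp_inversion[of x], of "\<lambda>w. w \<bullet> w"] cj_inner(2)[of "pp x" "pp x"] by simp
  then have D: "pp ?y \<bullet> pp ?y = inverse ?D" using pp_pos[of x] by (simp add: field_simps)
  have "?D *\<^sub>R act (pp ?y) (pv x) = act (cj (pp x)) (pv x)" using pp_inversion[of x] by (metis act_simps(4))
  also have "\<dots> = ?D *\<^sub>R (- pv ?y)" using pp_pos[of x] by (simp del: pp_components)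
  finally have "act (pp ?y) (pv x) = - pv ?y" using pp_pos[of x] by (simp only: scaleR_cancel_left) simp
  then have "act (pp ?y) (pv (inversion ?y) - pv x) = 0" using act_pp_inversion[of ?y] by (simp add: act_simps(5) del: inversion_components)
  then have "(pp ?y \<bullet> pp ?y) *\<^sub>R (pv (inversion ?y) - pv x) = 0"
    using act_inverse(1)[of "pp ?y" "pv (inversion ?y) - pv x"] by (simp add: act_simps(9) del: inversion_components pp_components(2,3)) 
  then have pv: "pv (inversion ?y) = pv x" using pp_pos[of ?y] by (simp del: inversion_components)
  have "lam (inversion ?y) = lam x" "pz (inversion ?y) = pz x"
    using pp_pos[of x] by (simp_all add: D ln_inverse)
  then show ?thesis using pv by (intro decomp_eqI[of "inversion ?y" x])
qed

lemma pp_has_derivative: "(pp has_derivative dpp x) (at x)"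
  unfolding pp_def[abs_def] dpp_def[abs_def]
  by (rule has_derivative_eq_rhs, (rule derivative_intros lam_has_derivative pv_has_derivative pz_has_derivative | simp)+)
    (auto simp: fun_eq_iff inner_commute)

lemma Cinf_on_pp: "Cinf_on pp UNIV"
proof -
  have "Cinf_on (\<lambda>x. (exp (lam x) + (pv x \<bullet> pv x) * (1/4)) *\<^sub>R B + pz x) UNIV"
    by (intro Cinf_on_add Cinf_on_scaleR Cinf_on_exp Cinf_on_mult Cinf_on_inner Cinf_on_lam Cinf_on_pv Cinf_on_pz Cinf_on_id Cinf_on_const open_UNIV)
  then show ?thesis by (simp add: pp_def[abs_def])
qed

lemma Cinf_on_inversion: "Cinf_on inversion UNIV"
proof -
  have D: "pp x \<bullet> pp x \<noteq> 0" for x using pp_pos[of x] by simp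
  have "Cinf_on (\<lambda>x. act (cj (pp x)) (pv x)) UNIV"
    by (rule Cinf_on_bilinear[OF bounded_bilinear_act open_UNIV Cinf_on_bounded_linear[OF bounded_linear_cj open_UNIV Cinf_on_pp] Cinf_on_pv[OF open_UNIV Cinf_on_id[OF open_UNIV]]])
  then show ?thesis
    unfolding inversion_def[abs_def] using D pp_pos
    by (intro Cinf_on_diff Cinf_on_add Cinf_on_scaleR Cinf_on_inverse Cinf_on_ln Cinf_on_inner Cinf_on_lam Cinf_on_pz Cinf_on_pp Cinf_on_id Cinf_on_const open_UNIV)
qed

text \<open>\<open>exp (lam x)\<close> times the component of \<open>th x u\<close> outside
  \<open>v\<close>; with this scaling the exponentials disappear from its relation to
  \<open>dpp\<close>.\<close>

definition th3 :: "'a => 'a => 'a" where "th3 x u = (exp (lam x) * lam u) *\<^sub>R B + (pz u - (1/2) *\<^sub>R N x u)"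

lemma pv_th3 [simp]: "pv (th3 x u) = 0"
  by (simp add: th3_def)

lemma th3_inner: "th3 x u \<bullet> w = dpp x u \<bullet> w - (1/2) * (act w (pv x) \<bullet> pv u)"
  by (simp add: th3_def dpp_def act_def inner_add_left inner_diff_left J_inner lam_def[of w] inner_commute[of w B] algebra_simps)

lemma th_norm: "exp (lam x) ^ 2 * (th x u \<bullet> th x u) = th3 x u \<bullet> th3 x u + exp (lam x) * (pv u \<bullet> pv u)"
proof -
  define t where "t = exp (lam x)"
  have t: "t > 0" "exp (- lam x) = inverse t" "exp (- lam x / 2) * exp (- lam x / 2) = inverse t"
    using exp_half(2)[of "lam x"] by (simp_all add: t_def exp_minus)
  define \<omega> where "\<omega> = pz u - (1/2) *\<^sub>R N x u"
  have "th x u \<bullet> th x u = lam u * lam u + inverse t * (pv u \<bullet> pv u) + inverse t * inverse t * (\<omega> \<bullet> \<omega>)"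
    unfolding inner_decomp[of "th x u"] th_components inner_scaleR_left inner_scaleR_right mult.assoc[symmetric] t \<omega>_def ..
  moreover have "th3 x u \<bullet> th3 x u = (t * lam u) * (t * lam u) + \<omega> \<bullet> \<omega>"
    using inner_w[of "th3 x u" "th3 x u"] by (simp add: th3_def t_def \<omega>_def)
  ultimately show ?thesis using t(1) unfolding t_def[symmetric] by (simp add: field_simps power2_eq_square)
qed

text \<open>Implicit differentiation of the relations \<open>act_pp_inversion\<close> and
  \<open>pp_inversion\<close>, in place of the closed formula.\<close>

lemma inversion_derivative:
  fixes x u
  defines "v \<equiv> fderiv inversion x u" and "D \<equiv> pp x \<bullet> pp x"
  shows "act (pp x) (pv v) = - (pv u + act (dpp x u) (pv (inversion x)))"
    and "D *\<^sub>R dpp (inversion x) v = cj (dpp x u) - (2 * (pp x \<bullet> dpp x u) / D) *\<^sub>R cj (pp x)"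
proof -
  have S: "(inversion has_derivative fderiv inversion x) (at x)" (is "(_ has_derivative ?S) _")
    by (rule Cinf_on_has_derivative[OF Cinf_on_inversion UNIV_I])
  have d1: "((\<lambda>y. act (pp y) (pv (inversion y))) has_derivative (\<lambda>u. act (pp x) (pv (?S u)) + act (dpp x u) (pv (inversion x)))) (at x)"
    by (rule bounded_bilinear.FDERIV[OF bounded_bilinear_act pp_has_derivative pv_has_derivative[OF S]])
  have d2: "((\<lambda>y. act (pp y) (pv (inversion y))) has_derivative (\<lambda>u. - pv u)) (at x)"
    unfolding act_pp_inversion by (intro has_derivative_minus pv_has_derivative has_derivative_ident)
  have "act (pp x) (pv (?S u)) + act (dpp x u) (pv (inversion x)) = - pv u"
    by (rule fun_cong[OF has_derivative_unique[OF d1 d2]])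
  then have "act (pp x) (pv (?S u)) = - pv u - act (dpp x u) (pv (inversion x))" by (simp only: eq_diff_eq)
  then show "act (pp x) (pv v) = - (pv u + act (dpp x u) (pv (inversion x)))"
    unfolding v_def by (simp only: minus_add_distrib diff_conv_add_uminus)
  have e1: "((\<lambda>y. (pp y \<bullet> pp y) *\<^sub>R pp (inversion y)) has_derivative
      (\<lambda>u. D *\<^sub>R dpp (inversion x) (?S u) + (pp x \<bullet> dpp x u + dpp x u \<bullet> pp x) *\<^sub>R pp (inversion x))) (at x)"
    unfolding D_def
    by (intro has_derivative_scaleR has_derivative_inner pp_has_derivative has_derivative_compose[OF S pp_has_derivative])
  have e2: "((\<lambda>y. (pp y \<bullet> pp y) *\<^sub>R pp (inversion y)) has_derivative (\<lambda>u. cj (dpp x u))) (at x)"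
    unfolding pp_inversion by (rule bounded_linear.has_derivative[OF bounded_linear_cj pp_has_derivative])
  have "D *\<^sub>R dpp (inversion x) v + (pp x \<bullet> dpp x u + dpp x u \<bullet> pp x) *\<^sub>R pp (inversion x) = cj (dpp x u)"
    unfolding v_def by (rule fun_cong[OF has_derivative_unique[OF e1 e2]])
  moreover have "pp (inversion x) = inverse D *\<^sub>R cj (pp x)"
    using pp_pos[of x] by (simp add: D_def flip: pp_inversion)
  ultimately show "D *\<^sub>R dpp (inversion x) v = cj (dpp x u) - (2 * (pp x \<bullet> dpp x u) / D) *\<^sub>R cj (pp x)"
    by (simp add: inner_commute[of "dpp x u"] divide_inverse algebra_simps)
qed

theorem inversion_isometry:
  assumes J2
  shows "th (inversion x) (fderiv inversion x u) \<bullet> th (inversion x) (fderiv inversion x w) = th x u \<bullet> th x w"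
proof -
  let ?S = "fderiv inversion x" and ?y = "inversion x" and ?D = "pp x \<bullet> pp x" and ?t = "exp (lam x)"
  \<comment> \<open>By \<open>th_norm\<close> the claim for a single vector, multiplied by
    \<open>?t ^ 2\<close>, is \<open>inversion_identity\<close>; the general case follows by
    polarization.\<close>
  have q: "th ?y (?S u) \<bullet> th ?y (?S u) = th x u \<bullet> th x u" for u
  proof -
    have "?D ^ 2 * (th3 ?y (?S u) \<bullet> th3 ?y (?S u)) + ?t * ?D * (pv (?S u) \<bullet> pv (?S u)) = th3 x u \<bullet> th3 x u + ?t * (pv u \<bullet> pv u)"
    proof (rule inversion_identity[OF \<open>J2\<close>])
      show "pv (pp x) = 0" "pv (dpp x u) = 0" "pv (th3 x u) = 0" "pv (th3 ?y (?S u)) = 0" "pv (pv x) = pv x"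
        "pv (pv ?y) = pv ?y" "pv (pv u) = pv u" "pv (pv (?S u)) = pv (?S u)" by simp_all
      show "lam (pp x) = ?t + (pv x \<bullet> pv x) / 4" by simp
      show "?D > 0" by (rule pp_pos)
      show "act (pp x) (pv ?y) = - pv x" by (rule act_pp_inversion)
      show "act (pp x) (pv (?S u)) = - (pv u + act (dpp x u) (pv ?y))" by (rule inversion_derivative(1))
      show "th3 x u \<bullet> w = dpp x u \<bullet> w - (1/2) * (act w (pv x) \<bullet> pv u)" for w by (rule th3_inner)
      show "th3 ?y (?S u) \<bullet> w = ((cj (dpp x u) - (2 * (pp x \<bullet> dpp x u) / ?D) *\<^sub>R cj (pp x)) \<bullet> w) / ?D - (1/2) * (act w (pv ?y) \<bullet> pv (?S u))" for w
        unfolding th3_inner inversion_derivative(2)[of x u, symmetric] using pp_pos[of x] by (simp del: inversion_components pp_components)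
    qed simp
    moreover have "?D ^ 2 * exp (lam ?y) ^ 2 = ?t ^ 2" "?D ^ 2 * exp (lam ?y) = ?t * ?D"
      using pp_pos[of x] unfolding exp_lam_inversion by (simp_all add: field_simps power2_eq_square)
    ultimately have "?t ^ 2 * (th ?y (?S u) \<bullet> th ?y (?S u)) = ?t ^ 2 * (th x u \<bullet> th x u)"
      using arg_cong[OF th_norm[of ?y "?S u"], of "\<lambda>r. ?D ^ 2 * r"] th_norm[of x u]
      by (simp only: mult.assoc[symmetric] distrib_left)
    then show ?thesis by simp
  qed
  have lin: "linear (\<lambda>u. th ?y (?S u))"
    using linear_compose[OF has_derivative_linear[OF Cinf_on_has_derivative[OF Cinf_on_inversion UNIV_I]] lin_th] by (simp add: o_def)
  show ?thesis
    using q[of "u + w"] q[of u] q[of w] unfolding linear_add[OF lin] linear_add[OF lin_th]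
    by (simp add: inner_add_left inner_add_right inner_commute[of "th x w" "th x u"] inner_commute[of "th ?y (?S w)" "th ?y (?S u)"])
qed

lemma inversion_0: "inversion 0 = 0" "fderiv inversion 0 u = - u"
proof -
  have p: "pp 0 = B" by (simp add: pp_def)
  show 0: "inversion 0 = 0" by (simp add: inversion_def p unit_B act_simps)
  let ?v = "fderiv inversion 0 u"
  have cB: "cj B = B" by (simp add: cj_def)
  have v: "pv ?v = - pv u" using inversion_derivative(1)[of 0 u] unfolding p 0 by (simp add: act_def)
  have d: "dpp 0 w = lam w *\<^sub>R B + pz w" for w by (simp add: dpp_def)
  have "dpp 0 ?v = cj (dpp 0 u) - (2 * lam u) *\<^sub>R B"
    using inversion_derivative(2)[of 0 u] unfolding p 0 cB d by (simp add: unit_B inner_add_right)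
  then have "lam (dpp 0 ?v) = - lam u" "pz (dpp 0 ?v) = - pz u" by (simp_all add: d)
  then have "lam ?v = lam (- u)" "pz ?v = pz (- u)" "pv ?v = pv (- u)" using v by (simp_all add: d)
  then show "?v = - u" by (metis decomp_eqI)
qed

end

section \<open>Transfer to the group\<close>

lemma (in heisenberg_model) isometric_linear:
  assumes "aut h"
  shows "Cinf_on h UNIV" "fderiv h x = h" "th (h x) (h u) \<bullet> th (h x) (h w) = th x u \<bullet> th x w"
  using Cinf_on_linear[OF autD(1)[OF assms] open_UNIV] frechet_derivative_at[OF linear_imp_has_derivative[OF autD(1)[OF assms]], of x]
  by (simp_all add: aut_th[OF assms] autD(2)[OF assms])

lemma (in heisenberg_model) flow_has_derivative':
  assumes "der D"
  shows "((\<lambda>t. flow D t x) has_derivative (\<lambda>r. r *\<^sub>R D (flow D t x))) (at t)"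
  using flow_has_derivative[OF assms] by (simp add: has_vector_derivative_def)

lemma (in heisenberg_model) Cinf_on_flow:
  assumes D: "der D"
  shows "Cinf_on (\<lambda>t. flow D t x) UNIV"
proof -
  have "Ck_on k (\<lambda>t. flow D t x) UNIV" for k
  proof (induction k)
    case 0
    then show ?case using flow_has_derivative'[OF D] by (auto intro!: continuous_at_imp_continuous_on has_derivative_continuous)
  next
    case (Suc k)
    have "bounded_linear (\<lambda>y. v *\<^sub>R D y)" for v
      using bounded_linear_compose[OF bounded_linear_scaleR_right derD(1)[OF D, unfolded linear_conv_bounded_linear]] .
    then show ?case by (intro Ck_onI[OF open_UNIV flow_has_derivative'[OF D]] Ck_on_bounded_linear[OF _ open_UNIV Suc])
  qed
  then show ?thesis by (simp add: Cinf_on_def)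
qed

lemma (in heisenberg_model) continuous_flow:
  assumes D: "der D"
  shows "continuous_on UNIV (\<lambda>(t, x). flow D t x)"
proof -
  have c: "continuous_on UNIV (\<lambda>t. flow D t b)" for b by (rule Cinf_on_continuous[OF Cinf_on_flow[OF D]])
  have "(\<lambda>p. flow D (fst p) (snd p)) = (\<lambda>p. \<Sum>b\<in>Basis. (snd p \<bullet> b) *\<^sub>R flow D (fst p) b)"
    by (rule ext) (rule linear_apply_basis[OF autD(1)[OF aut_flow[OF D]]])
  moreover have "continuous_on UNIV (\<lambda>p. \<Sum>b\<in>Basis. (snd p \<bullet> b) *\<^sub>R flow D (fst p) b)"
    by (intro continuous_intros continuous_on_compose2[OF c]) auto
  ultimately show ?thesis unfolding split_beta by (simp only:)
qed

locale global_coordinates = lie_model B pv pz N A mul e iv \<phi>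
  for B :: "'n::euclidean_space" and pv pz N and A :: "('m::{t2_space,second_countable_topology}, 'e::euclidean_space) chart set"
    and mul e iv \<phi> +
  fixes Psi :: "'n => 'm" and Phi :: "'m => 'n"
  assumes Phi_Psi [simp]: "Phi (Psi x) = x" and Psi_Phi [simp]: "Psi (Phi q) = q"
    and plot_Psi: "plot A UNIV Psi" and continuous_Phi: "continuous_on UNIV Phi"
    and Phi_chart: "(U, \<psi>) \<in> A ==> Cinf_on (\<lambda>x. Phi (inv_into U \<psi> x)) (\<psi> ` U)" and thM_Psi: "thM Psi x u = th x u"
begin

abbreviation g :: "'m metric_tensor" where "g \<equiv> left_invariant_metric A mul iv \<phi>"

abbreviation conjugate :: "('n => 'n) => 'm => 'm" where "conjugate h \<equiv> (\<lambda>q. Psi (h (Phi q)))"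

lemma continuous_Psi: "continuous_on UNIV Psi"
  by (rule plot_continuous[OF plot_Psi])

lemma Cinf_on_Phi: "plot A S c ==> Cinf_on (\<lambda>x. Phi (c x)) S"
  by (rule plot_local_inverse[OF charts open_UNIV]) (auto intro: Phi_chart)

lemma plot_Psi_compose: "open S ==> Cinf_on c S ==> plot A S (\<lambda>x. Psi (c x))"
  by (rule plot_compose[OF plot_Psi _ _ _ charts]) auto

lemma smooth_conjugate: "Cinf_on h UNIV ==> smooth_map A A (conjugate h)"
proof (rule smooth_map_plotI[OF charts])
  assume h: "Cinf_on h UNIV"
  show "continuous_on UNIV (conjugate h)"
    by (intro continuous_on_compose2[OF continuous_Psi] continuous_on_compose2[OF Cinf_on_continuous[OF h]] continuous_Phi) auto
  show "plot A (\<psi> ` U) (\<lambda>x. Psi (h (Phi (inv_into U \<psi> x))))" if "(U, \<psi>) \<in> A" for U \<psi>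
  proof (rule plot_Psi_compose)
    show "open (\<psi> ` U)" by (rule chartsD(2)[OF charts that])
    then show "Cinf_on (\<lambda>x. h (Phi (inv_into U \<psi> x))) (\<psi> ` U)"
      by (rule Cinf_on_compose[OF _ open_UNIV _ h Phi_chart[OF that]]) simp
  qed
qed

lemma g_pd: "g (Psi x) (pd A Psi x u) (pd A Psi x w) = th x u \<bullet> th x w"
  unfolding left_invariant_metric_def using thM_Psi[of x] by (simp add: thM_def)

lemma tangent_pd:
  assumes "X \<in> tangent_space A q"
  obtains u where "X = pd A Psi (Phi q) u"
proof -
  obtain U \<psi> where U: "(U, \<psi>) \<in> A" "q \<in> U" using chart_at[OF charts] .
  note c = chartsD[OF charts U(1)]
  have i: "inv_into U \<psi> (\<psi> q) = q" using U c(6) by simp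
  obtain w where w: "X = pd A (inv_into U \<psi>) (\<psi> q) w" by (rule tangent_vector_chart[OF atlas assms U])
  have "((\<lambda>x. Phi (inv_into U \<psi> x)) has_derivative fderiv (\<lambda>x. Phi (inv_into U \<psi> x)) ((\<psi> q))) (at (\<psi> q))"
    by (rule Cinf_on_has_derivative[OF Phi_chart[OF U(1)]]) (use U in auto)
  from pd_compose[OF atlas plot_Psi UNIV_I this, of w] show ?thesis using that by (simp add: w i)
qed

lemma differential_Psi: "smooth_map A A F ==> differential A F (pd A Psi x u) = pd A (\<lambda>y. F (Psi y)) x u"
  by (rule differential_pd[OF atlas])

lemma pd_Psi_compose:
  assumes "Cinf_on h UNIV"
  shows "pd A (\<lambda>y. Psi (h y)) x u = pd A Psi (h x) (fderiv h x u)"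
  by (rule pd_compose[OF atlas plot_Psi UNIV_I Cinf_on_has_derivative[OF assms UNIV_I]])

lemma isometry_coordinates:
  assumes F: "F \<in> isometry_group A g"
  defines "h \<equiv> \<lambda>x. Phi (F (Psi x))"
  shows "Cinf_on h UNIV" "th (h x) (fderiv h x u) \<bullet> th (h x) (fderiv h x w) = th x u \<bullet> th x w"
proof -
  have sF: "smooth_map A A F" using F by (simp add: isometry_group_def)
  show h: "Cinf_on h UNIV" unfolding h_def by (rule Cinf_on_Phi[OF smooth_map_plot[OF sF plot_Psi]])
  have d: "differential A F (pd A Psi x u) = pd A Psi (h x) (fderiv h x u)" for u
    using pd_Psi_compose[OF h, of x u] by (simp add: differential_Psi[OF sF] h_def)
  have "g (F (Psi x)) (differential A F (pd A Psi x u)) (differential A F (pd A Psi x w)) = g (Psi x) (pd A Psi x u) (pd A Psi x w)"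
    using F pd_tangent[OF atlas plot_Psi UNIV_I] by (simp add: isometry_group_def)
  then show "th (h x) (fderiv h x u) \<bullet> th (h x) (fderiv h x w) = th x u \<bullet> th x w"
    unfolding d g_pd[symmetric] by (simp add: h_def)
qed

lemma conjugate_isometry:
  assumes h: "Cinf_on h UNIV" "Cinf_on k UNIV" "\<And>x. h (k x) = x" "\<And>x. k (h x) = x"
    and iso: "\<And>x u w. th (h x) (fderiv h x u) \<bullet> th (h x) (fderiv h x w) = th x u \<bullet> th x w"
  shows "conjugate h \<in> isometry_group A g"
proof -
  have 1: "conjugate h (conjugate k q) = q" "conjugate k (conjugate h q) = q" for q by (simp_all add: h)
  then have "bij (conjugate h)" "inv (conjugate h) = conjugate k"
    by (auto intro!: bijI' inv_equality simp: h) (metis 1)+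
  moreover have "g (conjugate h q) (differential A (conjugate h) X) (differential A (conjugate h) Y) = g q X Y"
    if X: "X \<in> tangent_space A q" and Y: "Y \<in> tangent_space A q" for q X Y
  proof -
    obtain u where u: "X = pd A Psi (Phi q) u" by (rule tangent_pd[OF X])
    obtain w where w: "Y = pd A Psi (Phi q) w" by (rule tangent_pd[OF Y])
    have d: "differential A (conjugate h) (pd A Psi x u) = pd A Psi (h x) (fderiv h x u)" for x u
      using pd_Psi_compose[OF h(1), of x u] by (simp add: differential_Psi[OF smooth_conjugate[OF h(1)]])
    show ?thesis unfolding u w d g_pd using iso g_pd[of "Phi q" u w] by simp
  qed
  ultimately show ?thesis using smooth_conjugate h by (simp add: isometry_group_def)
qed

lemma isotropy_aut:
  assumes rigid and F: "F \<in> isotropy_group A g (Psi 0)"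
  shows "aut (\<lambda>x. Phi (F (Psi x)))"
proof -
  have iso: "F \<in> isometry_group A g" and fixed: "F (Psi 0) = Psi 0"
    using F connected_component_of_subset_topspace[of "subtopology compact_open_topology (isometry_group A g)" id]
    by (auto simp: isotropy_group_def isometry_identity_component_def)
  interpret model_isometry B pv pz N "\<lambda>x. Phi (F (Psi x))"
    by unfold_locales (use isometry_coordinates[OF iso] fixed in auto)
  show ?thesis by (rule isometry_aut[OF \<open>rigid\<close>])
qed

lemma conjugate_aut_isometry: "aut h ==> conjugate h \<in> isometry_group A g"
proof -
  assume h: "aut h"
  have "h (inv h x) = x" "inv h (h x) = x" for x using aut_bij[OF h] by (simp_all add: bij_is_surj surj_f_inv_f bij_is_inj)
  then show ?thesis
    using isometric_linear[OF h] isometric_linear(1)[OF aut_inv[OF h]] by (intro conjugate_isometry[of h "inv h"]) simp_all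
qed

text \<open>The flow is a path of isometries through the identity, continuous for the compact-open
  topology, so it stays in the identity component.\<close>

lemma flow_isotropy:
  assumes D: "der D"
  shows "conjugate (flow D t) \<in> isotropy_group A g (Psi 0)"
proof -
  let ?X = "subtopology compact_open_topology (isometry_group A g)" and ?f = "\<lambda>t. conjugate (flow D t)"
  have f0: "?f 0 = id" using flow_0[OF derD(1)[OF D]] by (auto simp: fun_eq_iff)
  have "continuous_map euclideanreal compact_open_topology ?f"
    unfolding compact_open_topology_def
  proof (rule continuous_on_generated_topo)
    fix V assume "V \<in> {{f :: 'm => 'm. f ` K \<subseteq> U} | K U. compact K \<and> open U}"
    then obtain K U where V: "V = {f :: 'm => 'm. f ` K \<subseteq> U}" and K: "compact K" and U: "open U" by blast
    define G where "G = (\<lambda>(t, q). ?f t q)"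
    have "continuous_on UNIV (\<lambda>p. flow D (fst p) (Phi (snd p)))"
    proof -
      have "continuous_on UNIV (\<lambda>p. (fst p, Phi (snd p)))"
        by (intro continuous_on_Pair continuous_on_compose2[OF continuous_Phi] continuous_intros) auto
      from continuous_on_compose2[OF continuous_flow[OF D] this] show ?thesis by simp
    qed
    from continuous_on_compose2[OF continuous_Psi this] have "continuous_on UNIV G" by (simp add: G_def split_beta)
    then have o: "open (G -` U)" using U by (simp add: continuous_on_open_vimage)
    have "open (?f -` V)"
    proof (subst open_subopen, intro ballI)
      fix t assume "t \<in> ?f -` V"
      then have "{t} \<times> K \<subseteq> G -` U" by (auto simp: V G_def)
      \<comment> \<open>Compactness of \<open>K\<close> lets the tube lemma find one neighbourhood
        of \<open>t\<close> that works for all points of \<open>K\<close>.\<close>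
      then obtain X where "t \<in> X" "open X" "X \<times> K \<subseteq> G -` U" using Elementary_Topology.tube_lemma[OF K o] by blast
      then show "\<exists>T. open T \<and> t \<in> T \<and> T \<subseteq> ?f -` V" by (intro exI[of _ X]) (auto simp: V G_def)
    qed
    then show "openin euclideanreal (?f -` V \<inter> topspace euclideanreal)" by simp
  next
    show "?f ` topspace euclideanreal \<subseteq> \<Union> {{f :: 'm => 'm. f ` K \<subseteq> U} | K U. compact K \<and> open U}"
    proof -
      have "UNIV \<in> {{f :: 'm => 'm. f ` K \<subseteq> U} | K U. compact K \<and> open U}"
        by (intro CollectI exI[of _ "{}"] exI[of _ UNIV]) simp
      from order_trans[OF subset_UNIV Union_upper[OF this]] show ?thesis .
    qed
  qed
  then have "continuous_map euclideanreal ?X ?f"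
    using conjugate_aut_isometry[OF aut_flow[OF D]] by (auto simp: continuous_map_in_subtopology)
  from connectedin_continuous_map_image[OF this, of UNIV]
  have "connectedin ?X (range ?f)" by (simp add: connectedin_iff_connected)
  moreover have "id \<in> range ?f" using f0 by (metis rangeI)
  ultimately have "connected_component_of ?X id (?f t)" unfolding connected_component_of_def by blast
  moreover have "?f t (Psi 0) = Psi 0" using linear_0[OF autD(1)[OF aut_flow[OF D]]] by simp
  ultimately show ?thesis by (simp add: isotropy_group_def isometry_identity_component_def)
qed

lemma velocity_Psi:
  assumes "Cinf_on c UNIV" "(c has_vector_derivative c') (at 0)"
  shows "velocity A (\<lambda>t. Psi (c t)) = pd A Psi (c 0) c'" "smooth_map euclidean_atlas A (\<lambda>t::real. Psi (c t))"
proof -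
  show s: "smooth_map euclidean_atlas A (\<lambda>t. Psi (c t))"
  proof (rule smooth_map_plotI[OF charts_euclidean_atlas])
    show "continuous_on UNIV (\<lambda>t. Psi (c t))"
      by (rule plot_continuous[OF plot_Psi_compose[OF open_UNIV assms(1)]])
    show "plot A (\<psi> ` U) (\<lambda>x. Psi (c (inv_into U \<psi> x)))" if "(U, \<psi>) \<in> euclidean_atlas" for U \<psi>
      using that plot_Psi_compose[OF open_UNIV assms(1)] by (simp add: euclidean_atlas_def id_def[symmetric])
  qed
  show "velocity A (\<lambda>t. Psi (c t)) = pd A Psi (c 0) c'"
    unfolding velocity_eq_pd[OF atlas s]
    using pd_compose[OF atlas plot_Psi UNIV_I assms(2)[unfolded has_vector_derivative_def], of 1] by simp
qed

text \<open>Compatibility of the slice chart with the atlas is what makes the change between slice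
  coordinates and \<open>Psi\<close> smooth in both directions.\<close>

lemma slice_Psi:
  assumes S: "smooth_atlas (insert (U, \<psi>) A)" "subspace L" "\<psi> ` (U \<inter> \<Sigma>) = \<psi> ` U \<inter> L"
  shows "slice (Psi -` \<Sigma>) (Psi -` U) (\<lambda>x. \<psi> (Psi x)) (\<lambda>u. Phi (inv_into U \<psi> u)) L"
proof
  note ch = charts_smooth_atlas[OF S(1)]
  note u = chartsD[OF ch insertI1]
  have im: "(\<lambda>x. \<psi> (Psi x)) ` (Psi -` T) = \<psi> ` T" for T
    using surj_image_vimage_eq[of Psi T] Psi_Phi by (metis image_image surjI)
  show "open (Psi -` U)" using continuous_Psi u(1) by (simp add: continuous_on_open_vimage)
  show "open ((\<lambda>x. \<psi> (Psi x)) ` (Psi -` U))" unfolding im by (rule u(2))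
  have "smooth_map A (insert (U, \<psi>) A) (\<lambda>q. q)"
    using S(1) by (auto simp: smooth_map_def smooth_atlas_def)
  from plot_smooth_map[OF charts ch this plot_Psi] have p: "plot (insert (U, \<psi>) A) UNIV Psi" .
  show "Cinf_on (\<lambda>x. \<psi> (Psi x)) (Psi -` U)" by (rule plot_Cinf_on[OF p insertI1]) auto
  have "plot A (\<psi> ` U) (inv_into U \<psi>)"
    using plot_inv_chart[OF S(1) insertI1] by (simp add: plot_def)
  from Cinf_on_Phi[OF this] show "Cinf_on (\<lambda>u. Phi (inv_into U \<psi> u)) ((\<lambda>x. \<psi> (Psi x)) ` (Psi -` U))" unfolding im .
  show "Phi (inv_into U \<psi> (\<psi> (Psi y))) = y" if "y \<in> Psi -` U" for y using that u(6) by simp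
  show "subspace L" by fact
  show "(\<lambda>x. \<psi> (Psi x)) ` (Psi -` U \<inter> Psi -` \<Sigma>) = (\<lambda>x. \<psi> (Psi x)) ` (Psi -` U) \<inter> L"
    unfolding im vimage_Int[symmetric] by (rule S(3))
qed

theorem not_polar:
  assumes rigid
  shows "\<not> polar_action A g (isotropy_group A g (Psi 0))"
proof
  let ?H = "isotropy_group A g (Psi 0)"
  assume "polar_action A g ?H"
  then obtain \<Sigma> where emb: "embedded_submanifold A \<Sigma>" and cl: "closed \<Sigma>" and meets: "\<And>x. orbit_of ?H x \<inter> \<Sigma> \<noteq> {}"
    and orth: "\<And>x X Y. x \<in> \<Sigma> ==> X \<in> tangent_of_subset A (orbit_of ?H x) x ==> Y \<in> tangent_of_subset A \<Sigma> x ==> g x X Y = 0"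
    unfolding polar_action_def by blast
  let ?S = "Psi -` \<Sigma>"
  have slice: "\<exists>W \<psi> \<psi>' L. slice ?S W \<psi> \<psi>' (L :: 'e set) \<and> x \<in> W" if "x \<in> ?S" for x
  proof -
    obtain U \<psi> L where "smooth_atlas (insert (U, \<psi>) A)" "Psi x \<in> U" "subspace L" "\<psi> ` (U \<inter> \<Sigma>) = \<psi> ` U \<inter> L"
      using emb \<open>x \<in> ?S\<close> unfolding embedded_submanifold_def by auto
    with slice_Psi show ?thesis by blast
  qed
  have closed: "closed ?S" using continuous_Psi cl by (simp add: continuous_on_closed_vimage)
  have "polar_section B pv pz N ?S"
  proof
    show "closed ?S" by (rule closed)
    show "\<exists>h. aut h \<and> h x \<in> ?S" for x
    proof -
      obtain F where "F \<in> ?H" "F (Psi x) \<in> \<Sigma>" using meets[of "Psi x"] by (auto simp: orbit_of_def)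
      then show ?thesis using isotropy_aut[OF \<open>rigid\<close>] by (intro exI[of _ "\<lambda>x. Phi (F (Psi x))"]) simp
    qed
    show "e' \<in> tvec ?S x"
      if y: "\<And>j. y j \<in> ?S" "y \<longlonglongrightarrow> x" "\<And>j. \<eta> j \<noteq> 0" "(\<lambda>j. (y j - x) /\<^sub>R \<eta> j) \<longlonglongrightarrow> e'" for y x \<eta> e'
    proof -
      have x: "x \<in> ?S" using closed_sequentially[OF closed] y(1,2) by blast
      from slice[OF this] obtain W \<psi> \<psi>' and L :: "'e set" where s: "slice ?S W \<psi> \<psi>' L" "x \<in> W" by blast
      show ?thesis by (rule slice.secant_tvec(2)[OF s x y])
    qed
    show "fderiv (\<lambda>y. \<omega> y e1) x e2 = fderiv (\<lambda>y. \<omega> y e2) x e1"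
      if x: "x \<in> ?S" and o: "\<And>w. Cinf_on (\<lambda>y. \<omega> y w) UNIV" "\<And>y. linear (\<omega> y)" "\<And>y w. y \<in> ?S ==> w \<in> tvec ?S y ==> \<omega> y w = (0 :: real)"
        and e: "e1 \<in> tvec ?S x" "e2 \<in> tvec ?S x" for x \<omega> e1 e2
    proof -
      from slice[OF x] obtain W \<psi> \<psi>' and L :: "'e set" where s: "slice ?S W \<psi> \<psi>' L" "x \<in> W" by blast
      show ?thesis by (rule slice.second_order[OF s x o e])
    qed
    show "th x (D x) \<bullet> th x w = 0" if D: "der D" and x: "x \<in> ?S" and w: "w \<in> tvec ?S x" for D x w
    proof -
      note f = Cinf_on_flow[OF D, of x]
      have f0: "flow D 0 x = x" by (rule flow_0[OF derD(1)[OF D]])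
      note v = velocity_Psi[OF f flow_has_derivative[OF D, of x 0], unfolded f0]
      have "pd A Psi x (D x) \<in> tangent_of_subset A (orbit_of ?H (Psi x)) (Psi x)"
      proof -
        have "Psi (flow D t x) \<in> orbit_of ?H (Psi x)" for t
          unfolding orbit_of_def using flow_isotropy[OF D, of t] by (auto intro!: exI[of _ "conjugate (flow D t)"])
        then show ?thesis unfolding tangent_of_subset_def
          using v f0 by (auto intro!: exI[of _ "\<lambda>t. Psi (flow D t x)"])
      qed
      moreover obtain c where c: "Cinf_on c UNIV" "range c \<subseteq> ?S" "c (0::real) = x" "(c has_vector_derivative w) (at 0)"
        using w by (auto simp: tvec_def)
      have "pd A Psi x w \<in> tangent_of_subset A \<Sigma> (Psi x)"
        unfolding tangent_of_subset_def using velocity_Psi[OF c(1,4)] c(2,3)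
        by (auto intro!: exI[of _ "\<lambda>t. Psi (c t)"])
      ultimately have "g (Psi x) (pd A Psi x (D x)) (pd A Psi x w) = 0" using orth x by simp
      then show ?thesis by (simp add: g_pd)
    qed
  qed
  then show False by (rule polar_section.false)
qed

text \<open>The geodesic symmetry at \<open>q\<close> is the inversion conjugated by left
  translation; its differential there is minus the identity because that of the inversion at 0
  is.\<close>

lemma symmetric:
  assumes "B \<bullet> B = 1" J2
  shows "riemannian_symmetric A g"
  unfolding riemannian_symmetric_def
proof
  fix q
  interpret damek_ricci_model B pv pz N by unfold_locales (rule assms)
  define a where "a = Phi q"
  define h where "h x = gm a (inversion (gm (gi a) x))" for x
  define Dh where "Dh x u = Xm a (fderiv inversion ((gm (gi a) x)) (Xm (gi a) u))" for x u
  have gm: "Cinf_on (gm b) UNIV" for b by (intro Cinf_on_gm Cinf_on_const Cinf_on_id open_UNIV)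
  have h: "Cinf_on h UNIV" unfolding h_def
    by (rule Cinf_on_compose[OF open_UNIV open_UNIV _ gm Cinf_on_compose[OF open_UNIV open_UNIV _ Cinf_on_inversion gm]]) auto
  have hh: "h (h x) = x" for x by (simp add: h_def gm_cancel inversion_inversion)
  have Dh: "(h has_derivative Dh x) (at x)" for x
    unfolding h_def[abs_def] Dh_def[abs_def]
    by (rule has_derivative_compose[OF has_derivative_compose[OF gm_has_derivative Cinf_on_has_derivative[OF Cinf_on_inversion UNIV_I]] gm_has_derivative])
  note fd = frechet_derivative_at[OF Dh, symmetric]
  have "th (h x) (fderiv h x u) \<bullet> th (h x) (fderiv h x w) = th x u \<bullet> th x w" for x u w
    unfolding fd h_def Dh_def th_left_invariant inversion_isometry[OF \<open>J2\<close>] ..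
  then have iso: "conjugate h \<in> isometry_group A g" by (rule conjugate_isometry[OF h h hh hh])
  have "h a = a" by (simp add: h_def inversion_0)
  then have "conjugate h q = q" by (simp add: a_def)
  moreover have "differential A (conjugate h) X = (\<lambda>f. - X f)" if X: "X \<in> tangent_space A q" for X
  proof -
    obtain u where u: "X = pd A Psi a u" unfolding a_def by (rule tangent_pd[OF X])
    have "Xm a (Xm (gi a) u) = u"
    proof -
      have "((\<lambda>x. gm a (gm (gi a) x)) has_derivative (\<lambda>u. Xm a (Xm (gi a) u))) (at 0)"
        by (rule has_derivative_compose[OF gm_has_derivative gm_has_derivative])
      then have d: "((\<lambda>x. x) has_derivative (\<lambda>u. Xm a (Xm (gi a) u))) (at 0)" by (simp add: gm_cancel)
      show ?thesis by (rule fun_cong[OF has_derivative_unique[OF d has_derivative_ident]])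
    qed
    then have "Dh a u = - 1 *\<^sub>R u"
      by (simp add: Dh_def inversion_0 linear_neg[OF lin_Xm])
    moreover have "differential A (conjugate h) X = pd A Psi (h a) (Dh a u)"
      using pd_Psi_compose[OF h, of a u] by (simp add: u differential_Psi[OF smooth_conjugate[OF h]] fd)
    ultimately show ?thesis using pd_linear(2)[OF atlas plot_Psi UNIV_I, of a "-1" u] \<open>h a = a\<close> by (simp add: u)
  qed
  ultimately show "\<exists>s\<in>isometry_group A g. s q = q \<and> (\<forall>X\<in>tangent_space A q. differential A s X = (\<lambda>f. - X f))"
    by (intro bexI[OF _ iso] conjI ballI)
qed

end

section \<open>The two families of algebras\<close>

text \<open>Replaces subspaces by projections. Orthogonality of \<open>v\<close> and
  \<open>z\<close> makes the decomposition unique, hence the projections linear, and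
  \<open>J_map\<close> becomes the globally defined \<open>J\<close>.\<close>

lemma heisenberg_model_exists:
  fixes br :: "'n::euclidean_space => 'n => 'n"
  assumes lie: "lie_algebra br" and heis: "generalized_heisenberg_on br v z"
    and B: "B = 0 \<or> B \<bullet> B = 1" and Bv: "\<And>U. U \<in> v ==> B \<bullet> U = 0" and Bz: "\<And>Z. Z \<in> z ==> B \<bullet> Z = 0"
    and dec: "\<And>x. \<exists>c. \<exists>U\<in>v. \<exists>Z\<in>z. x = c *\<^sub>R B + U + Z"
    and brB: "\<And>U Z. B \<bullet> B = 1 ==> U \<in> v ==> Z \<in> z ==> br B (U + Z) = (1/2) *\<^sub>R U + Z"
  obtains pv pz N where "heisenberg_model B pv pz N" "heisenberg_model.br B pv pz N = br"
proof -
  have lin: "linear (br x)" "linear (\<lambda>x. br x y)" and alt: "br x x = 0" for x y using lie by (auto simp: lie_algebra_def)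
  note add = lin[THEN linear_add] and cmul = lin[THEN linear_cmul]
  have skew: "br x y = - br y x" for x y
    using alt[of "x + y"] alt[of x] alt[of y] by (simp add: add eq_neg_iff_add_eq_0 add.commute)
  have sv: "subspace v" and sz: "subspace z" and nz: "v \<noteq> {0}" "z \<noteq> {0}"
    and vz: "\<And>U Z. U \<in> v ==> Z \<in> z ==> U \<bullet> Z = 0" and brv: "\<And>U V. U \<in> v ==> V \<in> v ==> br U V \<in> z"
    and br0: "\<And>U Z. U \<in> v ==> Z \<in> z ==> br U Z = 0" "\<And>Z W. Z \<in> z ==> W \<in> z ==> br Z W = 0"
    and JJ: "\<And>Z U. Z \<in> z ==> U \<in> v ==> J_map br v Z (J_map br v Z U) = - (Z \<bullet> Z) *\<^sub>R U"
    using heis by (auto simp: generalized_heisenberg_on_def)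
  have "\<exists>U\<in>v. \<exists>Z\<in>z. x = (x \<bullet> B) *\<^sub>R B + U + Z" for x
  proof -
    obtain c U Z where x: "U \<in> v" "Z \<in> z" "x = c *\<^sub>R B + U + Z" using dec by blast
    have "x \<bullet> B = c * (B \<bullet> B)" using Bv[OF x(1)] Bz[OF x(2)] by (simp add: x(3) inner_add_left inner_commute[of U B] inner_commute[of Z B])
    then have "(x \<bullet> B) *\<^sub>R B = c *\<^sub>R B" using B by auto
    then have "x = (x \<bullet> B) *\<^sub>R B + U + Z" using x(3) by (simp only:)
    then show ?thesis using x(1,2) by blast
  qed
  then obtain pv pz where P: "pv x \<in> v" "pz x \<in> z" "x = (x \<bullet> B) *\<^sub>R B + pv x + pz x" for x by metis
  have uniq: "pv x = U" "pz x = Z" if "U \<in> v" "Z \<in> z" "x = (x \<bullet> B) *\<^sub>R B + U + Z" for x U Z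
  proof -
    have "(x \<bullet> B) *\<^sub>R B + (pv x + pz x) = (x \<bullet> B) *\<^sub>R B + (U + Z)" using P(3)[of x] that(3) by (simp only: add.assoc)
    then have e: "pv x - U = Z - pz x" by (simp add: algebra_simps)
    have "(pv x - U) \<bullet> (Z - pz x) = 0" using subspace_diff[OF sv P(1) that(1)] subspace_diff[OF sz that(2) P(2)] by (rule vz)
    then have "pv x - U = 0" unfolding e by simp
    then show "pv x = U" "pz x = Z" using e by simp_all
  qed
  have pvv: "pv U = U" "pz U = 0" if "U \<in> v" for U
    using uniq[OF that subspace_0[OF sz], of U] Bv[OF that] by (simp_all add: inner_commute[of U B])
  have pzz: "pz Z = Z" "pv Z = 0" if "Z \<in> z" for Z
    using uniq[OF subspace_0[OF sv] that, of Z] Bz[OF that] by (simp_all add: inner_commute[of Z B])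
  have pB: "pv B = 0" "pz B = 0" using uniq[OF subspace_0[OF sv] subspace_0[OF sz], of B] B by auto
  have padd: "pv (x + y) = pv x + pv y" "pz (x + y) = pz x + pz y" for x y
  proof -
    have "x + y = ((x \<bullet> B) *\<^sub>R B + pv x + pz x) + ((y \<bullet> B) *\<^sub>R B + pv y + pz y)" using P(3)[of x] P(3)[of y] by (rule arg_cong2)
    also have "\<dots> = (x \<bullet> B + y \<bullet> B) *\<^sub>R B + (pv x + pv y) + (pz x + pz y)" by (simp add: algebra_simps)
    also have "x \<bullet> B + y \<bullet> B = (x + y) \<bullet> B" by (simp add: inner_add_left)
    finally have "x + y = ((x + y) \<bullet> B) *\<^sub>R B + (pv x + pv y) + (pz x + pz y)" .
    from uniq[OF subspace_add[OF sv P(1) P(1)] subspace_add[OF sz P(2) P(2)] this]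
    show "pv (x + y) = pv x + pv y" "pz (x + y) = pz x + pz y" .
  qed
  have pscale: "pv (c *\<^sub>R x) = c *\<^sub>R pv x" "pz (c *\<^sub>R x) = c *\<^sub>R pz x" for c x
  proof -
    have "c *\<^sub>R x = c *\<^sub>R ((x \<bullet> B) *\<^sub>R B + pv x + pz x)" using P(3)[of x] by (rule arg_cong)
    also have "\<dots> = (c * (x \<bullet> B)) *\<^sub>R B + c *\<^sub>R pv x + c *\<^sub>R pz x" by (simp add: scaleR_add_right)
    also have "c * (x \<bullet> B) = (c *\<^sub>R x) \<bullet> B" by simp
    finally have "c *\<^sub>R x = ((c *\<^sub>R x) \<bullet> B) *\<^sub>R B + c *\<^sub>R pv x + c *\<^sub>R pz x" .
    from uniq[OF subspace_scale[OF sv P(1)] subspace_scale[OF sz P(2)] this]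
    show "pv (c *\<^sub>R x) = c *\<^sub>R pv x" "pz (c *\<^sub>R x) = c *\<^sub>R pz x" .
  qed
  have inner: "pv x \<bullet> y = pv x \<bullet> pv y" "pz x \<bullet> y = pz x \<bullet> pz y" for x y
  proof -
    have "pv x \<bullet> y = pv x \<bullet> ((y \<bullet> B) *\<^sub>R B + pv y + pz y)" "pz x \<bullet> y = pz x \<bullet> ((y \<bullet> B) *\<^sub>R B + pv y + pz y)"
      using P(3)[of y] by (rule arg_cong)+
    then show "pv x \<bullet> y = pv x \<bullet> pv y" "pz x \<bullet> y = pz x \<bullet> pz y"
      using Bv[OF P(1)[of x]] Bz[OF P(2)[of x]] vz[OF P(1)[of x] P(2)[of y]] vz[OF P(1)[of y] P(2)[of x]]
      by (simp_all add: inner_add_right inner_commute[of "pv x" B] inner_commute[of "pz x" B] inner_commute[of "pz x" "pv y"])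
  qed
  define N where "N x y = br (pv x) (pv y)" for x y
  have Nz: "N x y \<in> z" for x y unfolding N_def by (rule brv[OF P(1) P(1)])
  define J where "J a u = (\<Sum>b\<in>Basis. (N u b \<bullet> a) *\<^sub>R b)" for a u
  have Ji: "J a u \<bullet> w = N u w \<bullet> a" for a u w
  proof -
    have "J a u \<bullet> w = (\<Sum>b\<in>Basis. (w \<bullet> b) *\<^sub>R (N u b \<bullet> a))"
      unfolding J_def inner_sum_left by (rule sum.cong) (simp_all add: inner_commute)
    also have "\<dots> = N u w \<bullet> a"
      using linear_apply_basis[of "\<lambda>w. N u w \<bullet> a" w] by (simp add: linear_iff inner_add_left N_def padd pscale add cmul)
    finally show ?thesis .
  qed
  have Jv: "pv (J a u) = J a u" for a u
  proof -
    have "pv (J a u) \<bullet> w = J a u \<bullet> w" for w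
    proof -
      have "pv (J a u) \<bullet> w = J a u \<bullet> pv w" using inner(1)[of "J a u" w] inner(1)[of w "J a u"] by (simp add: inner_commute)
      then show ?thesis by (simp add: Ji N_def pvv P)
    qed
    then show ?thesis using vector_eq_rdot by blast
  qed
  have Jmap: "J_map br v (pz a) (pv u) = J a u" for a u
    unfolding J_map_def
  proof (rule the_equality)
    have a: "J a u \<bullet> V = br (pv u) V \<bullet> pz a" if "V \<in> v" for V
      using inner(2)[of "N u V" a] by (simp add: Ji pvv[OF that] N_def pzz Nz[unfolded N_def, of u V, unfolded pvv[OF that]])
    then show "J a u \<in> v \<and> (\<forall>V\<in>v. J a u \<bullet> V = br (pv u) V \<bullet> pz a)" using P(1)[of "J a u"] Jv by simp
    fix W assume W: "W \<in> v \<and> (\<forall>V\<in>v. W \<bullet> V = br (pv u) V \<bullet> pz a)"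
    have Ja: "J a u \<in> v" using P(1)[of "J a u"] Jv by simp
    have "W - J a u \<in> v" using subspace_diff[OF sv _ Ja] W by blast
    then have "(W - J a u) \<bullet> (W - J a u) = 0" using W a by (simp only: inner_diff_left)
    then show "W = J a u" by simp
  qed
  have M: "heisenberg_model B pv pz N"
  proof (rule heisenberg_model.intro)
    show "B = 0 \<or> B \<bullet> B = 1" by (rule B)
    show "(x \<bullet> B) *\<^sub>R B + pv x + pz x = x" for x using P(3)[of x] by simp
    show "linear pv" "linear pz" by (auto simp: linear_iff padd pscale)
    show "pv (pv x) = pv x" "pz (pz x) = pz x" "pv (pz x) = 0" "pz (pv x) = 0" "pv B = 0" "pz B = 0" for x
      using pvv P pzz pB by auto
    show "pv x \<bullet> y = x \<bullet> pv y" "pz x \<bullet> y = x \<bullet> pz y" for x y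
      using inner[of x y] inner[of y x] by (simp_all add: inner_commute)
    show "linear (N x)" "linear (\<lambda>x. N x y)" "N x x = 0" "pz (N x y) = N x y" "N (pv x) y = N x y" for x y
      using pzz(1)[OF Nz] by (auto simp: linear_iff N_def padd pscale add cmul alt pvv P)
    show "\<exists>x. pv x \<noteq> 0"
    proof -
      obtain U where "U \<in> v" "U \<noteq> 0" using nz(1) subspace_0[OF sv] by blast
      then show ?thesis using pvv(1) by metis
    qed
    show "\<exists>x. pz x \<noteq> 0"
    proof -
      obtain U where "U \<in> z" "U \<noteq> 0" using nz(2) subspace_0[OF sz] by blast
      then show ?thesis using pzz(1) by metis
    qed
    have "J a (J a u) = - (pz a \<bullet> pz a) *\<^sub>R pv u" for a u
      using JJ[OF P(2)[of a] P(1)[of u]] Jmap[of a "J a u"] by (simp only: Jmap Jv)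
    then show "(\<Sum>b\<in>Basis. (N (\<Sum>c\<in>Basis. (N u c \<bullet> a) *\<^sub>R c) b \<bullet> a) *\<^sub>R b) = - (pz a \<bullet> pz a) *\<^sub>R pv u" for a u
      by (simp only: J_def)
  qed
  interpret heisenberg_model B pv pz N by (rule M)
  have "heisenberg_model.br B pv pz N x y = br x y" for x y
  proof -
    define l where "l = x \<bullet> B" define m where "m = y \<bullet> B"
    define x' where "x' = pv x + pz x" define y' where "y' = pv y + pz y"
    have xy: "x = l *\<^sub>R B + x'" "y = m *\<^sub>R B + y'" using P(3)[of x] P(3)[of y] by (simp_all add: l_def m_def x'_def y'_def add.assoc)
    have lB: "l *\<^sub>R br B y' = l *\<^sub>R ((1/2) *\<^sub>R pv y + pz y)" "m *\<^sub>R br B x' = m *\<^sub>R ((1/2) *\<^sub>R pv x + pz x)"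
      using B brB[OF _ P(1) P(2)] by (auto simp: l_def m_def x'_def y'_def)
    have "br x' y' = N x y"
      using br0 skew[of "pz x" "pv y"] P by (simp add: x'_def y'_def add N_def)
    moreover have "br x y = l *\<^sub>R br B y' - m *\<^sub>R br B x' + br x' y'"
      using skew[of x' B] by (subst xy(1), subst xy(2)) (simp add: add cmul alt)
    ultimately have "br x y = l *\<^sub>R ((1/2) *\<^sub>R pv y + pz y) - m *\<^sub>R ((1/2) *\<^sub>R pv x + pz x) + N x y" by (simp only: lB)
    then show ?thesis unfolding br_def lam_def l_def m_def by simp
  qed
  then have "heisenberg_model.br B pv pz N = br" by (intro ext)
  with M that show thesis by blast
qed

theorem theorem5p2:
  fixes A :: "('m::{t2_space,second_countable_topology}, 'e::euclidean_space) chart set"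
    and mul :: "'m \<Rightarrow> 'm \<Rightarrow> 'm" and e :: 'm and iv :: "'m \<Rightarrow> 'm"
    and br :: "'n::euclidean_space \<Rightarrow> 'n \<Rightarrow> 'n" and \<phi> :: "'n \<Rightarrow> 'm tangent"
    and g :: "'m metric_tensor" and p :: 'm
  assumes "simply_connected_lie_group_of A mul e iv br \<phi>"
    and "g = left_invariant_metric A mul iv \<phi>"
    and "generalized_heisenberg_algebra br \<or>
         (damek_ricci_algebra br \<and> \<not> riemannian_symmetric A g)"
  shows "\<not> polar_action A g (isotropy_group A g p)"
proof -
  have lg: "lie_group A mul e iv" and sc: "simply_connected (UNIV :: 'm set)" and alg: "is_lie_algebra_of A mul e br \<phi>"
    using assms(1) by (auto simp: simply_connected_lie_group_of_def)
  obtain B pv pz N where M: "heisenberg_model B pv pz N" "heisenberg_model.br B pv pz N = br"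
    and symm: "B \<bullet> B = 1 ==> \<not> riemannian_symmetric A g"
    using assms(3)
  proof
    assume "generalized_heisenberg_algebra br"
    then obtain v z where h: "lie_algebra br" "generalized_heisenberg_on br v z" "\<forall>x. \<exists>U\<in>v. \<exists>Z\<in>z. x = U + Z"
      by (auto simp: generalized_heisenberg_algebra_def)
    obtain pv pz N where "heisenberg_model 0 pv pz N" "heisenberg_model.br 0 pv pz N = br"
      by (rule heisenberg_model_exists[OF h(1,2), of 0]) (use h(3) in auto)
    then show thesis using that[of 0 pv pz N] by simp
  next
    assume d: "damek_ricci_algebra br \<and> \<not> riemannian_symmetric A g"
    then obtain B v z where h: "lie_algebra br" "generalized_heisenberg_on br v z" "norm B = 1" "\<forall>U\<in>v. B \<bullet> U = 0" "\<forall>Z\<in>z. B \<bullet> Z = 0"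
      "\<forall>x. \<exists>c. \<exists>U\<in>v. \<exists>Z\<in>z. x = c *\<^sub>R B + U + Z" "\<forall>U\<in>v. br B U = (1/2) *\<^sub>R U" "\<forall>Z\<in>z. br B Z = Z"
      unfolding damek_ricci_algebra_def by blast
    have "B \<bullet> B = 1" using h(3) by (simp add: norm_eq_1)
    moreover have "br B (U + Z) = (1/2) *\<^sub>R U + Z" if "U \<in> v" "Z \<in> z" for U Z
      using h(1,7,8) that by (simp add: lie_algebra_def linear_add)
    ultimately obtain pv pz N where "heisenberg_model B pv pz N" "heisenberg_model.br B pv pz N = br"
      using h(4,5,6) heisenberg_model_exists[OF h(1,2), of B] by blast
    then show thesis using that d by blast
  qed
  interpret heisenberg_model B pv pz N by (rule M(1))
  interpret lie_model B pv pz N A mul e iv \<phi>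
    by unfold_locales (use lg alg M(2) in simp_all)
  obtain Psi :: "'n => 'm" and Phi where Psi_0: "Psi 0 = p" and coords: "\<And>x. Phi (Psi x) = x" "\<And>q. Psi (Phi q) = q" "plot A UNIV Psi" "continuous_on UNIV Phi"
    "\<And>U \<psi>. (U, \<psi>) \<in> A ==> Cinf_on (\<lambda>x. Phi (inv_into U \<psi> x)) (\<psi> ` U)" "\<And>x u. thM Psi x u = th x u"
    by (rule coordinates_exist[OF sc, of p]) (rule that; assumption)
  interpret C: global_coordinates B pv pz N A mul e iv \<phi> Psi Phi
    by unfold_locales (rule coords; assumption?)+
  \<comment> \<open>If \<open>J2\<close> held for a unit \<open>B\<close>, then
    \<open>symmetric\<close> would contradict the assumption on \<open>g\<close>.\<close>
  have rigid using symm C.symmetric by (auto simp: rigid_def assms(2))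
  from C.not_polar[OF this] show ?thesis by (simp add: assms(2) Psi_0)
qed

end
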